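(* Let $\alpha>0$, let $K\in L^1(\mathbb{R})$, $K\ge0$, $\int_{\mathbb{R}}K(w)\,dw=1$ ($K$ may be asymmetric), let $P$ be a probability measure on $\mathbb{R}_+$, and let $f,g$ satisfy $(H_1)$, $(H_2)$, $(H_3)$ of the context. Suppose further that for any $c\in\mathbb{R}$ there exists some $\gamma^\#=\gamma^\#(c)\in(0,+\infty]$ such that $\chi_0(z,c)<\infty$ for each $z\in[0,\gamma^\#)$ and $\chi_0(\gamma^\#(c)-,c)=\lim_{z\uparrow\gamma^\#(c)}\chi_0(z,c)=+\infty$. Suppose that, for some $L>0$, $|g(s_1)-g(s_2)|\le L|s_1-s_2|$ for all $s_1,s_2\ge0$, and let $\chi_L$ and $c_\star$ be defined with this $L$. Then the system $$\begin{cases}u_t(t,x)=u_{xx}(t,x)-f(u(t,x))+\int_{\mathbb{R}}K(x-y)v(t,y)\,dy,\\ v_t(t,x)=-\alpha v(t,x)+\int_0^\infty g(u(t-s,x))\,P(ds),\end{cases}\qquad t\ge0,\ x\in\mathbb{R},$$ admits at most one (modulo translation) semi-wavefront solution $(u(t,x),v(t,x))=(\phi(x+ct),\psi(x+ct))$, $\phi(-\infty)=\psi(-\infty)=0$, for each admissible wave speed $c\ge c_\star$. Furthermore, the system has no semi-wavefront solution propagating with speed $c<c_*$.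
   Context: Hypotheses: $(H_1)$ $g\in C(\mathbb{R}_+,\mathbb{R}_+)$, $g(0)=0$, $g(s)>0$ for all $s>0$, and $g$ is differentiable at $0$ with $g'(0)>0$. $(H_2)$ $f\in C^1(\mathbb{R}_+,\mathbb{R}_+)$, $f(0)=0$, $f$ is strictly increasing, and $f'(0)<g'(0)$. $(H_3)$ $f,g\in C^{1,\theta}$ in some neighborhood of $0$, with $\theta\in(0,1)$. A semi-wavefront solution with speed $c$ is a solution $(u,v)=(\phi(x+ct),\psi(x+ct))$ where $\phi,\psi$ are continuous, non-constant, bounded on $\mathbb{R}$, positive, and $\phi(-\infty)=\psi(-\infty)=0$. A real number $c$ is an admissible wave speed if a semi-wavefront solution with speed $c$ exists. "At most one modulo translation" means that any two such solutions with the same $c$ have profiles that coincide after a shift of the argument. Characteristic functions, for $c\in\mathbb{R}$ and $z\ge0$ with $cz+\alpha>0$: $$\chi_0(z,c)=z^2-cz-f'(0)+\frac{g'(0)}{cz+\alpha}\int_0^\infty e^{-zcr}P(dr)\int_{\mathbb{R}}K(w)e^{-zw}\,dw,$$ $$\chi_L(z,c)=z^2-cz-\inf_{s\ge0}f'(s)+\frac{L}{cz+\alpha}\int_0^\infty e^{-zcr}P(dr)\int_{\mathbb{R}}K(w)e^{-zw}\,dw.$$ $c_*$ (respectively $c_\star$) is the minimal value of $c$ for which $\chi_0(z,c)=0$ (respectively $\chi_L(z,c)=0$) has at least one positive root $z$. *)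

theory Defs
  imports "HOL-Probability.Probability"
begin

text \<open>Functions on \<open>[0,\<infinity>)\<close> are represented by functions on all reals; only their values on
  \<open>{0..}\<close> matter. Their derivatives are taken relative to \<open>{0..}\<close>, so that the derivative
  at \<open>0\<close> is one-sided.\<close>

definition deriv_nonneg :: "(real \<Rightarrow> real) \<Rightarrow> real \<Rightarrow> real" where
  "deriv_nonneg h s = vector_derivative h (at s within {0..})"

definition hyp_H1 :: "(real \<Rightarrow> real) \<Rightarrow> bool" where
  "hyp_H1 g \<longleftrightarrow>
     continuous_on {0..} g \<and> (\<forall>s\<ge>0. 0 \<le> g s) \<and> g 0 = 0 \<and> (\<forall>s>0. 0 < g s) \<and>
     g differentiable (at 0 within {0..}) \<and> 0 < deriv_nonneg g 0"

definition hyp_H2 :: "(real \<Rightarrow> real) \<Rightarrow> (real \<Rightarrow> real) \<Rightarrow> bool" where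
  "hyp_H2 f g \<longleftrightarrow>
     f differentiable_on {0..} \<and> continuous_on {0..} (deriv_nonneg f) \<and>
     (\<forall>s\<ge>0. 0 \<le> f s) \<and> f 0 = 0 \<and> strict_mono_on {0..} f \<and>
     deriv_nonneg f 0 < deriv_nonneg g 0"

definition C1_holder_near_0 :: "real \<Rightarrow> (real \<Rightarrow> real) \<Rightarrow> bool" where
  "C1_holder_near_0 \<theta> h \<longleftrightarrow>
     (\<exists>\<delta>>0. \<exists>C.
        (\<forall>s\<in>{0..<\<delta>}. h differentiable (at s within {0..})) \<and>
        (\<forall>s\<in>{0..<\<delta>}. \<forall>t\<in>{0..<\<delta>}.
           \<bar>deriv_nonneg h s - deriv_nonneg h t\<bar> \<le> C * \<bar>s - t\<bar> powr \<theta>))"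

definition hyp_H3 :: "real \<Rightarrow> (real \<Rightarrow> real) \<Rightarrow> (real \<Rightarrow> real) \<Rightarrow> bool" where
  "hyp_H3 \<theta> f g \<longleftrightarrow> 0 < \<theta> \<and> \<theta> < 1 \<and> C1_holder_near_0 \<theta> f \<and> C1_holder_near_0 \<theta> g"

text \<open>The two exponential integrals may diverge, so the characteristic functions take values
  in the extended reals. They are meaningful only where \<open>c * z + \<alpha> > 0\<close>; the definitions below
  that use them impose this condition explicitly. The measure \<open>P\<close> lives on \<open>{0..}\<close>.\<close>

definition char_fun ::
  "real \<Rightarrow> (real \<Rightarrow> real) \<Rightarrow> real measure \<Rightarrow> real \<Rightarrow> real \<Rightarrow> real \<Rightarrow> real \<Rightarrow> ereal" where
  "char_fun \<alpha> K P m q z c =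
     ereal (z\<^sup>2 - c * z - m) +
     ereal (q / (c * z + \<alpha>)) *
       enn2ereal ((\<integral>\<^sup>+ r. ennreal (exp (- (z * c * r))) \<partial>P) *
                  (\<integral>\<^sup>+ w. ennreal (K w * exp (- (z * w))) \<partial>lborel))"

definition chi0 ::
  "real \<Rightarrow> (real \<Rightarrow> real) \<Rightarrow> (real \<Rightarrow> real) \<Rightarrow> (real \<Rightarrow> real) \<Rightarrow> real measure \<Rightarrow>
   real \<Rightarrow> real \<Rightarrow> ereal" where
  "chi0 \<alpha> f g K P = char_fun \<alpha> K P (deriv_nonneg f 0) (deriv_nonneg g 0)"

definition chiL ::
  "real \<Rightarrow> (real \<Rightarrow> real) \<Rightarrow> real \<Rightarrow> (real \<Rightarrow> real) \<Rightarrow> real measure \<Rightarrow>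
   real \<Rightarrow> real \<Rightarrow> ereal" where
  "chiL \<alpha> f L K P = char_fun \<alpha> K P (INF s\<in>{0..}. deriv_nonneg f s) L"

definition root_speeds :: "real \<Rightarrow> (real \<Rightarrow> real \<Rightarrow> ereal) \<Rightarrow> real set" where
  "root_speeds \<alpha> chi = {c. \<exists>z>0. c * z + \<alpha> > 0 \<and> chi z c = 0}"

definition minimal_speed :: "real \<Rightarrow> (real \<Rightarrow> real \<Rightarrow> ereal) \<Rightarrow> real \<Rightarrow> bool" where
  "minimal_speed \<alpha> chi c0 \<longleftrightarrow> c0 \<in> root_speeds \<alpha> chi \<and> (\<forall>c\<in>root_speeds \<alpha> chi. c0 \<le> c)"

text \<open>The bound \<open>\<gamma>\<close> may be \<open>\<infinity>\<close>, and \<open>at_left \<infinity>\<close> on \<open>ereal\<close> is the image of \<open>at_top\<close>. For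
  \<open>c < 0\<close> the domain condition forces \<open>\<gamma> \<le> \<alpha> / \<bar>c\<bar>\<close>.\<close>

definition blow_up_condition :: "real \<Rightarrow> (real \<Rightarrow> real \<Rightarrow> ereal) \<Rightarrow> real \<Rightarrow> bool" where
  "blow_up_condition \<alpha> chi c \<longleftrightarrow>
     (\<exists>\<gamma>::ereal. 0 < \<gamma> \<and>
        (\<forall>z\<ge>0. ereal z < \<gamma> \<longrightarrow> c * z + \<alpha> > 0 \<and> chi z c < \<infinity>) \<and>
        ((\<lambda>x. chi (real_of_ereal x) c) \<longlongrightarrow> \<infinity>) (at_left \<gamma>))"

text \<open>Classical solutions for \<open>t \<ge> 0\<close>. The values of \<open>u\<close> at negative times are the history
  needed for the delay term.\<close>

definition solves_system ::
  "real \<Rightarrow> (real \<Rightarrow> real) \<Rightarrow> (real \<Rightarrow> real) \<Rightarrow> (real \<Rightarrow> real) \<Rightarrow> real measure \<Rightarrow>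
   (real \<Rightarrow> real \<Rightarrow> real) \<Rightarrow> (real \<Rightarrow> real \<Rightarrow> real) \<Rightarrow> bool" where
  "solves_system \<alpha> f g K P u v \<longleftrightarrow>
     (\<exists>u_t u_x u_xx v_t. \<forall>t\<ge>0. \<forall>x.
        ((\<lambda>\<tau>. u \<tau> x) has_real_derivative u_t t x) (at t within {0..}) \<and>
        ((\<lambda>y. u t y) has_real_derivative u_x t x) (at x) \<and>
        ((\<lambda>y. u_x t y) has_real_derivative u_xx t x) (at x) \<and>
        ((\<lambda>\<tau>. v \<tau> x) has_real_derivative v_t t x) (at t within {0..}) \<and>
        integrable lborel (\<lambda>y. K (x - y) * v t y) \<and>
        integrable P (\<lambda>s. g (u (t - s) x)) \<and>
        u_t t x = u_xx t x - f (u t x) + (\<integral>y. K (x - y) * v t y \<partial>lborel) \<and>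
        v_t t x = - \<alpha> * v t x + (\<integral>s. g (u (t - s) x) \<partial>P))"

definition semi_wavefront ::
  "real \<Rightarrow> (real \<Rightarrow> real) \<Rightarrow> (real \<Rightarrow> real) \<Rightarrow> (real \<Rightarrow> real) \<Rightarrow> real measure \<Rightarrow>
   real \<Rightarrow> (real \<Rightarrow> real) \<Rightarrow> (real \<Rightarrow> real) \<Rightarrow> bool" where
  "semi_wavefront \<alpha> f g K P c \<phi> \<psi> \<longleftrightarrow>
     continuous_on UNIV \<phi> \<and> continuous_on UNIV \<psi> \<and>
     \<not> \<phi> constant_on UNIV \<and> \<not> \<psi> constant_on UNIV \<and>
     bounded (range \<phi>) \<and> bounded (range \<psi>) \<and>
     (\<forall>x. 0 < \<phi> x) \<and> (\<forall>x. 0 < \<psi> x) \<and>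
     (\<phi> \<longlongrightarrow> 0) at_bot \<and> (\<psi> \<longlongrightarrow> 0) at_bot \<and>
     solves_system \<alpha> f g K P (\<lambda>t x. \<phi> (x + c * t)) (\<lambda>t x. \<psi> (x + c * t))"

definition admissible_speed ::
  "real \<Rightarrow> (real \<Rightarrow> real) \<Rightarrow> (real \<Rightarrow> real) \<Rightarrow> (real \<Rightarrow> real) \<Rightarrow> real measure \<Rightarrow>
   real \<Rightarrow> bool" where
  "admissible_speed \<alpha> f g K P c \<longleftrightarrow> (\<exists>\<phi> \<psi>. semi_wavefront \<alpha> f g K P c \<phi> \<psi>)"

text \<open>Both components are shifted by the same amount.\<close>

definition unique_modulo_translation ::
  "real \<Rightarrow> (real \<Rightarrow> real) \<Rightarrow> (real \<Rightarrow> real) \<Rightarrow> (real \<Rightarrow> real) \<Rightarrow> real measure \<Rightarrow>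
   real \<Rightarrow> bool" where
  "unique_modulo_translation \<alpha> f g K P c \<longleftrightarrow>
     (\<forall>\<phi>\<^sub>1 \<psi>\<^sub>1 \<phi>\<^sub>2 \<psi>\<^sub>2.
        semi_wavefront \<alpha> f g K P c \<phi>\<^sub>1 \<psi>\<^sub>1 \<longrightarrow> semi_wavefront \<alpha> f g K P c \<phi>\<^sub>2 \<psi>\<^sub>2 \<longrightarrow>
        (\<exists>h. \<forall>x. \<phi>\<^sub>2 x = \<phi>\<^sub>1 (x + h) \<and> \<psi>\<^sub>2 x = \<psi>\<^sub>1 (x + h)))"

end

theory Submission
  imports Defs
begin

text \<open>Eliminating \<open>\<psi>\<close> and inverting \<open>\<phi>'' - c \<phi>' - \<kappa> \<phi>\<close> turns the profile equations into a
  convolution equation \<open>\<phi> = \<Sum>\<^sub>i k\<^sub>i * F\<^sub>i(\<phi>)\<close> with positive kernels. The transform of its linearization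
  at \<open>0\<close> exceeds \<open>1\<close> at \<open>z\<close> exactly when \<open>\<chi>\<^sub>0(z, c) > 0\<close>. Testing with suitable weights shows that
  \<open>\<phi>\<close> decays like \<open>exp (z x)\<close> at \<open>-\<infinity>\<close> as long as \<open>\<chi>\<^sub>0 > 0\<close> on \<open>[0, z]\<close>, whereas \<open>\<phi>\<close> dominates a kernel of
  fixed exponential rate; hence there are no waves if \<open>\<chi>\<^sub>0\<close> has no root. If \<open>\<rho>\<close> is the smallest root,
  \<open>\<phi> exp (- \<rho> x)\<close> is almost harmonic for a random walk, and the conserved flux of that walk at \<open>-\<infinity>\<close>
  determines its leading behaviour. After a shift the fluxes of two waves agree, so their difference decays
  faster than either wave, and a maximum principle based on a nonpositive value of \<open>\<chi>\<^sub>L\<close> makes it vanish. For a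
  double root the walk is recurrent and the maximum principle is replaced by a Liouville theorem.\<close>

section \<open>Subexponential functions and renewal kernels\<close>

text \<open>Since \<open>g\<close> is not assumed monotone, waves may oscillate and cannot be
  ordered by sub- and supersolutions; two waves are compared only through the absolute value of
  their difference, with an exponential weight. The maximum principle for this quantity involves the
  global constants \<open>L\<close> and the infimum of \<open>f'\<close>, and hence an exponent
  where \<open>\<chi>\<^sub>L\<close> is nonpositive. That exponent may lie beyond \<rho>, while
  each wave decays only at about the rate \<rho>. Equality of the fluxes gives the difference an
  extra exponential factor if the root is simple, and a barrier built from the linearization at 0,
  at exponents where its transform lies below 1, carries the decay past the exponent of the maximum
  principle. Hoelder regularity of \<open>f\<close> and \<open>g\<close> makes the nonlinear
  remainder, and so the variation of the flux, integrable at -infinity. The constant \<kappa> is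
  free: the transform minus 1 equals \<chi>0 divided by \<kappa> + c z - z^2, so its roots do not
  depend on \<kappa>. For nonexistence the Green kernel supplies the exponential lower bound; for
  uniqueness \<kappa> is taken so large that all transforms in question converge.\<close>

lemma continuous_antiderivative:
  fixes h :: "real \<Rightarrow> real"
  assumes "continuous_on UNIV h"
  obtains H where "\<And>x. (H has_real_derivative h x) (at x)"
proof -
  have "\<exists>F. \<forall>x::real. -\<infinity> < ereal x \<longrightarrow> ereal x < \<infinity> \<longrightarrow> (F has_vector_derivative h x) (at x)"
    using assms by (intro einterval_antiderivative) (auto simp: continuous_on_eq_continuous_at)
  then show ?thesis
    using that by (auto simp: has_real_derivative_iff_has_vector_derivative)
qed

lemma abs_le_exp:
  fixes e x :: real
  assumes "0 < e"
  shows "\<bar>x\<bar> \<le> inverse e * exp (e * \<bar>x\<bar>)"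
proof -
  have "e * \<bar>x\<bar> \<le> exp (e * \<bar>x\<bar>)"
    using exp_ge_add_one_self[of "e * \<bar>x\<bar>"] by linarith
  then show ?thesis using assms by (simp add: field_simps)
qed

text \<open>The equality case behind the maximum principles below: a kernel bounded below on each
  bounded interval sees every point, so a nonpositive integral forces the continuous nonnegative
  factor to vanish pointwise.\<close>

lemma continuous_nonneg_integral_0:
  fixes N e :: "real \<Rightarrow> real"
  assumes N0: "\<And>t. 0 \<le> N t"
    and low: "\<And>R. \<exists>c>0. \<forall>t. \<bar>t\<bar> \<le> R \<longrightarrow> c \<le> N t"
    and cont: "continuous_on UNIV e" and e0: "\<And>t. 0 \<le> e t"
    and int: "integrable lborel (\<lambda>t. N t * e t)"
    and le: "(\<integral>t. N t * e t \<partial>lborel) \<le> 0"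
  shows "e y = 0"
proof -
  define R where "R = \<bar>y\<bar> + 1"
  obtain c where c: "c > 0" "\<And>t. \<bar>t\<bar> \<le> R \<Longrightarrow> c \<le> N t" using low by blast
  have cR: "continuous_on {-R..R} e" using cont continuous_on_subset by blast
  then have si: "set_integrable lborel {-R..R} e" by (rule borel_integrable_atLeastAtMost')
  have "c * (LINT t:{-R..R}|lborel. e t) = (\<integral>t. c * (indicator {-R..R} t * e t) \<partial>lborel)"
    by (simp add: set_lebesgue_integral_def)
  also have "\<dots> \<le> (\<integral>t. N t * e t \<partial>lborel)"
  proof (rule integral_mono)
    show "integrable lborel (\<lambda>t. c * (indicator {-R..R} t * e t))"
      using si by (simp add: set_integrable_def)
    show "c * (indicator {-R..R} t * e t) \<le> N t * e t" for t
      using c N0[of t] e0[of t] by (auto simp: indicator_def intro!: mult_right_mono)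
  qed (rule int)
  finally have "(LINT t:{-R..R}|lborel. e t) \<le> 0" using le c(1)
    by (smt (verit) mult_pos_pos)
  then have "integral {-R..R} e \<le> 0"
    using si by (simp add: set_borel_integral_eq_integral)
  moreover have "0 \<le> integral {-R..R} e"
    by (rule integral_nonneg) (use e0 cR in \<open>auto intro: integrable_continuous_real\<close>)
  ultimately have "integral {-R..R} e = 0" by simp
  moreover have "-R < R" by (simp add: R_def)
  ultimately have "\<forall>x\<in>{-R..R}. e x = 0"
    using integral_eq_0_iff[OF cR _ e0] by blast
  then show ?thesis by (rule bspec) (auto simp: R_def)
qed

text \<open>The growth class of \<open>\<phi> x * exp (- (\<rho> * x))\<close> when \<phi> decays
  like exp (z x) for every z below \<rho>, but perhaps not at \<rho> itself. It is integrable
  against a kernel with some exponential moment and is closed under antiderivatives, so fluxes of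
  first and second order stay inside it.\<close>

definition subexponential :: "(real \<Rightarrow> real) \<Rightarrow> bool" where
  "subexponential h \<longleftrightarrow>
     continuous_on UNIV h \<and> (\<forall>e>0. \<exists>C. \<forall>x. \<bar>h x\<bar> \<le> C * exp (e * \<bar>x\<bar>))"

lemma subexponential_bound:
  assumes "subexponential h" "e > 0"
  obtains C where "C > 0" "\<And>x. \<bar>h x\<bar> \<le> C * exp (e * \<bar>x\<bar>)"
proof -
  obtain C where C: "\<And>x. \<bar>h x\<bar> \<le> C * exp (e * \<bar>x\<bar>)"
    using assms unfolding subexponential_def by blast
  have "\<bar>h x\<bar> \<le> (\<bar>C\<bar> + 1) * exp (e * \<bar>x\<bar>)" for x
    by (rule order_trans[OF C]) (auto intro!: mult_right_mono)
  then show ?thesis by (intro that[of "\<bar>C\<bar> + 1"]) auto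
qed

lemma subexponential_cont: "subexponential h \<Longrightarrow> continuous_on UNIV h"
  by (simp add: subexponential_def)

text \<open>The mean value theorem costs a factor \<open>\<bar>x\<bar>\<close>; half of the exponent
  bounds the integrand and the other half absorbs this factor.\<close>

lemma subexponential_antiderivative:
  assumes h: "subexponential h" and H: "\<And>x. (H has_real_derivative h x) (at x)"
  shows "subexponential H"
  unfolding subexponential_def
proof (intro conjI allI impI)
  show "continuous_on UNIV H"
    using H by (meson DERIV_continuous continuous_at_imp_continuous_on)
  fix e :: real assume e: "0 < e"
  obtain C where C: "C > 0" "\<And>x. \<bar>h x\<bar> \<le> C * exp (e/2 * \<bar>x\<bar>)"
    using subexponential_bound[OF h, of "e/2"] e by auto
  have "\<bar>H x\<bar> \<le> (\<bar>H 0\<bar> + C * inverse (e/2)) * exp (e * \<bar>x\<bar>)" for x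
  proof -
    have "norm (H x - H 0) \<le> (C * exp (e/2 * \<bar>x\<bar>)) * norm (x - 0)"
    proof (rule field_differentiable_bound[where S="{-\<bar>x\<bar>..\<bar>x\<bar>}" and f'=h])
      fix t assume "t \<in> {-\<bar>x\<bar>..\<bar>x\<bar>}"
      then have "\<bar>t\<bar> \<le> \<bar>x\<bar>" by auto
      then have "C * exp (e/2 * \<bar>t\<bar>) \<le> C * exp (e/2 * \<bar>x\<bar>)" using C(1) e by auto
      then show "norm (h t) \<le> C * exp (e/2 * \<bar>x\<bar>)" using C(2)[of t] by simp
    qed (use H in \<open>auto intro: DERIV_subset\<close>)
    also have "\<dots> \<le> (C * exp (e/2 * \<bar>x\<bar>)) * (inverse (e/2) * exp (e/2 * \<bar>x\<bar>))"
      using abs_le_exp[of "e/2" x] e C(1) by (intro mult_left_mono) auto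
    also have "\<dots> = C * inverse (e/2) * exp (e * \<bar>x\<bar>)"
      by (simp add: mult_exp_exp)
    finally have "\<bar>H x\<bar> \<le> \<bar>H 0\<bar> + C * inverse (e/2) * exp (e * \<bar>x\<bar>)" by simp
    also have "\<bar>H 0\<bar> \<le> \<bar>H 0\<bar> * exp (e * \<bar>x\<bar>)" using e by (simp add: mult_le_cancel_left1)
    finally show ?thesis by (simp add: algebra_simps)
  qed
  then show "\<exists>C. \<forall>x. \<bar>H x\<bar> \<le> C * exp (e * \<bar>x\<bar>)" by blast
qed

lemma subexponential_lincomb:
  assumes "subexponential g" "subexponential h"
  shows "subexponential (\<lambda>x. s * g x + t * h x)"
  unfolding subexponential_def
proof (intro conjI allI impI)
  show "continuous_on UNIV (\<lambda>x. s * g x + t * h x)"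
    using assms by (auto simp: subexponential_def intro!: continuous_intros)
  fix e :: real assume e: "0 < e"
  obtain C where C: "C > 0" "\<And>x. \<bar>g x\<bar> \<le> C * exp (e * \<bar>x\<bar>)"
    using subexponential_bound[OF assms(1) e] by auto
  obtain D where D: "D > 0" "\<And>x. \<bar>h x\<bar> \<le> D * exp (e * \<bar>x\<bar>)"
    using subexponential_bound[OF assms(2) e] by auto
  have "\<bar>s * g x + t * h x\<bar> \<le> (\<bar>s\<bar> * C + \<bar>t\<bar> * D) * exp (e * \<bar>x\<bar>)" for x
  proof -
    have "\<bar>s * g x + t * h x\<bar> \<le> \<bar>s\<bar> * \<bar>g x\<bar> + \<bar>t\<bar> * \<bar>h x\<bar>"
      by (metis abs_mult abs_triangle_ineq)
    also have "\<dots> \<le> \<bar>s\<bar> * (C * exp (e * \<bar>x\<bar>)) + \<bar>t\<bar> * (D * exp (e * \<bar>x\<bar>))"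
      by (intro add_mono mult_left_mono C D) auto
    finally show ?thesis by (simp add: algebra_simps)
  qed
  then show "\<exists>C. \<forall>x. \<bar>s * g x + t * h x\<bar> \<le> C * exp (e * \<bar>x\<bar>)" by blast
qed

section \<open>The defect operator of a renewal kernel\<close>

locale renewal_kernel =
  fixes N :: "real \<Rightarrow> real" and \<delta> :: real
  assumes N_meas [measurable]: "N \<in> borel_measurable borel"
    and N_nonneg: "0 \<le> N t"
    and N_mass: "(\<integral>t. N t \<partial>lborel) = 1"
    and \<delta>_pos: "0 < \<delta>"
    and N_exp: "integrable lborel (\<lambda>t. N t * exp (\<delta> * \<bar>t\<bar>))"
    and N_low: "\<exists>c>0. \<forall>t. \<bar>t\<bar> \<le> R \<longrightarrow> c \<le> N t"
begin

text \<open>Identity minus transition operator of the random walk with step density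
  \<open>N\<close>. If \<Omega> is an antiderivative of a density \<omega>, then
  \<open>defect \<Omega> x\<close> averages the mass of \<omega> between \<open>x - y\<close> and
  \<open>x\<close> over the steps \<open>y\<close>: it is the net flux of the walk across
  \<open>x\<close>.\<close>

definition defect :: "(real \<Rightarrow> real) \<Rightarrow> real \<Rightarrow> real" where
  "defect h x = (\<integral>y. N y * (h x - h (x - y)) \<partial>lborel)"

lemma integrable_N_mult:
  assumes [measurable]: "h \<in> borel_measurable borel"
    and "\<And>t. \<bar>h t\<bar> \<le> C * exp (e * \<bar>t\<bar>)" "e \<le> \<delta>"
  shows "integrable lborel (\<lambda>t. N t * h t)"
proof (rule Bochner_Integration.integrable_bound)
  show "integrable lborel (\<lambda>t. \<bar>C\<bar> * (N t * exp (\<delta> * \<bar>t\<bar>)))" using N_exp by simp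
  have hb: "\<bar>h t\<bar> \<le> \<bar>C\<bar> * exp (\<delta> * \<bar>t\<bar>)" for t
  proof -
    have "\<bar>h t\<bar> \<le> \<bar>C\<bar> * exp (e * \<bar>t\<bar>)"
      by (rule order_trans[OF assms(2)]) (auto intro!: mult_right_mono)
    also have "\<dots> \<le> \<bar>C\<bar> * exp (\<delta> * \<bar>t\<bar>)" using assms(3)
      by (auto intro!: mult_left_mono mult_right_mono)
    finally show ?thesis .
  qed
  have "\<bar>N t * h t\<bar> \<le> \<bar>\<bar>C\<bar> * (N t * exp (\<delta> * \<bar>t\<bar>))\<bar>" for t
    using mult_left_mono[OF hb N_nonneg[of t]] N_nonneg[of t] by (simp add: abs_mult mult.left_commute)
  then show "AE t in lborel. norm (N t * h t) \<le> norm (\<bar>C\<bar> * (N t * exp (\<delta> * \<bar>t\<bar>)))" by simp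
qed auto

lemma N_integrable: "integrable lborel N"
  using integrable_N_mult[of "\<lambda>_. 1" 1 0] \<delta>_pos by simp

lemma shift_bound:
  assumes "subexponential h" "e > 0"
  obtains C where "C > 0" "\<And>y. \<bar>h (x - y)\<bar> \<le> C * exp (e * \<bar>y\<bar>)"
proof -
  obtain C where C: "C > 0" "\<And>x. \<bar>h x\<bar> \<le> C * exp (e * \<bar>x\<bar>)"
    using subexponential_bound[OF assms] by blast
  have "\<bar>h (x - y)\<bar> \<le> C * exp (e * \<bar>x\<bar>) * exp (e * \<bar>y\<bar>)" for y
  proof -
    have "e * \<bar>x - y\<bar> \<le> e * \<bar>x\<bar> + e * \<bar>y\<bar>"
      using assms(2) by (metis abs_triangle_ineq4 distrib_left mult_le_cancel_left_pos)
    then have "C * exp (e * \<bar>x - y\<bar>) \<le> C * (exp (e * \<bar>x\<bar>) * exp (e * \<bar>y\<bar>))"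
      using C(1) by (simp add: mult_exp_exp)
    then show ?thesis using C(2)[of "x - y"] by (simp add: algebra_simps)
  qed
  then show ?thesis using C(1) by (intro that[of "C * exp (e * \<bar>x\<bar>)"]) auto
qed

lemma subexponential_meas [measurable_dest]: "subexponential h \<Longrightarrow> h \<in> borel_measurable borel"
  by (simp add: subexponential_def borel_measurable_continuous_onI)

lemma integrable_shift:
  assumes h: "subexponential h"
  shows "integrable lborel (\<lambda>y. N y * h (x - y))"
proof -
  obtain C where C: "\<And>y. \<bar>h (x - y)\<bar> \<le> C * exp (\<delta> * \<bar>y\<bar>)"
    using shift_bound[OF h \<delta>_pos] by blast
  have [measurable]: "h \<in> borel_measurable borel" using h by (rule subexponential_meas)
  show ?thesis by (rule integrable_N_mult[OF _ C]) auto
qed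

lemma integrable_defect:
  assumes h: "subexponential h"
  shows "integrable lborel (\<lambda>y. N y * (h x - h (x - y)))"
  using integrable_shift[OF h, of x] N_integrable by (simp add: right_diff_distrib)

lemma defect_eq:
  assumes h: "subexponential h"
  shows "defect h x = h x - (\<integral>y. N y * h (x - y) \<partial>lborel)"
  unfolding defect_def
  using integrable_shift[OF h, of x] N_integrable N_mass by (simp add: right_diff_distrib)

lemma defect_lincomb:
  assumes "subexponential g" "subexponential h"
  shows "defect (\<lambda>x. s * g x + t * h x) x = s * defect g x + t * defect h x"
proof -
  have "defect (\<lambda>x. s * g x + t * h x) x =
    (\<integral>y. s * (N y * (g x - g (x - y))) + t * (N y * (h x - h (x - y))) \<partial>lborel)"
    unfolding defect_def by (rule Bochner_Integration.integral_cong) (auto simp: algebra_simps)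
  also have "\<dots> = s * defect g x + t * defect h x"
    unfolding defect_def using integrable_defect[OF assms(1), of x] integrable_defect[OF assms(2), of x]
    by simp
  finally show ?thesis .
qed

text \<open>The conservation law of the walk: the derivative of the flux is the defect of the
  density. Difference quotients of \<open>H\<close> at \<open>x - y\<close> grow at most like exp
  (\<delta> \<bar>y\<bar>), which the exponential moment of \<open>N\<close> dominates.\<close>

lemma defect_deriv:
  assumes h: "subexponential h" and H: "\<And>x. (H has_real_derivative h x) (at x)"
  shows "(defect H has_real_derivative defect h x) (at x)"
proof -
  have sH: "subexponential H" by (rule subexponential_antiderivative[OF h H])
  have [measurable]: "h \<in> borel_measurable borel" "H \<in> borel_measurable borel"
    using h sH by (auto intro: subexponential_meas)
  obtain C where C: "C > 0" "\<And>x. \<bar>h x\<bar> \<le> C * exp (\<delta> * \<bar>x\<bar>)"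
    using subexponential_bound[OF h \<delta>_pos] by blast
  define C' where "C' = C * exp (\<delta> * (\<bar>x\<bar> + 1))"
  have q: "\<bar>(H (x - y + s) - H (x - y)) / s\<bar> \<le> C' * exp (\<delta> * \<bar>y\<bar>)" if "s \<noteq> 0" "\<bar>s\<bar> \<le> 1" for s y
  proof -
    have "norm (H (x - y + s) - H (x - y)) \<le> (C' * exp (\<delta> * \<bar>y\<bar>)) * norm (x - y + s - (x - y))"
    proof (rule field_differentiable_bound[where S="{x - y - \<bar>s\<bar>..x - y + \<bar>s\<bar>}" and f'=h])
      fix t assume "t \<in> {x - y - \<bar>s\<bar>..x - y + \<bar>s\<bar>}"
      then have "\<bar>t\<bar> \<le> \<bar>x\<bar> + 1 + \<bar>y\<bar>" using that by auto
      then have "\<delta> * \<bar>t\<bar> \<le> \<delta> * (\<bar>x\<bar> + 1) + \<delta> * \<bar>y\<bar>"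
        using \<delta>_pos by (metis distrib_left mult_le_cancel_left_pos)
      then have "C * exp (\<delta> * \<bar>t\<bar>) \<le> C' * exp (\<delta> * \<bar>y\<bar>)"
        using C(1) by (simp add: C'_def mult_exp_exp)
      then show "norm (h t) \<le> C' * exp (\<delta> * \<bar>y\<bar>)" using C(2)[of t] by simp
    qed (use H in \<open>auto intro: DERIV_subset\<close>)
    then show ?thesis using that by (simp add: field_simps)
  qed
  have "((\<lambda>s. (defect H (x + s) - defect H x) / s) \<longlongrightarrow> defect h x) (at 0)"
    unfolding tendsto_at_iff_sequentially
  proof (intro allI impI)
    fix S :: "nat \<Rightarrow> real" assume S: "\<forall>i. S i \<in> UNIV - {0}" "S \<longlonglongrightarrow> 0"
    have S0: "S i \<noteq> 0" for i using S(1) by auto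
    have "\<forall>\<^sub>F i in sequentially. \<bar>S i\<bar> < 1"
      using order_tendstoD(2)[OF tendsto_rabs[OF S(2)], of 1] by simp
    then obtain n0 where n0: "\<And>i. i \<ge> n0 \<Longrightarrow> \<bar>S i\<bar> < 1"
      by (auto simp: eventually_sequentially)
    \<comment> \<open>Dropping finitely many terms makes every increment at most 1 in absolute
      value, as the bound \<open>q\<close> requires.\<close>
    define T where "T i = S (i + n0)" for i
    have T: "T i \<noteq> 0" "\<bar>T i\<bar> \<le> 1" for i using S0 n0[of "i + n0"] by (auto simp: T_def)
    have Tlim: "T \<longlonglongrightarrow> 0" unfolding T_def using S(2) by (rule LIMSEQ_ignore_initial_segment)
    define Q where "Q i y = N y * ((H (x + T i) - H x) / T i - (H (x - y + T i) - H (x - y)) / T i)" for i y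
    have Qeq: "(defect H (x + T i) - defect H x) / T i = (\<integral>y. Q i y \<partial>lborel)" for i
    proof -
      have "(defect H (x + T i) - defect H x) / T i =
        (\<integral>y. (N y * (H (x + T i) - H (x + T i - y)) - N y * (H x - H (x - y))) / T i \<partial>lborel)"
        unfolding defect_def
        using integrable_defect[OF sH, of x] integrable_defect[OF sH, of "x + T i"] by simp
      also have "\<dots> = (\<integral>y. Q i y \<partial>lborel)"
      proof (rule Bochner_Integration.integral_cong)
        fix y
        have "x + T i - y = x - y + T i" by simp
        then show "(N y * (H (x + T i) - H (x + T i - y)) - N y * (H x - H (x - y))) / T i = Q i y"
          unfolding Q_def using T(1)[of i] by (simp add: divide_simps) (simp add: algebra_simps)
      qed simp
      finally show ?thesis .
    qed
    have der: "(\<lambda>i. (H (u + T i) - H u) / T i) \<longlonglongrightarrow> h u" for u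
    proof -
      have "((\<lambda>s. (H (u + s) - H u) / s) \<longlongrightarrow> h u) (at 0)" using H[of u] by (simp add: DERIV_def)
      then show ?thesis using T(1) Tlim unfolding tendsto_at_iff_sequentially
        by (auto simp: o_def)
    qed
    have "(\<lambda>i. \<integral>y. Q i y \<partial>lborel) \<longlonglongrightarrow> (\<integral>y. N y * (h x - h (x - y)) \<partial>lborel)"
    proof (rule integral_dominated_convergence)
      show "integrable lborel (\<lambda>y. 2 * C' * (N y * exp (\<delta> * \<bar>y\<bar>)))" using N_exp by simp
      show "AE y in lborel. (\<lambda>i. Q i y) \<longlonglongrightarrow> N y * (h x - h (x - y))"
        unfolding Q_def by (intro AE_I2 tendsto_intros der)
      show "AE y in lborel. norm (Q i y) \<le> 2 * C' * (N y * exp (\<delta> * \<bar>y\<bar>))" for i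
      proof (intro AE_I2)
        fix y
        have "\<bar>(H (x + T i) - H x) / T i\<bar> \<le> C'" using q[of "T i" 0, OF T] by simp
        also have "C' \<le> C' * exp (\<delta> * \<bar>y\<bar>)" using C(1) \<delta>_pos by (simp add: C'_def)
        finally have "\<bar>(H (x + T i) - H x) / T i - (H (x - y + T i) - H (x - y)) / T i\<bar> \<le> 2 * C' * exp (\<delta> * \<bar>y\<bar>)"
          using q[of "T i" y, OF T] by linarith
        then have "N y * \<bar>(H (x + T i) - H x) / T i - (H (x - y + T i) - H (x - y)) / T i\<bar> \<le> N y * (2 * C' * exp (\<delta> * \<bar>y\<bar>))"
          using N_nonneg by (rule mult_left_mono)
        then show "norm (Q i y) \<le> 2 * C' * (N y * exp (\<delta> * \<bar>y\<bar>))"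
          unfolding Q_def using N_nonneg[of y] by (simp add: abs_mult mult_ac)
      qed
    qed (auto simp: Q_def)
    then have "(\<lambda>i. (defect H (x + T i) - defect H x) / T i) \<longlonglongrightarrow> defect h x"
      unfolding Qeq by (simp only: defect_def)
    then have "(\<lambda>i. (defect H (x + S i) - defect H x) / S i) \<longlonglongrightarrow> defect h x"
      unfolding T_def by (rule LIMSEQ_offset)
    then show "((\<lambda>s. (defect H (x + s) - defect H x) / s) \<circ> S) \<longlonglongrightarrow> defect h x"
      by (simp add: o_def)
  qed
  then show ?thesis by (simp add: DERIV_def)
qed

end

section \<open>Solutions near a maximum of their growth rate\<close>

lemma vanishing_attains_max:
  fixes r :: "real \<Rightarrow> real"
  assumes cont: "continuous_on UNIV r"
    and bot: "(r \<longlongrightarrow> 0) at_bot" and top: "(r \<longlongrightarrow> 0) at_top"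
    and pos: "0 < r x1"
  obtains x0 where "\<And>x. r x \<le> r x0" "r x1 \<le> r x0"
proof -
  obtain A where A: "\<And>x. x \<le> A \<Longrightarrow> r x < r x1"
    using order_tendstoD(2)[OF bot pos] by (auto simp: eventually_at_bot_linorder)
  obtain B where B: "\<And>x. x \<ge> B \<Longrightarrow> r x < r x1"
    using order_tendstoD(2)[OF top pos] by (auto simp: eventually_at_top_linorder)
  have x1: "x1 \<in> {A..B}" using A[of x1] B[of x1] by force
  have "continuous_on {A..B} r" using cont continuous_on_subset by blast
  then obtain x0 where x0: "x0 \<in> {A..B}" "\<And>x. x \<in> {A..B} \<Longrightarrow> r x \<le> r x0"
    using continuous_attains_sup[of "{A..B}" r] x1 by auto
  have "r x1 \<le> r x0" using x0(2) x1 by blast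
  moreover have "r x \<le> r x0" for x
    using x0(2)[of x] A[of x] B[of x] \<open>r x1 \<le> r x0\<close> by force
  ultimately show ?thesis using that by blast
qed

lemma exp_minus_one_le: "exp u - 1 \<le> u * exp u" for u :: real
proof -
  have "1 - u \<le> exp (- u)" using exp_ge_add_one_self[of "-u"] by simp
  then have "exp u * (1 - u) \<le> exp u * exp (- u)" by (intro mult_left_mono) auto
  then show ?thesis by (simp add: mult_exp_exp algebra_simps)
qed

lemma poly_exp_bound:
  fixes e y :: real
  assumes "0 < e"
  shows "1 + \<bar>y\<bar> \<le> (1 + inverse e) * exp (e * \<bar>y\<bar>)"
proof -
  have "1 \<le> exp (e * \<bar>y\<bar>)" using assms by simp
  then show ?thesis using abs_le_exp[OF assms, of y] unfolding distrib_right by linarith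
qed

context renewal_kernel
begin

text \<open>Half of the exponential moment carries the factor exp (\<delta>/2 \<bar>y\<bar>); the
  other half, split into three sixths of \<delta>, pays for the three linear factors.\<close>

lemma integrable_poly_exp:
  assumes [measurable]: "h \<in> borel_measurable borel"
    and "\<And>y. \<bar>h y\<bar> \<le> C * (1 + \<bar>y\<bar>) ^ 3 * exp (\<delta>/2 * \<bar>y\<bar>)" and "0 \<le> C"
  shows "integrable lborel (\<lambda>y. N y * h y)"
proof (rule integrable_N_mult)
  fix y
  have "(1 + \<bar>y\<bar>) ^ 3 \<le> ((1 + inverse (\<delta>/6)) * exp (\<delta>/6 * \<bar>y\<bar>)) ^ 3"
    using \<delta>_pos by (intro power_mono poly_exp_bound) auto
  also have "\<dots> = (1 + inverse (\<delta>/6)) ^ 3 * exp (\<delta>/2 * \<bar>y\<bar>)"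
    by (simp add: power_mult_distrib flip: exp_of_nat_mult)
  finally have "C * (1 + \<bar>y\<bar>) ^ 3 * exp (\<delta>/2 * \<bar>y\<bar>) \<le> C * ((1 + inverse (\<delta>/6)) ^ 3 * exp (\<delta>/2 * \<bar>y\<bar>)) * exp (\<delta>/2 * \<bar>y\<bar>)"
    using assms(3) by (intro mult_right_mono mult_left_mono) auto
  also have "\<dots> = C * (1 + inverse (\<delta>/6)) ^ 3 * exp (\<delta> * \<bar>y\<bar>)"
    by (simp add: mult_exp_exp)
  finally show "\<bar>h y\<bar> \<le> C * (1 + inverse (\<delta>/6)) ^ 3 * exp (\<delta> * \<bar>y\<bar>)"
    using assms(2)[of y] by simp
qed auto

text \<open>These moments weigh three separate errors in \<open>oscillation_at_max\<close>:
  \<open>M1\<close> the oscillation inside a window of radius R, \<open>M2\<close> the deviation of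
  the majorant from a constant, and \<open>M3\<close> the part outside the window, where an extra
  factor \<bar>y\<bar> is traded for 1/R.\<close>

definition M1 :: real where "M1 = (\<integral>y. N y * (1 + \<bar>y\<bar>) \<partial>lborel)"
definition M2 :: real where "M2 = (\<integral>y. N y * (\<bar>y\<bar> * exp (\<delta>/2 * \<bar>y\<bar>)) \<partial>lborel)"
definition M3 :: real where "M3 = (\<integral>y. N y * ((1 + \<bar>y\<bar>) * 4 * \<bar>y\<bar>\<^sup>2 * exp (\<delta>/2 * \<bar>y\<bar>)) \<partial>lborel)"

lemma integrable_M1: "integrable lborel (\<lambda>y. N y * (1 + \<bar>y\<bar>))"
proof (rule integrable_poly_exp[where C=1])
  fix y :: real
  have "1 + \<bar>y\<bar> \<le> (1 + \<bar>y\<bar>) ^ 3" by (rule self_le_power) auto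
  moreover have "1 \<le> exp (\<delta>/2 * \<bar>y\<bar>)" using \<delta>_pos by simp
  ultimately have "(1 + \<bar>y\<bar>) * 1 \<le> (1 + \<bar>y\<bar>) ^ 3 * exp (\<delta>/2 * \<bar>y\<bar>)"
    by (intro mult_mono) auto
  then show "\<bar>1 + \<bar>y\<bar>\<bar> \<le> 1 * (1 + \<bar>y\<bar>) ^ 3 * exp (\<delta>/2 * \<bar>y\<bar>)" by simp
qed auto

lemma integrable_M2: "integrable lborel (\<lambda>y. N y * (\<bar>y\<bar> * exp (\<delta>/2 * \<bar>y\<bar>)))"
proof (rule integrable_poly_exp[where C=1])
  fix y :: real
  have "1 + \<bar>y\<bar> \<le> (1 + \<bar>y\<bar>) ^ 3" by (rule self_le_power) auto
  then have "\<bar>y\<bar> * exp (\<delta>/2 * \<bar>y\<bar>) \<le> (1 + \<bar>y\<bar>) ^ 3 * exp (\<delta>/2 * \<bar>y\<bar>)"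
    by (intro mult_right_mono) auto
  then show "\<bar>\<bar>y\<bar> * exp (\<delta>/2 * \<bar>y\<bar>)\<bar> \<le> 1 * (1 + \<bar>y\<bar>) ^ 3 * exp (\<delta>/2 * \<bar>y\<bar>)" by (simp add: abs_mult)
qed auto

lemma integrable_M3: "integrable lborel (\<lambda>y. N y * ((1 + \<bar>y\<bar>) * 4 * \<bar>y\<bar>\<^sup>2 * exp (\<delta>/2 * \<bar>y\<bar>)))"
proof (rule integrable_poly_exp[where C=4])
  fix y :: real
  have "\<bar>y\<bar>\<^sup>2 \<le> (1 + \<bar>y\<bar>)\<^sup>2" by (intro power_mono) auto
  then have "(1 + \<bar>y\<bar>) * \<bar>y\<bar>\<^sup>2 \<le> (1 + \<bar>y\<bar>) * (1 + \<bar>y\<bar>)\<^sup>2"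
    by (intro mult_left_mono) auto
  also have "\<dots> = (1 + \<bar>y\<bar>) ^ 3" by (simp add: power3_eq_cube power2_eq_square)
  finally have "4 * ((1 + \<bar>y\<bar>) * \<bar>y\<bar>\<^sup>2) * exp (\<delta>/2 * \<bar>y\<bar>) \<le> 4 * (1 + \<bar>y\<bar>) ^ 3 * exp (\<delta>/2 * \<bar>y\<bar>)"
    by (intro mult_right_mono) auto
  moreover have "\<bar>(1 + \<bar>y\<bar>) * 4 * \<bar>y\<bar>\<^sup>2 * exp (\<delta>/2 * \<bar>y\<bar>)\<bar> = 4 * ((1 + \<bar>y\<bar>) * \<bar>y\<bar>\<^sup>2) * exp (\<delta>/2 * \<bar>y\<bar>)"
    by (subst abs_of_nonneg) (auto simp only: mult_ac, auto)
  ultimately show "\<bar>(1 + \<bar>y\<bar>) * 4 * \<bar>y\<bar>\<^sup>2 * exp (\<delta>/2 * \<bar>y\<bar>)\<bar> \<le> 4 * (1 + \<bar>y\<bar>) ^ 3 * exp (\<delta>/2 * \<bar>y\<bar>)"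
    by (simp only:)
qed auto

lemma M_nonneg: "0 \<le> M1" "0 \<le> M2" "0 \<le> M3"
  unfolding M1_def M2_def M3_def
  using N_nonneg by (auto intro!: Bochner_Integration.integral_nonneg)

text \<open>A quantitative maximum principle. At a point where \<open>\<bar>\<omega>\<bar>\<close>
  touches the slowly varying majorant \<open>\<omega>0 * a\<close>, a small defect means that the
  average over \<open>N\<close> nearly equals the maximum, hence that \<omega> is nearly constant
  around \<open>x0\<close> in the mean. The oscillation is measured through its antiderivative
  \<open>E\<close>, because it enters the Taylor remainders only after integration.\<close>

lemma oscillation_at_max:
  assumes \<omega>: "subexponential \<omega>" and \<omega>0: "\<omega>0 = \<bar>\<omega> x0\<bar>" "0 < \<omega>0"
    and \<eta>: "0 \<le> \<eta>0" "\<eta>0 \<le> \<delta>/2"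
    and c: "0 < R" "0 < c" "\<And>t. \<bar>t\<bar> \<le> R \<Longrightarrow> c \<le> N t"
    and a: "continuous_on UNIV a" "\<And>y. \<bar>a y - 1\<bar> \<le> exp (\<eta>0 * \<bar>y\<bar>) - 1"
    and dom: "\<And>y. \<bar>\<omega> (x0 - y)\<bar> \<le> \<omega>0 * a y"
    and def: "\<bar>defect \<omega> x0\<bar> \<le> \<tau> * \<omega>0"
    and E: "\<And>t. (E has_real_derivative \<bar>\<omega> (x0 - t) - \<omega> x0\<bar>) (at t)"
  shows "(\<integral>y. N y * ((1 + \<bar>y\<bar>) * (E \<bar>y\<bar> - E (- \<bar>y\<bar>))) \<partial>lborel) \<le>
    \<omega>0 * (M1 * (2 * R * (\<eta>0 * R * exp (\<delta>/2 * R)) + (\<tau> + \<eta>0 * M2) / c) + M3 / R)"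
proof -
  note [measurable] = subexponential_meas[OF \<omega>] borel_measurable_continuous_onI[OF a(1)]
  have cw: "continuous_on UNIV \<omega>" using \<omega> by (rule subexponential_cont)
  have \<delta>0: "\<eta>0 * \<bar>y\<bar> \<le> \<delta>/2 * \<bar>y\<bar>" for y using \<eta> by (intro mult_right_mono) auto
  have ex: "exp (\<eta>0 * \<bar>y\<bar>) - 1 \<le> \<eta>0 * (\<bar>y\<bar> * exp (\<delta>/2 * \<bar>y\<bar>))" for y
  proof -
    have "exp (\<eta>0 * \<bar>y\<bar>) - 1 \<le> \<eta>0 * \<bar>y\<bar> * exp (\<eta>0 * \<bar>y\<bar>)" by (rule exp_minus_one_le)
    also have "\<dots> \<le> \<eta>0 * \<bar>y\<bar> * exp (\<delta>/2 * \<bar>y\<bar>)" using \<delta>0[of y] \<eta> by (intro mult_left_mono) auto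
    finally show ?thesis by simp
  qed
  define \<sigma> where "\<sigma> = sgn (\<omega> x0)"
  have \<sigma>: "\<bar>\<sigma>\<bar> = 1" "\<sigma> * \<omega> x0 = \<omega>0" using \<omega>0 by (auto simp: \<sigma>_def abs_sgn mult.commute)
  \<comment> \<open>The gap in the domination, nonnegative by \<open>dom\<close>. Its integral
    \<open>Z\<close> against \<open>N\<close> is governed by the defect at \<open>x0\<close> and by
    the distance of \<open>a\<close> from 1.\<close>
  define \<zeta> where "\<zeta> y = a y - \<sigma> * \<omega> (x0 - y) / \<omega>0" for y
  have \<zeta>0: "0 \<le> \<zeta> y" for y
  proof -
    have "\<sigma> * \<omega> (x0 - y) \<le> \<bar>\<sigma> * \<omega> (x0 - y)\<bar>" by simp
    also have "\<dots> \<le> \<omega>0 * a y" using dom[of y] \<sigma> by (simp add: abs_mult)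
    finally show ?thesis using \<omega>0(2) by (simp add: \<zeta>_def field_simps)
  qed
  have c\<zeta>: "continuous_on UNIV \<zeta>" unfolding \<zeta>_def
    by (intro continuous_intros a continuous_on_compose2[OF cw]) (use \<omega>0 in auto)
  have abd: "\<bar>a y\<bar> \<le> 1 * exp (\<eta>0 * \<bar>y\<bar>)" for y
  proof -
    have "0 \<le> \<omega>0 * a y" using dom[of y] by linarith
    then have "0 \<le> a y" using \<omega>0(2) by (simp add: zero_le_mult_iff)
    then show ?thesis using a(2)[of y] by simp
  qed
  have intNa: "integrable lborel (\<lambda>y. N y * a y)"
    by (rule integrable_N_mult[OF _ abd]) (use \<eta> \<delta>_pos in auto)
  have intNw: "integrable lborel (\<lambda>y. N y * \<omega> (x0 - y))" by (rule integrable_shift[OF \<omega>])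
  have N\<zeta>: "N y * \<zeta> y = N y * a y - (\<sigma> / \<omega>0) * (N y * \<omega> (x0 - y))" for y
    by (simp add: \<zeta>_def algebra_simps)
  have intN\<zeta>: "integrable lborel (\<lambda>y. N y * \<zeta> y)"
    unfolding N\<zeta> using intNa intNw by simp
  define Z where "Z = (\<integral>y. N y * \<zeta> y \<partial>lborel)"
  have "Z = (\<integral>y. N y * a y \<partial>lborel) - (\<sigma> / \<omega>0) * (\<omega> x0 - defect \<omega> x0)"
    unfolding Z_def N\<zeta> using intNa intNw by (simp add: defect_eq[OF \<omega>])
  also have "(\<sigma> / \<omega>0) * (\<omega> x0 - defect \<omega> x0) = 1 - \<sigma> * defect \<omega> x0 / \<omega>0"
    using \<sigma> \<omega>0(2) by (simp add: field_simps)
  finally have Z1: "Z = ((\<integral>y. N y * a y \<partial>lborel) - 1) + \<sigma> * defect \<omega> x0 / \<omega>0" by simp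
  have "(\<integral>y. N y * a y \<partial>lborel) - 1 = (\<integral>y. N y * (a y - 1) \<partial>lborel)"
    using intNa N_integrable N_mass by (simp add: right_diff_distrib)
  also have "\<dots> \<le> (\<integral>y. \<eta>0 * (N y * (\<bar>y\<bar> * exp (\<delta>/2 * \<bar>y\<bar>))) \<partial>lborel)"
  proof (rule integral_mono)
    show "integrable lborel (\<lambda>y. N y * (a y - 1))"
      using intNa N_integrable by (simp add: right_diff_distrib)
    show "integrable lborel (\<lambda>y. \<eta>0 * (N y * (\<bar>y\<bar> * exp (\<delta>/2 * \<bar>y\<bar>))))"
      using integrable_M2 by simp
    fix y
    have "a y - 1 \<le> \<eta>0 * (\<bar>y\<bar> * exp (\<delta>/2 * \<bar>y\<bar>))" using a(2)[of y] ex[of y] by linarith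
    then have "N y * (a y - 1) \<le> N y * (\<eta>0 * (\<bar>y\<bar> * exp (\<delta>/2 * \<bar>y\<bar>)))"
      using N_nonneg by (rule mult_left_mono)
    then show "N y * (a y - 1) \<le> \<eta>0 * (N y * (\<bar>y\<bar> * exp (\<delta>/2 * \<bar>y\<bar>)))" by (simp add: mult_ac)
  qed
  also have "\<dots> = \<eta>0 * M2" unfolding M2_def using integrable_M2 by simp
  finally have "(\<integral>y. N y * a y \<partial>lborel) - 1 \<le> \<eta>0 * M2" .
  moreover have "\<sigma> * defect \<omega> x0 / \<omega>0 \<le> \<tau>"
  proof -
    have "\<sigma> * defect \<omega> x0 \<le> \<bar>\<sigma> * defect \<omega> x0\<bar>" by simp
    also have "\<dots> \<le> \<tau> * \<omega>0" using def \<sigma> by (simp add: abs_mult)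
    finally show ?thesis using \<omega>0 by (simp add: field_simps)
  qed
  ultimately have Z: "Z \<le> \<tau> + \<eta>0 * M2" using Z1 by linarith
  define e where "e t = \<bar>\<omega> (x0 - t) - \<omega> x0\<bar>" for t
  have E': "(E has_real_derivative e t) (at t)" for t using E by (simp add: e_def)
  have ce: "continuous_on UNIV e" unfolding e_def
    by (intro continuous_intros continuous_on_compose2[OF cw]) auto
  have e0: "0 \<le> e t" for t by (simp add: e_def)
  have eeq: "e t = \<omega>0 * \<bar>a t - 1 - \<zeta> t\<bar>" for t
  proof -
    have "e t = \<bar>\<sigma>\<bar> * \<bar>\<omega> (x0 - t) - \<omega> x0\<bar>" using \<sigma> by (simp add: e_def)
    also have "\<dots> = \<bar>\<sigma> * \<omega> (x0 - t) - \<omega>0\<bar>" using \<sigma>(2) by (metis abs_mult right_diff_distrib)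
    also have "\<sigma> * \<omega> (x0 - t) - \<omega>0 = \<omega>0 * (a t - 1 - \<zeta> t)"
      using \<omega>0(2) by (simp add: \<zeta>_def field_simps)
    finally show ?thesis using \<omega>0(2) by (simp add: abs_mult)
  qed
  have e1: "e t \<le> \<omega>0 * (exp (\<eta>0 * \<bar>t\<bar>) - 1 + \<zeta> t)" for t
    unfolding eeq using a(2)[of t] \<zeta>0[of t] \<omega>0(2) by (intro mult_left_mono) auto
  have e2: "e t \<le> \<omega>0 * (2 * exp (\<eta>0 * \<bar>t\<bar>))" for t
  proof -
    have "e t \<le> \<bar>\<omega> (x0 - t)\<bar> + \<omega>0" using \<omega>0(1) by (simp add: e_def)
    also have "\<dots> \<le> \<omega>0 * exp (\<eta>0 * \<bar>t\<bar>) + \<omega>0 * exp (\<eta>0 * \<bar>t\<bar>)"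
    proof (rule add_mono)
      have "a t \<le> exp (\<eta>0 * \<bar>t\<bar>)" using abd[of t] by simp
      then show "\<bar>\<omega> (x0 - t)\<bar> \<le> \<omega>0 * exp (\<eta>0 * \<bar>t\<bar>)"
        using dom[of t] \<omega>0(2) by (meson less_eq_real_def mult_left_mono order_trans)
      show "\<omega>0 \<le> \<omega>0 * exp (\<eta>0 * \<bar>t\<bar>)" using \<omega>0(2) \<eta> by simp
    qed
    finally show ?thesis by simp
  qed
  \<comment> \<open>Bound for the oscillation over the window, relative to \<open>\<omega>0\<close>.
    The first summand comes from \<open>a\<close>, the second from the gap, where the lower bound
    \<open>c\<close> turns an integral against \<open>N\<close> into a Lebesgue integral.\<close>
  define X where "X = 2 * R * (\<eta>0 * R * exp (\<delta>/2 * R)) + (\<tau> + \<eta>0 * M2) / c"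
  have Emono: "E s \<le> E t" if "s \<le> t" for s t
    by (rule DERIV_nonneg_imp_nondecreasing[OF that]) (use E' e0 in blast)
  have ER: "E R - E (- R) \<le> \<omega>0 * X"
  proof -
    have hbi: "integrable lborel (\<lambda>t. e t * indicator {-R..R} t)"
         "(\<integral>t. e t * indicator {-R..R} t \<partial>lborel) = E R - E (-R)"
      using has_bochner_integral_FTC_Icc_real[of "-R" R E e] E' ce c(1)
      by (auto simp: has_bochner_integral_iff continuous_on_eq_continuous_at)
    have "E R - E (- R) = (\<integral>t. e t * indicator {-R..R} t \<partial>lborel)" using hbi by simp
    also have "\<dots> \<le> (\<integral>t. \<omega>0 * (\<eta>0 * R * exp (\<delta>/2 * R)) * indicator {-R..R} t + \<omega>0 / c * (N t * \<zeta> t) \<partial>lborel)"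
    proof (rule integral_mono)
      show "integrable lborel (\<lambda>t. \<omega>0 * (\<eta>0 * R * exp (\<delta>/2 * R)) * indicator {-R..R} t + \<omega>0 / c * (N t * \<zeta> t))"
        using intN\<zeta>
        by (intro Bochner_Integration.integrable_add integrable_mult_right integrable_real_indicator)
           (auto simp: emeasure_lborel_Icc_eq)
      fix t
      show "e t * indicator {-R..R} t \<le> \<omega>0 * (\<eta>0 * R * exp (\<delta>/2 * R)) * indicator {-R..R} t + \<omega>0 / c * (N t * \<zeta> t)"
      proof (cases "\<bar>t\<bar> \<le> R")
        case True
        have "exp (\<eta>0 * \<bar>t\<bar>) - 1 \<le> exp (\<eta>0 * \<bar>R\<bar>) - 1" using True \<eta> c(1) by (auto intro: mult_left_mono)
        also have "\<dots> \<le> \<eta>0 * R * exp (\<delta>/2 * R)" using ex[of R] c(1) by simp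
        finally have "\<omega>0 * (exp (\<eta>0 * \<bar>t\<bar>) - 1) \<le> \<omega>0 * (\<eta>0 * R * exp (\<delta>/2 * R))"
          using \<omega>0(2) by (intro mult_left_mono) auto
        moreover have "\<omega>0 * \<zeta> t \<le> \<omega>0 / c * (N t * \<zeta> t)"
        proof -
          have "c * \<zeta> t \<le> N t * \<zeta> t" using c(3)[OF True] \<zeta>0 by (rule mult_right_mono)
          then have "\<omega>0 / c * (c * \<zeta> t) \<le> \<omega>0 / c * (N t * \<zeta> t)" using \<omega>0(2) c(2) by (intro mult_left_mono) auto
          then show ?thesis using c(2) by simp
        qed
        ultimately show ?thesis using e1[of t] True by (auto simp: indicator_def algebra_simps)
      next
        case False
        then have "t \<notin> {-R..R}" by auto
        then show ?thesis using N_nonneg[of t] \<zeta>0[of t] \<omega>0(2) c(2) by simp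
      qed
    qed (rule hbi)
    also have "\<dots> = \<omega>0 * (\<eta>0 * R * exp (\<delta>/2 * R)) * (2 * R) + \<omega>0 / c * Z"
      using intN\<zeta> c(1) by (simp add: Z_def)
    also have "\<dots> \<le> \<omega>0 * (\<eta>0 * R * exp (\<delta>/2 * R)) * (2 * R) + \<omega>0 / c * (\<tau> + \<eta>0 * M2)"
      using Z \<omega>0(2) c(2) by (intro add_left_mono mult_left_mono) auto
    also have "\<dots> = \<omega>0 * X" by (simp add: X_def algebra_simps add_divide_distrib)
    finally show ?thesis .
  qed
  have X0: "0 \<le> X"
  proof -
    have "0 \<le> E R - E (- R)" using Emono[of "-R" R] c(1) by simp
    then have "0 \<le> \<omega>0 * X" using ER by linarith
    then show ?thesis using \<omega>0(2) by (simp add: zero_le_mult_iff)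
  qed
  \<comment> \<open>Inside the window monotonicity of \<open>E\<close> suffices. Outside it
    \<bar>y\<bar> exceeds R, so \<bar>y\<bar> is at most \<bar>y\<bar>^2 / R, which makes this part
    small for large R.\<close>
  have G: "E \<bar>y\<bar> - E (- \<bar>y\<bar>) \<le> \<omega>0 * X + \<omega>0 / R * (4 * \<bar>y\<bar>\<^sup>2 * exp (\<delta>/2 * \<bar>y\<bar>))" for y
  proof (cases "\<bar>y\<bar> \<le> R")
    case True
    have "E \<bar>y\<bar> - E (- \<bar>y\<bar>) \<le> E R - E (- R)"
      using Emono[of "\<bar>y\<bar>" R] Emono[of "-R" "-\<bar>y\<bar>"] True by simp
    moreover have "0 \<le> \<omega>0 / R * (4 * \<bar>y\<bar>\<^sup>2 * exp (\<delta>/2 * \<bar>y\<bar>))"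
      using \<omega>0(2) c(1) by (intro mult_nonneg_nonneg) auto
    ultimately show ?thesis using ER by linarith
  next
    case False
    have "norm (E \<bar>y\<bar> - E (- \<bar>y\<bar>)) \<le> \<omega>0 * (2 * exp (\<delta>/2 * \<bar>y\<bar>)) * norm (\<bar>y\<bar> - - \<bar>y\<bar>)"
    proof (rule field_differentiable_bound[where S="{-\<bar>y\<bar>..\<bar>y\<bar>}" and f'=e])
      fix t assume "t \<in> {-\<bar>y\<bar>..\<bar>y\<bar>}"
      then have "\<bar>t\<bar> \<le> \<bar>y\<bar>" by auto
      then have "\<eta>0 * \<bar>t\<bar> \<le> \<delta>/2 * \<bar>y\<bar>" using \<eta> by (intro mult_mono) auto
      then have "\<omega>0 * (2 * exp (\<eta>0 * \<bar>t\<bar>)) \<le> \<omega>0 * (2 * exp (\<delta>/2 * \<bar>y\<bar>))"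
        using \<omega>0(2) by (intro mult_left_mono) auto
      then show "norm (e t) \<le> \<omega>0 * (2 * exp (\<delta>/2 * \<bar>y\<bar>))" using e2[of t] e0[of t] by simp
    qed (use E' in \<open>auto intro: DERIV_subset\<close>)
    then have "E \<bar>y\<bar> - E (- \<bar>y\<bar>) \<le> \<omega>0 * (4 * \<bar>y\<bar> * exp (\<delta>/2 * \<bar>y\<bar>))" by (simp add: mult_ac)
    also have "\<dots> \<le> \<omega>0 / R * (4 * \<bar>y\<bar>\<^sup>2 * exp (\<delta>/2 * \<bar>y\<bar>))"
    proof -
      have "R * \<bar>y\<bar> \<le> \<bar>y\<bar> * \<bar>y\<bar>" using False by (intro mult_right_mono) auto
      then have "\<bar>y\<bar> \<le> \<bar>y\<bar>\<^sup>2 / R" using c(1) by (simp add: power2_eq_square field_simps)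
      then have "\<omega>0 * (4 * \<bar>y\<bar> * exp (\<delta>/2 * \<bar>y\<bar>)) \<le> \<omega>0 * (4 * (\<bar>y\<bar>\<^sup>2 / R) * exp (\<delta>/2 * \<bar>y\<bar>))"
        using \<omega>0(2) by (intro mult_left_mono mult_right_mono) auto
      then show ?thesis by (simp add: mult_ac)
    qed
    also have "\<dots> \<le> \<omega>0 * X + \<omega>0 / R * (4 * \<bar>y\<bar>\<^sup>2 * exp (\<delta>/2 * \<bar>y\<bar>))"
      using X0 \<omega>0(2) by simp
    finally show ?thesis .
  qed
  have "(\<integral>y. N y * ((1 + \<bar>y\<bar>) * (E \<bar>y\<bar> - E (- \<bar>y\<bar>))) \<partial>lborel) \<le>
     (\<integral>y. \<omega>0 * X * (N y * (1 + \<bar>y\<bar>)) + \<omega>0 / R * (N y * ((1 + \<bar>y\<bar>) * 4 * \<bar>y\<bar>\<^sup>2 * exp (\<delta>/2 * \<bar>y\<bar>))) \<partial>lborel)"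
  proof (rule integral_mono')
    show "integrable lborel (\<lambda>y. \<omega>0 * X * (N y * (1 + \<bar>y\<bar>)) + \<omega>0 / R * (N y * ((1 + \<bar>y\<bar>) * 4 * \<bar>y\<bar>\<^sup>2 * exp (\<delta>/2 * \<bar>y\<bar>))))"
      using integrable_M1 integrable_M3 by (intro Bochner_Integration.integrable_add integrable_mult_right) auto
    fix y
    have "N y * ((1 + \<bar>y\<bar>) * (E \<bar>y\<bar> - E (- \<bar>y\<bar>))) \<le>
      N y * ((1 + \<bar>y\<bar>) * (\<omega>0 * X + \<omega>0 / R * (4 * \<bar>y\<bar>\<^sup>2 * exp (\<delta>/2 * \<bar>y\<bar>))))"
      using G[of y] N_nonneg by (intro mult_left_mono) auto
    also have "\<dots> = \<omega>0 * X * (N y * (1 + \<bar>y\<bar>)) + \<omega>0 / R * (N y * ((1 + \<bar>y\<bar>) * 4 * \<bar>y\<bar>\<^sup>2 * exp (\<delta>/2 * \<bar>y\<bar>)))"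
      by (simp add: distrib_left distrib_right mult_ac add_divide_distrib)
    finally show "N y * ((1 + \<bar>y\<bar>) * (E \<bar>y\<bar> - E (- \<bar>y\<bar>))) \<le>
      \<omega>0 * X * (N y * (1 + \<bar>y\<bar>)) + \<omega>0 / R * (N y * ((1 + \<bar>y\<bar>) * 4 * \<bar>y\<bar>\<^sup>2 * exp (\<delta>/2 * \<bar>y\<bar>)))" .
    show "0 \<le> \<omega>0 * X * (N y * (1 + \<bar>y\<bar>)) + \<omega>0 / R * (N y * ((1 + \<bar>y\<bar>) * 4 * \<bar>y\<bar>\<^sup>2 * exp (\<delta>/2 * \<bar>y\<bar>)))"
      using N_nonneg[of y] X0 \<omega>0(2) c(1) by (intro add_nonneg_nonneg mult_nonneg_nonneg) auto
  qed
  also have "\<dots> = \<omega>0 * X * M1 + \<omega>0 / R * M3"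
    unfolding M1_def M3_def
    by (subst Bochner_Integration.integral_add, (intro integrable_mult_right integrable_M1 integrable_M3)+)
       simp
  also have "\<dots> = \<omega>0 * (M1 * X + M3 / R)" by (simp add: algebra_simps)
  finally show ?thesis unfolding X_def .
qed

end

lemma field_le_epsilon_mult:
  fixes x y c :: real
  assumes "\<And>k. 0 < k \<Longrightarrow> x \<le> y + k * c"
  shows "x \<le> y"
proof (rule field_le_epsilon)
  fix e :: real assume e: "0 < e"
  define k where "k = e / (\<bar>c\<bar> + 1)"
  have k: "0 < k" unfolding k_def using e by simp
  have "k * c \<le> k * (\<bar>c\<bar> + 1)" using k by (intro mult_left_mono) auto
  also have "\<dots> = e" by (simp add: k_def)
  finally show "x \<le> y + e" using assms[OF k] by linarith
qed

lemma deriv_dominated: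
  fixes p E p' E' :: "real \<Rightarrow> real"
  assumes p: "\<And>t. (p has_real_derivative p' t) (at t)"
    and E: "\<And>t. (E has_real_derivative E' t) (at t)"
    and le: "\<And>t. \<bar>p' t\<bar> \<le> E' t"
  shows "\<bar>p s - p t\<bar> \<le> \<bar>E s - E t\<bar>"
proof -
  have *: "\<bar>p s - p t\<bar> \<le> \<bar>E s - E t\<bar>" if "t \<le> s" for s t
  proof -
    have "E t - p t \<le> E s - p s"
    proof (rule DERIV_nonneg_imp_nondecreasing[OF that], intro exI conjI)
      fix u show "((\<lambda>u. E u - p u) has_real_derivative E' u - p' u) (at u)"
        by (intro derivative_intros p E)
      show "0 \<le> E' u - p' u" using le[of u] by linarith
    qed
    moreover have "E t + p t \<le> E s + p s"
    proof (rule DERIV_nonneg_imp_nondecreasing[OF that], intro exI conjI)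
      fix u show "((\<lambda>u. E u + p u) has_real_derivative E' u + p' u) (at u)"
        by (intro derivative_intros p E)
      show "0 \<le> E' u + p' u" using le[of u] by linarith
    qed
    ultimately show ?thesis by linarith
  qed
  show ?thesis using *[of t s] *[of s t] by (metis abs_minus_commute linear)
qed

lemma exp_int_deriv:
  fixes \<eta> B :: real assumes "\<eta> \<noteq> 0"
  shows "((\<lambda>x. B / \<eta> * exp (\<eta> * x)) has_real_derivative B * exp (\<eta> * x)) (at x)"
  using assms by (auto intro!: derivative_eq_intros)

lemma tendsto_exp_at_bot:
  fixes \<eta> :: real assumes "0 < \<eta>"
  shows "((\<lambda>x. exp (\<eta> * x)) \<longlongrightarrow> 0) at_bot"
  by (rule filterlim_compose[OF exp_at_bot], rule filterlim_tendsto_pos_mult_at_bot[OF tendsto_const assms])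
     (rule filterlim_ident)

lemma tendsto_exp_neg_at_top:
  fixes \<eta> :: real assumes "0 < \<eta>"
  shows "((\<lambda>x. exp (- (\<eta> * x))) \<longlongrightarrow> 0) at_top"
  by (rule filterlim_compose[OF exp_at_bot])
     (use assms in \<open>auto simp: filterlim_uminus_at_bot intro!: filterlim_tendsto_pos_mult_at_top[OF tendsto_const assms] filterlim_ident\<close>)

lemma limit_at_bot_exp:
  fixes V \<rho> :: "real \<Rightarrow> real"
  assumes V: "\<And>x. (V has_real_derivative \<rho> x) (at x)"
    and \<rho>: "\<And>x. \<bar>\<rho> x\<bar> \<le> B * exp (\<eta> * x)" and \<eta>: "0 < \<eta>"
  obtains v where "(V \<longlongrightarrow> v) at_bot" "\<And>x. \<bar>V x - v\<bar> \<le> B / \<eta> * exp (\<eta> * x)"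
proof -
  have B: "0 \<le> B" using \<rho>[of 0] by simp
  have diff: "\<bar>V x - V y\<bar> \<le> B / \<eta> * exp (\<eta> * x)" if "y \<le> x" for x y
  proof -
    have "\<bar>V x - V y\<bar> \<le> \<bar>B / \<eta> * exp (\<eta> * x) - B / \<eta> * exp (\<eta> * y)\<bar>"
      using \<eta> by (intro deriv_dominated[OF V exp_int_deriv \<rho>]) auto
    moreover have "B / \<eta> * exp (\<eta> * y) \<le> B / \<eta> * exp (\<eta> * x)"
      using that \<eta> B by (intro mult_left_mono) auto
    moreover have "0 \<le> B / \<eta> * exp (\<eta> * y)" using \<eta> B by simp
    ultimately show ?thesis by linarith
  qed
  have e0: "((\<lambda>x. B / \<eta> * exp (\<eta> * x)) \<longlongrightarrow> 0) at_bot"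
    by (rule tendsto_mult_right_zero[OF tendsto_exp_at_bot[OF \<eta>]])
  have "Cauchy (\<lambda>n. V (- real n))"
    unfolding Cauchy_def
  proof (intro allI impI)
    fix e :: real assume "0 < e"
    then have "\<forall>\<^sub>F x in at_bot. B / \<eta> * exp (\<eta> * x) < e / 2"
      using order_tendstoD(2)[OF e0, of "e/2"] by simp
    then obtain A where A: "\<And>x. x \<le> A \<Longrightarrow> B / \<eta> * exp (\<eta> * x) < e / 2"
      by (auto simp: eventually_at_bot_linorder)
    obtain M :: nat where M: "- A \<le> real M" using real_arch_simple by blast
    have "dist (V (- real m)) (V (- real n)) < e" if "m \<ge> M" "n \<ge> M" for m n
    proof -
      have o: "- real m \<le> - real M" "- real n \<le> - real M" "- real M \<le> A" using that M by auto
      have "\<bar>V (- real M) - V (- real m)\<bar> < e / 2" "\<bar>V (- real M) - V (- real n)\<bar> < e / 2"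
        using diff[OF o(1)] diff[OF o(2)] A[OF o(3)] by linarith+
      then show ?thesis unfolding dist_real_def by linarith
    qed
    then show "\<exists>M. \<forall>m\<ge>M. \<forall>n\<ge>M. dist (V (- real m)) (V (- real n)) < e" by blast
  qed
  then obtain v where v: "(\<lambda>n. V (- real n)) \<longlonglongrightarrow> v"
    using Cauchy_convergent convergent_def by blast
  have b: "\<bar>V x - v\<bar> \<le> B / \<eta> * exp (\<eta> * x)" for x
  proof (rule tendsto_upperbound)
    show "(\<lambda>n. \<bar>V x - V (- real n)\<bar>) \<longlonglongrightarrow> \<bar>V x - v\<bar>" by (intro tendsto_intros v)
    obtain M :: nat where M: "- x \<le> real M" using real_arch_simple by blast
    then show "\<forall>\<^sub>F n in sequentially. \<bar>V x - V (- real n)\<bar> \<le> B / \<eta> * exp (\<eta> * x)"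
      by (intro eventually_sequentiallyI[of M] diff) (simp add: order_trans)
  qed simp
  have "((\<lambda>x. V x - v) \<longlongrightarrow> 0) at_bot"
    by (rule tendsto_rabs_zero_cancel, rule tendsto_sandwich[OF _ _ tendsto_const e0]) (use b in auto)
  then have "(V \<longlongrightarrow> v) at_bot" by (simp add: LIM_zero_iff)
  then show ?thesis using b that by blast
qed

lemma continuous_vanishing_bounded:
  fixes w :: "real \<Rightarrow> real"
  assumes "continuous_on UNIV w" "(w \<longlongrightarrow> 0) at_top"
  obtains C where "0 < C" "\<And>x. 0 \<le> x \<Longrightarrow> \<bar>w x\<bar> \<le> C"
proof -
  have "\<forall>\<^sub>F x in at_top. \<bar>w x\<bar> < 1"
    using order_tendstoD(2)[OF tendsto_rabs[OF assms(2)], of 1] by simp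
  then obtain A where A: "\<And>x. x \<ge> A \<Longrightarrow> \<bar>w x\<bar> < 1" by (auto simp: eventually_at_top_linorder)
  have "compact (w ` {0..A})"
    using assms(1) by (intro compact_continuous_image) (auto intro: continuous_on_subset)
  then obtain D where D: "\<And>x. x \<in> {0..A} \<Longrightarrow> \<bar>w x\<bar> \<le> D"
    using compact_imp_bounded by (force simp: bounded_iff)
  have "\<bar>w x\<bar> \<le> \<bar>D\<bar> + 1" if "0 \<le> x" for x
    using A[of x] D[of x] that by (cases "x \<le> A") auto
  then show ?thesis by (intro that[of "\<bar>D\<bar> + 1"]) auto
qed

context renewal_kernel
begin

text \<open>If \<theta> \<omega> agrees with a decaying \<open>Q\<close> up to the oscillation of
  \<omega>, and the defect decays as well, then \<omega> decays at the same rate: at a maximum of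
  \<bar>\<omega>\<bar> relative to exp (\<eta> x) the oscillation is a small fraction of
  \<bar>\<theta> \<omega>\<bar>, so a large \<omega> contradicts the bound for \<open>Q\<close>. The
  threshold \<open>\<eta>0\<close> depends on \<theta> and the kernel alone, so it can be fixed
  before the rate is chosen.\<close>

lemma defect_bound:
  assumes \<theta>: "\<theta> \<noteq> 0"
  obtains \<eta>0 where "\<eta>0 > 0" "\<And>\<omega> Q \<eta> B. \<lbrakk>subexponential \<omega>; (\<omega> \<longlongrightarrow> 0) at_top; 0 \<le> \<eta>; \<eta> \<le> \<eta>0;
      \<And>x. x \<le> 0 \<Longrightarrow> \<bar>defect \<omega> x\<bar> \<le> B * exp (\<eta> * x); \<And>x. x \<le> 0 \<Longrightarrow> \<bar>Q x\<bar> \<le> B * exp (\<eta> * x);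
      \<And>x E. (\<And>t. (E has_real_derivative \<bar>\<omega> (x - t) - \<omega> x\<bar>) (at t)) \<Longrightarrow>
        \<bar>Q x - \<theta> * \<omega> x\<bar> \<le> (\<integral>y. N y * ((1 + \<bar>y\<bar>) * (E \<bar>y\<bar> - E (- \<bar>y\<bar>))) \<partial>lborel)\<rbrakk>
    \<Longrightarrow> \<exists>B'. \<forall>x. \<bar>\<omega> x\<bar> \<le> B' * exp (\<eta> * x)"
proof -
  \<comment> \<open>The budget of the contradiction: \<bar>\<theta>\<bar> consists of eight shares;
    the tail outside the window, the majorant and the defect may use one share each, and
    \<open>Q\<close> uses at most four.\<close>
  define h where "h = \<bar>\<theta>\<bar> / 8"
  have h: "0 < h" using \<theta> by (simp add: h_def)
  define R where "R = M3 / h + 1"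
  have R: "0 < R" using M_nonneg h by (simp add: R_def add_nonneg_pos)
  have MR: "M3 / R \<le> h"
    using R h by (simp add: divide_le_eq) (simp add: R_def field_simps)
  obtain c where c: "0 < c" "\<And>t. \<bar>t\<bar> \<le> R \<Longrightarrow> c \<le> N t" using N_low[of R] by blast
  define Y where "Y = M1 * (2 * R * (R * exp (\<delta>/2 * R)) + M2 / c)"
  have Y: "0 \<le> Y" unfolding Y_def using M_nonneg R c by (intro mult_nonneg_nonneg add_nonneg_nonneg) auto
  define \<eta>0 where "\<eta>0 = min (\<delta>/2) (h / (Y + 1))"
  have "0 < h / (Y + 1)" using h Y by simp
  then have \<eta>0: "0 < \<eta>0" "\<eta>0 \<le> \<delta>/2" using \<delta>_pos unfolding \<eta>0_def by linarith+
  have Yh: "\<eta>0 * Y \<le> h"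
  proof -
    have "\<eta>0 * Y \<le> h / (Y + 1) * Y" using Y by (intro mult_right_mono) (auto simp: \<eta>0_def)
    also have "\<dots> \<le> h" using Y h by (simp add: field_simps)
    finally show ?thesis .
  qed
  show ?thesis
  proof (rule that[OF \<eta>0(1)])
    fix \<omega> Q :: "real \<Rightarrow> real" and \<eta> B :: real
    assume \<omega>: "subexponential \<omega>" and top: "(\<omega> \<longlongrightarrow> 0) at_top" and \<eta>: "0 \<le> \<eta>" "\<eta> \<le> \<eta>0"
      and df: "\<And>x. x \<le> 0 \<Longrightarrow> \<bar>defect \<omega> x\<bar> \<le> B * exp (\<eta> * x)"
      and Q: "\<And>x. x \<le> 0 \<Longrightarrow> \<bar>Q x\<bar> \<le> B * exp (\<eta> * x)"
      and osc: "\<And>x E. (\<And>t. (E has_real_derivative \<bar>\<omega> (x - t) - \<omega> x\<bar>) (at t)) \<Longrightarrow>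
        \<bar>Q x - \<theta> * \<omega> x\<bar> \<le> (\<integral>y. N y * ((1 + \<bar>y\<bar>) * (E \<bar>y\<bar> - E (- \<bar>y\<bar>))) \<partial>lborel)"
    have cw: "continuous_on UNIV \<omega>" using \<omega> by (rule subexponential_cont)
    have B: "0 \<le> B" using df[of 0] by simp
    obtain C where C: "0 < C" "\<And>x. 0 \<le> x \<Longrightarrow> \<bar>\<omega> x\<bar> \<le> C"
      using continuous_vanishing_bounded[OF cw top] by blast
    \<comment> \<open>The summand \<open>C\<close> keeps the maximum point off the positive
      half-line, the second makes the defect term at most \<open>h\<close>, and the third makes
      \<open>Q\<close> at most \<open>4 * h\<close>, both relative to \<omega>.\<close>
    define B1 where "B1 = C + M1 * B / (c * h) + 2 * B / \<bar>\<theta>\<bar>"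
    have B1: "0 < B1" "C \<le> B1" "M1 * B / (c * h) \<le> B1" "2 * B / \<bar>\<theta>\<bar> \<le> B1"
      using C B M_nonneg c h \<theta> unfolding B1_def by (auto intro!: add_pos_nonneg)
    have main: "\<bar>\<omega> x\<bar> \<le> B1 * exp (\<eta> * x) + k * (B1 * exp (- (\<eta>0 * x)))" if k: "0 < k" for k x
    proof (rule ccontr)
      assume neg: "\<not> ?thesis"
      \<comment> \<open>The term with \<open>k\<close> makes the ratio vanish at -infinity, as
        \<omega> is subexponential, so that a maximum exists; it disappears when \<open>k\<close>
        tends to 0. Both exponents are at most \<open>\<eta>0\<close> in size, so a shift by y
        changes \<beta> by a factor of at most exp (\<open>\<eta>0\<close> \<bar>y\<bar>).\<close>
      define \<beta> where "\<beta> x = exp (\<eta> * x) + k * exp (- (\<eta>0 * x))" for x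
      have \<beta>0: "0 < \<beta> x" for x using k by (auto simp: \<beta>_def intro: add_pos_pos)
      define r where "r x = \<bar>\<omega> x\<bar> / \<beta> x" for x
      have rx: "B1 < r x" using neg \<beta>0[of x] by (simp add: r_def pos_less_divide_eq) (simp add: \<beta>_def algebra_simps)
      have c\<beta>: "continuous_on UNIV \<beta>" unfolding \<beta>_def by (intro continuous_intros)
      have cr: "continuous_on UNIV r" unfolding r_def
        by (intro continuous_intros cw c\<beta>) (use \<beta>0 in \<open>auto simp: less_imp_neq[symmetric]\<close>)
      have \<beta>k: "k * exp (- (\<eta>0 * x)) \<le> \<beta> x" for x by (simp add: \<beta>_def)
      obtain D where D: "0 < D" "\<And>x. \<bar>\<omega> x\<bar> \<le> D * exp (\<eta>0/2 * \<bar>x\<bar>)"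
        using subexponential_bound[OF \<omega>, of "\<eta>0/2"] \<eta>0 by auto
      have rbot: "(r \<longlongrightarrow> 0) at_bot"
      proof (rule tendsto_sandwich[OF _ _ tendsto_const])
        show "((\<lambda>x. D / k * exp (\<eta>0/2 * x)) \<longlongrightarrow> 0) at_bot"
          using \<eta>0 by (intro tendsto_mult_right_zero[OF tendsto_exp_at_bot]) auto
        show "\<forall>\<^sub>F x in at_bot. r x \<le> D / k * exp (\<eta>0/2 * x)"
        proof (rule eventually_at_bot_linorderI[of 0])
          fix x :: real assume x: "x \<le> 0"
          have "r x \<le> (D * exp (\<eta>0/2 * \<bar>x\<bar>)) / (k * exp (- (\<eta>0 * x)))"
            unfolding r_def using D \<beta>k[of x] k \<beta>0[of x] by (intro frac_le) auto
          also have "\<dots> = D / k * (exp (\<eta>0/2 * \<bar>x\<bar>) / exp (- (\<eta>0 * x)))" by simp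
          also have "exp (\<eta>0/2 * \<bar>x\<bar>) / exp (- (\<eta>0 * x)) = exp (\<eta>0/2 * x)"
            using x by (simp add: exp_diff[symmetric])
          finally show "r x \<le> D / k * exp (\<eta>0/2 * x)" .
        qed
        show "\<forall>\<^sub>F x in at_bot. 0 \<le> r x" using \<beta>0 by (auto simp: r_def less_imp_le)
      qed
      have rtop: "(r \<longlongrightarrow> 0) at_top"
      proof (rule tendsto_sandwich[OF _ _ tendsto_const])
        show "((\<lambda>x. \<bar>\<omega> x\<bar>) \<longlongrightarrow> 0) at_top" using tendsto_rabs[OF top] by simp
        show "\<forall>\<^sub>F x in at_top. r x \<le> \<bar>\<omega> x\<bar>"
        proof (rule eventually_at_top_linorderI[of 0])
          fix x :: real assume x: "0 \<le> x"
          have "1 \<le> \<beta> x" using x \<eta> k unfolding \<beta>_def by (intro add_increasing2) auto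
          then show "r x \<le> \<bar>\<omega> x\<bar>" unfolding r_def by (simp add: divide_le_eq mult_le_cancel_left1)
        qed
        show "\<forall>\<^sub>F x in at_top. 0 \<le> r x" using \<beta>0 by (auto simp: r_def less_imp_le)
      qed
      obtain x0 where x0: "\<And>x. r x \<le> r x0" "r x \<le> r x0"
        using vanishing_attains_max[OF cr rbot rtop, of x] rx B1 by auto
      define \<omega>0 where "\<omega>0 = \<bar>\<omega> x0\<bar>"
      have r0: "B1 < r x0" using rx x0(2) by linarith
      have w0: "\<omega>0 = r x0 * \<beta> x0" using \<beta>0[of x0] by (simp add: \<omega>0_def r_def)
      have w0B: "B1 * \<beta> x0 < \<omega>0" unfolding w0 using r0 \<beta>0 by (rule mult_strict_right_mono)
      have "0 < B1 * \<beta> x0" using B1(1) \<beta>0 by simp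
      with w0B have w0pos: "0 < \<omega>0" by linarith
      have x00: "x0 \<le> 0"
      proof (rule ccontr)
        assume "\<not> x0 \<le> 0"
        then have p: "0 \<le> x0" by simp
        have "1 \<le> \<beta> x0" using p \<eta> k unfolding \<beta>_def by (intro add_increasing2) auto
        then have "B1 * 1 \<le> B1 * \<beta> x0" using B1 by (intro mult_left_mono) auto
        then show False using C(2)[OF p] w0B B1(2) by (simp add: \<omega>0_def)
      qed
      have e\<beta>: "exp (\<eta> * x0) \<le> \<beta> x0" using k by (simp add: \<beta>_def)
      have ew: "B * exp (\<eta> * x0) \<le> B / B1 * \<omega>0"
      proof -
        have "B * exp (\<eta> * x0) \<le> B * \<beta> x0" using e\<beta> B by (rule mult_left_mono)
        also have "\<dots> = B / B1 * (B1 * \<beta> x0)" using B1 by simp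
        also have "\<dots> \<le> B / B1 * \<omega>0" using w0B B B1 by (intro mult_left_mono) auto
        finally show ?thesis .
      qed
      define a where "a y = \<beta> (x0 - y) / \<beta> x0" for y
      have ca: "continuous_on UNIV a" unfolding a_def
        by (intro continuous_intros continuous_on_compose2[OF c\<beta>]) (use \<beta>0[of x0] in auto)
      have up: "\<beta> (x0 - y) \<le> exp (\<eta>0 * \<bar>y\<bar>) * \<beta> x0" for y
      proof -
        have "exp (\<eta> * (x0 - y)) \<le> exp (\<eta>0 * \<bar>y\<bar>) * exp (\<eta> * x0)"
        proof -
          have "\<eta> * (- y) \<le> \<eta>0 * \<bar>y\<bar>" using \<eta>
            by (metis abs_ge_minus_self abs_ge_zero mult_left_mono mult_right_mono order_trans)
          then show ?thesis by (simp add: mult_exp_exp right_diff_distrib)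
        qed
        moreover have "exp (- (\<eta>0 * (x0 - y))) \<le> exp (\<eta>0 * \<bar>y\<bar>) * exp (- (\<eta>0 * x0))"
          using \<eta>0 by (simp add: mult_exp_exp right_diff_distrib)
        ultimately show ?thesis using k unfolding \<beta>_def
          by (simp add: distrib_left add_mono mult.left_commute)
      qed
      have ab: "\<bar>a y - 1\<bar> \<le> exp (\<eta>0 * \<bar>y\<bar>) - 1" for y
      proof -
        have 1: "a y \<le> exp (\<eta>0 * \<bar>y\<bar>)" unfolding a_def using up[of y] \<beta>0[of x0] by (simp add: divide_le_eq)
        have "\<beta> x0 \<le> exp (\<eta>0 * \<bar>y\<bar>) * \<beta> (x0 - y)"
        proof -
          have "exp (\<eta> * x0) \<le> exp (\<eta>0 * \<bar>y\<bar>) * exp (\<eta> * (x0 - y))"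
          proof -
            have "\<eta> * y \<le> \<eta>0 * \<bar>y\<bar>" using \<eta>
              by (metis abs_ge_self abs_ge_zero mult_left_mono mult_right_mono order_trans)
            then show ?thesis by (simp add: mult_exp_exp right_diff_distrib)
          qed
          moreover have "exp (- (\<eta>0 * x0)) \<le> exp (\<eta>0 * \<bar>y\<bar>) * exp (- (\<eta>0 * (x0 - y)))"
          proof -
            have "- y \<le> \<bar>y\<bar>" by simp
            then have "\<eta>0 * - y \<le> \<eta>0 * \<bar>y\<bar>" using \<eta>0(1) by (intro mult_left_mono) auto
            then show ?thesis by (simp add: mult_exp_exp right_diff_distrib)
          qed
          ultimately show ?thesis using k unfolding \<beta>_def
            by (simp add: distrib_left add_mono mult.left_commute)
        qed
        then have "1 \<le> exp (\<eta>0 * \<bar>y\<bar>) * a y" unfolding a_def using \<beta>0[of x0] by (simp add: le_divide_eq)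
        then have "exp (- (\<eta>0 * \<bar>y\<bar>)) * 1 \<le> exp (- (\<eta>0 * \<bar>y\<bar>)) * (exp (\<eta>0 * \<bar>y\<bar>) * a y)"
          by (intro mult_left_mono) auto
        then have 2: "exp (- (\<eta>0 * \<bar>y\<bar>)) \<le> a y" by (simp add: mult.assoc[symmetric] mult_exp_exp)
        have "\<eta>0 * \<bar>y\<bar> + 1 \<le> exp (\<eta>0 * \<bar>y\<bar>)" "- (\<eta>0 * \<bar>y\<bar>) + 1 \<le> exp (- (\<eta>0 * \<bar>y\<bar>))"
          by (metis add.commute exp_ge_add_one_self)+
        then show ?thesis using 1 2 by linarith
      qed
      have dom: "\<bar>\<omega> (x0 - y)\<bar> \<le> \<omega>0 * a y" for y
      proof -
        have "\<bar>\<omega> (x0 - y)\<bar> = r (x0 - y) * \<beta> (x0 - y)" using \<beta>0[of "x0 - y"] by (simp add: r_def)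
        also have "\<dots> \<le> r x0 * \<beta> (x0 - y)" using x0(1) \<beta>0[of "x0 - y"] by (intro mult_right_mono) auto
        also have "\<dots> = \<omega>0 * a y" unfolding w0 a_def using \<beta>0[of x0] by simp
        finally show ?thesis .
      qed
      have "continuous_on UNIV (\<lambda>t. \<bar>\<omega> (x0 - t) - \<omega> x0\<bar>)"
        by (intro continuous_intros continuous_on_compose2[OF cw]) auto
      then obtain E where E: "\<And>t. (E has_real_derivative \<bar>\<omega> (x0 - t) - \<omega> x0\<bar>) (at t)"
        using continuous_antiderivative by blast
      have "\<bar>defect \<omega> x0\<bar> \<le> B / B1 * \<omega>0" using df[OF x00] ew by linarith
      then have "(\<integral>y. N y * ((1 + \<bar>y\<bar>) * (E \<bar>y\<bar> - E (- \<bar>y\<bar>))) \<partial>lborel) \<le>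
        \<omega>0 * (M1 * (2 * R * (\<eta>0 * R * exp (\<delta>/2 * R)) + (B / B1 + \<eta>0 * M2) / c) + M3 / R)"
        using \<eta>0 by (intro oscillation_at_max[OF \<omega> \<omega>0_def w0pos _ _ R c ca ab dom _ E]) auto
      also have "M1 * (2 * R * (\<eta>0 * R * exp (\<delta>/2 * R)) + (B / B1 + \<eta>0 * M2) / c) =
         \<eta>0 * Y + M1 * B / c / B1"
        unfolding Y_def by (simp add: algebra_simps add_divide_distrib)
      also have "\<omega>0 * (\<eta>0 * Y + M1 * B / c / B1 + M3 / R) \<le> \<omega>0 * (h + h + h)"
      proof -
        have "M1 * B / c / B1 \<le> h" using B1(1,3) h c by (simp add: field_simps)
        then show ?thesis using Yh MR w0pos by (intro mult_left_mono add_mono) auto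
      qed
      finally have "\<bar>Q x0 - \<theta> * \<omega> x0\<bar> \<le> \<omega>0 * (3 * h)" using osc[OF E] by simp
      moreover have "\<bar>\<theta> * \<omega> x0\<bar> = \<omega>0 * (8 * h)" by (simp add: \<omega>0_def h_def abs_mult)
      ultimately have "\<omega>0 * (5 * h) \<le> \<bar>Q x0\<bar>" by (simp add: algebra_simps)
      also have "\<dots> \<le> B / B1 * \<omega>0" using Q[OF x00] ew by linarith
      finally have "5 * h \<le> B / B1" using w0pos by (simp only: mult.commute[of _ \<omega>0] mult_le_cancel_left_pos)
      moreover have "B / B1 \<le> 4 * h"
        using B1(1,4) \<theta> by (simp add: h_def field_simps)
      ultimately show False using h by linarith
    qed
    have "\<bar>\<omega> x\<bar> \<le> B1 * exp (\<eta> * x)" for x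
      by (rule field_le_epsilon_mult) (rule main)
    then show "\<exists>B'. \<forall>x. \<bar>\<omega> x\<bar> \<le> B' * exp (\<eta> * x)" by blast
  qed
qed


section \<open>Moments of the walk and Taylor expansion of the defect\<close>

definition mean :: real where "mean = (\<integral>y. N y * y \<partial>lborel)"
definition moment2 :: real where "moment2 = (\<integral>y. N y * y\<^sup>2 \<partial>lborel)"

lemma integrable_poly:
  assumes [measurable]: "h \<in> borel_measurable borel" and "\<And>y. \<bar>h y\<bar> \<le> C * (1 + \<bar>y\<bar>)\<^sup>2" and C: "0 \<le> C"
  shows "integrable lborel (\<lambda>y. N y * h y)"
proof (rule integrable_poly_exp[OF _ _ C])
  fix y :: real
  have "C * (1 + \<bar>y\<bar>)\<^sup>2 * 1 \<le> C * (1 + \<bar>y\<bar>) ^ 3 * exp (\<delta>/2 * \<bar>y\<bar>)"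
    using C \<delta>_pos by (intro mult_mono power_increasing) auto
  then show "\<bar>h y\<bar> \<le> C * (1 + \<bar>y\<bar>) ^ 3 * exp (\<delta>/2 * \<bar>y\<bar>)" using assms(2)[of y] by simp
qed auto

lemma one_plus_sq: "\<bar>y\<bar> \<le> (1 + \<bar>y\<bar>)\<^sup>2" "y\<^sup>2 \<le> (1 + \<bar>y\<bar>)\<^sup>2" for y :: real
proof -
  have "(1 + \<bar>y\<bar>)\<^sup>2 = 1 + 2 * \<bar>y\<bar> + y\<^sup>2" by (simp add: power2_eq_square algebra_simps)
  then show "\<bar>y\<bar> \<le> (1 + \<bar>y\<bar>)\<^sup>2" "y\<^sup>2 \<le> (1 + \<bar>y\<bar>)\<^sup>2"
    using zero_le_power2[of y] by (simp_all del: zero_le_power2)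
qed

lemma integrable_mean: "integrable lborel (\<lambda>y. N y * y)"
  by (rule integrable_poly[where C=1]) (auto simp: one_plus_sq)

lemma integrable_moment2: "integrable lborel (\<lambda>y. N y * y\<^sup>2)"
  by (rule integrable_poly[where C=1]) (auto simp: one_plus_sq)

lemma moment2_pos: "0 < moment2"
proof (rule ccontr)
  assume "\<not> ?thesis"
  then have "(\<integral>y. N y * y\<^sup>2 \<partial>lborel) \<le> 0" by (simp add: moment2_def)
  then have "(1::real)\<^sup>2 = 0"
    by (intro continuous_nonneg_integral_0[of N "\<lambda>y. y\<^sup>2" 1])
       (auto intro!: N_nonneg N_low integrable_moment2 continuous_intros)
  then show False by simp
qed

lemma oscillation_integral:
  assumes \<omega>: "subexponential \<omega>"
    and E: "\<And>t. (E has_real_derivative \<bar>\<omega> (x - t) - \<omega> x\<bar>) (at t)"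
    and [measurable]: "q \<in> borel_measurable borel"
    and q: "\<And>y. \<bar>q y\<bar> \<le> (1 + \<bar>y\<bar>) * (E \<bar>y\<bar> - E (- \<bar>y\<bar>))"
  shows "\<bar>\<integral>y. N y * q y \<partial>lborel\<bar> \<le> (\<integral>y. N y * ((1 + \<bar>y\<bar>) * (E \<bar>y\<bar> - E (- \<bar>y\<bar>))) \<partial>lborel)"
proof -
  have sub: "subexponential (\<lambda>t. \<bar>\<omega> (x - t) - \<omega> x\<bar>)"
    unfolding subexponential_def
  proof (intro conjI allI impI)
    show "continuous_on UNIV (\<lambda>t. \<bar>\<omega> (x - t) - \<omega> x\<bar>)"
      by (intro continuous_intros continuous_on_compose2[OF subexponential_cont[OF \<omega>]]) auto
    fix e :: real assume e: "0 < e"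
    obtain C where C: "0 < C" "\<And>y. \<bar>\<omega> (x - y)\<bar> \<le> C * exp (e * \<bar>y\<bar>)"
      using shift_bound[OF \<omega> e] by blast
    have "\<bar>\<bar>\<omega> (x - t) - \<omega> x\<bar>\<bar> \<le> (C + \<bar>\<omega> x\<bar>) * exp (e * \<bar>t\<bar>)" for t
    proof -
      have "\<bar>\<bar>\<omega> (x - t) - \<omega> x\<bar>\<bar> \<le> \<bar>\<omega> (x - t)\<bar> + \<bar>\<omega> x\<bar>" by simp
      also have "\<bar>\<omega> x\<bar> \<le> \<bar>\<omega> x\<bar> * exp (e * \<bar>t\<bar>)" using e by (simp add: mult_le_cancel_left1)
      finally show ?thesis using C(2)[of t] by (simp add: algebra_simps)
    qed
    then show "\<exists>C. \<forall>t. \<bar>\<bar>\<omega> (x - t) - \<omega> x\<bar>\<bar> \<le> C * exp (e * \<bar>t\<bar>)" by blast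
  qed
  have sE: "subexponential E" by (rule subexponential_antiderivative[OF sub E])
  note [measurable] = subexponential_meas[OF sE]
  obtain C where C: "0 < C" "\<And>y. \<bar>E y\<bar> \<le> C * exp (\<delta>/2 * \<bar>y\<bar>)"
    using subexponential_bound[OF sE, of "\<delta>/2"] \<delta>_pos by auto
  have int: "integrable lborel (\<lambda>y. N y * ((1 + \<bar>y\<bar>) * (E \<bar>y\<bar> - E (- \<bar>y\<bar>))))"
  proof (rule integrable_poly_exp[where C="2 * C"])
    fix y :: real
    have "\<bar>E \<bar>y\<bar> - E (- \<bar>y\<bar>)\<bar> \<le> 2 * C * exp (\<delta>/2 * \<bar>y\<bar>)"
      using C(2)[of "\<bar>y\<bar>"] C(2)[of "- \<bar>y\<bar>"] unfolding abs_minus_cancel abs_idempotent by linarith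
    moreover have "1 + \<bar>y\<bar> \<le> (1 + \<bar>y\<bar>) ^ 3" by (rule self_le_power) auto
    ultimately have "(1 + \<bar>y\<bar>) * \<bar>E \<bar>y\<bar> - E (- \<bar>y\<bar>)\<bar> \<le> (1 + \<bar>y\<bar>) ^ 3 * (2 * C * exp (\<delta>/2 * \<bar>y\<bar>))"
      by (intro mult_mono) auto
    then show "\<bar>(1 + \<bar>y\<bar>) * (E \<bar>y\<bar> - E (- \<bar>y\<bar>))\<bar> \<le> 2 * C * (1 + \<bar>y\<bar>) ^ 3 * exp (\<delta>/2 * \<bar>y\<bar>)"
      by (simp add: abs_mult mult_ac)
  qed (use C in auto)
  have "\<bar>\<integral>y. N y * q y \<partial>lborel\<bar> \<le> (\<integral>y. \<bar>N y * q y\<bar> \<partial>lborel)" by (rule integral_abs_bound)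
  also have "\<dots> \<le> (\<integral>y. N y * ((1 + \<bar>y\<bar>) * (E \<bar>y\<bar> - E (- \<bar>y\<bar>))) \<partial>lborel)"
  proof (rule integral_mono'[OF int])
    fix y
    show "\<bar>N y * q y\<bar> \<le> N y * ((1 + \<bar>y\<bar>) * (E \<bar>y\<bar> - E (- \<bar>y\<bar>)))"
      using mult_left_mono[OF q[of y] N_nonneg[of y]] N_nonneg[of y] by (simp add: abs_mult)
    then show "0 \<le> N y * ((1 + \<bar>y\<bar>) * (E \<bar>y\<bar> - E (- \<bar>y\<bar>)))" by linarith
  qed
  finally show ?thesis .
qed

text \<open>The remainder vanishes at \<open>y = 0\<close> and has derivative
  \<open>\<omega> (x - y) - \<omega> x\<close> in \<open>y\<close>, whose absolute value is the
  derivative of \<open>E\<close>. The symmetric form of the bound covers both signs of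
  \<open>y\<close>.\<close>

lemma first_remainder:
  assumes \<Omega>: "\<And>x. (\<Omega> has_real_derivative \<omega> x) (at x)"
    and E: "\<And>t. (E has_real_derivative \<bar>\<omega> (x - t) - \<omega> x\<bar>) (at t)"
  shows "\<bar>\<Omega> x - \<Omega> (x - y) - y * \<omega> x\<bar> \<le> E \<bar>y\<bar> - E (- \<bar>y\<bar>)"
proof -
  define p where "p t = \<Omega> x - \<Omega> (x - t) - t * \<omega> x" for t
  have p': "(p has_real_derivative (\<omega> (x - t) - \<omega> x)) (at t)" for t
    unfolding p_def by (auto intro!: derivative_eq_intros DERIV_chain2[OF \<Omega>])
  have "\<bar>p y - p 0\<bar> \<le> \<bar>E y - E 0\<bar>" by (rule deriv_dominated[OF p' E]) simp
  moreover have "E s \<le> E t" if "s \<le> t" for s t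
    by (rule DERIV_nonneg_imp_nondecreasing[OF that]) (use E abs_ge_zero in blast)
  then have "E 0 \<le> E \<bar>y\<bar>" "E (- \<bar>y\<bar>) \<le> E 0" by auto
  ultimately show ?thesis by (cases "0 \<le> y") (auto simp: p_def abs_if split: if_splits)
qed

text \<open>Averaging the linear Taylor term of \<Omega> over the steps gives
  \<open>mean * \<omega> x\<close>; the rest is \<open>first_remainder\<close>. For a walk with
  drift the flux thus reads off the density.\<close>

lemma defect_oscillation1:
  assumes \<omega>: "subexponential \<omega>" and \<Omega>: "\<And>x. (\<Omega> has_real_derivative \<omega> x) (at x)"
    and E: "\<And>t. (E has_real_derivative \<bar>\<omega> (x - t) - \<omega> x\<bar>) (at t)"
  shows "\<bar>defect \<Omega> x - mean * \<omega> x\<bar> \<le> (\<integral>y. N y * ((1 + \<bar>y\<bar>) * (E \<bar>y\<bar> - E (- \<bar>y\<bar>))) \<partial>lborel)"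
proof -
  have s\<Omega>: "subexponential \<Omega>" by (rule subexponential_antiderivative[OF \<omega> \<Omega>])
  note [measurable] = subexponential_meas[OF s\<Omega>]
  have "defect \<Omega> x - mean * \<omega> x = (\<integral>y. N y * (\<Omega> x - \<Omega> (x - y)) - (N y * y) * \<omega> x \<partial>lborel)"
    unfolding defect_def mean_def using integrable_defect[OF s\<Omega>] integrable_mean by simp
  also have "\<dots> = (\<integral>y. N y * (\<Omega> x - \<Omega> (x - y) - y * \<omega> x) \<partial>lborel)"
    by (simp add: algebra_simps)
  also have "\<bar>\<dots>\<bar> \<le> (\<integral>y. N y * ((1 + \<bar>y\<bar>) * (E \<bar>y\<bar> - E (- \<bar>y\<bar>))) \<partial>lborel)"
  proof (rule oscillation_integral[OF \<omega> E])
    fix y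
    have b: "\<bar>\<Omega> x - \<Omega> (x - y) - y * \<omega> x\<bar> \<le> E \<bar>y\<bar> - E (- \<bar>y\<bar>)" by (rule first_remainder[OF \<Omega> E])
    then have "0 \<le> E \<bar>y\<bar> - E (- \<bar>y\<bar>)" by linarith
    then have b2: "1 * (E \<bar>y\<bar> - E (- \<bar>y\<bar>)) \<le> (1 + \<bar>y\<bar>) * (E \<bar>y\<bar> - E (- \<bar>y\<bar>))"
      by (intro mult_right_mono) auto
    show "\<bar>\<Omega> x - \<Omega> (x - y) - y * \<omega> x\<bar> \<le> (1 + \<bar>y\<bar>) * (E \<bar>y\<bar> - E (- \<bar>y\<bar>))"
      by (rule order_trans[OF b b2[unfolded mult_1]])
  qed auto
  finally show ?thesis .
qed

lemma defect_mean_zero: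
  assumes m: "mean = 0" and s: "subexponential \<Omega>2"
  shows "defect \<Omega>2 x = (\<integral>y. N y * (\<Omega>2 x - \<Omega>2 (x - y) - y * b) \<partial>lborel)"
proof -
  have "defect \<Omega>2 x = defect \<Omega>2 x - mean * b" using m by simp
  also have "\<dots> = (\<integral>y. N y * (\<Omega>2 x - \<Omega>2 (x - y)) - (N y * y) * b \<partial>lborel)"
    unfolding defect_def mean_def using integrable_defect[OF s] integrable_mean by simp
  also have "\<dots> = (\<integral>y. N y * (\<Omega>2 x - \<Omega>2 (x - y) - y * b) \<partial>lborel)"
    by (simp add: algebra_simps)
  finally show ?thesis .
qed

text \<open>Without drift the linear term averages to 0 and the quadratic one to
  \<open>- moment2 / 2 * \<omega> x\<close>. The second-order remainder is the integral of
  \<open>first_remainder\<close>, which costs a factor \<bar>y\<bar>; this is why the oscillation is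
  weighted with 1 + \<bar>y\<bar>.\<close>

lemma defect_oscillation2:
  assumes m: "mean = 0" and \<omega>: "subexponential \<omega>"
    and \<Omega>: "\<And>x. (\<Omega> has_real_derivative \<omega> x) (at x)"
    and \<Omega>2: "\<And>x. (\<Omega>2 has_real_derivative \<Omega> x) (at x)"
    and E: "\<And>t. (E has_real_derivative \<bar>\<omega> (x - t) - \<omega> x\<bar>) (at t)"
  shows "\<bar>- defect \<Omega>2 x - moment2 / 2 * \<omega> x\<bar> \<le> (\<integral>y. N y * ((1 + \<bar>y\<bar>) * (E \<bar>y\<bar> - E (- \<bar>y\<bar>))) \<partial>lborel)"
proof -
  have s\<Omega>: "subexponential \<Omega>" by (rule subexponential_antiderivative[OF \<omega> \<Omega>])
  have s\<Omega>2: "subexponential \<Omega>2" by (rule subexponential_antiderivative[OF s\<Omega> \<Omega>2])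
  note [measurable] = subexponential_meas[OF s\<Omega>2]
  define p where "p y = \<Omega>2 x - \<Omega>2 (x - y) - y * \<Omega> x" for y
  have "integrable lborel (\<lambda>y. N y * (\<Omega>2 x - \<Omega>2 (x - y)) - (N y * y) * \<Omega> x)"
    using integrable_defect[OF s\<Omega>2] integrable_mean by simp
  then have ip: "integrable lborel (\<lambda>y. N y * p y)" by (simp add: p_def algebra_simps)
  have "\<bar>- defect \<Omega>2 x - moment2 / 2 * \<omega> x\<bar> = \<bar>defect \<Omega>2 x + moment2 * (\<omega> x / 2)\<bar>" by simp
  also have "defect \<Omega>2 x + moment2 * (\<omega> x / 2) = (\<integral>y. N y * p y + (N y * y\<^sup>2) * (\<omega> x / 2) \<partial>lborel)"
    unfolding defect_mean_zero[OF m s\<Omega>2, of x "\<Omega> x"] moment2_def using ip integrable_moment2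
    by (simp add: p_def)
  also have "\<dots> = (\<integral>y. N y * (p y + y\<^sup>2 * (\<omega> x / 2)) \<partial>lborel)"
    by (simp add: algebra_simps)
  also have "\<bar>\<dots>\<bar> \<le> (\<integral>y. N y * ((1 + \<bar>y\<bar>) * (E \<bar>y\<bar> - E (- \<bar>y\<bar>))) \<partial>lborel)"
  proof (rule oscillation_integral[OF \<omega> E])
    fix y
    define P where "P t = p t + t\<^sup>2 * (\<omega> x / 2)" for t
    have P': "(P has_real_derivative - (\<Omega> x - \<Omega> (x - t) - t * \<omega> x)) (at t)" for t
      unfolding P_def p_def by (auto intro!: derivative_eq_intros DERIV_chain2[OF \<Omega>2])
    have Em: "E s \<le> E t" if "s \<le> t" for s t
      by (rule DERIV_nonneg_imp_nondecreasing[OF that]) (use E abs_ge_zero in blast)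
    have "norm (P y - P 0) \<le> (E \<bar>y\<bar> - E (- \<bar>y\<bar>)) * norm (y - 0)"
    proof (rule field_differentiable_bound[where S="{-\<bar>y\<bar>..\<bar>y\<bar>}"])
      fix t assume t: "t \<in> {-\<bar>y\<bar>..\<bar>y\<bar>}"
      show "(P has_field_derivative - (\<Omega> x - \<Omega> (x - t) - t * \<omega> x)) (at t within {- \<bar>y\<bar>..\<bar>y\<bar>})"
        using P' by (rule DERIV_subset) simp
      have "\<bar>\<Omega> x - \<Omega> (x - t) - t * \<omega> x\<bar> \<le> E \<bar>t\<bar> - E (- \<bar>t\<bar>)" by (rule first_remainder[OF \<Omega> E])
      also have "\<dots> \<le> E \<bar>y\<bar> - E (- \<bar>y\<bar>)" using t by (intro diff_mono Em) auto
      finally show "norm (- (\<Omega> x - \<Omega> (x - t) - t * \<omega> x)) \<le> E \<bar>y\<bar> - E (- \<bar>y\<bar>)" 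
        by (simp only: norm_minus_cancel real_norm_def)
    qed auto
    then have "\<bar>p y + y\<^sup>2 * (\<omega> x / 2)\<bar> \<le> \<bar>y\<bar> * (E \<bar>y\<bar> - E (- \<bar>y\<bar>))"
      by (simp add: P_def p_def mult.commute)
    also have "\<dots> \<le> (1 + \<bar>y\<bar>) * (E \<bar>y\<bar> - E (- \<bar>y\<bar>))"
      using Em[of "-\<bar>y\<bar>" "\<bar>y\<bar>"] by (intro mult_right_mono) auto
    finally show "\<bar>p y + y\<^sup>2 * (\<omega> x / 2)\<bar> \<le> (1 + \<bar>y\<bar>) * (E \<bar>y\<bar> - E (- \<bar>y\<bar>))" .
  qed (auto simp: p_def)
  finally show ?thesis .
qed

text \<open>A flux that vanishes at -infinity is exponentially small, since its derivative, the
  defect of \<omega>, is. If the walk has drift, the flux equals \<open>mean * \<omega>\<close> up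
  to oscillation and \<omega> decays exponentially. Without drift a further antiderivative, with
  \<open>moment2 / 2\<close> in place of the mean, still yields boundedness of \<omega>.\<close>

lemma decay_of_zero_flux:
  assumes \<omega>: "subexponential \<omega>" "(\<omega> \<longlongrightarrow> 0) at_top"
    and \<Omega>: "\<And>x. (\<Omega> has_real_derivative \<omega> x) (at x)"
    and df: "\<And>x. \<bar>defect \<omega> x\<bar> \<le> B * exp (\<eta> * x)" and \<eta>: "0 < \<eta>"
    and flux: "(defect \<Omega> \<longlongrightarrow> 0) at_bot"
  obtains \<eta>' C where "0 \<le> \<eta>'" "mean \<noteq> 0 \<Longrightarrow> 0 < \<eta>'" "\<And>x. \<bar>\<omega> x\<bar> \<le> C * exp (\<eta>' * x)"
proof -
  have s\<Omega>: "subexponential \<Omega>" by (rule subexponential_antiderivative[OF \<omega>(1) \<Omega>])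
  have B: "0 \<le> B" using df[of 0] by simp
  have V': "(defect \<Omega> has_real_derivative defect \<omega> x) (at x)" for x
    by (rule defect_deriv[OF \<omega>(1) \<Omega>])
  obtain v where v: "(defect \<Omega> \<longlongrightarrow> v) at_bot" "\<And>x. \<bar>defect \<Omega> x - v\<bar> \<le> B / \<eta> * exp (\<eta> * x)"
    using limit_at_bot_exp[OF V' df \<eta>] by blast
  have "v = 0" using tendsto_unique[OF trivial_limit_at_bot_linorder v(1) flux] .
  then have V: "\<bar>defect \<Omega> x\<bar> \<le> B / \<eta> * exp (\<eta> * x)" for x using v(2)[of x] by simp
  have le: "b * exp (\<eta> * x) \<le> (\<bar>b\<bar> + c) * exp (\<eta>' * x)" if "x \<le> 0" "\<eta>' \<le> \<eta>" "0 \<le> c" for b c x \<eta>'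
  proof -
    have "\<eta> * x \<le> \<eta>' * x" using that by (intro mult_right_mono_neg) auto
    then show ?thesis using that by (intro mult_mono) auto
  qed
  show ?thesis
  proof (cases "mean = 0")
    case False
    obtain \<eta>0 where \<eta>0: "\<eta>0 > 0" "\<And>\<omega> Q \<eta> B. \<lbrakk>subexponential \<omega>; (\<omega> \<longlongrightarrow> 0) at_top; 0 \<le> \<eta>; \<eta> \<le> \<eta>0;
      \<And>x. x \<le> 0 \<Longrightarrow> \<bar>defect \<omega> x\<bar> \<le> B * exp (\<eta> * x); \<And>x. x \<le> 0 \<Longrightarrow> \<bar>Q x\<bar> \<le> B * exp (\<eta> * x);
      \<And>x E. (\<And>t. (E has_real_derivative \<bar>\<omega> (x - t) - \<omega> x\<bar>) (at t)) \<Longrightarrow>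
        \<bar>Q x - mean * \<omega> x\<bar> \<le> (\<integral>y. N y * ((1 + \<bar>y\<bar>) * (E \<bar>y\<bar> - E (- \<bar>y\<bar>))) \<partial>lborel)\<rbrakk>
    \<Longrightarrow> \<exists>B'. \<forall>x. \<bar>\<omega> x\<bar> \<le> B' * exp (\<eta> * x)"
      using defect_bound[OF False] by blast
    define \<eta>' where "\<eta>' = min \<eta> \<eta>0"
    have \<eta>': "0 < \<eta>'" "\<eta>' \<le> \<eta>" "\<eta>' \<le> \<eta>0" using \<eta> \<eta>0 by (auto simp: \<eta>'_def)
    have "\<exists>B'. \<forall>x. \<bar>\<omega> x\<bar> \<le> B' * exp (\<eta>' * x)"
    proof (rule \<eta>0(2)[OF \<omega> _ \<eta>'(3), where Q="defect \<Omega>" and B="\<bar>B\<bar> + \<bar>B / \<eta>\<bar>"])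
      fix x :: real assume x: "x \<le> 0"
      show "\<bar>defect \<omega> x\<bar> \<le> (\<bar>B\<bar> + \<bar>B / \<eta>\<bar>) * exp (\<eta>' * x)"
        using df[of x] le[OF x \<eta>'(2), of "\<bar>B / \<eta>\<bar>" B] by simp
      show "\<bar>defect \<Omega> x\<bar> \<le> (\<bar>B\<bar> + \<bar>B / \<eta>\<bar>) * exp (\<eta>' * x)"
        using V[of x] le[OF x \<eta>'(2), of "\<bar>B\<bar>" "B / \<eta>"] by (simp add: add.commute)
    qed (use \<eta>' defect_oscillation1[OF \<omega>(1) \<Omega>] in auto)
    then show ?thesis using that \<eta>' by (meson less_imp_le)
  next
    case m: True
    obtain \<Omega>2 where \<Omega>2: "\<And>x. (\<Omega>2 has_real_derivative \<Omega> x) (at x)"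
      using continuous_antiderivative[OF subexponential_cont[OF s\<Omega>]] by blast
    have U': "(defect \<Omega>2 has_real_derivative defect \<Omega> x) (at x)" for x
      by (rule defect_deriv[OF s\<Omega> \<Omega>2])
    have "moment2 / 2 \<noteq> 0" using moment2_pos by simp
    then obtain \<eta>0 where \<eta>0: "\<eta>0 > 0" "\<And>\<omega> Q \<eta> B. \<lbrakk>subexponential \<omega>; (\<omega> \<longlongrightarrow> 0) at_top; 0 \<le> \<eta>; \<eta> \<le> \<eta>0;
      \<And>x. x \<le> 0 \<Longrightarrow> \<bar>defect \<omega> x\<bar> \<le> B * exp (\<eta> * x); \<And>x. x \<le> 0 \<Longrightarrow> \<bar>Q x\<bar> \<le> B * exp (\<eta> * x);
      \<And>x E. (\<And>t. (E has_real_derivative \<bar>\<omega> (x - t) - \<omega> x\<bar>) (at t)) \<Longrightarrow>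
        \<bar>Q x - moment2 / 2 * \<omega> x\<bar> \<le> (\<integral>y. N y * ((1 + \<bar>y\<bar>) * (E \<bar>y\<bar> - E (- \<bar>y\<bar>))) \<partial>lborel)\<rbrakk>
    \<Longrightarrow> \<exists>B'. \<forall>x. \<bar>\<omega> x\<bar> \<le> B' * exp (\<eta> * x)"
      using defect_bound[of "moment2 / 2"] by blast
    \<comment> \<open>As an antiderivative of the small flux, \<open>defect \<Omega>2\<close> is
      bounded on the negative half-line, but its additive constant is not controlled; hence the rate
      0.\<close>
    define B2 where "B2 = \<bar>B\<bar> + (\<bar>defect \<Omega>2 0\<bar> + B / \<eta> / \<eta>)"
    have "\<exists>B'. \<forall>x. \<bar>\<omega> x\<bar> \<le> B' * exp (0 * x)"
    proof (rule \<eta>0(2)[OF \<omega>, where Q="\<lambda>x. - defect \<Omega>2 x" and B=B2])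
      fix x :: real assume x: "x \<le> 0"
      have "\<bar>defect \<omega> x\<bar> \<le> B" using df[of x] B x \<eta> by (smt (verit) exp_le_one_iff mult_left_le mult_nonneg_nonpos)
      then show "\<bar>defect \<omega> x\<bar> \<le> B2 * exp (0 * x)" using B \<eta> by (simp add: B2_def add_increasing2)
      have "\<bar>defect \<Omega>2 0 - defect \<Omega>2 x\<bar> \<le> \<bar>B / \<eta> / \<eta> * exp (\<eta> * 0) - B / \<eta> / \<eta> * exp (\<eta> * x)\<bar>"
        using \<eta> by (intro deriv_dominated[OF U' exp_int_deriv V]) auto
      also have "\<dots> \<le> B / \<eta> / \<eta>"
      proof -
        have "0 \<le> B / \<eta> / \<eta> * exp (\<eta> * x)" using B \<eta> by simp
        moreover have "B / \<eta> / \<eta> * exp (\<eta> * x) \<le> B / \<eta> / \<eta> * 1"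
          using B \<eta> x by (intro mult_left_mono) (auto simp: mult_nonneg_nonpos)
        ultimately show ?thesis by simp
      qed
      finally show "\<bar>- defect \<Omega>2 x\<bar> \<le> B2 * exp (0 * x)" by (simp add: B2_def)
    qed (use \<eta>0 defect_oscillation2[OF m \<omega>(1) \<Omega> \<Omega>2] in auto)
    then show ?thesis using that[of 0] m by auto
  qed
qed


lemma defect_shift: "defect (\<lambda>x. s * h (x + u)) x = s * defect h (x + u)"
proof -
  have "defect (\<lambda>x. s * h (x + u)) x = (\<integral>y. s * (N y * (h (x + u) - h (x + u - y))) \<partial>lborel)"
    unfolding defect_def
    by (rule Bochner_Integration.integral_cong) (simp_all add: algebra_simps)
  then show ?thesis by (simp add: defect_def)
qed

text \<open>With mean zero the renewal walk is recurrent. If \<open>V\<close> denotes the defect of an antiderivative of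
  \<open>\<omega>\<close> and \<open>U\<close> that of a second antiderivative, then \<open>U' = V\<close> and \<open>V'\<close> is the (nonpositive) defect
  of \<open>\<omega>\<close>; as \<open>U\<close> is bounded, the monotone function \<open>V\<close> must vanish.\<close>

lemma Liouville_mean_zero:
  assumes m: "mean = 0" and cw: "continuous_on UNIV \<omega>" and w0: "\<And>x. 0 \<le> \<omega> x" and wB: "\<And>x. \<omega> x \<le> B"
    and top: "(\<omega> \<longlongrightarrow> 0) at_top" and df: "\<And>x. defect \<omega> x \<le> 0"
  shows "\<omega> x = 0"
proof -
  have B0: "0 \<le> B" using w0[of 0] wB[of 0] by linarith
  have s: "subexponential \<omega>"
    unfolding subexponential_def
  proof (intro conjI allI impI exI)
    fix e x :: real assume "0 < e"
    then have "B * 1 \<le> B * exp (e * \<bar>x\<bar>)" using B0 by (intro mult_left_mono) auto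
    then show "\<bar>\<omega> x\<bar> \<le> B * exp (e * \<bar>x\<bar>)" using w0[of x] wB[of x] by simp
  qed (rule cw)
  obtain \<Omega> where \<Omega>: "\<And>x. (\<Omega> has_real_derivative \<omega> x) (at x)"
    using continuous_antiderivative[OF cw] by blast
  have s\<Omega>: "subexponential \<Omega>" by (rule subexponential_antiderivative[OF s \<Omega>])
  obtain \<Omega>2 where \<Omega>2: "\<And>x. (\<Omega>2 has_real_derivative \<Omega> x) (at x)"
    using continuous_antiderivative[OF subexponential_cont[OF s\<Omega>]] by blast
  have s\<Omega>2: "subexponential \<Omega>2" by (rule subexponential_antiderivative[OF s\<Omega> \<Omega>2])
  note [measurable] = subexponential_meas[OF s\<Omega>2]
  define V where "V = defect \<Omega>"
  define U where "U = defect \<Omega>2"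
  have V': "(V has_real_derivative defect \<omega> x) (at x)" for x
    unfolding V_def by (rule defect_deriv[OF s \<Omega>])
  have U': "(U has_real_derivative V x) (at x)" for x
    unfolding V_def U_def by (rule defect_deriv[OF s\<Omega> \<Omega>2])
  have Vdec: "V y \<le> V x" if "x \<le> y" for x y
    by (rule DERIV_nonpos_imp_nonincreasing[OF that]) (use V' df in blast)
  have \<Omega>mono: "\<Omega> x \<le> \<Omega> y" if "x \<le> y" for x y
    by (rule DERIV_nonneg_imp_nondecreasing[OF that]) (use \<Omega> w0 in blast)
  define P where "P x y = \<Omega>2 x - \<Omega>2 (x - y) - y * \<Omega> x" for x y
  have P': "(P x has_real_derivative (\<Omega> (x - t) - \<Omega> x)) (at t)" for x t
    unfolding P_def by (auto intro!: derivative_eq_intros DERIV_chain2[OF \<Omega>2])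
  have P0: "P x 0 = 0" for x by (simp add: P_def)
  have Pneg: "P x y \<le> 0" for x y
  proof (cases "0 \<le> y")
    case True
    have "P x y \<le> P x 0"
      by (rule DERIV_nonpos_imp_nonincreasing[OF True]) (use P' \<Omega>mono in \<open>force intro!: exI\<close>)
    then show ?thesis by (simp add: P0)
  next
    case False
    then have "y \<le> 0" by simp
    then have "P x y \<le> P x 0"
      by (rule DERIV_nonneg_imp_nondecreasing) (use P' \<Omega>mono in \<open>force intro!: exI\<close>)
    then show ?thesis by (simp add: P0)
  qed
  have Pb: "\<bar>P x y\<bar> \<le> b * y\<^sup>2" if b: "\<And>t. \<bar>t\<bar> \<le> \<bar>y\<bar> \<Longrightarrow> \<omega> (x - t) \<le> b" for x y b
  proof -
    have "0 \<le> b" using b[of 0] w0[of x] by simp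
    have "norm (P x y - P x 0) \<le> (b * \<bar>y\<bar>) * norm (y - 0)"
    proof (rule field_differentiable_bound[where S="{-\<bar>y\<bar>..\<bar>y\<bar>}"])
      fix t assume t: "t \<in> {-\<bar>y\<bar>..\<bar>y\<bar>}"
      show "(P x has_field_derivative (\<Omega> (x - t) - \<Omega> x)) (at t within {- \<bar>y\<bar>..\<bar>y\<bar>})"
        using P' by (rule DERIV_subset) simp
      have "norm (\<Omega> (x - t) - \<Omega> x) \<le> b * norm (x - t - x)"
      proof (rule field_differentiable_bound[where S="{x - \<bar>y\<bar>..x + \<bar>y\<bar>}"])
        fix u assume "u \<in> {x - \<bar>y\<bar>..x + \<bar>y\<bar>}"
        then have "\<omega> (x - (x - u)) \<le> b" by (intro b) auto
        then show "norm (\<omega> u) \<le> b" using w0[of u] by simp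
      next
        fix u show "(\<Omega> has_field_derivative \<omega> u) (at u within {x - \<bar>y\<bar>..x + \<bar>y\<bar>})"
          using \<Omega> by (rule DERIV_subset) simp
      qed (use t in auto)
      also have "\<dots> \<le> b * \<bar>y\<bar>" using t \<open>0 \<le> b\<close> by (intro mult_left_mono) auto
      finally show "norm (\<Omega> (x - t) - \<Omega> x) \<le> b * \<bar>y\<bar>" .
    qed auto
    then show ?thesis by (simp add: P0 power2_eq_square mult.assoc)
  qed
  have UP: "U x = (\<integral>y. N y * P x y \<partial>lborel)" for x
    unfolding U_def P_def by (rule defect_mean_zero[OF m s\<Omega>2])
  have intP: "integrable lborel (\<lambda>y. N y * P x y)" for x
  proof (rule integrable_poly[where C=B])
    fix y
    have "\<bar>P x y\<bar> \<le> B * y\<^sup>2" by (rule Pb) (rule wB)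
    also have "\<dots> \<le> B * (1 + \<bar>y\<bar>)\<^sup>2" using B0 one_plus_sq by (intro mult_left_mono) auto
    finally show "\<bar>P x y\<bar> \<le> B * (1 + \<bar>y\<bar>)\<^sup>2" .
  qed (use B0 in \<open>auto simp: P_def\<close>)
  have Nb: "\<bar>N y * P x y\<bar> \<le> B * (N y * y\<^sup>2)" for x y
  proof -
    have "\<bar>P x y\<bar> \<le> B * y\<^sup>2" by (rule Pb) (rule wB)
    then have "N y * \<bar>P x y\<bar> \<le> N y * (B * y\<^sup>2)" using N_nonneg by (rule mult_left_mono)
    then show ?thesis using N_nonneg[of y] by (simp add: abs_mult mult_ac)
  qed
  define D where "D = B * moment2"
  have UB: "\<bar>U x\<bar> \<le> D" for x
  proof -
    have "\<bar>U x\<bar> \<le> (\<integral>y. \<bar>N y * P x y\<bar> \<partial>lborel)" unfolding UP by (rule integral_abs_bound)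
    also have "\<dots> \<le> (\<integral>y. B * (N y * y\<^sup>2) \<partial>lborel)"
      by (rule integral_mono) (use intP integrable_moment2 Nb in auto)
    also have "\<dots> = D" by (simp add: D_def moment2_def)
    finally show ?thesis .
  qed
  have D0: "0 \<le> D" using UB[of 0] by linarith
  have slope: "k * (y - x) \<le> U y - U x" if "x \<le> y" "\<And>t. x \<le> t \<Longrightarrow> t \<le> y \<Longrightarrow> k \<le> V t" for x y k
  proof -
    have "U x - k * x \<le> U y - k * y"
    proof (rule DERIV_nonneg_imp_nondecreasing[OF that(1)], intro exI conjI)
      fix t assume t: "x \<le> t" "t \<le> y"
      show "((\<lambda>t. U t - k * t) has_real_derivative V t - k) (at t)"
        by (auto intro!: derivative_eq_intros U')
      show "0 \<le> V t - k" using that(2)[OF t] by simp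
    qed
    then show ?thesis by (simp add: algebra_simps)
  qed
  have slope': "U y - U x \<le> k * (y - x)" if "x \<le> y" "\<And>t. x \<le> t \<Longrightarrow> t \<le> y \<Longrightarrow> V t \<le> k" for x y k
  proof -
    have "U y - k * y \<le> U x - k * x"
    proof (rule DERIV_nonpos_imp_nonincreasing[OF that(1)], intro exI conjI)
      fix t assume t: "x \<le> t" "t \<le> y"
      show "((\<lambda>t. U t - k * t) has_real_derivative V t - k) (at t)"
        by (auto intro!: derivative_eq_intros U')
      show "V t - k \<le> 0" using that(2)[OF t] by simp
    qed
    then show ?thesis by (simp add: algebra_simps)
  qed
  have V0: "V x = 0" for x
  proof (rule ccontr)
    assume "V x \<noteq> 0"
    then consider "0 < V x" | "V x < 0" by linarith
    then show False
    proof cases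
      case 1
      \<comment> \<open>Monotonicity keeps \<open>V\<close> above \<open>V x\<close> to the left of
        \<open>x\<close>, so over the length \<open>l\<close> the function \<open>U\<close> gains
        \<open>2 * D + 1\<close>, more than its range between \<open>- D\<close> and
        \<open>D\<close> allows. A negative value is handled by moving to the right.\<close>
      define l where "l = (2 * D + 1) / V x"
      have l: "0 < l" using 1 D0 by (simp add: l_def)
      have "V x * (x - (x - l)) \<le> U x - U (x - l)"
        using l Vdec by (intro slope) auto
      moreover have "V x * l = 2 * D + 1" using 1 by (simp add: l_def)
      ultimately show False using UB[of x] UB[of "x - l"] by simp
    next
      case 2
      define l where "l = (2 * D + 1) / - V x"
      have l: "0 < l" using 2 D0 unfolding l_def by (intro divide_pos_pos) auto
      have "U (x + l) - U x \<le> V x * (x + l - x)"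
        using l Vdec by (intro slope') auto
      moreover have "V x * l = - (2 * D + 1)" using 2 by (simp add: l_def)
      ultimately show False using UB[of x] UB[of "x + l"] by simp
    qed
  qed
  have "(U has_real_derivative 0) (at x)" for x using U'[of x] V0 by simp
  then have Uconst: "U x = U y" for x y by (intro DERIV_isconst_all) simp
  \<comment> \<open>The constant value of \<open>U\<close> is 0: \<open>U x\<close> averages Taylor
    remainders of \<open>\<Omega>2\<close> at \<open>x\<close>, and these tend to 0 at +infinity
    together with \<omega>.\<close>
  have "(\<lambda>n. U (real n)) \<longlonglongrightarrow> (\<integral>y. 0 \<partial>(lborel :: real measure))"
    unfolding UP
  proof (rule integral_dominated_convergence[where f="\<lambda>y. 0" and s="\<lambda>n y. N y * P (real n) y" and w="\<lambda>y. B * (N y * y\<^sup>2)"])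
    show "integrable lborel (\<lambda>y. B * (N y * y\<^sup>2))" using integrable_moment2 by simp
    show "AE y in lborel. norm (N y * P (real n) y) \<le> B * (N y * y\<^sup>2)" for n
      using Nb by auto
    show "AE y in lborel. (\<lambda>n. N y * P (real n) y) \<longlonglongrightarrow> 0"
    proof (intro AE_I2 tendsto_mult_right_zero)
      fix y :: real
      show "(\<lambda>n. P (real n) y) \<longlonglongrightarrow> 0"
      proof (rule LIMSEQ_I)
        fix e :: real assume e: "0 < e"
        define b where "b = e / (2 * (1 + y\<^sup>2))"
        have p: "0 < 2 * (1 + y\<^sup>2)" by (simp add: add_pos_nonneg)
        have b: "0 < b" using e p by (simp add: b_def)
        obtain A where A: "\<And>x. x \<ge> A \<Longrightarrow> \<omega> x < b"
          using order_tendstoD(2)[OF top b] by (auto simp: eventually_at_top_linorder)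
        obtain n0 :: nat where n0: "A + \<bar>y\<bar> \<le> real n0" using real_arch_simple by blast
        have "norm (P (real n) y - 0) < e" if "n \<ge> n0" for n
        proof -
          have "\<bar>P (real n) y\<bar> \<le> b * y\<^sup>2"
          proof (rule Pb)
            fix t assume "\<bar>t\<bar> \<le> \<bar>y\<bar>"
            moreover have "real n0 \<le> real n" using that by simp
            ultimately have "A \<le> real n - t" using n0 by linarith
            then show "\<omega> (real n - t) \<le> b" using A by (simp add: less_imp_le)
          qed
          also have "\<dots> \<le> b * (1 + y\<^sup>2)" using b by (intro mult_left_mono) auto
          also have "\<dots> = e / 2" using p by (simp add: b_def field_simps)
          finally show ?thesis using e by simp
        qed
        then show "\<exists>no. \<forall>n\<ge>no. norm (P (real n) y - 0) < e" by blast
      qed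
    qed
  qed (auto simp: P_def)
  moreover have "(\<lambda>n::nat. U (real n)) = (\<lambda>n. U 0)" by (rule ext, rule Uconst)
  ultimately have "(\<lambda>n::nat. U 0) \<longlonglongrightarrow> 0" by simp
  then have U0: "U 0 = 0" by (simp add: LIMSEQ_const_iff)
  \<comment> \<open>\<open>P 0\<close> is nonpositive with zero average, so it vanishes identically.
    Its derivative then says that \<Omega> is constant, whence \<omega> vanishes.\<close>
  have Pz: "- P 0 y = 0" for y
  proof (rule continuous_nonneg_integral_0[of N "\<lambda>y. - P 0 y"])
    show "continuous_on UNIV (\<lambda>y. - P 0 y)"
      using P' by (intro continuous_intros) (meson DERIV_continuous continuous_at_imp_continuous_on)
    show "integrable lborel (\<lambda>t. N t * - P 0 t)" using intP[of 0] by simp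
    show "(\<integral>t. N t * - P 0 t \<partial>lborel) \<le> 0" using U0 by (simp add: UP)
  qed (use N_nonneg N_low Pneg in auto)
  have "\<Omega> (0 - t) - \<Omega> 0 = 0" for t
  proof -
    have "P 0 = (\<lambda>y. 0)" using Pz by auto
    then have "((\<lambda>y. 0) has_real_derivative (\<Omega> (0 - t) - \<Omega> 0)) (at t)" using P'[of 0 t] by simp
    then show ?thesis using DERIV_unique[OF _ DERIV_const] by blast
  qed
  from this[of "- t" for t] have "\<Omega> = (\<lambda>t. \<Omega> 0)" by (auto simp: fun_eq_iff)
  then have "((\<lambda>t. \<Omega> 0) has_real_derivative \<omega> x) (at x)" using \<Omega>[of x] by metis
  then show ?thesis using DERIV_unique[OF _ DERIV_const] by blast
qed

end

section \<open>Positive convolution equations\<close>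

lemma integrable_mult_bounded:
  fixes k h :: "real \<Rightarrow> real"
  assumes "integrable lborel k" and [measurable]: "h \<in> borel_measurable borel"
    and "\<And>x. \<bar>h x\<bar> \<le> B"
  shows "integrable lborel (\<lambda>x. k x * h x)"
proof (rule Bochner_Integration.integrable_bound)
  show "integrable lborel (\<lambda>x. B * k x)" using assms(1) by simp
  have [measurable]: "k \<in> borel_measurable borel" using assms(1) by auto
  show "(\<lambda>x. k x * h x) \<in> borel_measurable lborel" by simp
  show "AE x in lborel. norm (k x * h x) \<le> norm (B * k x)"
  proof (intro AE_I2)
    fix x
    have "\<bar>k x\<bar> * \<bar>h x\<bar> \<le> \<bar>k x\<bar> * \<bar>B\<bar>" using assms(3)[of x] by (intro mult_left_mono) auto
    then show "norm (k x * h x) \<le> norm (B * k x)" by (simp add: abs_mult mult.commute)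
  qed
qed

lemma conv_swap:
  fixes k h :: "real \<Rightarrow> real"
  shows "(\<integral>y. k y * h (x - y) \<partial>lborel) = (\<integral>u. k (x - u) * h u \<partial>lborel)"
  using lborel_integral_real_affine[of "-1" "\<lambda>y. k y * h (x - y)" x] by simp

lemma nn_integral_exp_atMost:
  fixes c :: real assumes c: "0 < c"
  shows "(\<integral>\<^sup>+x. ennreal (exp (c * x)) * indicator {..0} x \<partial>lborel) = ennreal (1 / c)"
proof -
  have "(\<integral>\<^sup>+x. ennreal (exp (c * x)) * indicator {..0} x \<partial>lborel) =
     (\<integral>\<^sup>+x. ennreal (exp (- (c * x))) * indicator {0..} x \<partial>lborel)"
    by (subst nn_integral_real_affine[of _ "-1" 0]) (auto simp: indicator_def intro!: nn_integral_cong)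
  also have "\<dots> = ennreal (0 - (- exp (- (c * 0)) / c))"
  proof (rule nn_integral_FTC_atLeast)
    show "((\<lambda>x. - exp (- (c * x)) / c) \<longlongrightarrow> 0) at_top"
      using tendsto_divide[OF tendsto_minus[OF tendsto_exp_neg_at_top[OF c]] tendsto_const[of c]] c by simp
    show "((\<lambda>x. - exp (- (c * x)) / c) has_real_derivative exp (- (c * x))) (at x)" for x
      using c by (auto intro!: derivative_eq_intros)
  qed auto
  finally show ?thesis by simp
qed

text \<open>The bound \<open>harnack\<close> has one constant for all shifts of length at most 1 and
  passes from the kernels to the solutions. \<open>F_lin\<close> is stated for two arguments, so
  that it yields the remainder at one solution, with \<open>t = 0\<close>, as well as the
  linearization of the difference of two.\<close>

locale convolution_equation =
  fixes I :: "'i set" and k :: "'i \<Rightarrow> real \<Rightarrow> real" and F :: "'i \<Rightarrow> real \<Rightarrow> real"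
    and a :: "'i \<Rightarrow> real" and S C \<theta> H :: real
  assumes finite_I: "finite I" and I_nonempty: "I \<noteq> {}"
    and k_meas: "i \<in> I \<Longrightarrow> k i \<in> borel_measurable borel"
    and k_pos: "i \<in> I \<Longrightarrow> 0 < k i x"
    and k_int: "i \<in> I \<Longrightarrow> integrable lborel (k i)"
    and harnack: "i \<in> I \<Longrightarrow> \<bar>t\<bar> \<le> 1 \<Longrightarrow> k i x \<le> H * k i (x + t)"
    and a_pos: "i \<in> I \<Longrightarrow> 0 < a i"
    and S_pos: "0 < S" and C_nonneg: "0 \<le> C" and \<theta>_pos: "0 < \<theta>"
    and F_zero: "i \<in> I \<Longrightarrow> F i 0 = 0"
    and F_nonneg: "i \<in> I \<Longrightarrow> 0 \<le> s \<Longrightarrow> s \<le> S \<Longrightarrow> 0 \<le> F i s"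
    and F_lin: "i \<in> I \<Longrightarrow> 0 \<le> s \<Longrightarrow> s \<le> S \<Longrightarrow> 0 \<le> t \<Longrightarrow> t \<le> S \<Longrightarrow>
      \<bar>F i s - F i t - a i * (s - t)\<bar> \<le> C * (max s t powr \<theta>) * \<bar>s - t\<bar>"
begin

definition n :: "real \<Rightarrow> real" where "n x = (\<Sum>i\<in>I. a i * k i x)"

text \<open>Solutions are only nonnegative, so that the zero function is one of them; comparison
  with it shows later that the flux of a positive solution does not vanish.\<close>

definition sol :: "(real \<Rightarrow> real) \<Rightarrow> bool" where
  "sol \<phi> \<longleftrightarrow> continuous_on UNIV \<phi> \<and> (\<forall>x. 0 \<le> \<phi> x \<and> \<phi> x \<le> S) \<and> (\<phi> \<longlongrightarrow> 0) at_bot \<and>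
     (\<forall>x. \<phi> x = (\<Sum>i\<in>I. \<integral>y. k i y * F i (\<phi> (x - y)) \<partial>lborel))"

lemma solD:
  assumes "sol \<phi>"
  shows "continuous_on UNIV \<phi>" "0 \<le> \<phi> x" "\<phi> x \<le> S" "(\<phi> \<longlongrightarrow> 0) at_bot"
    "\<phi> x = (\<Sum>i\<in>I. \<integral>y. k i y * F i (\<phi> (x - y)) \<partial>lborel)" "\<phi> \<in> borel_measurable borel"
proof -
  show c: "continuous_on UNIV \<phi>" and "0 \<le> \<phi> x" "\<phi> x \<le> S" "(\<phi> \<longlongrightarrow> 0) at_bot"
    "\<phi> x = (\<Sum>i\<in>I. \<integral>y. k i y * F i (\<phi> (x - y)) \<partial>lborel)"
    using assms unfolding sol_def by blast+
  show "\<phi> \<in> borel_measurable borel" using c by (rule borel_measurable_continuous_onI)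
qed

lemma sol_zero: "sol (\<lambda>_. 0)"
  using S_pos by (auto simp: sol_def F_zero)

lemma n_meas [measurable]: "n \<in> borel_measurable borel"
  unfolding n_def using k_meas by (intro borel_measurable_sum borel_measurable_times) auto

lemma n_pos: "0 < n x"
  unfolding n_def using finite_I I_nonempty a_pos k_pos by (intro sum_pos) auto

lemma n_int: "integrable lborel n"
  unfolding n_def using k_int by auto

lemma H_pos: "0 < H"
proof -
  obtain i where i: "i \<in> I" using I_nonempty by blast
  have "0 < H * k i 0" using k_pos[OF i, of 0] harnack[OF i, of 0 0] by simp
  then show ?thesis using k_pos[OF i, of 0] by (simp add: zero_less_mult_iff)
qed

section \<open>Elementary properties of solutions\<close>

lemma F_lip:
  assumes "i \<in> I" "0 \<le> s" "s \<le> S" "0 \<le> t" "t \<le> S"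
  shows "\<bar>F i s - F i t\<bar> \<le> (a i + C * S powr \<theta>) * \<bar>s - t\<bar>"
proof -
  have "C * (max s t powr \<theta>) * \<bar>s - t\<bar> \<le> C * S powr \<theta> * \<bar>s - t\<bar>"
    using assms C_nonneg \<theta>_pos by (intro mult_right_mono mult_left_mono powr_mono2) auto
  moreover have "\<bar>a i * (s - t)\<bar> = a i * \<bar>s - t\<bar>" using a_pos[OF assms(1)] by (simp add: abs_mult)
  ultimately show ?thesis using F_lin[OF assms] unfolding distrib_right by linarith
qed

lemma F_cont: "i \<in> I \<Longrightarrow> continuous_on {0..S} (F i)"
proof -
  assume i: "i \<in> I"
  have "(a i + C * S powr \<theta>)-lipschitz_on {0..S} (F i)"
    using F_lip[OF i] a_pos[OF i] C_nonneg
    by (auto simp: lipschitz_on_def dist_real_def intro: add_nonneg_nonneg)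
  then show ?thesis by (rule lipschitz_on_continuous_on)
qed

lemma F_sol_cont:
  assumes "sol \<phi>" "i \<in> I"
  shows "continuous_on UNIV (\<lambda>x. F i (\<phi> x))"
  by (rule continuous_on_compose2[OF F_cont[OF assms(2)] solD(1)[OF assms(1)]]) (use solD(2,3)[OF assms(1)] in auto)

lemma F_sol_meas:
  assumes "sol \<phi>" "i \<in> I"
  shows "(\<lambda>x. F i (\<phi> x)) \<in> borel_measurable borel"
  by (rule borel_measurable_continuous_onI[OF F_sol_cont[OF assms]])

lemma F_sol_nonneg: "sol \<phi> \<Longrightarrow> i \<in> I \<Longrightarrow> 0 \<le> F i (\<phi> x)"
  using F_nonneg solD(2,3) by blast

lemma F_bound:
  assumes "i \<in> I" "0 \<le> s" "s \<le> S"
  shows "\<bar>F i s\<bar> \<le> (a i + C * S powr \<theta>) * s"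
  using F_lip[OF assms, of 0] F_zero[OF assms(1)] assms S_pos by simp

lemma F_sol_bound:
  assumes "sol \<phi>" "i \<in> I"
  shows "\<bar>F i (\<phi> x)\<bar> \<le> (a i + C * S powr \<theta>) * S"
proof -
  have "\<bar>F i (\<phi> x)\<bar> \<le> (a i + C * S powr \<theta>) * \<phi> x"
    using F_bound[OF assms(2)] solD(2,3)[OF assms(1)] by blast
  also have "\<dots> \<le> (a i + C * S powr \<theta>) * S"
    using solD(3)[OF assms(1)] a_pos[OF assms(2)] C_nonneg by (intro mult_left_mono) (auto simp: less_imp_le)
  finally show ?thesis .
qed

lemma conv_int:
  assumes "sol \<phi>" "i \<in> I"
  shows "integrable lborel (\<lambda>y. k i y * F i (\<phi> (x - y)))"
proof -
  note [measurable] = F_sol_meas[OF assms]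
  show ?thesis by (rule integrable_mult_bounded[OF k_int[OF assms(2)] _ F_sol_bound[OF assms]]) measurable
qed

text \<open>Writing the convolution with the kernel at \<open>x - u\<close> moves the shift from the
  solution to the kernel, where \<open>harnack\<close> applies termwise because the nonlinear terms
  are nonnegative.\<close>

lemma sol_harnack:
  assumes s: "sol \<phi>" and t: "\<bar>t\<bar> \<le> 1"
  shows "\<phi> x \<le> H * \<phi> (x + t)"
proof -
  have "\<phi> x = (\<Sum>i\<in>I. \<integral>u. k i (x - u) * F i (\<phi> u) \<partial>lborel)"
    using solD(5)[OF s, of x] by (simp add: conv_swap[where h="\<lambda>u. F _ (\<phi> u)"])
  also have "\<dots> \<le> (\<Sum>i\<in>I. \<integral>u. H * (k i (x + t - u) * F i (\<phi> u)) \<partial>lborel)"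
  proof (rule sum_mono)
    fix i assume i: "i \<in> I"
    have int: "integrable lborel (\<lambda>u. k i (x - u) * F i (\<phi> u))" for x
      using lborel_integrable_real_affine[OF conv_int[OF s i, of x], of "-1" x] by simp
    show "(\<integral>u. k i (x - u) * F i (\<phi> u) \<partial>lborel) \<le> (\<integral>u. H * (k i (x + t - u) * F i (\<phi> u)) \<partial>lborel)"
    proof (rule integral_mono[OF int])
      show "integrable lborel (\<lambda>u. H * (k i (x + t - u) * F i (\<phi> u)))" using int[of "x + t"] by simp
      fix u
      have "k i (x - u) \<le> H * k i (x + t - u)" using harnack[OF i t, of "x - u"] by (simp add: algebra_simps)
      from mult_right_mono[OF this F_sol_nonneg[OF s i, of u]]
      show "k i (x - u) * F i (\<phi> u) \<le> H * (k i (x + t - u) * F i (\<phi> u))" by (simp add: mult.assoc)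
    qed
  qed
  also have "\<dots> = H * (\<Sum>i\<in>I. \<integral>u. k i (x + t - u) * F i (\<phi> u) \<partial>lborel)"
    by (simp add: sum_distrib_left)
  also have "(\<Sum>i\<in>I. \<integral>u. k i (x + t - u) * F i (\<phi> u) \<partial>lborel) = \<phi> (x + t)"
    using solD(5)[OF s, of "x + t"] by (simp add: conv_swap[where h="\<lambda>u. F _ (\<phi> u)"])
  finally show ?thesis .
qed

lemma sol_pos:
  assumes s: "sol \<phi>" and p: "0 < \<phi> x0"
  shows "0 < \<phi> x"
proof -
  have step: "0 < \<phi> (x + t)" if "0 < \<phi> x" "\<bar>t\<bar> \<le> 1" for x t
  proof -
    have "0 < H * \<phi> (x + t)" using sol_harnack[OF s that(2), of x] that(1) by linarith
    then show ?thesis using H_pos by (simp add: zero_less_mult_iff)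
  qed
  have "\<forall>x. \<bar>x - x0\<bar> \<le> real m \<longrightarrow> 0 < \<phi> x" for m
  proof (induction m)
    case 0
    then show ?case using p by auto
  next
    case (Suc m)
    show ?case
    proof (intro allI impI)
      fix x assume x: "\<bar>x - x0\<bar> \<le> real (Suc m)"
      define t where "t = max (-1) (min 1 (x - x0))"
      have "\<bar>x - t - x0\<bar> \<le> real m" "\<bar>t\<bar> \<le> 1" using x by (auto simp: t_def)
      with Suc step[of "x - t" t] show "0 < \<phi> x" by auto
    qed
  qed
  then show ?thesis using real_arch_simple[of "\<bar>x - x0\<bar>"] by blast
qed

lemma k_low:
  assumes i: "i \<in> I"
  shows "\<exists>c>0. \<forall>t. \<bar>t\<bar> \<le> R \<longrightarrow> c \<le> k i t"
proof -
  have "\<exists>c>0. \<forall>t. \<bar>t\<bar> \<le> real m \<longrightarrow> c \<le> k i t" for m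
  proof (induction m)
    case 0
    then show ?case using k_pos[OF i, of 0] by (intro exI[of _ "k i 0"]) auto
  next
    case (Suc m)
    then obtain c where c: "c > 0" "\<And>t. \<bar>t\<bar> \<le> real m \<Longrightarrow> c \<le> k i t" by blast
    have "c / H \<le> k i x" if x: "\<bar>x\<bar> \<le> real (Suc m)" for x
    proof -
      define t where "t = max (-1) (min 1 x)"
      have t: "\<bar>x - t\<bar> \<le> real m" "\<bar>t\<bar> \<le> 1" using x by (auto simp: t_def)
      have "c \<le> H * k i (x - t + t)" using c(2)[OF t(1)] harnack[OF i t(2), of "x - t"] by linarith
      then show ?thesis using H_pos by (simp add: pos_divide_le_eq mult.commute)
    qed
    then show ?case using c(1) H_pos by (intro exI[of _ "c / H"]) auto
  qed
  moreover obtain m where "R \<le> real m" using real_arch_simple by blast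
  ultimately show ?thesis by (meson order_trans)
qed

lemma n_low: "\<exists>c>0. \<forall>t. \<bar>t\<bar> \<le> R \<longrightarrow> c \<le> n t"
proof -
  obtain i where i: "i \<in> I" using I_nonempty by blast
  obtain c where c: "c > 0" "\<And>t. \<bar>t\<bar> \<le> R \<Longrightarrow> c \<le> k i t" using k_low[OF i] by blast
  have "a i * c \<le> n t" if "\<bar>t\<bar> \<le> R" for t
  proof -
    have "a i * c \<le> a i * k i t" using c(2)[OF that] a_pos[OF i] by simp
    also have "\<dots> \<le> n t" unfolding n_def
      using finite_I i a_pos k_pos by (intro member_le_sum) (auto intro: less_imp_le mult_nonneg_nonneg)
    finally show ?thesis .
  qed
  then show ?thesis using c(1) a_pos[OF i] by (intro exI[of _ "a i * c"]) auto
qed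

lemma small_nonlinearity:
  assumes e: "0 < e"
  obtains s0 where "0 < s0" "s0 \<le> S" "\<And>i s. i \<in> I \<Longrightarrow> 0 \<le> s \<Longrightarrow> s \<le> s0 \<Longrightarrow> C * s powr \<theta> \<le> e * a i"
proof -
  define m where "m = Min (a ` I)"
  have m: "0 < m" "\<And>i. i \<in> I \<Longrightarrow> m \<le> a i"
    unfolding m_def using finite_I I_nonempty a_pos by auto
  define r where "r = e * m / (C + 1)"
  have p: "0 < r" using e m C_nonneg by (simp add: r_def)
  define s1 where "s1 = r powr (1/\<theta>)"
  have s1: "0 < s1" using p by (simp add: s1_def)
  show ?thesis
  proof (rule that[of "min S s1"])
    fix i s assume i: "i \<in> I" and s: "0 \<le> s" "s \<le> min S s1"
    have "s powr \<theta> \<le> s1 powr \<theta>" using s \<theta>_pos by (intro powr_mono2) auto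
    also have "\<dots> = r" using p \<theta>_pos by (simp add: s1_def powr_powr)
    finally have "C * s powr \<theta> \<le> C * r" using C_nonneg by (rule mult_left_mono)
    also have "\<dots> = e * m * (C / (C + 1))" by (simp add: r_def)
    also have "\<dots> \<le> e * m * 1" using e m C_nonneg by (intro mult_left_mono) auto
    also have "\<dots> \<le> e * a i" using m(2)[OF i] e by simp
    finally show "C * s powr \<theta> \<le> e * a i" .
  qed (use s1 S_pos in auto)
qed

lemma sol_nn:
  assumes s: "sol \<phi>"
  shows "ennreal (\<phi> x) = (\<integral>\<^sup>+y. ennreal (\<Sum>i\<in>I. k i y * F i (\<phi> (x - y))) \<partial>lborel)"
proof -
  have int: "integrable lborel (\<lambda>y. \<Sum>i\<in>I. k i y * F i (\<phi> (x - y)))"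
    using conv_int[OF s] by auto
  have "(\<integral>\<^sup>+y. ennreal (\<Sum>i\<in>I. k i y * F i (\<phi> (x - y))) \<partial>lborel) =
      ennreal (\<integral>y. (\<Sum>i\<in>I. k i y * F i (\<phi> (x - y))) \<partial>lborel)"
    using int by (rule nn_integral_eq_integral)
      (auto intro!: sum_nonneg mult_nonneg_nonneg F_sol_nonneg[OF s] less_imp_le[OF k_pos])
  also have "(\<integral>y. (\<Sum>i\<in>I. k i y * F i (\<phi> (x - y))) \<partial>lborel) = \<phi> x"
    using solD(5)[OF s, of x] conv_int[OF s] by simp
  finally show ?thesis by simp
qed

text \<open>The Laplace transform restricted to the left half-line, where decay at -infinity is
  decided. It takes extended values because its finiteness is the assertion to be proved.\<close>

definition tail :: "(real \<Rightarrow> real) \<Rightarrow> real \<Rightarrow> ennreal" where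
  "tail \<phi> b = (\<integral>\<^sup>+x. ennreal (\<phi> x * exp (- (b * x))) * indicator {..0} x \<partial>lborel)"

lemma finite_on_compact:
  assumes s: "sol \<phi>"
  shows "(\<integral>\<^sup>+x. ennreal (\<phi> x * exp (- (b * x))) * indicator {A..B} x \<partial>lborel) < \<infinity>"
proof -
  have "(\<integral>\<^sup>+x. ennreal (\<phi> x * exp (- (b * x))) * indicator {A..B} x \<partial>lborel) \<le>
    (\<integral>\<^sup>+x. ennreal (S * exp (\<bar>b\<bar> * (\<bar>A\<bar> + \<bar>B\<bar>))) * indicator {A..B} x \<partial>lborel)"
  proof (rule nn_integral_mono)
    fix x
    show "ennreal (\<phi> x * exp (- (b * x))) * indicator {A..B} x \<le>
      ennreal (S * exp (\<bar>b\<bar> * (\<bar>A\<bar> + \<bar>B\<bar>))) * indicator {A..B} x"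
    proof (cases "x \<in> {A..B}")
      case True
      then have "\<bar>x\<bar> \<le> \<bar>A\<bar> + \<bar>B\<bar>" by auto
      then have "\<bar>b\<bar> * \<bar>x\<bar> \<le> \<bar>b\<bar> * (\<bar>A\<bar> + \<bar>B\<bar>)" by (intro mult_left_mono) auto
      moreover have "- (b * x) \<le> \<bar>b\<bar> * \<bar>x\<bar>" by (metis abs_ge_minus_self abs_mult)
      ultimately have "\<phi> x * exp (- (b * x)) \<le> S * exp (\<bar>b\<bar> * (\<bar>A\<bar> + \<bar>B\<bar>))"
        using solD(2,3)[OF s, of x] by (intro mult_mono) auto
      then show ?thesis using True by (simp add: ennreal_leI)
    qed simp
  qed
  also have "\<dots> < \<infinity>"
    by (simp add: nn_integral_cmult_indicator emeasure_lborel_Icc_eq ennreal_mult_less_top)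
  finally show ?thesis .
qed

lemma tail_mono: assumes "b \<le> c" "sol \<phi>" shows "tail \<phi> b \<le> tail \<phi> c"
  unfolding tail_def
proof (rule nn_integral_mono)
  fix x
  show "ennreal (\<phi> x * exp (- (b * x))) * indicator {..0} x \<le> ennreal (\<phi> x * exp (- (c * x))) * indicator {..0} x"
  proof (cases "x \<le> 0")
    case True
    then have "c * x \<le> b * x" using assms(1) by (intro mult_right_mono_neg) auto
    then have "\<phi> x * exp (- (b * x)) \<le> \<phi> x * exp (- (c * x))" 
      using solD(2)[OF assms(2)] by (intro mult_left_mono) auto
    then show ?thesis using True by (simp add: ennreal_leI)
  qed simp
qed

lemma tail_neg:
  assumes s: "sol \<phi>" and b: "b < 0"
  shows "tail \<phi> b < \<infinity>"
proof -
  have "tail \<phi> b \<le> (\<integral>\<^sup>+x. ennreal S * (ennreal (exp (- b * x)) * indicator {..0} x) \<partial>lborel)"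
    unfolding tail_def
  proof (rule nn_integral_mono)
    fix x
    have "ennreal (\<phi> x * exp (- (b * x))) \<le> ennreal (S * exp (- (b * x)))"
      using solD(3)[OF s] by (intro ennreal_leI mult_right_mono) auto
    also have "\<dots> = ennreal S * ennreal (exp (- b * x))" using S_pos by (simp add: ennreal_mult)
    finally show "ennreal (\<phi> x * exp (- (b * x))) * indicator {..0} x \<le>
      ennreal S * (ennreal (exp (- b * x)) * indicator {..0} x)"
      by (simp add: indicator_def)
  qed
  also have "\<dots> = ennreal S * (\<integral>\<^sup>+x. ennreal (exp (- b * x)) * indicator {..0} x \<partial>lborel)"
    by (rule nn_integral_cmult) simp
  also have "\<dots> < \<infinity>"
    unfolding nn_integral_exp_atMost[of "-b", OF b[folded neg_0_less_iff_less]] by (simp add: ennreal_mult_less_top)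
  finally show ?thesis .
qed

end

section \<open>Exponential decay of solutions\<close>

context convolution_equation
begin

text \<open>Monotone convergence. The truncation serves two purposes: the full transform may be
  infinite at \<open>z\<close>, and bounded shifts keep the argument of a solution near -infinity,
  where linearization is valid.\<close>

lemma truncated_kernel:
  assumes "1 < (\<integral>\<^sup>+x. ennreal (n x * exp (- (z * x))) \<partial>lborel)"
  obtains R v where "0 < R" "1 < v"
    "(\<integral>\<^sup>+x. ennreal (n x * exp (- (z * x))) * indicator {-R..R} x \<partial>lborel) = ennreal v"
proof -
  define J where "J m = {- (real m + 1)..real m + 1}" for m :: nat
  have J: "x \<in> J m \<longleftrightarrow> \<bar>x\<bar> \<le> real m + 1" for x m by (auto simp: J_def)
  have "(\<lambda>m. \<integral>\<^sup>+x. ennreal (n x * exp (- (z * x))) * indicator (J m) x \<partial>lborel)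
    \<longlonglongrightarrow> (\<integral>\<^sup>+x. ennreal (n x * exp (- (z * x))) \<partial>lborel)"
  proof (rule nn_integral_LIMSEQ)
    show "incseq (\<lambda>m x. ennreal (n x * exp (- (z * x))) * indicator (J m) x)"
      by (auto simp: incseq_def le_fun_def indicator_def J)
    fix x :: real
    obtain m0 :: nat where m0: "\<bar>x\<bar> \<le> real m0" using real_arch_simple by blast
    have "\<forall>\<^sub>F m in sequentially. ennreal (n x * exp (- (z * x))) * indicator (J m) x = ennreal (n x * exp (- (z * x)))"
      by (rule eventually_sequentiallyI[of m0]) (use m0 in \<open>auto simp: indicator_def J\<close>)
    then show "(\<lambda>m. ennreal (n x * exp (- (z * x))) * indicator (J m) x) \<longlonglongrightarrow> ennreal (n x * exp (- (z * x)))"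
      by (rule tendsto_eventually)
  qed (auto simp: J_def)
  from order_tendstoD(1)[OF this assms]
  obtain m where m: "1 < (\<integral>\<^sup>+x. ennreal (n x * exp (- (z * x))) * indicator (J m) x \<partial>lborel)"
    by (auto simp: eventually_sequentially)
  define R where "R = real m + 1"
  have R: "0 < R" "J m = {-R..R}" by (auto simp: R_def J_def)
  have "(\<integral>\<^sup>+x. ennreal (n x * exp (- (z * x))) * indicator {-R..R} x \<partial>lborel) \<le>
    (\<integral>\<^sup>+x. ennreal (exp (\<bar>z\<bar> * R) * n x) \<partial>lborel)"
  proof (rule nn_integral_mono)
    fix x
    show "ennreal (n x * exp (- (z * x))) * indicator {-R..R} x \<le> ennreal (exp (\<bar>z\<bar> * R) * n x)"
    proof (cases "x \<in> {-R..R}")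
      case True
      then have "\<bar>z\<bar> * \<bar>x\<bar> \<le> \<bar>z\<bar> * R" by (intro mult_left_mono) auto
      moreover have "- (z * x) \<le> \<bar>z\<bar> * \<bar>x\<bar>" by (metis abs_ge_minus_self abs_mult)
      ultimately have "n x * exp (- (z * x)) \<le> n x * exp (\<bar>z\<bar> * R)"
        using n_pos[of x] by (intro mult_left_mono) auto
      then show ?thesis using True by (simp add: ennreal_leI mult.commute)
    qed simp
  qed
  also have "\<dots> = ennreal (\<integral>x. exp (\<bar>z\<bar> * R) * n x \<partial>lborel)"
    using n_int less_imp_le[OF n_pos] by (intro nn_integral_eq_integral) auto
  also have "\<dots> < \<infinity>" by simp
  finally have fin: "(\<integral>\<^sup>+x. ennreal (n x * exp (- (z * x))) * indicator {-R..R} x \<partial>lborel) < \<infinity>" .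
  define v where "v = enn2real (\<integral>\<^sup>+x. ennreal (n x * exp (- (z * x))) * indicator {-R..R} x \<partial>lborel)"
  have v: "(\<integral>\<^sup>+x. ennreal (n x * exp (- (z * x))) * indicator {-R..R} x \<partial>lborel) = ennreal v"
    unfolding v_def using fin by simp
  have "1 < ennreal v" using m unfolding R v .
  then have "1 < v" by (metis ennreal_1 ennreal_less_iff zero_le_one)
  then show ?thesis using that[OF R(1) _ v] by blast
qed

text \<open>Near -infinity the solution is so small that each \<open>F i s\<close> is at least
  \<open>q * a i * s\<close>. Shifts of size at most \<open>R\<close> stay in that region once
  \<open>x\<close> is at least \<open>R\<close> to the left of its edge.\<close>

lemma sol_lower_linear:
  assumes s: "sol \<phi>" and q: "0 < q" "q < 1" and R: "0 < R"
  obtains X where "X \<le> 0" "\<And>x. x \<le> X \<Longrightarrow>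
    (\<integral>\<^sup>+y. ennreal (q * (n y * \<phi> (x - y))) * indicator {-R..R} y \<partial>lborel) \<le> ennreal (\<phi> x)"
proof -
  obtain s0 where s0: "0 < s0" "s0 \<le> S" "\<And>i s. i \<in> I \<Longrightarrow> 0 \<le> s \<Longrightarrow> s \<le> s0 \<Longrightarrow> C * s powr \<theta> \<le> (1 - q) * a i"
    using small_nonlinearity[of "1 - q"] q by auto
  have low: "q * a i * s \<le> F i s" if i: "i \<in> I" and t: "0 \<le> s" "s \<le> s0" for i s
  proof -
    have "\<bar>F i s - F i 0 - a i * (s - 0)\<bar> \<le> C * (max s 0 powr \<theta>) * \<bar>s - 0\<bar>"
      using i t s0 S_pos by (intro F_lin) auto
    then have "a i * s - C * s powr \<theta> * s \<le> F i s" using t F_zero[OF i] by (simp add: max_absorb1)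
    moreover have "C * s powr \<theta> * s \<le> (1 - q) * a i * s" using s0(3)[OF i t] t by (intro mult_right_mono) auto
    ultimately show ?thesis by (simp add: algebra_simps)
  qed
  obtain A where A: "\<And>x. x \<le> A \<Longrightarrow> \<phi> x < s0"
    using order_tendstoD(2)[OF solD(4)[OF s] s0(1)] by (auto simp: eventually_at_bot_linorder)
  show ?thesis
  proof (rule that[of "min 0 (A - R)"])
    fix x assume x: "x \<le> min 0 (A - R)"
    show "(\<integral>\<^sup>+y. ennreal (q * (n y * \<phi> (x - y))) * indicator {-R..R} y \<partial>lborel) \<le> ennreal (\<phi> x)"
      unfolding sol_nn[OF s]
    proof (rule nn_integral_mono)
      fix y
      show "ennreal (q * (n y * \<phi> (x - y))) * indicator {-R..R} y \<le> ennreal (\<Sum>i\<in>I. k i y * F i (\<phi> (x - y)))"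
      proof (cases "y \<in> {-R..R}")
        case True
        then have f: "\<phi> (x - y) \<le> s0" using A[of "x - y"] x by (auto intro: less_imp_le)
        have "q * (n y * \<phi> (x - y)) = (\<Sum>i\<in>I. k i y * (q * a i * \<phi> (x - y)))"
          by (simp add: n_def sum_distrib_left sum_distrib_right mult_ac)
        also have "\<dots> \<le> (\<Sum>i\<in>I. k i y * F i (\<phi> (x - y)))"
          using low f solD(2)[OF s] k_pos by (intro sum_mono mult_left_mono) (auto intro: less_imp_le)
        finally show ?thesis using True by (simp add: ennreal_leI)
      qed simp
    qed
  qed simp
qed

text \<open>The weight \<open>1 / (exp (p x) + \<kappa> exp (b x))\<close> behaves on bounded scales like an exponential with exponent
  between \<open>b\<close> and \<open>p\<close>, uniformly in \<open>\<kappa>\<close>; letting \<open>\<kappa>\<close> tend to \<open>0\<close> raises the exponent from \<open>b\<close> to \<open>p\<close>.\<close>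

lemma tail_step:
  assumes s: "sol \<phi>" and z: "1 < (\<integral>\<^sup>+x. ennreal (n x * exp (- (z * x))) \<partial>lborel)"
  obtains \<eta> where "0 < \<eta>" "tail \<phi> (z - \<eta>) < \<infinity> \<Longrightarrow> tail \<phi> (z + \<eta>) < \<infinity>"
proof -
  note [measurable] = solD(6)[OF s]
  obtain R v where R: "0 < R" and v: "1 < v"
    "(\<integral>\<^sup>+x. ennreal (n x * exp (- (z * x))) * indicator {-R..R} x \<partial>lborel) = ennreal v"
    using truncated_kernel[OF z] by blast
  define u where "u = (1 + v) / 2"
  have u: "1 < u" "u < v" using v by (auto simp: u_def)
  \<comment> \<open>The truncated transform \<open>v\<close> may lose the factor \<open>q\<close>
    twice and still leave \<open>u > 1\<close>: one factor pays for the linearization, the other for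
    shifting the weight. The choice of \<eta> makes the latter cost exactly \<open>q\<close> at
    distance \<open>R\<close>.\<close>
  define q where "q = sqrt (u / v)"
  have q: "0 < q" "q < 1" using u v by (auto simp: q_def)
  have qv: "q * q * v = u" using u v by (simp add: q_def)
  define \<eta> where "\<eta> = - ln q / R"
  have \<eta>: "0 < \<eta>" using q R by (simp add: \<eta>_def divide_neg_pos)
  have e\<eta>: "exp (- (\<eta> * R)) = q" using q R by (simp add: \<eta>_def)
  obtain X where X: "X \<le> 0" "\<And>x. x \<le> X \<Longrightarrow>
    (\<integral>\<^sup>+y. ennreal (q * (n y * \<phi> (x - y))) * indicator {-R..R} y \<partial>lborel) \<le> ennreal (\<phi> x)"
    using sol_lower_linear[OF s q R] by blast
  define p where "p = z + \<eta>"
  define b where "b = z - \<eta>"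
  have fin: "tail \<phi> p < \<infinity>" if tb: "tail \<phi> b < \<infinity>"
  proof -
    define Z0 where "Z0 = (\<integral>\<^sup>+x. ennreal (\<phi> x * exp (- (p * x))) * indicator {X-R..X} x \<partial>lborel)"
    have Z0: "Z0 < \<infinity>" unfolding Z0_def by (rule finite_on_compact[OF s])
    define Z1 where "Z1 = (\<integral>\<^sup>+x. ennreal (\<phi> x * exp (- (p * x))) * indicator {X-R..0} x \<partial>lborel)"
    have Z1: "Z1 < \<infinity>" unfolding Z1_def by (rule finite_on_compact[OF s])
    define w where "w \<kappa> x = inverse (exp (p * x) + \<kappa> * exp (b * x))" for \<kappa> x :: real
    define Y where "Y \<kappa> = (\<integral>\<^sup>+x. ennreal (w \<kappa> x * \<phi> x) * indicator {..X-R} x \<partial>lborel)" for \<kappa>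
    have Y: "Y \<kappa> \<le> ennreal (enn2real Z0 / (u - 1))" if \<kappa>: "0 < \<kappa>" for \<kappa>
    proof -
      have dpos: "0 < exp (p * x) + \<kappa> * exp (b * x)" for x using \<kappa> by (intro add_pos_pos) auto
      have wpos: "0 < w \<kappa> x" for x using dpos by (simp add: w_def)
      have [measurable]: "w \<kappa> \<in> borel_measurable borel" unfolding w_def by measurable
      have wp: "w \<kappa> x \<le> exp (- (p * x))" for x
        unfolding w_def exp_minus using \<kappa> by (intro le_imp_inverse_le) auto
      have wb: "w \<kappa> x \<le> inverse \<kappa> * exp (- (b * x))" for x
        unfolding w_def exp_minus inverse_mult_distrib[symmetric] using \<kappa> by (intro le_imp_inverse_le) auto
      \<comment> \<open>Both exponents differ from \<open>z\<close> by \<eta>, so a shift by at most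
        \<open>R\<close> multiplies either exponential by at most exp (z y + \<eta> R). The weight
        therefore behaves like exp (- z x) up to the factor \<open>q\<close>, whatever \<kappa>
        is.\<close>
      have wshift: "w \<kappa> x * exp (- (z * y)) * q \<le> w \<kappa> (x + y)" if "\<bar>y\<bar> \<le> R" for x y
      proof -
        have "\<eta> * \<bar>y\<bar> \<le> \<eta> * R" using that \<eta> by (intro mult_left_mono) auto
        moreover have "\<eta> * y \<le> \<eta> * \<bar>y\<bar>" "- (\<eta> * y) \<le> \<eta> * \<bar>y\<bar>" using \<eta> by (auto simp: abs_if)
        ultimately have e: "p * y \<le> z * y + \<eta> * R" "b * y \<le> z * y + \<eta> * R"
          unfolding p_def b_def by (auto simp: algebra_simps)
        have "exp (p * (x + y)) + \<kappa> * exp (b * (x + y)) = exp (p * x) * exp (p * y) + \<kappa> * exp (b * x) * exp (b * y)"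
          by (simp add: distrib_left exp_add)
        also have "\<dots> \<le> exp (p * x) * exp (z * y + \<eta> * R) + \<kappa> * exp (b * x) * exp (z * y + \<eta> * R)"
          using e \<kappa> by (intro add_mono mult_left_mono) auto
        also have "\<dots> = (exp (p * x) + \<kappa> * exp (b * x)) * exp (z * y + \<eta> * R)" by (simp add: distrib_right)
        finally have "inverse ((exp (p * x) + \<kappa> * exp (b * x)) * exp (z * y + \<eta> * R)) \<le> w \<kappa> (x + y)"
          unfolding w_def using dpos by (intro le_imp_inverse_le)
        moreover have "inverse ((exp (p * x) + \<kappa> * exp (b * x)) * exp (z * y + \<eta> * R)) = w \<kappa> x * exp (- (z * y)) * q"
          unfolding w_def inverse_mult_distrib e\<eta>[symmetric] by (simp add: exp_minus[symmetric] mult_exp_exp)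
        ultimately show ?thesis by simp
      qed
      define G where "G = (\<integral>\<^sup>+x. ennreal (w \<kappa> x * \<phi> x) * indicator {..X} x \<partial>lborel)"
      \<comment> \<open>Integrating the linear lower bound against the weight and exchanging the
        integrals gives \<open>u * Y\<close> at most \<open>Y + Z0\<close>, with \<open>Z0\<close>
        collecting a strip of width \<open>R\<close>. Since \<open>u > 1\<close> and
        \<open>Y\<close> is finite by the assumption on \<open>tail \<phi> b\<close>, this bounds
        \<open>Y\<close> independently of \<kappa>.\<close>
      have "ennreal u * Y \<kappa> = (\<integral>\<^sup>+y. ennreal (q * q * (n y * exp (- (z * y)))) * indicator {-R..R} y * Y \<kappa> \<partial>lborel)"
      proof -
        have "(\<integral>\<^sup>+y. ennreal (q * q * (n y * exp (- (z * y)))) * indicator {-R..R} y \<partial>lborel) =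
            (\<integral>\<^sup>+y. ennreal (q * q) * (ennreal (n y * exp (- (z * y))) * indicator {-R..R} y) \<partial>lborel)"
          using q n_pos by (intro nn_integral_cong) (simp add: ennreal_mult' mult.assoc)
        also have "\<dots> = ennreal (q * q) * ennreal v"
          by (subst nn_integral_cmult) (auto simp: v(2))
        also have "\<dots> = ennreal u" using q v by (simp add: ennreal_mult[symmetric] qv)
        finally show ?thesis by (subst nn_integral_multc) auto
      qed
      also have "\<dots> \<le> (\<integral>\<^sup>+y. (\<integral>\<^sup>+x. ennreal (q * (w \<kappa> x * (n y * \<phi> (x - y)))) * indicator {-R..R} y * indicator {..X} x \<partial>lborel) \<partial>lborel)"
      proof (rule nn_integral_mono)
        fix y :: real
        show "ennreal (q * q * (n y * exp (- (z * y)))) * indicator {-R..R} y * Y \<kappa> \<le>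
          (\<integral>\<^sup>+x. ennreal (q * (w \<kappa> x * (n y * \<phi> (x - y)))) * indicator {-R..R} y * indicator {..X} x \<partial>lborel)"
        proof (cases "y \<in> {-R..R}")
          case True
          then have yR: "\<bar>y\<bar> \<le> R" by auto
          have "ennreal (q * q * (n y * exp (- (z * y)))) * Y \<kappa> =
            (\<integral>\<^sup>+x. ennreal (q * q * (n y * exp (- (z * y)))) * (ennreal (w \<kappa> x * \<phi> x) * indicator {..X-R} x) \<partial>lborel)"
            unfolding Y_def by (rule nn_integral_cmult[symmetric]) measurable
          also have "\<dots> \<le> (\<integral>\<^sup>+x. ennreal (q * (w \<kappa> (y + 1 * x) * (n y * \<phi> (y + 1 * x - y)))) * indicator {..X} (y + 1 * x) \<partial>lborel)"
          proof (rule nn_integral_mono)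
            fix x
            show "ennreal (q * q * (n y * exp (- (z * y)))) * (ennreal (w \<kappa> x * \<phi> x) * indicator {..X-R} x) \<le>
              ennreal (q * (w \<kappa> (y + 1 * x) * (n y * \<phi> (y + 1 * x - y)))) * indicator {..X} (y + 1 * x)"
            proof (cases "x \<le> X - R")
              case xX: True
              then have "y + x \<le> X" using yR by auto
              have "q * q * (n y * exp (- (z * y))) * (w \<kappa> x * \<phi> x) = q * n y * \<phi> x * (w \<kappa> x * exp (- (z * y)) * q)"
                by (simp add: mult_ac)
              also have "\<dots> \<le> q * n y * \<phi> x * w \<kappa> (x + y)"
                using q n_pos[of y] solD(2)[OF s, of x] by (intro mult_left_mono wshift yR) (auto intro!: mult_nonneg_nonneg)
              also have "\<dots> = q * (w \<kappa> (y + 1 * x) * (n y * \<phi> (y + 1 * x - y)))" by (simp add: mult_ac add.commute)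
              finally show ?thesis using xX \<open>y + x \<le> X\<close> q n_pos[of y] wpos[of x] solD(2)[OF s, of x]
                by (simp add: ennreal_mult'[symmetric] ennreal_leI)
            qed simp
          qed
          also have "\<dots> = (\<integral>\<^sup>+x. ennreal (q * (w \<kappa> x * (n y * \<phi> (x - y)))) * indicator {..X} x \<partial>lborel)"
            using nn_integral_real_affine[of "\<lambda>x. ennreal (q * (w \<kappa> x * (n y * \<phi> (x - y)))) * indicator {..X} x" 1 y]
            by simp
          finally show ?thesis using True by simp
        qed simp
      qed
      also have "\<dots> = (\<integral>\<^sup>+x. (\<integral>\<^sup>+y. ennreal (q * (w \<kappa> x * (n y * \<phi> (x - y)))) * indicator {-R..R} y * indicator {..X} x \<partial>lborel) \<partial>lborel)"
        by (rule lborel_pair.Fubini') measurable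
      also have "\<dots> \<le> G"
        unfolding G_def
      proof (rule nn_integral_mono)
        fix x
        show "(\<integral>\<^sup>+y. ennreal (q * (w \<kappa> x * (n y * \<phi> (x - y)))) * indicator {-R..R} y * indicator {..X} x \<partial>lborel) \<le>
          ennreal (w \<kappa> x * \<phi> x) * indicator {..X} x"
        proof (cases "x \<le> X")
          case True
          have "(\<integral>\<^sup>+y. ennreal (q * (w \<kappa> x * (n y * \<phi> (x - y)))) * indicator {-R..R} y * indicator {..X} x \<partial>lborel) =
            (\<integral>\<^sup>+y. ennreal (w \<kappa> x) * (ennreal (q * (n y * \<phi> (x - y))) * indicator {-R..R} y) \<partial>lborel)"
          proof (intro nn_integral_cong)
            fix y
            have "q * (w \<kappa> x * (n y * \<phi> (x - y))) = w \<kappa> x * (q * (n y * \<phi> (x - y)))"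
              by (rule mult.left_commute)
            then have "ennreal (q * (w \<kappa> x * (n y * \<phi> (x - y)))) = ennreal (w \<kappa> x) * ennreal (q * (n y * \<phi> (x - y)))"
              using wpos[of x] by (simp only: ennreal_mult' less_imp_le)
            then show "ennreal (q * (w \<kappa> x * (n y * \<phi> (x - y)))) * indicator {-R..R} y * indicator {..X} x =
              ennreal (w \<kappa> x) * (ennreal (q * (n y * \<phi> (x - y))) * indicator {-R..R} y)"
              using True by (simp only: mult.assoc) simp
          qed
          also have "\<dots> = ennreal (w \<kappa> x) * (\<integral>\<^sup>+y. ennreal (q * (n y * \<phi> (x - y))) * indicator {-R..R} y \<partial>lborel)"
            by (rule nn_integral_cmult) measurable
          also have "\<dots> \<le> ennreal (w \<kappa> x) * ennreal (\<phi> x)" by (intro mult_left_mono X(2) True) auto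
          also have "\<dots> = ennreal (w \<kappa> x * \<phi> x)" using wpos[of x] by (simp add: ennreal_mult')
          finally show ?thesis using True by simp
        qed simp
      qed
      also have "G \<le> (\<integral>\<^sup>+x. ennreal (w \<kappa> x * \<phi> x) * indicator {..X-R} x + ennreal (\<phi> x * exp (- (p * x))) * indicator {X-R..X} x \<partial>lborel)"
        unfolding G_def
      proof (rule nn_integral_mono)
        fix x
        have "ennreal (w \<kappa> x * \<phi> x) \<le> ennreal (\<phi> x * exp (- (p * x)))"
          using wp[of x] solD(2)[OF s, of x] by (intro ennreal_leI) (metis mult.commute mult_left_mono)
        then show "ennreal (w \<kappa> x * \<phi> x) * indicator {..X} x \<le>
          ennreal (w \<kappa> x * \<phi> x) * indicator {..X-R} x + ennreal (\<phi> x * exp (- (p * x))) * indicator {X-R..X} x"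
          by (auto simp: indicator_def)
      qed
      also have "\<dots> = Y \<kappa> + Z0" unfolding Y_def Z0_def by (rule nn_integral_add) measurable
      finally have le: "ennreal u * Y \<kappa> \<le> Y \<kappa> + Z0" .
      have "Y \<kappa> \<le> (\<integral>\<^sup>+x. ennreal (inverse \<kappa>) * (ennreal (\<phi> x * exp (- (b * x))) * indicator {..0} x) \<partial>lborel)"
        unfolding Y_def
      proof (rule nn_integral_mono)
        fix x
        have "w \<kappa> x * \<phi> x \<le> inverse \<kappa> * exp (- (b * x)) * \<phi> x"
          using wb[of x] solD(2)[OF s, of x] by (rule mult_right_mono)
        then have "ennreal (w \<kappa> x * \<phi> x) \<le> ennreal (inverse \<kappa>) * ennreal (\<phi> x * exp (- (b * x)))"
          using \<kappa> by (simp add: ennreal_mult'[symmetric] ennreal_leI mult_ac)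
        then show "ennreal (w \<kappa> x * \<phi> x) * indicator {..X-R} x \<le>
          ennreal (inverse \<kappa>) * (ennreal (\<phi> x * exp (- (b * x))) * indicator {..0} x)"
          using X(1) R by (auto simp: indicator_def)
      qed
      also have "\<dots> = ennreal (inverse \<kappa>) * tail \<phi> b"
        unfolding tail_def by (rule nn_integral_cmult) measurable
      also have "\<dots> < \<infinity>" using tb by (simp add: ennreal_mult_less_top)
      finally have Yfin: "Y \<kappa> < \<infinity>" .
      obtain y where y: "Y \<kappa> = ennreal y" "0 \<le> y" using Yfin by (cases "Y \<kappa>") auto
      obtain z0 where z0: "Z0 = ennreal z0" "0 \<le> z0" using Z0 by (cases Z0) auto
      have "ennreal (u * y) \<le> ennreal (y + z0)"
        using le u y(2) z0(2) unfolding y(1) z0(1) by (simp add: ennreal_mult' ennreal_plus)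
      then have "u * y \<le> y + z0" using y(2) z0(2) by (subst (asm) ennreal_le_iff) auto
      then have "y \<le> z0 / (u - 1)" using u by (simp add: pos_le_divide_eq algebra_simps)
      then show ?thesis unfolding y(1) z0(1) using z0(2) by (simp add: ennreal_leI)
    qed
    \<comment> \<open>Along this sequence the weights increase to exp (- p x), so monotone
      convergence transfers the uniform bound to the exponent \<open>p\<close>.\<close>
    define \<kappa> where "\<kappa> m = inverse (real (Suc m))" for m
    have \<kappa>: "0 < \<kappa> m" for m by (simp add: \<kappa>_def)
    have lim: "(\<lambda>m. Y (\<kappa> m)) \<longlonglongrightarrow> (\<integral>\<^sup>+x. ennreal (\<phi> x * exp (- (p * x))) * indicator {..X-R} x \<partial>lborel)"
      unfolding Y_def
    proof (rule nn_integral_LIMSEQ)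
      show "incseq (\<lambda>m x. ennreal (w (\<kappa> m) x * \<phi> x) * indicator {..X-R} x)"
      proof (intro incseq_SucI le_funI mult_right_mono ennreal_leI)
        fix m x
        have "\<kappa> (Suc m) \<le> \<kappa> m" by (simp add: \<kappa>_def)
        then show "w (\<kappa> m) x \<le> w (\<kappa> (Suc m)) x" unfolding w_def
          using \<kappa>[of "Suc m"] by (intro le_imp_inverse_le add_left_mono mult_right_mono) (auto intro!: add_pos_pos)
      qed (use solD(2)[OF s] in auto)
      fix x
      have "(\<lambda>m. w (\<kappa> m) x * \<phi> x) \<longlonglongrightarrow> inverse (exp (p * x) + 0 * exp (b * x)) * \<phi> x"
        unfolding w_def \<kappa>_def by (intro tendsto_intros LIMSEQ_inverse_real_of_nat) auto
      then have "(\<lambda>m. ennreal (w (\<kappa> m) x * \<phi> x)) \<longlonglongrightarrow> ennreal (\<phi> x * exp (- (p * x)))"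
        by (intro tendsto_ennrealI) (simp add: exp_minus mult.commute)
      then show "(\<lambda>m. ennreal (w (\<kappa> m) x * \<phi> x) * indicator {..X-R} x) \<longlonglongrightarrow> ennreal (\<phi> x * exp (- (p * x))) * indicator {..X-R} x"
        by (cases "x \<le> X - R") auto
    qed (simp add: w_def)
    have le: "(\<integral>\<^sup>+x. ennreal (\<phi> x * exp (- (p * x))) * indicator {..X-R} x \<partial>lborel) \<le> ennreal (enn2real Z0 / (u - 1))"
      by (rule LIMSEQ_le_const2[OF lim]) (use Y \<kappa> in blast)
    have "tail \<phi> p \<le> (\<integral>\<^sup>+x. ennreal (\<phi> x * exp (- (p * x))) * indicator {..X-R} x + ennreal (\<phi> x * exp (- (p * x))) * indicator {X-R..0} x \<partial>lborel)"
      unfolding tail_def by (rule nn_integral_mono) (auto simp: indicator_def)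
    also have "\<dots> = (\<integral>\<^sup>+x. ennreal (\<phi> x * exp (- (p * x))) * indicator {..X-R} x \<partial>lborel) + Z1"
      unfolding Z1_def by (rule nn_integral_add) measurable
    also have "\<dots> \<le> ennreal (enn2real Z0 / (u - 1)) + Z1" using le by (rule add_right_mono)
    also have "\<dots> < \<infinity>" using Z1 by simp
    finally show ?thesis .
  qed
  then show ?thesis using that[OF \<eta>] unfolding p_def b_def by blast
qed

text \<open>Continuation in the exponent. Negative exponents are harmless since solutions are
  bounded. At the supremum of the admissible exponents \<open>tail_step\<close> asks for finiteness
  only slightly below and yields it slightly above, so the supremum cannot stop short of
  \<open>Z\<close>.\<close>

lemma tail_finite:
  assumes s: "sol \<phi>" and Z: "0 \<le> Z"
    and z: "\<And>z. 0 \<le> z \<Longrightarrow> z \<le> Z \<Longrightarrow> 1 < (\<integral>\<^sup>+x. ennreal (n x * exp (- (z * x))) \<partial>lborel)"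
  shows "tail \<phi> Z < \<infinity>"
proof (rule ccontr)
  assume inf: "\<not> ?thesis"
  define B where "B = {b. b \<le> Z \<and> tail \<phi> b < \<infinity>}"
  have bdd: "bdd_above B" unfolding B_def by (rule bdd_aboveI[of _ Z]) auto
  have neg: "b \<in> B" if "b < 0" for b using that Z tail_neg[OF s that] by (auto simp: B_def)
  have ne: "B \<noteq> {}" using neg[of "-1"] by auto
  define \<sigma> where "\<sigma> = Sup B"
  have \<sigma>Z: "\<sigma> \<le> Z" unfolding \<sigma>_def using ne by (intro cSup_least) (auto simp: B_def)
  have \<sigma>0: "0 \<le> \<sigma>"
  proof (rule ccontr)
    assume "\<not> 0 \<le> \<sigma>"
    then have "\<sigma> / 2 \<in> B" by (intro neg) auto
    then have "\<sigma> / 2 \<le> \<sigma>" unfolding \<sigma>_def using bdd by (rule cSup_upper)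
    with \<open>\<not> 0 \<le> \<sigma>\<close> show False by simp
  qed
  obtain \<eta> where \<eta>: "0 < \<eta>" "tail \<phi> (\<sigma> - \<eta>) < \<infinity> \<Longrightarrow> tail \<phi> (\<sigma> + \<eta>) < \<infinity>"
    using tail_step[OF s z[OF \<sigma>0 \<sigma>Z]] by blast
  obtain b where b: "b \<in> B" "\<sigma> - \<eta> < b"
    using less_cSup_iff[OF ne bdd, of "\<sigma> - \<eta>"] \<eta>(1) by (auto simp: \<sigma>_def)
  have "tail \<phi> (\<sigma> - \<eta>) \<le> tail \<phi> b" using b(2) by (intro tail_mono s) auto
  also have "\<dots> < \<infinity>" using b(1) by (simp add: B_def)
  finally have f: "tail \<phi> (\<sigma> + \<eta>) < \<infinity>" by (rule \<eta>(2))
  show False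
  proof (cases "Z \<le> \<sigma> + \<eta>")
    case True
    then have "tail \<phi> Z \<le> tail \<phi> (\<sigma> + \<eta>)" by (intro tail_mono s)
    with f inf show False by (simp add: not_less top_unique)
  next
    case False
    then have "\<sigma> + \<eta> \<in> B" using f by (simp add: B_def)
    then have "\<sigma> + \<eta> \<le> \<sigma>" unfolding \<sigma>_def using bdd by (rule cSup_upper)
    with \<eta>(1) show False by simp
  qed
qed

text \<open>By the Harnack inequality the value at \<open>x\<close> is controlled by the integral
  over the interval from \<open>x - 1\<close> to \<open>x\<close>, so the weighted integral bound
  becomes pointwise. For positive \<open>x\<close> the bound \<open>S\<close> is enough.\<close>

lemma decay_of_tail:
  assumes s: "sol \<phi>" and Z: "0 \<le> Z" and f: "tail \<phi> Z < \<infinity>"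
  obtains D where "0 < D" "\<And>x. \<phi> x \<le> D * exp (Z * x)"
proof -
  note [measurable] = solD(6)[OF s]
  obtain t where t: "tail \<phi> Z = ennreal t" "0 \<le> t" using f by (cases "tail \<phi> Z") auto
  have "\<phi> x \<le> (H * t + S) * exp (Z * x)" for x
  proof (cases "x \<le> 0")
    case True
    have "ennreal (\<phi> x * exp (- (Z * x))) = (\<integral>\<^sup>+y. ennreal (\<phi> x * exp (- (Z * x))) * indicator {x-1..x} y \<partial>lborel)"
      by (simp add: nn_integral_cmult_indicator)
    also have "\<dots> \<le> (\<integral>\<^sup>+y. ennreal H * (ennreal (\<phi> y * exp (- (Z * y))) * indicator {..0} y) \<partial>lborel)"
    proof (rule nn_integral_mono)
      fix y
      show "ennreal (\<phi> x * exp (- (Z * x))) * indicator {x-1..x} y \<le> ennreal H * (ennreal (\<phi> y * exp (- (Z * y))) * indicator {..0} y)"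
      proof (cases "y \<in> {x-1..x}")
        case yx: True
        then have "\<phi> x \<le> H * \<phi> (x + (y - x))" by (intro sol_harnack[OF s]) auto
        moreover have "Z * y \<le> Z * x" using yx Z by (intro mult_left_mono) auto
        ultimately have "\<phi> x * exp (- (Z * x)) \<le> H * \<phi> y * exp (- (Z * y))"
          using solD(2)[OF s] H_pos by (intro mult_mono) auto
        then show ?thesis using yx True H_pos solD(2)[OF s]
          by (simp add: ennreal_mult'[symmetric] ennreal_leI mult.assoc)
      qed simp
    qed
    also have "\<dots> = ennreal H * tail \<phi> Z" unfolding tail_def by (rule nn_integral_cmult) measurable
    also have "\<dots> = ennreal (H * t)" using H_pos t by (simp add: ennreal_mult')
    finally have "\<phi> x * exp (- (Z * x)) \<le> H * t" using H_pos t by (simp add: ennreal_le_iff)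
    then have "\<phi> x * exp (- (Z * x)) * exp (Z * x) \<le> (H * t + S) * exp (Z * x)"
      using S_pos by (intro mult_right_mono) auto
    then show ?thesis by (simp add: mult.assoc mult_exp_exp)
  next
    case False
    then have "1 \<le> exp (Z * x)" using Z by simp
    then have "S * 1 \<le> (H * t + S) * exp (Z * x)" using S_pos H_pos t by (intro mult_mono) auto
    then show ?thesis using solD(3)[OF s, of x] by simp
  qed
  then show ?thesis using S_pos H_pos t by (intro that[of "H * t + S"]) (auto intro: add_nonneg_pos)
qed

lemma decay:
  assumes "sol \<phi>" "0 \<le> Z"
    "\<And>z. 0 \<le> z \<Longrightarrow> z \<le> Z \<Longrightarrow> 1 < (\<integral>\<^sup>+x. ennreal (n x * exp (- (z * x))) \<partial>lborel)"
  obtains D where "0 < D" "\<And>x. \<phi> x \<le> D * exp (Z * x)"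
  using decay_of_tail[OF assms(1,2) tail_finite[OF assms]] by blast

text \<open>A positive solution dominates a multiple of the kernel \<open>k j\<close>, whose
  weighted integral on the left half-line diverges at \<open>Z\<close>, while the decay argument
  makes the same integral of the solution finite.\<close>

lemma no_positive_solution:
  assumes s: "sol \<phi>" and Z: "0 \<le> Z"
    and z: "\<And>z. 0 \<le> z \<Longrightarrow> z \<le> Z \<Longrightarrow> 1 < (\<integral>\<^sup>+x. ennreal (n x * exp (- (z * x))) \<partial>lborel)"
    and j: "j \<in> I" "\<And>s. 0 < s \<Longrightarrow> s \<le> S \<Longrightarrow> 0 < F j s"
    and inf: "(\<integral>\<^sup>+x. ennreal (k j x * exp (- (Z * x))) * indicator {..0} x \<partial>lborel) = \<infinity>"
  shows "\<phi> x = 0"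
proof (rule ccontr)
  assume "\<phi> x \<noteq> 0"
  then have "0 < \<phi> x" using solD(2)[OF s, of x] by simp
  then have pos: "0 < \<phi> y" for y using sol_pos[OF s] by blast
  note [measurable] = k_meas[OF j(1)] F_sol_meas[OF s j(1)] solD(6)[OF s]
  have "continuous_on {0..1} (\<lambda>y. F j (\<phi> y))" using F_sol_cont[OF s j(1)] continuous_on_subset by blast
  then have "\<exists>x\<in>{0..1::real}. \<forall>y\<in>{0..1}. F j (\<phi> x) \<le> F j (\<phi> y)"
    by (intro continuous_attains_inf) auto
  then obtain y0 where y0: "\<And>y. y \<in> {0..1::real} \<Longrightarrow> F j (\<phi> y0) \<le> F j (\<phi> y)"
    by blast
  define m where "m = F j (\<phi> y0)"
  have m: "0 < m" unfolding m_def using j(2) pos solD(3)[OF s] by blast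
  \<comment> \<open>The convolution is restricted to arguments in the unit interval, where the
    nonlinearity is at least \<open>m\<close>; there the kernel is moved back to \<open>x\<close> at
    the cost of \<open>H\<close>.\<close>
  have low: "m / H * k j x \<le> \<phi> x" for x
  proof -
    have int: "integrable lborel (\<lambda>u. k j (x - u) * F j (\<phi> u))"
      using lborel_integrable_real_affine[OF conv_int[OF s j(1), of x], of "-1" x] by simp
    have "m / H * k j x = (\<integral>u. (m / H * k j x) * indicator {0..1::real} u \<partial>lborel)" by simp
    also have "\<dots> \<le> (\<integral>u. k j (x - u) * F j (\<phi> u) \<partial>lborel)"
    proof (rule integral_mono[OF _ int])
      fix u
      show "(m / H * k j x) * indicator {0..1::real} u \<le> k j (x - u) * F j (\<phi> u)"
      proof (cases "u \<in> {0..1}")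
        case True
        have "k j x \<le> H * k j (x + - u)" using True by (intro harnack[OF j(1)]) auto
        then have "k j x / H \<le> k j (x - u)" using H_pos by (simp add: pos_divide_le_eq mult.commute)
        then have "k j x / H * m \<le> k j (x - u) * F j (\<phi> u)"
          using y0[OF True] m k_pos[OF j(1)] by (intro mult_mono) (auto simp: m_def less_imp_le)
        then show ?thesis using True by (simp add: mult.commute)
      next
        case False
        then show ?thesis using k_pos[OF j(1), of "x - u"] F_sol_nonneg[OF s j(1), of u] by simp
      qed
    qed simp
    also have "\<dots> = (\<integral>y. k j y * F j (\<phi> (x - y)) \<partial>lborel)" by (simp add: conv_swap[where h="\<lambda>u. F _ (\<phi> u)"])
    also have "\<dots> \<le> (\<Sum>i\<in>I. \<integral>y. k i y * F i (\<phi> (x - y)) \<partial>lborel)"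
      using finite_I j(1) F_sol_nonneg[OF s] k_pos
      by (intro member_le_sum) (auto intro!: Bochner_Integration.integral_nonneg mult_nonneg_nonneg intro: less_imp_le)
    also have "\<dots> = \<phi> x" using solD(5)[OF s, of x] by simp
    finally show ?thesis .
  qed
  have "ennreal (m / H) * (\<integral>\<^sup>+x. ennreal (k j x * exp (- (Z * x))) * indicator {..0} x \<partial>lborel) =
    (\<integral>\<^sup>+x. ennreal (m / H) * (ennreal (k j x * exp (- (Z * x))) * indicator {..0} x) \<partial>lborel)"
    by (rule nn_integral_cmult[symmetric]) measurable
  also have "\<dots> \<le> tail \<phi> Z"
    unfolding tail_def
  proof (rule nn_integral_mono)
    fix x
    have "m / H * k j x * exp (- (Z * x)) \<le> \<phi> x * exp (- (Z * x))" using low by (rule mult_right_mono) simp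
    then have "ennreal (m / H) * ennreal (k j x * exp (- (Z * x))) \<le> ennreal (\<phi> x * exp (- (Z * x)))"
      using m H_pos by (simp add: ennreal_mult'[symmetric] ennreal_leI mult.assoc)
    then show "ennreal (m / H) * (ennreal (k j x * exp (- (Z * x))) * indicator {..0} x) \<le>
      ennreal (\<phi> x * exp (- (Z * x))) * indicator {..0} x"
      by (simp add: indicator_def)
  qed
  also have "\<dots> < \<infinity>" by (rule tail_finite[OF s Z z])
  finally show False unfolding inf using m H_pos by (simp add: ennreal_mult_top)
qed

end

section \<open>Comparison of two solutions\<close>

lemma subexponential_bounded:
  fixes h :: "real \<Rightarrow> real"
  assumes "continuous_on UNIV h" "\<And>x. \<bar>h x\<bar> \<le> B"
  shows "subexponential h"
  unfolding subexponential_def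
proof (intro conjI allI impI exI)
  fix e x :: real assume "0 < e"
  moreover have "0 \<le> B" using assms(2)[of 0] by simp
  ultimately have "B * 1 \<le> B * exp (e * \<bar>x\<bar>)" by (intro mult_left_mono) auto
  then show "\<bar>h x\<bar> \<le> B * exp (e * \<bar>x\<bar>)" using assms(2)[of x] by simp
qed (rule assms)

text \<open>Here \<open>A i\<close> are Lipschitz constants on the whole range of solutions, at
  least as large as the slopes \<open>a i\<close> at 0. The inequality at \<open>\<mu>0\<close>
  translates a nonpositive value of \<open>\<chi>\<^sub>L\<close>, and \<open>n_mass\<close> a
  positive value of \<open>\<chi>\<^sub>0\<close> at 0. Convergence at
  \<open>\<gamma> > \<mu>0\<close> leaves room for exponents slightly beyond
  \<open>\<mu>0\<close>.\<close>

locale convolution_lipschitz = convolution_equation +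
  fixes A :: "'a \<Rightarrow> real" and \<gamma> \<mu>0 :: real
  assumes A_ge: "i \<in> I \<Longrightarrow> a i \<le> A i"
    and F_Lip: "i \<in> I \<Longrightarrow> 0 \<le> s \<Longrightarrow> s \<le> S \<Longrightarrow> 0 \<le> t \<Longrightarrow> t \<le> S \<Longrightarrow> \<bar>F i s - F i t\<bar> \<le> A i * \<bar>s - t\<bar>"
    and k_exp\<gamma>: "i \<in> I \<Longrightarrow> integrable lborel (\<lambda>x. k i x * exp (- (\<gamma> * x)))"
    and \<mu>0: "0 < \<mu>0" "\<mu>0 < \<gamma>" "(\<Sum>i\<in>I. A i * (\<integral>x. k i x * exp (- (\<mu>0 * x)) \<partial>lborel)) \<le> 1"
    and n_mass: "1 < (\<integral>x. n x \<partial>lborel)"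
begin

lemma \<gamma>_pos: "0 < \<gamma>" using \<mu>0 by simp

section \<open>Transforms of the kernels and their smallest critical exponent\<close>

definition khat :: "'a \<Rightarrow> real \<Rightarrow> real" where "khat i z = (\<integral>x. k i x * exp (- (z * x)) \<partial>lborel)"
definition nhat :: "real \<Rightarrow> real" where "nhat z = (\<integral>x. n x * exp (- (z * x)) \<partial>lborel)"

lemma exp_le_1_\<gamma>: "0 \<le> z \<Longrightarrow> z \<le> \<gamma> \<Longrightarrow> exp (- (z * x)) \<le> 1 + exp (- (\<gamma> * x))"
proof (cases "0 \<le> x")
  case True
  assume "0 \<le> z" "z \<le> \<gamma>"
  then have "exp (- (z * x)) \<le> 1" using True by simp
  then show ?thesis by (simp add: add_increasing2)
next
  case False
  assume "0 \<le> z" "z \<le> \<gamma>"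
  then have "\<gamma> * x \<le> z * x" using False by (intro mult_right_mono_neg) auto
  then have "exp (- (z * x)) \<le> exp (- (\<gamma> * x))" by simp
  then show ?thesis by linarith
qed

lemma k_exp:
  assumes "i \<in> I" "0 \<le> z" "z \<le> \<gamma>"
  shows "integrable lborel (\<lambda>x. k i x * exp (- (z * x)))"
proof (rule Bochner_Integration.integrable_bound)
  show "integrable lborel (\<lambda>x. k i x + k i x * exp (- (\<gamma> * x)))"
    using k_int k_exp\<gamma> assms(1) by auto
  note [measurable] = k_meas[OF assms(1)]
  show "(\<lambda>x. k i x * exp (- (z * x))) \<in> borel_measurable lborel" by measurable
  show "AE x in lborel. norm (k i x * exp (- (z * x))) \<le> norm (k i x + k i x * exp (- (\<gamma> * x)))"
  proof (intro AE_I2)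
    fix x
    have "k i x * exp (- (z * x)) \<le> k i x * (1 + exp (- (\<gamma> * x)))"
      using exp_le_1_\<gamma>[OF assms(2,3), of x] k_pos[OF assms(1), of x] by (intro mult_left_mono) auto
    then show "norm (k i x * exp (- (z * x))) \<le> norm (k i x + k i x * exp (- (\<gamma> * x)))"
      using k_pos[OF assms(1), of x] by (simp add: abs_mult distrib_left)
  qed
qed

lemma n_exp: "0 \<le> z \<Longrightarrow> z \<le> \<gamma> \<Longrightarrow> integrable lborel (\<lambda>x. n x * exp (- (z * x)))"
  unfolding n_def sum_distrib_right mult.assoc using k_exp by auto

lemma nhat_sum: "0 \<le> z \<Longrightarrow> z \<le> \<gamma> \<Longrightarrow> nhat z = (\<Sum>i\<in>I. a i * khat i z)"
  unfolding nhat_def khat_def n_def sum_distrib_right mult.assoc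
  by (subst Bochner_Integration.integral_sum) (use k_exp in auto)

lemma khat_pos:
  assumes "i \<in> I" "0 \<le> z" "z \<le> \<gamma>"
  shows "0 < khat i z"
proof (rule ccontr)
  assume "\<not> ?thesis"
  then have le: "(\<integral>x. k i x * exp (- (z * x)) \<partial>lborel) \<le> 0" by (simp add: khat_def)
  have "(1::real) = 0"
  proof (rule continuous_nonneg_integral_0[of "\<lambda>x. k i x * exp (- (z * x))" "\<lambda>_. 1"])
    fix R
    obtain c where c: "c > 0" "\<And>t. \<bar>t\<bar> \<le> R \<Longrightarrow> c \<le> k i t" using k_low[OF assms(1)] by blast
    have "c * exp (- (z * R)) \<le> k i t * exp (- (z * t))" if t: "\<bar>t\<bar> \<le> R" for t
    proof -
      have "z * t \<le> z * R" using t assms(2) by (intro mult_left_mono) auto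
      then show ?thesis using c(2)[OF t] c(1) by (intro mult_mono) auto
    qed
    then show "\<exists>c>0. \<forall>t. \<bar>t\<bar> \<le> R \<longrightarrow> c \<le> k i t * exp (- (z * t))"
      using c(1) by (intro exI[of _ "c * exp (- (z * R))"]) auto
  qed (use k_exp[OF assms] le k_pos[OF assms(1)] in \<open>auto intro: less_imp_le\<close>)
  then show False by simp
qed

lemma nhat_nn:
  assumes "0 \<le> z" "z \<le> \<gamma>"
  shows "(\<integral>\<^sup>+x. ennreal (n x * exp (- (z * x))) \<partial>lborel) = ennreal (nhat z)"
  unfolding nhat_def using n_exp[OF assms] less_imp_le[OF n_pos]
  by (intro nn_integral_eq_integral) auto

lemma nhat_cont: "continuous_on {0..\<gamma>} nhat"
  unfolding continuous_on_sequentially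
proof (intro ballI allI impI)
  fix X z assume z: "z \<in> {0..\<gamma>}" and X: "(\<forall>m. X m \<in> {0..\<gamma>}) \<and> X \<longlonglongrightarrow> z"
  have "(\<lambda>m. nhat (X m)) \<longlonglongrightarrow> nhat z"
    unfolding nhat_def
  proof (rule integral_dominated_convergence[where w="\<lambda>x. n x + n x * exp (- (\<gamma> * x))"])
    show "integrable lborel (\<lambda>x. n x + n x * exp (- (\<gamma> * x)))"
      using n_int n_exp[of \<gamma>] \<gamma>_pos by auto
    show "AE x in lborel. (\<lambda>m. n x * exp (- (X m * x))) \<longlonglongrightarrow> n x * exp (- (z * x))"
      using X by (intro AE_I2 tendsto_intros) auto
    show "AE x in lborel. norm (n x * exp (- (X m * x))) \<le> n x + n x * exp (- (\<gamma> * x))" for m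
    proof (intro AE_I2)
      fix x
      have "n x * exp (- (X m * x)) \<le> n x * (1 + exp (- (\<gamma> * x)))"
        using exp_le_1_\<gamma>[of "X m" x] X n_pos[of x] by (intro mult_left_mono) auto
      then show "norm (n x * exp (- (X m * x))) \<le> n x + n x * exp (- (\<gamma> * x))"
        using n_pos[of x] by (simp add: abs_mult distrib_left)
    qed
  qed auto
  then show "(nhat \<circ> X) \<longlonglongrightarrow> nhat z" by (simp add: o_def)
qed

lemma nhat_convex:
  assumes "0 \<le> x" "x \<le> \<gamma>" "0 \<le> y" "y \<le> \<gamma>" "0 \<le> t" "t \<le> 1"
  shows "nhat ((1 - t) * x + t * y) \<le> (1 - t) * nhat x + t * nhat y"
proof -
  have m: "0 \<le> (1 - t) * x + t * y" "(1 - t) * x + t * y \<le> \<gamma>"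
    using assms by (auto intro: convex_bound_le)
  have "nhat ((1 - t) * x + t * y) \<le> (\<integral>u. (1 - t) * (n u * exp (- (x * u))) + t * (n u * exp (- (y * u))) \<partial>lborel)"
    unfolding nhat_def
  proof (rule integral_mono[OF n_exp[OF m]])
    show "integrable lborel (\<lambda>u. (1 - t) * (n u * exp (- (x * u))) + t * (n u * exp (- (y * u))))"
      using n_exp assms by auto
    fix u
    have "exp ((1 - t) *\<^sub>R (- (x * u)) + t *\<^sub>R (- (y * u))) \<le> (1 - t) * exp (- (x * u)) + t * exp (- (y * u))"
      using assms by (intro convex_onD[OF exp_convex]) auto
    then have "n u * exp (- (((1 - t) * x + t * y) * u)) \<le> n u * ((1 - t) * exp (- (x * u)) + t * exp (- (y * u)))"
      using n_pos[of u] by (intro mult_left_mono) (auto simp: algebra_simps)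
    then show "n u * exp (- (((1 - t) * x + t * y) * u)) \<le> (1 - t) * (n u * exp (- (x * u))) + t * (n u * exp (- (y * u)))"
      by (simp add: algebra_simps)
  qed
  also have "\<dots> = (1 - t) * nhat x + t * nhat y"
    unfolding nhat_def using n_exp assms by simp
  finally show ?thesis .
qed

lemma nhat_\<mu>0: "nhat \<mu>0 \<le> 1"
proof -
  have "nhat \<mu>0 = (\<Sum>i\<in>I. a i * khat i \<mu>0)" using \<mu>0 by (intro nhat_sum) auto
  also have "\<dots> \<le> (\<Sum>i\<in>I. A i * khat i \<mu>0)"
    using A_ge khat_pos \<mu>0 by (intro sum_mono mult_right_mono) (auto intro: less_imp_le)
  also have "\<dots> \<le> 1" using \<mu>0(3) by (simp add: khat_def)
  finally show ?thesis .
qed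

text \<open>The exponents up to \<open>\<mu>0\<close> whose transform is at most 1 form a compact
  set containing \<open>\<mu>0\<close> but not 0; its least element is the root, by the intermediate
  value theorem.\<close>

lemma smallest_root:
  obtains \<rho> where "0 < \<rho>" "\<rho> \<le> \<mu>0" "nhat \<rho> = 1" "\<And>z. 0 \<le> z \<Longrightarrow> z < \<rho> \<Longrightarrow> 1 < nhat z"
proof -
  have c: "continuous_on {0..\<mu>0} nhat" using nhat_cont \<mu>0 by (auto intro: continuous_on_subset)
  have n0: "1 < nhat 0" using n_mass by (simp add: nhat_def)
  define Z where "Z = {0..\<mu>0} \<inter> nhat -` {..1}"
  have "compact Z" unfolding Z_def compact_eq_bounded_closed
    using continuous_closed_preimage[OF c closed_atLeastAtMost closed_atMost]
      bounded_subset[OF bounded_closed_interval Int_lower1] by blast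
  moreover have "\<mu>0 \<in> Z" using nhat_\<mu>0 \<mu>0 by (simp add: Z_def)
  ultimately obtain \<rho> where \<rho>: "\<rho> \<in> Z" "\<And>z. z \<in> Z \<Longrightarrow> \<rho> \<le> z"
    using continuous_attains_inf[of Z "\<lambda>z. z"] by auto
  have r: "0 \<le> \<rho>" "\<rho> \<le> \<mu>0" "nhat \<rho> \<le> 1" using \<rho>(1) by (auto simp: Z_def)
  have p: "1 < nhat z" if "0 \<le> z" "z < \<rho>" for z
    using \<rho>(2)[of z] that r by (force simp: Z_def)
  have "nhat \<rho> = 1"
  proof -
    have "continuous_on {0..\<rho>} nhat" using c r by (auto intro: continuous_on_subset)
    then obtain z where z: "0 \<le> z" "z \<le> \<rho>" "nhat z = 1"
      using IVT2'[of nhat \<rho> 1 0] r n0 by auto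
    then show ?thesis using p[of z] by (cases "z = \<rho>") auto
  qed
  moreover have "\<rho> \<noteq> 0" using n0 r by auto
  ultimately show ?thesis using r p that[of \<rho>] by auto
qed

section \<open>Maximum principle and barrier for the difference of two solutions\<close>

lemma difference_bound:
  assumes s1: "sol \<phi>1" and s2: "sol \<phi>2"
  shows "\<bar>\<phi>1 x - \<phi>2 x\<bar> \<le> (\<Sum>i\<in>I. \<integral>y. k i y * \<bar>F i (\<phi>1 (x - y)) - F i (\<phi>2 (x - y))\<bar> \<partial>lborel)"
proof -
  have "\<phi>1 x - \<phi>2 x = (\<Sum>i\<in>I. (\<integral>y. k i y * F i (\<phi>1 (x - y)) \<partial>lborel) - (\<integral>y. k i y * F i (\<phi>2 (x - y)) \<partial>lborel))"
    unfolding sum_subtractf by (rule arg_cong2[where f="(-)"]) (use solD(5)[OF s1, of x] solD(5)[OF s2, of x] in auto)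
  also have "\<dots> = (\<Sum>i\<in>I. \<integral>y. k i y * (F i (\<phi>1 (x - y)) - F i (\<phi>2 (x - y))) \<partial>lborel)"
    using conv_int[OF s1] conv_int[OF s2] by (intro sum.cong) (simp_all add: right_diff_distrib)
  also have "\<bar>\<dots>\<bar> \<le> (\<Sum>i\<in>I. \<bar>\<integral>y. k i y * (F i (\<phi>1 (x - y)) - F i (\<phi>2 (x - y))) \<partial>lborel\<bar>)" by (rule sum_abs)
  also have "\<dots> \<le> (\<Sum>i\<in>I. \<integral>y. k i y * \<bar>F i (\<phi>1 (x - y)) - F i (\<phi>2 (x - y))\<bar> \<partial>lborel)"
  proof (rule sum_mono)
    fix i assume i: "i \<in> I"
    have "(\<lambda>y. \<bar>k i y * (F i (\<phi>1 (x - y)) - F i (\<phi>2 (x - y)))\<bar>) = (\<lambda>y. k i y * \<bar>F i (\<phi>1 (x - y)) - F i (\<phi>2 (x - y))\<bar>)"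
      using k_pos[OF i] by (auto simp: abs_mult less_imp_le)
    then show "\<bar>\<integral>y. k i y * (F i (\<phi>1 (x - y)) - F i (\<phi>2 (x - y))) \<partial>lborel\<bar> \<le>
      (\<integral>y. k i y * \<bar>F i (\<phi>1 (x - y)) - F i (\<phi>2 (x - y))\<bar> \<partial>lborel)"
      using integral_abs_bound[of lborel "\<lambda>y. k i y * (F i (\<phi>1 (x - y)) - F i (\<phi>2 (x - y)))"] by simp
  qed
  finally show ?thesis .
qed

lemma difference_le_S:
  assumes "sol \<phi>1" "sol \<phi>2"
  shows "\<bar>\<phi>1 x - \<phi>2 x\<bar> \<le> S"
  using solD(2,3)[OF assms(1), of x] solD(2,3)[OF assms(2), of x] by (simp add: abs_le_iff)

lemma difference_cont:
  assumes "sol \<phi>1" "sol \<phi>2"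
  shows "continuous_on UNIV (\<lambda>x. \<bar>\<phi>1 x - \<phi>2 x\<bar> * exp (- (\<mu> * x)))"
  using solD(1)[OF assms(1)] solD(1)[OF assms(2)] by (intro continuous_intros)

lemma k_diff_int:
  assumes s: "sol \<phi>1" "sol \<phi>2" and i: "i \<in> I"
  shows "integrable lborel (\<lambda>y. k i y * \<bar>\<phi>1 (x - y) - \<phi>2 (x - y)\<bar>)"
proof -
  note [measurable] = solD(6)[OF s(1)] solD(6)[OF s(2)]
  show ?thesis
    by (rule integrable_mult_bounded[OF k_int[OF i], where B=S]) (use difference_le_S[OF s] in auto)
qed

lemma k_Fdiff_int:
  assumes s: "sol \<phi>1" "sol \<phi>2" and i: "i \<in> I"
  shows "integrable lborel (\<lambda>y. k i y * \<bar>F i (\<phi>1 (x - y)) - F i (\<phi>2 (x - y))\<bar>)"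
proof -
  have "integrable lborel (\<lambda>y. \<bar>k i y * F i (\<phi>1 (x - y)) - k i y * F i (\<phi>2 (x - y))\<bar>)"
    using conv_int[OF s(1) i] conv_int[OF s(2) i] by auto
  moreover have "(\<lambda>y. \<bar>k i y * F i (\<phi>1 (x - y)) - k i y * F i (\<phi>2 (x - y))\<bar>) =
    (\<lambda>y. k i y * \<bar>F i (\<phi>1 (x - y)) - F i (\<phi>2 (x - y))\<bar>)"
    using k_pos[OF i] by (auto simp: abs_mult less_imp_le right_diff_distrib[symmetric])
  ultimately show ?thesis by simp
qed

text \<open>The weight at \<open>x\<close> is the product of the weights at \<open>y\<close> and at
  \<open>x - y\<close>, so the Lipschitz bound for the difference becomes a convolution inequality
  with exponentially tilted kernels.\<close>

lemma tilted_difference: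
  assumes s1: "sol \<phi>1" and s2: "sol \<phi>2"
  defines "\<omega> \<equiv> \<lambda>\<mu> x. \<bar>\<phi>1 x - \<phi>2 x\<bar> * exp (- (\<mu> * x))"
  shows "\<omega> \<mu> x \<le> (\<Sum>i\<in>I. A i * (\<integral>y. (k i y * exp (- (\<mu> * y))) * \<omega> \<mu> (x - y) \<partial>lborel))"
proof -
  have "\<omega> \<mu> x \<le> (\<Sum>i\<in>I. \<integral>y. k i y * \<bar>F i (\<phi>1 (x - y)) - F i (\<phi>2 (x - y))\<bar> \<partial>lborel) * exp (- (\<mu> * x))"
    unfolding \<omega>_def by (intro mult_right_mono difference_bound s1 s2) auto
  also have "\<dots> \<le> (\<Sum>i\<in>I. A i * (\<integral>y. k i y * \<bar>\<phi>1 (x - y) - \<phi>2 (x - y)\<bar> \<partial>lborel)) * exp (- (\<mu> * x))"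
  proof (intro mult_right_mono sum_mono)
    fix i assume i: "i \<in> I"
    have "(\<integral>y. k i y * \<bar>F i (\<phi>1 (x - y)) - F i (\<phi>2 (x - y))\<bar> \<partial>lborel) \<le> (\<integral>y. A i * (k i y * \<bar>\<phi>1 (x - y) - \<phi>2 (x - y)\<bar>) \<partial>lborel)"
    proof (rule integral_mono[OF k_Fdiff_int[OF s1 s2 i]])
      show "integrable lborel (\<lambda>y. A i * (k i y * \<bar>\<phi>1 (x - y) - \<phi>2 (x - y)\<bar>))"
        using k_diff_int[OF s1 s2 i] by simp
      fix y
      have "\<bar>F i (\<phi>1 (x - y)) - F i (\<phi>2 (x - y))\<bar> \<le> A i * \<bar>\<phi>1 (x - y) - \<phi>2 (x - y)\<bar>"
        using solD(2,3)[OF s1] solD(2,3)[OF s2] by (intro F_Lip[OF i]) auto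
      then have "k i y * \<bar>F i (\<phi>1 (x - y)) - F i (\<phi>2 (x - y))\<bar> \<le> k i y * (A i * \<bar>\<phi>1 (x - y) - \<phi>2 (x - y)\<bar>)"
        using k_pos[OF i] by (intro mult_left_mono) (auto intro: less_imp_le)
      then show "k i y * \<bar>F i (\<phi>1 (x - y)) - F i (\<phi>2 (x - y))\<bar> \<le> A i * (k i y * \<bar>\<phi>1 (x - y) - \<phi>2 (x - y)\<bar>)"
        by (simp add: mult.left_commute)
    qed
    then show "(\<integral>y. k i y * \<bar>F i (\<phi>1 (x - y)) - F i (\<phi>2 (x - y))\<bar> \<partial>lborel) \<le> A i * (\<integral>y. k i y * \<bar>\<phi>1 (x - y) - \<phi>2 (x - y)\<bar> \<partial>lborel)"
      by simp
  qed simp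
  also have "\<dots> = (\<Sum>i\<in>I. A i * (\<integral>y. (k i y * exp (- (\<mu> * y))) * \<omega> \<mu> (x - y) \<partial>lborel))"
    unfolding sum_distrib_right
  proof (rule sum.cong)
    fix i
    have "A i * (\<integral>y. k i y * \<bar>\<phi>1 (x - y) - \<phi>2 (x - y)\<bar> \<partial>lborel) * exp (- (\<mu> * x)) =
      A i * (\<integral>y. (k i y * \<bar>\<phi>1 (x - y) - \<phi>2 (x - y)\<bar>) * exp (- (\<mu> * x)) \<partial>lborel)" by simp
    also have "(\<integral>y. (k i y * \<bar>\<phi>1 (x - y) - \<phi>2 (x - y)\<bar>) * exp (- (\<mu> * x)) \<partial>lborel) =
      (\<integral>y. (k i y * exp (- (\<mu> * y))) * \<omega> \<mu> (x - y) \<partial>lborel)"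
    proof (rule Bochner_Integration.integral_cong)
      fix y
      have "exp (- (\<mu> * x)) = exp (- (\<mu> * y)) * exp (- (\<mu> * (x - y)))" by (simp add: mult_exp_exp algebra_simps)
      then show "k i y * \<bar>\<phi>1 (x - y) - \<phi>2 (x - y)\<bar> * exp (- (\<mu> * x)) = k i y * exp (- (\<mu> * y)) * \<omega> \<mu> (x - y)"
        unfolding \<omega>_def by (simp only: mult_ac)
    qed simp
    finally show "A i * (\<integral>y. k i y * \<bar>\<phi>1 (x - y) - \<phi>2 (x - y)\<bar> \<partial>lborel) * exp (- (\<mu> * x)) =
      A i * (\<integral>y. (k i y * exp (- (\<mu> * y))) * \<omega> \<mu> (x - y) \<partial>lborel)" .
  qed simp
  finally show ?thesis .
qed

text \<open>With total tilted mass at most 1, the weighted difference is bounded by an average of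
  itself, so it cannot have a positive maximum unless it is constant, and a constant contradicts its
  limit 0 at +infinity. The decay assumption at -infinity is what makes the maximum exist.\<close>

lemma unique_of_fast_decay:
  assumes s1: "sol \<phi>1" and s2: "sol \<phi>2"
    and \<mu>: "0 < \<mu>" "\<mu> \<le> \<gamma>" "(\<Sum>i\<in>I. A i * khat i \<mu>) \<le> 1"
    and bot: "((\<lambda>x. \<bar>\<phi>1 x - \<phi>2 x\<bar> * exp (- (\<mu> * x))) \<longlongrightarrow> 0) at_bot"
  shows "\<phi>1 x = \<phi>2 x"
proof (rule ccontr)
  assume neq: "\<phi>1 x \<noteq> \<phi>2 x"
  define \<omega> where "\<omega> x = \<bar>\<phi>1 x - \<phi>2 x\<bar> * exp (- (\<mu> * x))" for x
  have c\<omega>: "continuous_on UNIV \<omega>" unfolding \<omega>_def by (rule difference_cont[OF s1 s2])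
  have \<omega>0: "0 \<le> \<omega> x" for x by (simp add: \<omega>_def)
  have top: "(\<omega> \<longlongrightarrow> 0) at_top"
  proof (rule tendsto_sandwich[OF _ _ tendsto_const])
    show "((\<lambda>x. S * exp (- (\<mu> * x))) \<longlongrightarrow> 0) at_top"
      by (rule tendsto_mult_right_zero[OF tendsto_exp_neg_at_top[OF \<mu>(1)]])
    show "\<forall>\<^sub>F x in at_top. \<omega> x \<le> S * exp (- (\<mu> * x))"
      unfolding \<omega>_def using difference_le_S[OF s1 s2] by (intro always_eventually allI mult_right_mono) auto
  qed (use \<omega>0 in auto)
  have bot': "(\<omega> \<longlongrightarrow> 0) at_bot" using bot by (simp add: \<omega>_def[abs_def])
  have pos: "0 < \<omega> x" using neq by (simp add: \<omega>_def)
  obtain x0 where x0: "\<And>x. \<omega> x \<le> \<omega> x0" "\<omega> x \<le> \<omega> x0"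
    using vanishing_attains_max[OF c\<omega> bot' top pos] by blast
  define M where "M y = (\<Sum>i\<in>I. A i * (k i y * exp (- (\<mu> * y))))" for y
  have kint: "i \<in> I \<Longrightarrow> integrable lborel (\<lambda>y. k i y * exp (- (\<mu> * y)))" for i
    using k_exp \<mu> by simp
  have A0: "i \<in> I \<Longrightarrow> 0 < A i" for i using A_ge a_pos by (meson less_le_trans)
  have [measurable]: "\<omega> \<in> borel_measurable borel" using c\<omega> by (rule borel_measurable_continuous_onI)
  have kwint: "i \<in> I \<Longrightarrow> integrable lborel (\<lambda>y. (k i y * exp (- (\<mu> * y))) * \<omega> (x0 - y))" for i
    by (rule integrable_mult_bounded[OF kint, where B="\<omega> x0"]) (use \<omega>0 x0 in auto)
  have Mint: "integrable lborel M" unfolding M_def using kint by auto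
  have Mwint: "integrable lborel (\<lambda>y. M y * \<omega> (x0 - y))"
    unfolding M_def sum_distrib_right using kwint by (auto simp: mult.assoc)
  have "(\<integral>y. M y \<partial>lborel) = (\<Sum>i\<in>I. A i * khat i \<mu>)"
    unfolding M_def khat_def using kint by simp
  then have Mle: "(\<integral>y. M y \<partial>lborel) \<le> 1" using \<mu>(3) by simp
  have "\<omega> x0 \<le> (\<Sum>i\<in>I. A i * (\<integral>y. (k i y * exp (- (\<mu> * y))) * \<omega> (x0 - y) \<partial>lborel))"
    unfolding \<omega>_def by (rule tilted_difference[OF s1 s2])
  also have "\<dots> = (\<integral>y. M y * \<omega> (x0 - y) \<partial>lborel)"
    unfolding M_def sum_distrib_right using kwint by (simp add: mult.assoc)
  finally have le: "\<omega> x0 \<le> (\<integral>y. M y * \<omega> (x0 - y) \<partial>lborel)" .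
  \<comment> \<open>Equality in the averaging inequality: the nonnegative deficit has nonpositive
    integral against a kernel that is bounded below on bounded intervals.\<close>
  have e: "\<omega> x0 - \<omega> (x0 - y) = 0" for y
  proof (rule continuous_nonneg_integral_0[of M "\<lambda>y. \<omega> x0 - \<omega> (x0 - y)"])
    show "0 \<le> M t" for t unfolding M_def using A0 k_pos by (intro sum_nonneg) (auto intro: less_imp_le)
    fix R
    obtain c where c: "c > 0" "\<And>t. \<bar>t\<bar> \<le> R \<Longrightarrow> c \<le> n t" using n_low by blast
    have "c * exp (- (\<mu> * R)) \<le> M t" if t: "\<bar>t\<bar> \<le> R" for t
    proof -
      have "\<mu> * t \<le> \<mu> * R" using t \<mu>(1) by (intro mult_left_mono) auto
      then have "c * exp (- (\<mu> * R)) \<le> n t * exp (- (\<mu> * t))" using c(2)[OF t] c(1) by (intro mult_mono) auto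
      also have "\<dots> = (\<Sum>i\<in>I. a i * (k i t * exp (- (\<mu> * t))))" by (simp add: n_def sum_distrib_right mult.assoc)
      also have "\<dots> \<le> M t" unfolding M_def using A_ge k_pos
        by (intro sum_mono mult_right_mono) (auto intro: less_imp_le)
      finally show ?thesis .
    qed
    then show "\<exists>c>0. \<forall>t. \<bar>t\<bar> \<le> R \<longrightarrow> c \<le> M t"
      using c(1) by (intro exI[of _ "c * exp (- (\<mu> * R))"]) auto
  next
    show "continuous_on UNIV (\<lambda>y. \<omega> x0 - \<omega> (x0 - y))"
      by (intro continuous_intros continuous_on_compose2[OF c\<omega>]) auto
    show "0 \<le> \<omega> x0 - \<omega> (x0 - t)" for t using x0(1) by simp
    show "integrable lborel (\<lambda>t. M t * (\<omega> x0 - \<omega> (x0 - t)))"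
      using Mint Mwint by (simp add: right_diff_distrib)
    have "(\<integral>t. M t * (\<omega> x0 - \<omega> (x0 - t)) \<partial>lborel) = (\<integral>t. M t \<partial>lborel) * \<omega> x0 - (\<integral>t. M t * \<omega> (x0 - t) \<partial>lborel)"
      using Mint Mwint by (simp add: right_diff_distrib)
    moreover have "(\<integral>t. M t \<partial>lborel) * \<omega> x0 \<le> 1 * \<omega> x0" using Mle \<omega>0 by (rule mult_right_mono)
    ultimately show "(\<integral>t. M t * (\<omega> x0 - \<omega> (x0 - t)) \<partial>lborel) \<le> 0" using le by simp
  qed
  have "\<omega> u = \<omega> x0" for u using e[of "x0 - u"] by simp
  then have "\<omega> = (\<lambda>_. \<omega> x0)" by (rule ext)
  then have "((\<lambda>_::real. \<omega> x0) \<longlongrightarrow> 0) at_top" using top by metis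
  then have "\<omega> x0 = 0" by (simp add: tendsto_const_iff)
  then show False using pos x0(2) by simp
qed

text \<open>Decay of the difference improves to the rate \<kappa>, even across exponents where only
  the linearization, and not the Lipschitz bound, has mass below 1. The comparison function adds to
  exp (\<kappa> x) a small multiple of exp (\<open>\<kappa>2\<close> x), which dominates the
  difference at -infinity because \<open>\<kappa>2 < \<kappa>1\<close>.\<close>

lemma barrier:
  assumes s1: "sol \<phi>1" and s2: "sol \<phi>2"
    and init: "\<And>x. \<bar>\<phi>1 x - \<phi>2 x\<bar> \<le> B0 * exp (\<kappa>1 * x)"
    and \<kappa>: "0 \<le> \<kappa>2" "\<kappa>2 < \<kappa>1" "\<kappa>2 \<le> \<kappa>" "0 < \<kappa>" "\<kappa> \<le> \<gamma>" "nhat \<kappa> < 1" "nhat \<kappa>2 < 1"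
  obtains B where "\<And>x. \<bar>\<phi>1 x - \<phi>2 x\<bar> \<le> B * exp (\<kappa> * x)"
proof -
  define w where "w x = \<bar>\<phi>1 x - \<phi>2 x\<bar>" for x
  have w0: "0 \<le> w x" for x by (simp add: w_def)
  have wS: "w x \<le> S" for x unfolding w_def by (rule difference_le_S[OF s1 s2])
  have cw: "continuous_on UNIV w" unfolding w_def using solD(1)[OF s1] solD(1)[OF s2] by (intro continuous_intros)
  note [measurable] = borel_measurable_continuous_onI[OF cw]
  define m where "m = max 0 (max (nhat \<kappa>) (nhat \<kappa>2))"
  have m: "0 \<le> m" "m < 1" "nhat \<kappa> \<le> m" "nhat \<kappa>2 \<le> m" using \<kappa> by (auto simp: m_def)
  \<comment> \<open>Solves \<open>(1 + e) * m = 1 - e\<close>: the linearization may be enlarged by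
    the relative error \<open>e\<close>, and a gain of the same size \<open>e\<close>
    remains.\<close>
  define e where "e = (1 - m) / (1 + m)"
  have e: "0 < e" using m by (simp add: e_def)
  have em: "(1 + e) * m = 1 - e" using m by (simp add: e_def field_simps)
  obtain s0 where s0: "0 < s0" "s0 \<le> S" "\<And>i s. i \<in> I \<Longrightarrow> 0 \<le> s \<Longrightarrow> s \<le> s0 \<Longrightarrow> C * s powr \<theta> \<le> e * a i"
    using small_nonlinearity[OF e] by blast
  obtain X1 where X1: "\<And>x. x \<le> X1 \<Longrightarrow> \<phi>1 x < s0"
    using order_tendstoD(2)[OF solD(4)[OF s1] s0(1)] by (auto simp: eventually_at_bot_linorder)
  obtain X2 where X2: "\<And>x. x \<le> X2 \<Longrightarrow> \<phi>2 x < s0"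
    using order_tendstoD(2)[OF solD(4)[OF s2] s0(1)] by (auto simp: eventually_at_bot_linorder)
  define X where "X = min X1 X2"
  \<comment> \<open>Makes \<open>D * exp (\<kappa> * u)\<close> at least \<open>S\<close> to the
    right of \<open>X\<close>, so the region where linearization fails contributes only an
    inhomogeneous term of the desired rate.\<close>
  define D where "D = S * exp (- (\<kappa> * X))"
  have D: "0 < D" using S_pos by (simp add: D_def)
  have A0: "i \<in> I \<Longrightarrow> 0 < A i" for i using A_ge a_pos by (meson less_le_trans)
  have Fd: "\<bar>F i (\<phi>1 u) - F i (\<phi>2 u)\<bar> \<le> (1 + e) * a i * w u + A i * D * exp (\<kappa> * u)" if i: "i \<in> I" for i u
  proof (cases "u \<le> X")
    case True
    then have mx: "max (\<phi>1 u) (\<phi>2 u) \<le> s0" using X1[of u] X2[of u] by (simp add: X_def)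
    have "\<bar>F i (\<phi>1 u) - F i (\<phi>2 u) - a i * (\<phi>1 u - \<phi>2 u)\<bar> \<le> C * (max (\<phi>1 u) (\<phi>2 u) powr \<theta>) * w u"
      unfolding w_def using solD(2,3)[OF s1] solD(2,3)[OF s2] by (intro F_lin[OF i]) auto
    also have "\<dots> \<le> e * a i * w u"
      using mx solD(2)[OF s1] w0 by (intro mult_right_mono s0(3)[OF i]) (auto simp: le_max_iff_disj)
    finally have 1: "\<bar>F i (\<phi>1 u) - F i (\<phi>2 u) - a i * (\<phi>1 u - \<phi>2 u)\<bar> \<le> e * a i * w u" .
    have 2: "\<bar>a i * (\<phi>1 u - \<phi>2 u)\<bar> = a i * w u" using a_pos[OF i] by (simp add: w_def abs_mult)
    have 3: "0 \<le> A i * D * exp (\<kappa> * u)" using A0[OF i] D by simp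
    have 4: "(1 + e) * a i * w u = a i * w u + e * a i * w u" by (simp add: algebra_simps)
    show ?thesis unfolding 4 using 1 2 3 by linarith
  next
    case False
    have "\<bar>F i (\<phi>1 u) - F i (\<phi>2 u)\<bar> \<le> A i * w u"
      unfolding w_def using solD(2,3)[OF s1] solD(2,3)[OF s2] by (intro F_Lip[OF i]) auto
    also have "\<dots> \<le> A i * (D * exp (\<kappa> * u))"
    proof (rule mult_left_mono)
      have "\<kappa> * X \<le> \<kappa> * u" using False \<kappa> by (intro mult_left_mono) auto
      then have "S * 1 \<le> S * exp (- (\<kappa> * X) + \<kappa> * u)" using S_pos by (intro mult_left_mono) auto
      also have "\<dots> = D * exp (\<kappa> * u)" by (simp only: D_def exp_add mult.assoc)
      finally show "w u \<le> D * exp (\<kappa> * u)" using wS[of u] by simp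
    qed (use A0[OF i] in simp)
    also have "\<dots> \<le> (1 + e) * a i * w u + A i * D * exp (\<kappa> * u)"
      using a_pos[OF i] w0[of u] e by (simp add: mult.assoc)
    finally show ?thesis .
  qed
  define D1 where "D1 = D * (\<Sum>i\<in>I. A i * khat i \<kappa>)"
  have D1: "0 \<le> D1" unfolding D1_def using D A0 khat_pos \<kappa>
    by (intro mult_nonneg_nonneg sum_nonneg) (auto intro: less_imp_le)
  have nw_int: "integrable lborel (\<lambda>y. n y * w (x - y))" for x
    by (rule integrable_mult_bounded[OF n_int, where B=S]) (use w0 wS in auto)
  have main: "w x \<le> (1 + e) * (\<integral>y. n y * w (x - y) \<partial>lborel) + D1 * exp (\<kappa> * x)" for x
  proof -
    have "w x \<le> (\<Sum>i\<in>I. \<integral>y. k i y * \<bar>F i (\<phi>1 (x - y)) - F i (\<phi>2 (x - y))\<bar> \<partial>lborel)"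
      unfolding w_def by (rule difference_bound[OF s1 s2])
    also have "\<dots> \<le> (\<Sum>i\<in>I. (1 + e) * (a i * (\<integral>y. k i y * w (x - y) \<partial>lborel)) + D * (A i * khat i \<kappa>) * exp (\<kappa> * x))"
    proof (rule sum_mono)
      fix i assume i: "i \<in> I"
      have ki: "integrable lborel (\<lambda>y. k i y * w (x - y))" unfolding w_def by (rule k_diff_int[OF s1 s2 i])
      have kk: "integrable lborel (\<lambda>y. k i y * exp (- (\<kappa> * y)))" using k_exp[OF i] \<kappa> by simp
      have "(\<integral>y. k i y * \<bar>F i (\<phi>1 (x - y)) - F i (\<phi>2 (x - y))\<bar> \<partial>lborel) \<le>
        (\<integral>y. (1 + e) * a i * (k i y * w (x - y)) + A i * D * exp (\<kappa> * x) * (k i y * exp (- (\<kappa> * y))) \<partial>lborel)"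
      proof (rule integral_mono[OF k_Fdiff_int[OF s1 s2 i]])
        show "integrable lborel (\<lambda>y. (1 + e) * a i * (k i y * w (x - y)) + A i * D * exp (\<kappa> * x) * (k i y * exp (- (\<kappa> * y))))"
          using ki kk by (intro Bochner_Integration.integrable_add integrable_mult_right) auto
        fix y
        have "k i y * \<bar>F i (\<phi>1 (x - y)) - F i (\<phi>2 (x - y))\<bar> \<le> k i y * ((1 + e) * a i * w (x - y) + A i * D * exp (\<kappa> * (x - y)))"
          using Fd[OF i, of "x - y"] k_pos[OF i, of y] by (intro mult_left_mono) auto
        also have "exp (\<kappa> * (x - y)) = exp (\<kappa> * x) * exp (- (\<kappa> * y))" by (simp add: mult_exp_exp algebra_simps)
        also have "k i y * ((1 + e) * a i * w (x - y) + A i * D * (exp (\<kappa> * x) * exp (- (\<kappa> * y)))) =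
          (1 + e) * a i * (k i y * w (x - y)) + A i * D * exp (\<kappa> * x) * (k i y * exp (- (\<kappa> * y)))"
          by (simp only: distrib_left mult_ac)
        finally show "k i y * \<bar>F i (\<phi>1 (x - y)) - F i (\<phi>2 (x - y))\<bar> \<le>
          (1 + e) * a i * (k i y * w (x - y)) + A i * D * exp (\<kappa> * x) * (k i y * exp (- (\<kappa> * y)))" .
      qed
      also have "\<dots> = (1 + e) * a i * (\<integral>y. k i y * w (x - y) \<partial>lborel) + A i * D * exp (\<kappa> * x) * khat i \<kappa>"
        unfolding khat_def using ki kk by simp
      also have "\<dots> = (1 + e) * (a i * (\<integral>y. k i y * w (x - y) \<partial>lborel)) + D * (A i * khat i \<kappa>) * exp (\<kappa> * x)"
        by (simp only: mult_ac)
      finally show "(\<integral>y. k i y * \<bar>F i (\<phi>1 (x - y)) - F i (\<phi>2 (x - y))\<bar> \<partial>lborel) \<le>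
        (1 + e) * (a i * (\<integral>y. k i y * w (x - y) \<partial>lborel)) + D * (A i * khat i \<kappa>) * exp (\<kappa> * x)" .
    qed
    also have "\<dots> = (1 + e) * (\<Sum>i\<in>I. a i * (\<integral>y. k i y * w (x - y) \<partial>lborel)) + D1 * exp (\<kappa> * x)"
      by (simp only: sum.distrib sum_distrib_left sum_distrib_right D1_def)
    also have "(\<Sum>i\<in>I. a i * (\<integral>y. k i y * w (x - y) \<partial>lborel)) = (\<integral>y. n y * w (x - y) \<partial>lborel)"
      unfolding n_def sum_distrib_right mult.assoc
      by (subst Bochner_Integration.integral_sum) (use k_diff_int[OF s1 s2] in \<open>auto simp: w_def\<close>)
    finally show ?thesis .
  qed
  \<comment> \<open>With \<open>D1 < e * B\<close> the inhomogeneous term cannot sustain a ratio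
    above 1: at its maximum the loss \<open>e\<close> outweighs \<open>D1\<close>.\<close>
  define B where "B = D1 / e + 1"
  have B: "0 < B" "D1 < e * B" using D1 e by (auto simp: B_def add_nonneg_pos distrib_left)
  have bound: "w x \<le> B * exp (\<kappa> * x) + p * exp (\<kappa>2 * x)" if p: "0 < p" for p x
  proof (rule ccontr)
    assume neg: "\<not> ?thesis"
    \<comment> \<open>The first summand makes the ratio vanish at +infinity, the second at
      -infinity; \<open>p\<close> tends to 0 once the bound is proved.\<close>
    define b where "b x = B * exp (\<kappa> * x) + p * exp (\<kappa>2 * x)" for x
    have b1: "B * exp (\<kappa> * x) \<le> b x" "p * exp (\<kappa>2 * x) \<le> b x" "0 < b x" for x
      using B p by (auto simp: b_def intro: add_pos_pos)
    define r where "r x = w x / b x" for x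
    have cb: "continuous_on UNIV b" unfolding b_def by (intro continuous_intros)
    have cr: "continuous_on UNIV r" unfolding r_def
      by (intro continuous_intros cw cb) (use b1(3) in \<open>auto simp: less_imp_neq[symmetric]\<close>)
    have r0: "0 \<le> r x" for x using w0 b1(3)[of x] by (simp add: r_def)
    have rbot: "(r \<longlongrightarrow> 0) at_bot"
    proof (rule tendsto_sandwich[OF _ _ tendsto_const])
      show "((\<lambda>x. B0 / p * exp ((\<kappa>1 - \<kappa>2) * x)) \<longlongrightarrow> 0) at_bot"
        using \<kappa> by (intro tendsto_mult_right_zero[OF tendsto_exp_at_bot]) auto
      show "\<forall>\<^sub>F x in at_bot. r x \<le> B0 / p * exp ((\<kappa>1 - \<kappa>2) * x)"
      proof (intro always_eventually allI)
        fix x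
        have "r x \<le> (B0 * exp (\<kappa>1 * x)) / (p * exp (\<kappa>2 * x))"
          unfolding r_def using init[of x] b1[of x] p w0[of x] by (intro frac_le) (auto simp: w_def)
        also have "\<dots> = B0 / p * (exp (\<kappa>1 * x) / exp (\<kappa>2 * x))" by simp
        also have "exp (\<kappa>1 * x) / exp (\<kappa>2 * x) = exp ((\<kappa>1 - \<kappa>2) * x)" by (simp add: exp_diff[symmetric] left_diff_distrib)
        finally show "r x \<le> B0 / p * exp ((\<kappa>1 - \<kappa>2) * x)" .
      qed
    qed (use r0 in auto)
    have rtop: "(r \<longlongrightarrow> 0) at_top"
    proof (rule tendsto_sandwich[OF _ _ tendsto_const])
      show "((\<lambda>x. S / B * exp (- (\<kappa> * x))) \<longlongrightarrow> 0) at_top"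
        using \<kappa> by (intro tendsto_mult_right_zero[OF tendsto_exp_neg_at_top]) auto
      show "\<forall>\<^sub>F x in at_top. r x \<le> S / B * exp (- (\<kappa> * x))"
      proof (intro always_eventually allI)
        fix x
        have "r x \<le> S / (B * exp (\<kappa> * x))"
          unfolding r_def using wS[of x] b1[of x] B w0[of x] S_pos by (intro frac_le) auto
        also have "\<dots> = S / B * exp (- (\<kappa> * x))" by (simp add: exp_minus field_simps)
        finally show "r x \<le> S / B * exp (- (\<kappa> * x))" .
      qed
    qed (use r0 in auto)
    have rx: "1 < r x" using neg b1(3)[of x] by (simp add: r_def pos_less_divide_eq) (simp add: b_def)
    then have "0 < r x" by simp
    then obtain x0 where x0: "\<And>x. r x \<le> r x0" "r x \<le> r x0"
      using vanishing_attains_max[OF cr rbot rtop] by blast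
    define s where "s = r x0"
    have s: "1 < s" unfolding s_def using rx x0(1)[of x] by linarith
    have wb: "w u \<le> s * b u" for u
    proof -
      have "w u = r u * b u" using b1(3)[of u] by (simp add: r_def)
      also have "\<dots> \<le> s * b u" using x0(1)[of u] b1(3)[of u] by (intro mult_right_mono) (auto simp: s_def)
      finally show ?thesis .
    qed
    have wx0: "w x0 = s * b x0" using b1(3)[of x0] by (simp add: s_def r_def)
    define E1 where "E1 = exp (\<kappa> * x0)"
    define E2 where "E2 = exp (\<kappa>2 * x0)"
    have k2g: "\<kappa>2 \<le> \<gamma>" using \<kappa> by simp
    have i1: "integrable lborel (\<lambda>y. n y * exp (- (\<kappa> * y)))" and i2: "integrable lborel (\<lambda>y. n y * exp (- (\<kappa>2 * y)))"
      using n_exp \<kappa> k2g by auto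
    have "(\<integral>y. n y * w (x0 - y) \<partial>lborel) \<le> (\<integral>y. s * B * E1 * (n y * exp (- (\<kappa> * y))) + s * p * E2 * (n y * exp (- (\<kappa>2 * y))) \<partial>lborel)"
    proof (rule integral_mono[OF nw_int])
      show "integrable lborel (\<lambda>y. s * B * E1 * (n y * exp (- (\<kappa> * y))) + s * p * E2 * (n y * exp (- (\<kappa>2 * y))))"
        using i1 i2 by (intro Bochner_Integration.integrable_add integrable_mult_right) auto
      fix y
      have "n y * w (x0 - y) \<le> n y * (s * b (x0 - y))" using wb n_pos[of y] by (intro mult_left_mono) auto
      also have "b (x0 - y) = B * (E1 * exp (- (\<kappa> * y))) + p * (E2 * exp (- (\<kappa>2 * y)))"
        by (simp add: b_def E1_def E2_def mult_exp_exp algebra_simps)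
      also have "n y * (s * (B * (E1 * exp (- (\<kappa> * y))) + p * (E2 * exp (- (\<kappa>2 * y))))) =
        s * B * E1 * (n y * exp (- (\<kappa> * y))) + s * p * E2 * (n y * exp (- (\<kappa>2 * y)))"
        by (simp only: distrib_left mult_ac)
      finally show "n y * w (x0 - y) \<le> s * B * E1 * (n y * exp (- (\<kappa> * y))) + s * p * E2 * (n y * exp (- (\<kappa>2 * y)))" .
    qed
    also have "\<dots> = s * B * E1 * nhat \<kappa> + s * p * E2 * nhat \<kappa>2" unfolding nhat_def using i1 i2 by simp
    also have "\<dots> \<le> s * B * E1 * m + s * p * E2 * m"
      using s B p m by (intro add_mono mult_left_mono) (auto simp: E1_def E2_def)
    also have "\<dots> = s * b x0 * m" by (simp add: b_def E1_def E2_def algebra_simps)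
    finally have "(1 + e) * (\<integral>y. n y * w (x0 - y) \<partial>lborel) \<le> (1 + e) * (s * b x0 * m)"
      using e by (intro mult_left_mono) auto
    also have "\<dots> = s * b x0 * ((1 + e) * m)" by (simp only: mult_ac)
    also have "\<dots> = s * b x0 * (1 - e)" by (simp only: em)
    finally have "s * b x0 \<le> s * b x0 * (1 - e) + D1 * E1" using main[of x0] wx0 by (simp add: E1_def)
    then have "e * (s * b x0) \<le> D1 * E1" by (simp add: algebra_simps)
    moreover have "e * (1 * (B * E1)) \<le> e * (s * b x0)"
      using e s b1[of x0] B by (intro mult_left_mono mult_mono) (auto simp: E1_def)
    ultimately have "(e * B) * E1 \<le> D1 * E1" by simp
    then have "e * B \<le> D1" by (simp add: E1_def)
    with B(2) show False by simp
  qed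
  have "w x \<le> B * exp (\<kappa> * x)" for x by (rule field_le_epsilon_mult) (rule bound)
  then show ?thesis unfolding w_def by (rule that)
qed

end

section \<open>Asymptotics at the critical exponent\<close>

locale critical_exponent = convolution_lipschitz +
  fixes \<rho> :: real
  assumes \<rho>: "0 < \<rho>" "\<rho> \<le> \<mu>0" "nhat \<rho> = 1"
    and nhat_gt_1: "0 \<le> z \<Longrightarrow> z < \<rho> \<Longrightarrow> 1 < nhat z"
begin

lemma \<rho>\<gamma>: "\<rho> < \<gamma>" using \<rho> \<mu>0 by simp

text \<open>The Esscher transform of the linearized kernel, a probability density because
  \<open>nhat \<rho> = 1\<close>. Its mean is minus the derivative of \<open>nhat\<close> at \<rho>,
  so the walk has no drift exactly when the root is double.\<close>

definition N :: "real \<Rightarrow> real" where "N t = n t * exp (- (\<rho> * t))"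
text \<open>Keeps both \<rho> - \<delta> and \<rho> + \<delta> between 0 and \<gamma>, where the
  transform of \<open>n\<close> converges; these two exponents dominate the two-sided
  weight.\<close>

definition \<delta> :: real where "\<delta> = min \<rho> (\<gamma> - \<rho>)"

sublocale R: renewal_kernel N \<delta>
proof
  show [measurable]: "N \<in> borel_measurable borel" unfolding N_def by measurable
  show "0 \<le> N t" for t unfolding N_def using n_pos[of t] by simp
  show "(\<integral>t. N t \<partial>lborel) = 1" using \<rho>(3) by (simp add: N_def nhat_def)
  show d: "0 < \<delta>" using \<rho> \<rho>\<gamma> by (simp add: \<delta>_def)
  show "integrable lborel (\<lambda>t. N t * exp (\<delta> * \<bar>t\<bar>))"
  proof (rule Bochner_Integration.integrable_bound)
    show "integrable lborel (\<lambda>t. n t * exp (- ((\<rho> + \<delta>) * t)) + n t * exp (- ((\<rho> - \<delta>) * t)))"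
      using n_exp[of "\<rho> + \<delta>"] n_exp[of "\<rho> - \<delta>"] d \<rho> \<rho>\<gamma> by (auto simp: \<delta>_def)
    show "AE t in lborel. norm (N t * exp (\<delta> * \<bar>t\<bar>)) \<le>
      norm (n t * exp (- ((\<rho> + \<delta>) * t)) + n t * exp (- ((\<rho> - \<delta>) * t)))"
    proof (intro AE_I2)
      fix t
      have "exp (- (\<rho> * t)) * exp (\<delta> * \<bar>t\<bar>) \<le> exp (- ((\<rho> + \<delta>) * t)) + exp (- ((\<rho> - \<delta>) * t))"
      proof (cases "0 \<le> t")
        case True
        then have "exp (- (\<rho> * t)) * exp (\<delta> * \<bar>t\<bar>) = exp (- ((\<rho> - \<delta>) * t))" by (simp add: mult_exp_exp algebra_simps)
        then show ?thesis by simp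
      next
        case False
        then have "exp (- (\<rho> * t)) * exp (\<delta> * \<bar>t\<bar>) = exp (- ((\<rho> + \<delta>) * t))" by (simp add: mult_exp_exp algebra_simps)
        then show ?thesis by simp
      qed
      then have "n t * (exp (- (\<rho> * t)) * exp (\<delta> * \<bar>t\<bar>)) \<le> n t * (exp (- ((\<rho> + \<delta>) * t)) + exp (- ((\<rho> - \<delta>) * t)))"
        using n_pos[of t] by (intro mult_left_mono) auto
      then show "norm (N t * exp (\<delta> * \<bar>t\<bar>)) \<le> norm (n t * exp (- ((\<rho> + \<delta>) * t)) + n t * exp (- ((\<rho> - \<delta>) * t)))"
        using n_pos[of t] by (simp add: N_def abs_mult distrib_left mult.assoc)
    qed
  qed measurable
  fix R :: real
  obtain c where c: "c > 0" "\<And>t. \<bar>t\<bar> \<le> R \<Longrightarrow> c \<le> n t" using n_low by blast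
  have "c * exp (- (\<rho> * R)) \<le> N t" if t: "\<bar>t\<bar> \<le> R" for t
  proof -
    have "\<rho> * t \<le> \<rho> * R" using t \<rho>(1) by (intro mult_left_mono) auto
    then show ?thesis unfolding N_def using c(2)[OF t] c(1) by (intro mult_mono) auto
  qed
  then show "\<exists>c>0. \<forall>t. \<bar>t\<bar> \<le> R \<longrightarrow> c \<le> N t"
    using c(1) by (intro exI[of _ "c * exp (- (\<rho> * R))"]) auto
qed

definition tilt :: "(real \<Rightarrow> real) \<Rightarrow> real \<Rightarrow> real" where "tilt \<phi> x = \<phi> x * exp (- (\<rho> * x))"

text \<open>The gain from the Hoelder remainder of order 1 + \<theta>. Only rates below \<rho> are
  available for a solution, so half of \<theta> is given away; the cap at \<gamma> keeps the kernel
  integrals finite.\<close>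

definition \<eta> :: real where "\<eta> = min \<gamma> (\<rho> * (1 + \<theta> / 2)) - \<rho>"

lemma \<eta>_pos: "0 < \<eta>"
proof -
  have "\<rho> * 1 < \<rho> * (1 + \<theta> / 2)" using \<rho>(1) \<theta>_pos by (intro mult_strict_left_mono) auto
  then show ?thesis using \<rho>\<gamma> by (simp add: \<eta>_def)
qed

section \<open>Tilted solutions as almost harmonic functions\<close>

lemma sol_decay:
  assumes s: "sol \<phi>" and z: "0 \<le> Z" "Z < \<rho>"
  obtains D where "0 < D" "\<And>x. \<phi> x \<le> D * exp (Z * x)"
proof (rule decay[OF s z(1)])
  fix u assume u: "0 \<le> u" "u \<le> Z"
  then have "1 < nhat u" using z by (intro nhat_gt_1) auto
  then have "ennreal 1 < ennreal (nhat u)" by (simp add: ennreal_less_iff)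
  then show "1 < (\<integral>\<^sup>+x. ennreal (n x * exp (- (u * x))) \<partial>lborel)"
    using u z \<rho>\<gamma> by (subst nhat_nn) auto
qed (use that in blast)

lemma tilt_nonneg: "sol \<phi> \<Longrightarrow> 0 \<le> tilt \<phi> x"
  using solD(2) by (simp add: tilt_def)

lemma tilt_subexponential:
  assumes s: "sol \<phi>"
  shows "subexponential (tilt \<phi>)"
  unfolding subexponential_def
proof (intro conjI allI impI)
  show "continuous_on UNIV (tilt \<phi>)" unfolding tilt_def
    using solD(1)[OF s] by (intro continuous_intros)
  fix e :: real assume e: "0 < e"
  define e' where "e' = min e \<rho>"
  have e': "0 < e'" "e' \<le> e" "e' \<le> \<rho>" using e \<rho> by (auto simp: e'_def)
  obtain D where D: "0 < D" "\<And>x. \<phi> x \<le> D * exp ((\<rho> - e') * x)"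
    using sol_decay[OF s, of "\<rho> - e'"] e' by auto
  have "\<bar>tilt \<phi> x\<bar> \<le> D * exp (e * \<bar>x\<bar>)" for x
  proof -
    have "\<bar>tilt \<phi> x\<bar> \<le> D * exp ((\<rho> - e') * x) * exp (- (\<rho> * x))"
      using D(2)[of x] solD(2)[OF s, of x] by (simp add: tilt_def)
    also have "\<dots> = D * exp (- e' * x)" by (simp add: mult_exp_exp algebra_simps)
    also have "- e' * x \<le> e' * \<bar>x\<bar>" using e' by (simp add: abs_if)
    then have "D * exp (- e' * x) \<le> D * exp (e' * \<bar>x\<bar>)" using D(1) by simp
    also have "e' * \<bar>x\<bar> \<le> e * \<bar>x\<bar>" using e' by (intro mult_right_mono) auto
    then have "D * exp (e' * \<bar>x\<bar>) \<le> D * exp (e * \<bar>x\<bar>)" using D(1) by simp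
    finally show ?thesis .
  qed
  then show "\<exists>C. \<forall>x. \<bar>tilt \<phi> x\<bar> \<le> C * exp (e * \<bar>x\<bar>)" by blast
qed

lemma tilt_top:
  assumes s: "sol \<phi>"
  shows "(tilt \<phi> \<longlongrightarrow> 0) at_top"
proof (rule tendsto_sandwich[OF _ _ tendsto_const])
  show "((\<lambda>x. S * exp (- (\<rho> * x))) \<longlongrightarrow> 0) at_top"
    by (rule tendsto_mult_right_zero[OF tendsto_exp_neg_at_top[OF \<rho>(1)]])
  show "\<forall>\<^sub>F x in at_top. tilt \<phi> x \<le> S * exp (- (\<rho> * x))"
    unfolding tilt_def using solD(3)[OF s] by (intro always_eventually allI mult_right_mono) auto
qed (use tilt_nonneg[OF s] in auto)

text \<open>Subtracting the linearized convolution leaves only the nonlinear remainder in the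
  defect. It is of order 1 + \<theta> in the solution and therefore decays faster than exp (\<rho>
  x), which survives division by that factor.\<close>

lemma tilt_defect:
  assumes s: "sol \<phi>"
  obtains B where "\<And>x. \<bar>R.defect (tilt \<phi>) x\<bar> \<le> B * exp (\<eta> * x)"
proof -
  note [measurable] = solD(6)[OF s]
  define \<kappa> where "\<kappa> = \<rho> + \<eta>"
  have \<kappa>: "\<kappa> \<le> \<gamma>" "\<kappa> \<le> \<rho> * (1 + \<theta> / 2)" "0 < \<kappa>" using \<eta>_pos \<rho> by (auto simp: \<kappa>_def \<eta>_def)
  \<comment> \<open>The rate at which the solution must decay for the remainder to decay at rate
    \<kappa>; it is strictly below \<rho>, where decay is known.\<close>
  define Z where "Z = \<kappa> / (1 + \<theta>)"
  have Z: "0 \<le> Z" "Z * (1 + \<theta>) = \<kappa>" using \<kappa> \<theta>_pos by (auto simp: Z_def)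
  have "\<rho> * (1 + \<theta> / 2) < \<rho> * (1 + \<theta>)" using \<rho> \<theta>_pos by (intro mult_strict_left_mono) auto
  then have "Z * (1 + \<theta>) < \<rho> * (1 + \<theta>)" using Z \<kappa> by linarith
  then have Z\<rho>: "Z < \<rho>" using \<theta>_pos by simp
  obtain D where D: "0 < D" "\<And>x. \<phi> x \<le> D * exp (Z * x)" using sol_decay[OF s Z(1) Z\<rho>] by blast
  define D' where "D' = C * (D powr \<theta> * D)"
  have err: "\<bar>F i (\<phi> u) - a i * \<phi> u\<bar> \<le> D' * exp (\<kappa> * u)" if i: "i \<in> I" for i u
  proof -
    have "\<bar>F i (\<phi> u) - F i 0 - a i * (\<phi> u - 0)\<bar> \<le> C * (max (\<phi> u) 0 powr \<theta>) * \<bar>\<phi> u - 0\<bar>"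
      using solD(2,3)[OF s] S_pos by (intro F_lin[OF i]) auto
    then have "\<bar>F i (\<phi> u) - a i * \<phi> u\<bar> \<le> C * (\<phi> u powr \<theta>) * \<phi> u"
      using F_zero[OF i] solD(2)[OF s, of u] by (simp add: max_absorb1)
    also have "\<dots> \<le> C * ((D * exp (Z * u)) powr \<theta>) * (D * exp (Z * u))"
      using solD(2)[OF s, of u] D(2)[of u] \<theta>_pos C_nonneg by (intro mult_mono powr_mono2) auto
    also have "(D * exp (Z * u)) powr \<theta> = D powr \<theta> * exp (Z * u * \<theta>)"
      using D(1) by (simp add: powr_mult exp_powr_real)
    also have "C * (D powr \<theta> * exp (Z * u * \<theta>)) * (D * exp (Z * u)) = D' * (exp (Z * u * \<theta>) * exp (Z * u))"
      by (simp only: D'_def mult_ac)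
    also have "exp (Z * u * \<theta>) * exp (Z * u) = exp (\<kappa> * u)"
      unfolding Z(2)[symmetric] by (simp add: mult_exp_exp algebra_simps)
    finally show ?thesis .
  qed
  define B where "B = (\<Sum>i\<in>I. D' * khat i \<kappa>)"
  have "\<bar>R.defect (tilt \<phi>) x\<bar> \<le> B * exp (\<eta> * x)" for x
  proof -
    have ki: "i \<in> I \<Longrightarrow> integrable lborel (\<lambda>y. k i y * \<phi> (x - y))" for i
      using solD(2,3)[OF s] by (intro integrable_mult_bounded[OF k_int, where B=S]) auto
    have kk: "i \<in> I \<Longrightarrow> integrable lborel (\<lambda>y. k i y * exp (- (\<kappa> * y)))" for i
      using k_exp \<kappa> by simp
    have "R.defect (tilt \<phi>) x = tilt \<phi> x - (\<integral>y. N y * tilt \<phi> (x - y) \<partial>lborel)"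
      by (rule R.defect_eq[OF tilt_subexponential[OF s]])
    also have "(\<lambda>y. N y * tilt \<phi> (x - y)) = (\<lambda>y. (n y * \<phi> (x - y)) * exp (- (\<rho> * x)))"
    proof
      fix y
      have "exp (- (\<rho> * x)) = exp (- (\<rho> * y)) * exp (- (\<rho> * (x - y)))" by (simp add: mult_exp_exp algebra_simps)
      then show "N y * tilt \<phi> (x - y) = (n y * \<phi> (x - y)) * exp (- (\<rho> * x))"
        unfolding N_def tilt_def by (simp only: mult_ac)
    qed
    also have "(\<integral>y. (n y * \<phi> (x - y)) * exp (- (\<rho> * x)) \<partial>lborel) = (\<integral>y. n y * \<phi> (x - y) \<partial>lborel) * exp (- (\<rho> * x))"
      by simp
    also have "(\<integral>y. n y * \<phi> (x - y) \<partial>lborel) = (\<Sum>i\<in>I. a i * (\<integral>y. k i y * \<phi> (x - y) \<partial>lborel))"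
      unfolding n_def sum_distrib_right mult.assoc
      by (subst Bochner_Integration.integral_sum) (use ki in auto)
    also have "tilt \<phi> x = (\<Sum>i\<in>I. \<integral>y. k i y * F i (\<phi> (x - y)) \<partial>lborel) * exp (- (\<rho> * x))"
      unfolding tilt_def using solD(5)[OF s, of x] by simp
    also have "(\<Sum>i\<in>I. \<integral>y. k i y * F i (\<phi> (x - y)) \<partial>lborel) * exp (- (\<rho> * x)) -
       (\<Sum>i\<in>I. a i * (\<integral>y. k i y * \<phi> (x - y) \<partial>lborel)) * exp (- (\<rho> * x)) =
       (\<Sum>i\<in>I. \<integral>y. k i y * (F i (\<phi> (x - y)) - a i * \<phi> (x - y)) \<partial>lborel) * exp (- (\<rho> * x))"
    proof -
      have "(\<integral>y. k i y * (F i (\<phi> (x - y)) - a i * \<phi> (x - y)) \<partial>lborel) =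
         (\<integral>y. k i y * F i (\<phi> (x - y)) \<partial>lborel) - a i * (\<integral>y. k i y * \<phi> (x - y) \<partial>lborel)" if i: "i \<in> I" for i
      proof -
        have "(\<integral>y. k i y * (F i (\<phi> (x - y)) - a i * \<phi> (x - y)) \<partial>lborel) =
          (\<integral>y. k i y * F i (\<phi> (x - y)) - a i * (k i y * \<phi> (x - y)) \<partial>lborel)"
          by (simp add: right_diff_distrib mult.left_commute)
        then show ?thesis using conv_int[OF s i] ki[OF i] by simp
      qed
      then show ?thesis by (simp add: sum_subtractf left_diff_distrib)
    qed
    also have "\<bar>\<dots>\<bar> = \<bar>\<Sum>i\<in>I. \<integral>y. k i y * (F i (\<phi> (x - y)) - a i * \<phi> (x - y)) \<partial>lborel\<bar> * exp (- (\<rho> * x))"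
      by (simp add: abs_mult)
    also have "\<dots> \<le> (\<Sum>i\<in>I. D' * khat i \<kappa> * exp (\<kappa> * x)) * exp (- (\<rho> * x))"
    proof (intro mult_right_mono order_trans[OF sum_abs] sum_mono)
      fix i assume i: "i \<in> I"
      have "\<bar>\<integral>y. k i y * (F i (\<phi> (x - y)) - a i * \<phi> (x - y)) \<partial>lborel\<bar> \<le>
        (\<integral>y. \<bar>k i y * (F i (\<phi> (x - y)) - a i * \<phi> (x - y))\<bar> \<partial>lborel)" by (rule integral_abs_bound)
      also have "\<dots> \<le> (\<integral>y. D' * exp (\<kappa> * x) * (k i y * exp (- (\<kappa> * y))) \<partial>lborel)"
      proof (rule integral_mono')
        show "integrable lborel (\<lambda>y. D' * exp (\<kappa> * x) * (k i y * exp (- (\<kappa> * y))))" using kk[OF i] by simp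
        fix y
        have "\<bar>F i (\<phi> (x - y)) - a i * \<phi> (x - y)\<bar> \<le> D' * exp (\<kappa> * (x - y))" by (rule err[OF i])
        also have "exp (\<kappa> * (x - y)) = exp (\<kappa> * x) * exp (- (\<kappa> * y))" by (simp add: mult_exp_exp algebra_simps)
        finally have "k i y * \<bar>F i (\<phi> (x - y)) - a i * \<phi> (x - y)\<bar> \<le> k i y * (D' * (exp (\<kappa> * x) * exp (- (\<kappa> * y))))"
          using k_pos[OF i, of y] by (intro mult_left_mono) auto
        then show "\<bar>k i y * (F i (\<phi> (x - y)) - a i * \<phi> (x - y))\<bar> \<le> D' * exp (\<kappa> * x) * (k i y * exp (- (\<kappa> * y)))"
          using k_pos[OF i, of y] by (simp add: abs_mult mult_ac)
        then show "0 \<le> D' * exp (\<kappa> * x) * (k i y * exp (- (\<kappa> * y)))" by linarith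
      qed
      also have "\<dots> = D' * khat i \<kappa> * exp (\<kappa> * x)" unfolding khat_def using kk[OF i] by simp
      finally show "\<bar>\<integral>y. k i y * (F i (\<phi> (x - y)) - a i * \<phi> (x - y)) \<partial>lborel\<bar> \<le> D' * khat i \<kappa> * exp (\<kappa> * x)" .
    qed simp
    also have "\<dots> = B * (exp (\<kappa> * x) * exp (- (\<rho> * x)))" by (simp only: B_def sum_distrib_right mult.assoc)
    also have "exp (\<kappa> * x) * exp (- (\<rho> * x)) = exp (\<eta> * x)" by (simp add: \<kappa>_def mult_exp_exp algebra_simps)
    finally show ?thesis .
  qed
  then show ?thesis by (rule that)
qed

text \<open>The tangent inequality for the exponential at \<rho> gives \<open>nhat \<mu>0\<close> at
  least \<open>1 - (\<mu>0 - \<rho>) * R.mean\<close>, so a value below 1 excludes zero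
  drift.\<close>

lemma mean_pos_of_subcritical:
  assumes "nhat \<mu>0 < 1"
  shows "R.mean \<noteq> 0" "\<rho> < \<mu>0"
proof -
  show r: "\<rho> < \<mu>0" using assms \<rho> by (cases "\<rho> = \<mu>0") auto
  have Ni: "integrable lborel N" by (rule R.N_integrable)
  have "(\<integral>t. N t - (\<mu>0 - \<rho>) * (N t * t) \<partial>lborel) \<le> nhat \<mu>0"
    unfolding nhat_def
  proof (rule integral_mono)
    show "integrable lborel (\<lambda>t. N t - (\<mu>0 - \<rho>) * (N t * t))" using Ni R.integrable_mean by simp
    show "integrable lborel (\<lambda>x. n x * exp (- (\<mu>0 * x)))" using \<mu>0 by (intro n_exp) auto
    fix t
    have "N t * (1 + - ((\<mu>0 - \<rho>) * t)) \<le> N t * exp (- ((\<mu>0 - \<rho>) * t))"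
      using R.N_nonneg by (intro mult_left_mono exp_ge_add_one_self) auto
    also have "\<dots> = n t * exp (- (\<mu>0 * t))" by (simp add: N_def mult.assoc mult_exp_exp algebra_simps)
    finally show "N t - (\<mu>0 - \<rho>) * (N t * t) \<le> n t * exp (- (\<mu>0 * t))" by (simp add: algebra_simps)
  qed
  moreover have "(\<integral>t. N t - (\<mu>0 - \<rho>) * (N t * t) \<partial>lborel) = 1 - (\<mu>0 - \<rho>) * R.mean"
    unfolding R.mean_def using Ni R.integrable_mean R.N_mass by simp
  ultimately show "R.mean \<noteq> 0" using assms by auto
qed

text \<open>If \<open>nhat \<mu>0 < 1\<close>, the root is simple and the barrier raises the decay
  beyond \<open>\<mu>0\<close>, where the maximum principle applies. Otherwise the Lipschitz
  constants coincide with the slopes at 0 and \<rho> itself serves as the exponent of the maximum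
  principle; only a double root then leaves no extra decay, and the Liouville theorem takes
  over.\<close>

lemma unique_of_decay:
  assumes s1: "sol \<phi>1" and s2: "sol \<phi>2"
    and e: "0 \<le> e" "R.mean \<noteq> 0 \<Longrightarrow> 0 < e" and B: "\<And>x. \<bar>tilt \<phi>1 x - tilt \<phi>2 x\<bar> \<le> B * exp (e * x)"
  shows "\<phi>1 x = \<phi>2 x"
proof -
  define \<omega> where "\<omega> x = \<bar>\<phi>1 x - \<phi>2 x\<bar> * exp (- (\<rho> * x))" for x
  have \<omega>t: "\<omega> x = \<bar>tilt \<phi>1 x - tilt \<phi>2 x\<bar>" for x
  proof -
    have "tilt \<phi>1 x - tilt \<phi>2 x = (\<phi>1 x - \<phi>2 x) * exp (- (\<rho> * x))" by (simp add: tilt_def left_diff_distrib)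
    then show ?thesis by (simp add: \<omega>_def abs_mult)
  qed
  have dB: "\<bar>\<phi>1 x - \<phi>2 x\<bar> \<le> B * exp ((\<rho> + e) * x)" for x
  proof -
    have "\<bar>\<phi>1 x - \<phi>2 x\<bar> = \<omega> x * exp (\<rho> * x)" by (simp add: \<omega>_def mult.assoc mult_exp_exp)
    also have "\<dots> \<le> B * exp (e * x) * exp (\<rho> * x)" using B[of x] by (intro mult_right_mono) (auto simp: \<omega>t)
    also have "\<dots> = B * exp ((\<rho> + e) * x)" by (simp add: mult.assoc mult_exp_exp algebra_simps)
    finally show ?thesis .
  qed
  have B0: "0 \<le> B" using B[of 0] by simp
  show ?thesis
  proof (cases "nhat \<mu>0 < 1")
    case True
    note sub = mean_pos_of_subcritical[OF True]
    have e0: "0 < e" by (rule e(2)[OF sub(1)])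
    \<comment> \<open>Strictly between \<rho> and both \<open>\<mu>0\<close> and the known rate
      \<open>\<rho> + e\<close>; convexity puts \<open>nhat\<close> below 1 there.\<close>
    define \<kappa>2 where "\<kappa>2 = \<rho> + min e (\<mu>0 - \<rho>) / 2"
    have \<kappa>2: "\<rho> < \<kappa>2" "\<kappa>2 < \<mu>0" "\<kappa>2 < \<rho> + e" using e0 sub(2) by (auto simp: \<kappa>2_def min_def field_simps)
    have n2: "nhat \<kappa>2 < 1"
    proof -
      define t where "t = (\<kappa>2 - \<rho>) / (\<mu>0 - \<rho>)"
      have t: "0 < t" "t < 1" using \<kappa>2 by (auto simp: t_def)
      have "t * (\<mu>0 - \<rho>) = \<kappa>2 - \<rho>" using sub(2) by (simp add: t_def)
      then have k: "\<kappa>2 = (1 - t) * \<rho> + t * \<mu>0" by (simp add: algebra_simps)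
      have "nhat \<kappa>2 \<le> (1 - t) * nhat \<rho> + t * nhat \<mu>0"
        unfolding k using \<rho> \<mu>0 \<rho>\<gamma> t by (intro nhat_convex) auto
      also have "\<dots> < (1 - t) * 1 + t * 1" using True t \<rho>(3) by simp
      finally show ?thesis by simp
    qed
    obtain \<kappa> where \<kappa>: "\<mu>0 < \<kappa>" "\<kappa> \<le> \<gamma>" "nhat \<kappa> < 1"
    proof -
      \<comment> \<open>An upper bound for the increase of \<open>nhat\<close> from
        \<open>\<mu>0\<close> to \<gamma>. Moving by the fraction \<open>t\<close> towards \<gamma>
        then uses at most half of the margin below 1.\<close>
      define P where "P = 1 - nhat \<mu>0 + \<bar>nhat \<gamma>\<bar>"
      define t where "t = (1 - nhat \<mu>0) / (2 * P)"
      have p: "0 < P" using True unfolding P_def by linarith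
      have "1 - nhat \<mu>0 \<le> P" by (simp add: P_def)
      then have t: "0 < t" "t < 1" using True p by (auto simp: t_def divide_less_eq)
      have "nhat ((1 - t) * \<mu>0 + t * \<gamma>) \<le> (1 - t) * nhat \<mu>0 + t * nhat \<gamma>"
        using \<mu>0 t by (intro nhat_convex) auto
      also have "\<dots> = nhat \<mu>0 + t * (nhat \<gamma> - nhat \<mu>0)" by (simp add: algebra_simps)
      also have "\<dots> \<le> nhat \<mu>0 + t * P" using t by (intro add_left_mono mult_left_mono) (auto simp: P_def)
      also have "t * P = (1 - nhat \<mu>0) / 2" using p by (simp add: t_def)
      also have "nhat \<mu>0 + (1 - nhat \<mu>0) / 2 < 1" using True by (simp add: field_simps)
      finally have 1: "nhat ((1 - t) * \<mu>0 + t * \<gamma>) < 1" .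
      have "0 < t * (\<gamma> - \<mu>0)" using t \<mu>0 by simp
      then have 2: "\<mu>0 < (1 - t) * \<mu>0 + t * \<gamma>" by (simp add: algebra_simps)
      have 3: "(1 - t) * \<mu>0 + t * \<gamma> \<le> \<gamma>" using t \<mu>0 by (intro convex_bound_le) auto
      show ?thesis using that[OF 2 3 1] .
    qed
    obtain B' where B': "\<And>x. \<bar>\<phi>1 x - \<phi>2 x\<bar> \<le> B' * exp (\<kappa> * x)"
      by (rule barrier[OF s1 s2 dB, of \<kappa>2 \<kappa>]) (use \<kappa>2 \<kappa> \<rho> \<mu>0 n2 in auto)
    show ?thesis
    proof (rule unique_of_fast_decay[OF s1 s2 \<mu>0(1)])
      show "\<mu>0 \<le> \<gamma>" "(\<Sum>i\<in>I. A i * khat i \<mu>0) \<le> 1" using \<mu>0 by (auto simp: khat_def)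
      show "((\<lambda>x. \<bar>\<phi>1 x - \<phi>2 x\<bar> * exp (- (\<mu>0 * x))) \<longlongrightarrow> 0) at_bot"
      proof (rule tendsto_sandwich[OF _ _ tendsto_const])
        show "((\<lambda>x. B' * exp ((\<kappa> - \<mu>0) * x)) \<longlongrightarrow> 0) at_bot"
          using \<kappa> by (intro tendsto_mult_right_zero[OF tendsto_exp_at_bot]) auto
        show "\<forall>\<^sub>F x in at_bot. \<bar>\<phi>1 x - \<phi>2 x\<bar> * exp (- (\<mu>0 * x)) \<le> B' * exp ((\<kappa> - \<mu>0) * x)"
        proof (intro always_eventually allI)
          fix x
          have "\<bar>\<phi>1 x - \<phi>2 x\<bar> * exp (- (\<mu>0 * x)) \<le> B' * exp (\<kappa> * x) * exp (- (\<mu>0 * x))"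
            using B' by (intro mult_right_mono) auto
          also have "\<dots> = B' * exp ((\<kappa> - \<mu>0) * x)" by (simp add: mult.assoc mult_exp_exp algebra_simps)
          finally show "\<bar>\<phi>1 x - \<phi>2 x\<bar> * exp (- (\<mu>0 * x)) \<le> B' * exp ((\<kappa> - \<mu>0) * x)" .
        qed
      qed auto
    qed
  next
    case False
    \<comment> \<open>The sum with \<open>A\<close> is at most 1 while the sum with \<open>a\<close>
      is at least 1, so no constant can be strictly larger than its slope.\<close>
    have Aa: "A i = a i" if i: "i \<in> I" for i
    proof (rule ccontr)
      assume "A i \<noteq> a i"
      then have "a i < A i" using A_ge[OF i] by simp
      then have "(\<Sum>i\<in>I. a i * khat i \<mu>0) < (\<Sum>i\<in>I. A i * khat i \<mu>0)"
        using i finite_I A_ge khat_pos \<mu>0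
        by (intro sum_strict_mono_ex1) (auto intro!: mult_right_mono mult_strict_right_mono intro: less_imp_le)
      also have "\<dots> \<le> 1" using \<mu>0(3) by (simp add: khat_def)
      finally have "nhat \<mu>0 < 1" using nhat_sum[of \<mu>0] \<mu>0 by simp
      with False show False by simp
    qed
    have sumA: "(\<Sum>i\<in>I. A i * khat i \<rho>) = 1" using nhat_sum[of \<rho>] \<rho> \<rho>\<gamma> Aa by simp
    show ?thesis
    proof (cases "R.mean = 0")
      case False
      show ?thesis
      proof (rule unique_of_fast_decay[OF s1 s2 \<rho>(1)])
        show "\<rho> \<le> \<gamma>" "(\<Sum>i\<in>I. A i * khat i \<rho>) \<le> 1" using \<rho>\<gamma> sumA by auto
        show "((\<lambda>x. \<bar>\<phi>1 x - \<phi>2 x\<bar> * exp (- (\<rho> * x))) \<longlongrightarrow> 0) at_bot"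
        proof (rule tendsto_sandwich[OF _ _ tendsto_const])
          show "((\<lambda>x. B * exp (e * x)) \<longlongrightarrow> 0) at_bot"
            by (intro tendsto_mult_right_zero[OF tendsto_exp_at_bot] e False)
          show "\<forall>\<^sub>F x in at_bot. \<bar>\<phi>1 x - \<phi>2 x\<bar> * exp (- (\<rho> * x)) \<le> B * exp (e * x)"
            using B \<omega>t unfolding \<omega>_def by simp
        qed auto
      qed
    next
      case True
      have c\<omega>: "continuous_on UNIV \<omega>" unfolding \<omega>_def by (rule difference_cont[OF s1 s2])
      have \<omega>b: "\<omega> x \<le> B + S" for x
      proof (cases "x \<le> 0")
        case True
        then have "exp (e * x) \<le> 1" using e(1) by (simp add: mult_nonneg_nonpos)
        then have "B * exp (e * x) \<le> B * 1" using B0 by (intro mult_left_mono) auto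
        then show ?thesis using B[of x] S_pos by (simp add: \<omega>t)
      next
        case False
        then have "exp (- (\<rho> * x)) \<le> 1" using \<rho> by simp
        then have "\<omega> x \<le> S * 1" unfolding \<omega>_def using difference_le_S[OF s1 s2, of x] S_pos by (intro mult_mono) auto
        then show ?thesis using B0 by simp
      qed
      have \<omega>0: "0 \<le> \<omega> x" for x by (simp add: \<omega>_def)
      have sub: "subexponential \<omega>" by (rule subexponential_bounded[OF c\<omega>, of "B + S"]) (use \<omega>0 \<omega>b in simp)
      have top: "(\<omega> \<longlongrightarrow> 0) at_top"
        unfolding \<omega>t[abs_def] using tendsto_rabs[OF tendsto_diff[OF tilt_top[OF s1] tilt_top[OF s2]]] by simp
      \<comment> \<open>With \<open>A = a\<close> the tilted kernels add up to \<open>N\<close>, so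
        the comparison inequality says that \<omega> is subharmonic for the walk.\<close>
      have df: "R.defect \<omega> x \<le> 0" for x
      proof -
        note [measurable] = borel_measurable_continuous_onI[OF c\<omega>]
        have ki: "i \<in> I \<Longrightarrow> integrable lborel (\<lambda>y. (k i y * exp (- (\<rho> * y))) * \<omega> (x - y))" for i
          by (rule integrable_mult_bounded[where B="B + S"]) (use \<omega>0 \<omega>b k_exp \<rho> \<rho>\<gamma> in auto)
        have "\<omega> x \<le> (\<Sum>i\<in>I. A i * (\<integral>y. (k i y * exp (- (\<rho> * y))) * \<omega> (x - y) \<partial>lborel))"
          unfolding \<omega>_def by (rule tilted_difference[OF s1 s2])
        also have "\<dots> = (\<integral>y. N y * \<omega> (x - y) \<partial>lborel)"
          unfolding N_def n_def sum_distrib_right mult.assoc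
          by (subst Bochner_Integration.integral_sum) (use ki Aa in \<open>auto simp: mult.assoc\<close>)
        finally show ?thesis by (simp add: R.defect_eq[OF sub])
      qed
      have "\<omega> x = 0" by (rule R.Liouville_mean_zero[OF True c\<omega> \<omega>0 \<omega>b top df])
      then show ?thesis by (simp add: \<omega>_def)
    qed
  qed
qed

section \<open>Flux at -infinity and uniqueness up to a shift\<close>

lemma sol_shift:
  assumes s: "sol \<phi>"
  shows "sol (\<lambda>x. \<phi> (x + h))"
  unfolding sol_def
proof (intro conjI allI)
  show "continuous_on UNIV (\<lambda>x. \<phi> (x + h))"
    by (intro continuous_on_compose2[OF solD(1)[OF s]] continuous_intros) auto
  show "((\<lambda>x. \<phi> (x + h)) \<longlongrightarrow> 0) at_bot"
    by (rule filterlim_compose[OF solD(4)[OF s]])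
       (simp add: filterlim_at_bot, metis (mono_tags, lifting) eventually_at_bot_linorder le_diff_eq)
  show "\<phi> (x + h) = (\<Sum>i\<in>I. \<integral>y. k i y * F i (\<phi> (x - y + h)) \<partial>lborel)" for x
    using solD(5)[OF s, of "x + h"] by (simp add: algebra_simps)
qed (use solD(2,3)[OF s] in auto)

text \<open>The flux has an exponentially small derivative at -infinity, so it converges there. The
  choice of antiderivative is immaterial, since constants have zero defect.\<close>

lemma flux_limit:
  assumes s: "sol \<phi>"
  obtains \<Omega> v where "\<And>x. (\<Omega> has_real_derivative tilt \<phi> x) (at x)" "(R.defect \<Omega> \<longlongrightarrow> v) at_bot"
proof -
  obtain \<Omega> where \<Omega>: "\<And>x. (\<Omega> has_real_derivative tilt \<phi> x) (at x)"
    using continuous_antiderivative[OF subexponential_cont[OF tilt_subexponential[OF s]]] by blast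
  obtain B where B: "\<And>x. \<bar>R.defect (tilt \<phi>) x\<bar> \<le> B * exp (\<eta> * x)" using tilt_defect[OF s] by blast
  obtain v where "(R.defect \<Omega> \<longlongrightarrow> v) at_bot"
    using limit_at_bot_exp[OF R.defect_deriv[OF tilt_subexponential[OF s] \<Omega>] B \<eta>_pos] by blast
  with \<Omega> show ?thesis using that by blast
qed

text \<open>Defect, flux and tilt are linear, so a combination of two solutions, although not a
  solution itself, satisfies the decay criterion as soon as its limiting flux cancels.\<close>

lemma decay_of_combination:
  assumes s1: "sol \<phi>1" and s2: "sol \<phi>2"
    and \<Omega>1: "\<And>x. (\<Omega>1 has_real_derivative tilt \<phi>1 x) (at x)" and v1: "(R.defect \<Omega>1 \<longlongrightarrow> v1) at_bot"
    and \<Omega>2: "\<And>x. (\<Omega>2 has_real_derivative tilt \<phi>2 x) (at x)" and v2: "(R.defect \<Omega>2 \<longlongrightarrow> v2) at_bot"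
    and flux: "p * v1 + q * v2 = 0"
  obtains e B where "0 \<le> e" "R.mean \<noteq> 0 \<Longrightarrow> 0 < e" "\<And>x. \<bar>p * tilt \<phi>1 x + q * tilt \<phi>2 x\<bar> \<le> B * exp (e * x)"
proof -
  note t1 = tilt_subexponential[OF s1] and t2 = tilt_subexponential[OF s2]
  obtain B1 where B1: "\<And>x. \<bar>R.defect (tilt \<phi>1) x\<bar> \<le> B1 * exp (\<eta> * x)" using tilt_defect[OF s1] by blast
  obtain B2 where B2: "\<And>x. \<bar>R.defect (tilt \<phi>2) x\<bar> \<le> B2 * exp (\<eta> * x)" using tilt_defect[OF s2] by blast
  define \<omega> where "\<omega> x = p * tilt \<phi>1 x + q * tilt \<phi>2 x" for x
  define \<Omega> where "\<Omega> x = p * \<Omega>1 x + q * \<Omega>2 x" for x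
  have sub: "subexponential \<omega>" unfolding \<omega>_def by (rule subexponential_lincomb[OF t1 t2])
  have top: "(\<omega> \<longlongrightarrow> 0) at_top"
    unfolding \<omega>_def using tendsto_add[OF tendsto_mult_right_zero[OF tilt_top[OF s1]] tendsto_mult_right_zero[OF tilt_top[OF s2]]] by simp
  have der: "(\<Omega> has_real_derivative \<omega> x) (at x)" for x
    unfolding \<Omega>_def \<omega>_def by (auto intro!: derivative_eq_intros \<Omega>1 \<Omega>2)
  have df: "\<bar>R.defect \<omega> x\<bar> \<le> (\<bar>p\<bar> * B1 + \<bar>q\<bar> * B2) * exp (\<eta> * x)" for x
  proof -
    have "\<bar>R.defect \<omega> x\<bar> \<le> \<bar>p\<bar> * \<bar>R.defect (tilt \<phi>1) x\<bar> + \<bar>q\<bar> * \<bar>R.defect (tilt \<phi>2) x\<bar>"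
      unfolding \<omega>_def R.defect_lincomb[OF t1 t2] by (metis abs_mult abs_triangle_ineq)
    also have "\<dots> \<le> \<bar>p\<bar> * (B1 * exp (\<eta> * x)) + \<bar>q\<bar> * (B2 * exp (\<eta> * x))"
      using B1 B2 by (intro add_mono mult_left_mono) auto
    finally show ?thesis by (simp add: algebra_simps)
  qed
  have "(R.defect \<Omega> \<longlongrightarrow> p * v1 + q * v2) at_bot"
    unfolding \<Omega>_def R.defect_lincomb[OF subexponential_antiderivative[OF t1 \<Omega>1] subexponential_antiderivative[OF t2 \<Omega>2], abs_def]
    by (intro tendsto_intros v1 v2)
  then have fl: "(R.defect \<Omega> \<longlongrightarrow> 0) at_bot" using flux by simp
  show ?thesis
    using R.decay_of_zero_flux[OF sub top der df \<eta>_pos fl] that unfolding \<omega>_def by blast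
qed

text \<open>A shift by \<open>h\<close> multiplies the tilted solution, and with it the flux, by exp
  (\<rho> h). Two fluxes can be matched by a shift provided they are nonzero and of equal
  sign.\<close>

theorem unique_up_to_shift:
  assumes s1: "sol \<phi>1" and s2: "sol \<phi>2" and p1: "0 < \<phi>1 x1" and p2: "0 < \<phi>2 x2"
  shows "\<exists>h. \<forall>x. \<phi>2 x = \<phi>1 (x + h)"
proof -
  obtain \<Omega>1 v1 where 1: "\<And>x. (\<Omega>1 has_real_derivative tilt \<phi>1 x) (at x)" "(R.defect \<Omega>1 \<longlongrightarrow> v1) at_bot"
    using flux_limit[OF s1] by blast
  obtain \<Omega>2 v2 where 2: "\<And>x. (\<Omega>2 has_real_derivative tilt \<phi>2 x) (at x)" "(R.defect \<Omega>2 \<longlongrightarrow> v2) at_bot"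
    using flux_limit[OF s2] by blast
  \<comment> \<open>A nonnegative combination with zero flux decays fast and dominates the tilted
    \<phi>, which then coincides with the zero solution. With \<open>q = 0\<close> this excludes
    zero flux, with both coefficients positive it excludes fluxes of opposite sign.\<close>
  have zero: False if p: "0 < p" "0 \<le> q" "p * v + q * v' = 0"
    and s: "sol \<phi>" "sol \<phi>'" "0 < \<phi> x"
    and o: "\<And>x. (\<Omega> has_real_derivative tilt \<phi> x) (at x)" "(R.defect \<Omega> \<longlongrightarrow> v) at_bot"
    and o': "\<And>x. (\<Omega>' has_real_derivative tilt \<phi>' x) (at x)" "(R.defect \<Omega>' \<longlongrightarrow> v') at_bot"
    for p q v v' \<phi> \<phi>' \<Omega> \<Omega>' x
  proof -
    obtain e B where e: "0 \<le> e" "R.mean \<noteq> 0 \<Longrightarrow> 0 < e"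
      and B: "\<And>x. \<bar>p * tilt \<phi> x + q * tilt \<phi>' x\<bar> \<le> B * exp (e * x)"
      using decay_of_combination[OF s(1,2) o o' p(3)] by blast
    have "\<bar>tilt \<phi> x - tilt (\<lambda>_. 0) x\<bar> \<le> B / p * exp (e * x)" for x
    proof -
      have "p * tilt \<phi> x \<le> \<bar>p * tilt \<phi> x + q * tilt \<phi>' x\<bar>"
        using mult_nonneg_nonneg[OF p(2) tilt_nonneg[OF s(2), of x]] by linarith
      then have "p * tilt \<phi> x \<le> B * exp (e * x)" using B[of x] by linarith
      then have "tilt \<phi> x \<le> B / p * exp (e * x)" using p(1) by (simp add: field_simps)
      then show ?thesis using tilt_nonneg[OF s(1), of x] by (simp add: tilt_def)
    qed
    from unique_of_decay[OF s(1) sol_zero e this, of x] s(3) show False by simp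
  qed
  have v10: "v1 \<noteq> 0"
    using zero[of 1 0 v1 v1 \<phi>1 \<phi>1, OF _ _ _ s1 s1 p1 1 1] by auto
  have v20: "v2 \<noteq> 0"
    using zero[of 1 0 v2 v2 \<phi>2 \<phi>2, OF _ _ _ s2 s2 p2 2 2] by auto
  have same: "0 < v2 / v1"
  proof (rule ccontr)
    assume "\<not> 0 < v2 / v1"
    then have "v1 * v2 \<le> 0" using v10 v20
      by (simp add: not_less zero_less_divide_iff mult_le_0_iff divide_le_0_iff) linarith
    then have "\<bar>v2\<bar> * v1 + \<bar>v1\<bar> * v2 = 0" using v10 v20
      by (auto simp: mult_le_0_iff abs_if)
    then show False using zero[of "\<bar>v2\<bar>" "\<bar>v1\<bar>" v1 v2 \<phi>1 \<phi>2, OF _ _ _ s1 s2 p1 1 2] v20 by auto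
  qed
  \<comment> \<open>The shift for which exp (\<rho> h) equals the ratio of the fluxes; the logarithm
    is meaningful because the ratio is positive.\<close>
  define h where "h = ln (v2 / v1) / \<rho>"
  have eh: "exp (\<rho> * h) * v1 = v2" using same \<rho>(1) v10 by (simp add: h_def)
  define \<phi>3 where "\<phi>3 x = \<phi>1 (x + h)" for x
  have s3: "sol \<phi>3" unfolding \<phi>3_def by (rule sol_shift[OF s1])
  have t3: "tilt \<phi>3 x = exp (\<rho> * h) * tilt \<phi>1 (x + h)" for x
  proof -
    have "exp (- (\<rho> * x)) = exp (\<rho> * h) * exp (- (\<rho> * (x + h)))" by (simp add: mult_exp_exp algebra_simps)
    then show ?thesis by (simp add: tilt_def \<phi>3_def mult.left_commute)
  qed
  define \<Omega>3 where "\<Omega>3 x = exp (\<rho> * h) * \<Omega>1 (x + h)" for x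
  have d3: "(\<Omega>3 has_real_derivative tilt \<phi>3 x) (at x)" for x
    unfolding \<Omega>3_def t3 by (auto intro!: derivative_eq_intros DERIV_chain2[OF 1(1)])
  have v3: "(R.defect \<Omega>3 \<longlongrightarrow> v2) at_bot"
  proof -
    have "((\<lambda>x. R.defect \<Omega>1 (x + h)) \<longlongrightarrow> v1) at_bot"
      by (rule filterlim_compose[OF 1(2)])
         (simp add: filterlim_at_bot, metis (mono_tags, lifting) eventually_at_bot_linorder le_diff_eq)
    then have "((\<lambda>x. exp (\<rho> * h) * R.defect \<Omega>1 (x + h)) \<longlongrightarrow> exp (\<rho> * h) * v1) at_bot"
      by (intro tendsto_intros)
    then show ?thesis unfolding \<Omega>3_def R.defect_shift[abs_def] eh .
  qed
  obtain e B where e: "0 \<le> e" "R.mean \<noteq> 0 \<Longrightarrow> 0 < e"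
    and B: "\<And>x. \<bar>1 * tilt \<phi>2 x + (-1) * tilt \<phi>3 x\<bar> \<le> B * exp (e * x)"
    using decay_of_combination[OF s2 s3 2 d3 v3, of 1 "-1"] by auto
  have "\<phi>2 x = \<phi>3 x" for x
    by (rule unique_of_decay[OF s2 s3 e]) (use B in auto)
  then show ?thesis unfolding \<phi>3_def by blast
qed

end

context convolution_lipschitz
begin

theorem unique_modulo_shift:
  assumes "sol \<phi>1" "sol \<phi>2" "0 < \<phi>1 x1" "0 < \<phi>2 x2"
  shows "\<exists>h. \<forall>x. \<phi>2 x = \<phi>1 (x + h)"
proof -
  obtain \<rho> where "0 < \<rho>" "\<rho> \<le> \<mu>0" "nhat \<rho> = 1" "\<And>z. 0 \<le> z \<Longrightarrow> z < \<rho> \<Longrightarrow> 1 < nhat z"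
    using smallest_root by blast
  then interpret critical_exponent I k F a S C \<theta> H A \<gamma> \<mu>0 \<rho> by unfold_locales
  show ?thesis by (rule unique_up_to_shift[OF assms])
qed

end

section \<open>Green kernels and the delay law\<close>

lemma integral_half_line:
  fixes f P :: "real \<Rightarrow> real"
  assumes int: "integrable lborel (\<lambda>y. f y * indicator {x..} y)"
    and cf: "continuous_on UNIV f"
    and P: "\<And>y. (P has_real_derivative f y) (at y)"
    and Y: "filterlim Y at_top sequentially" and lim: "(\<lambda>m. P (Y m)) \<longlonglongrightarrow> 0"
  shows "(\<integral>y. f y * indicator {x..} y \<partial>lborel) = - P x"
proof -
  have [measurable]: "f \<in> borel_measurable borel" using cf by (rule borel_measurable_continuous_onI)
  have "(\<lambda>m. \<integral>y. f y * indicator {x..Y m} y \<partial>lborel) \<longlonglongrightarrow> (\<integral>y. f y * indicator {x..} y \<partial>lborel)"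
  proof (rule integral_dominated_convergence[where w="\<lambda>y. \<bar>f y * indicator {x..} y\<bar>"])
    show "integrable lborel (\<lambda>y. \<bar>f y * indicator {x..} y\<bar>)" using int by simp
    show "AE y in lborel. norm (f y * indicator {x..Y m} y) \<le> \<bar>f y * indicator {x..} y\<bar>" for m
      by (intro AE_I2) (auto simp: indicator_def)
    show "AE y in lborel. (\<lambda>m. f y * indicator {x..Y m} y) \<longlonglongrightarrow> f y * indicator {x..} y"
    proof (intro AE_I2 tendsto_eventually)
      fix y
      have "\<forall>\<^sub>F m in sequentially. y \<le> Y m" using Y by (simp add: filterlim_at_top)
      then show "\<forall>\<^sub>F m in sequentially. f y * indicator {x..Y m} y = f y * indicator {x..} y"
        by eventually_elim (auto simp: indicator_def)
    qed
  qed auto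
  moreover have "\<forall>\<^sub>F m in sequentially. (\<integral>y. f y * indicator {x..Y m} y \<partial>lborel) = P (Y m) - P x"
  proof -
    have "\<forall>\<^sub>F m in sequentially. x \<le> Y m" using Y by (simp add: filterlim_at_top)
    then show ?thesis
    proof eventually_elim
      case (elim m)
      show ?case using has_bochner_integral_FTC_Icc_real[OF elim P] cf
        by (auto simp: has_bochner_integral_iff continuous_on_eq_continuous_at)
    qed
  qed
  ultimately have "(\<lambda>m. P (Y m) - P x) \<longlonglongrightarrow> (\<integral>y. f y * indicator {x..} y \<partial>lborel)"
    by (rule Lim_transform_eventually)
  moreover have "(\<lambda>m. P (Y m) - P x) \<longlonglongrightarrow> 0 - P x" by (intro tendsto_intros lim)
  ultimately show ?thesis using LIMSEQ_unique by fastforce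
qed

lemma integrable_exp_half_line:
  fixes h :: "real \<Rightarrow> real"
  assumes r: "0 < r" and ch: "continuous_on UNIV h" and hB: "\<And>y. \<bar>h y\<bar> \<le> B"
  shows "integrable lborel (\<lambda>y. (exp (r * (x - y)) * h y) * indicator {x..} y)"
proof -
  have [measurable]: "h \<in> borel_measurable borel" using ch by (rule borel_measurable_continuous_onI)
  have nn: "(\<integral>\<^sup>+y. ennreal (exp (r * (x - y))) * indicator {x..} y \<partial>lborel) = ennreal (0 - (- exp (r * (x - x)) / r))"
  proof (rule nn_integral_FTC_atLeast[where F="\<lambda>y. - exp (r * (x - y)) / r"])
    show "((\<lambda>y. - exp (r * (x - y)) / r) has_real_derivative exp (r * (x - y))) (at y)" for y
      using r by (auto intro!: derivative_eq_intros)
    have "((\<lambda>y. - (exp (r * x) * exp (- (r * y))) / r) \<longlongrightarrow> - (exp (r * x) * 0) / r) at_top"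
      using r by (intro tendsto_intros tendsto_exp_neg_at_top) auto
    then show "((\<lambda>y. - exp (r * (x - y)) / r) \<longlongrightarrow> 0) at_top"
      by (simp add: mult_exp_exp right_diff_distrib)
  qed auto
  have "integrable lborel (\<lambda>y. exp (r * (x - y)) * indicator {x..} y)"
  proof (rule integrableI_nonneg)
    have "(\<integral>\<^sup>+y. ennreal (exp (r * (x - y)) * indicator {x..} y) \<partial>lborel) =
      (\<integral>\<^sup>+y. ennreal (exp (r * (x - y))) * indicator {x..} y \<partial>lborel)"
      by (intro nn_integral_cong) (simp add: indicator_def)
    then show "(\<integral>\<^sup>+y. ennreal (exp (r * (x - y)) * indicator {x..} y) \<partial>lborel) < \<infinity>" using nn by simp
  qed auto
  then have "integrable lborel (\<lambda>y. (exp (r * (x - y)) * indicator {x..} y) * h y)"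
    by (rule integrable_mult_bounded[OF _ _ hB]) simp
  then show ?thesis by (simp add: mult_ac)
qed

text \<open>The operator factors through the two exponents: \<open>\<phi>' - r1 * \<phi>\<close>
  solves a first-order equation with coefficient \<open>r2\<close> and right-hand side
  \<open>- h\<close>. Multiplied by the integrating factor, it tends to 0 along a sequence going to
  +infinity, and integration gives the formula.\<close>

lemma half_line_rep:
  fixes \<phi> \<phi>' \<phi>'' h :: "real \<Rightarrow> real"
  assumes r: "0 < r2"
    and d1: "\<And>x. (\<phi> has_real_derivative \<phi>' x) (at x)" and d2: "\<And>x. (\<phi>' has_real_derivative \<phi>'' x) (at x)"
    and ode: "\<And>x. \<phi>'' x - (r1 + r2) * \<phi>' x + r1 * r2 * \<phi> x = - h x"
    and \<phi>B: "\<And>x. \<bar>\<phi> x\<bar> \<le> B" and ch: "continuous_on UNIV h" and hB: "\<And>x. \<bar>h x\<bar> \<le> B'"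
  shows "(\<integral>y. (exp (r2 * (x - y)) * h y) * indicator {x..} y \<partial>lborel) = \<phi>' x - r1 * \<phi> x"
proof -
  define P where "P y = - (exp (r2 * (x - y)) * (\<phi>' y - r1 * \<phi> y))" for y
  have P': "(P has_real_derivative exp (r2 * (x - y)) * h y) (at y)" for y
  proof -
    have "(P has_real_derivative - (exp (r2 * (x - y)) * (\<phi>'' y - r1 * \<phi>' y) - r2 * exp (r2 * (x - y)) * (\<phi>' y - r1 * \<phi> y))) (at y)"
      unfolding P_def by (auto intro!: derivative_eq_intros d1 d2 simp: algebra_simps)
    also have "- (exp (r2 * (x - y)) * (\<phi>'' y - r1 * \<phi>' y) - r2 * exp (r2 * (x - y)) * (\<phi>' y - r1 * \<phi> y)) =
      - (exp (r2 * (x - y)) * (\<phi>'' y - (r1 + r2) * \<phi>' y + r1 * r2 * \<phi> y))" by (simp add: algebra_simps)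
    finally show ?thesis unfolding ode by simp
  qed
  \<comment> \<open>No bound on \<phi>' is at hand. The mean value theorem supplies points tending
    to +infinity where \<phi>' is at most \<open>2 * B\<close> in absolute value, which suffices for
    the boundary term.\<close>
  have "\<exists>y. real m < y \<and> y < real m + 1 \<and> \<phi> (real m + 1) - \<phi> (real m) = (real m + 1 - real m) * \<phi>' y" for m
    by (rule MVT2) (use d1 in auto)
  then obtain Y where Y: "\<And>m. real m < Y m" "\<And>m. \<phi> (real m + 1) - \<phi> (real m) = \<phi>' (Y m)"
    by simp metis
  have lim: "filterlim Y at_top sequentially"
    by (rule filterlim_at_top_mono[OF filterlim_real_sequentially]) (intro always_eventually allI less_imp_le Y(1))
  have "(\<lambda>m. P (Y m)) \<longlonglongrightarrow> 0"
  proof (rule Lim_null_comparison)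
    show "((\<lambda>m. exp (r2 * x) * ((2 + \<bar>r1\<bar>) * B) * exp (- (r2 * Y m))) \<longlongrightarrow> 0) sequentially"
      using filterlim_compose[OF tendsto_exp_neg_at_top[OF r] lim] by (rule tendsto_mult_right_zero)
    show "\<forall>\<^sub>F m in sequentially. norm (P (Y m)) \<le> exp (r2 * x) * ((2 + \<bar>r1\<bar>) * B) * exp (- (r2 * Y m))"
    proof (intro always_eventually allI)
      fix m
      have "\<bar>\<phi>' (Y m)\<bar> \<le> 2 * B" using Y(2)[of m] \<phi>B[of "real m"] \<phi>B[of "real m + 1"] by linarith
      moreover have "\<bar>r1 * \<phi> (Y m)\<bar> \<le> \<bar>r1\<bar> * B" unfolding abs_mult using \<phi>B by (intro mult_left_mono) auto
      ultimately have "\<bar>\<phi>' (Y m) - r1 * \<phi> (Y m)\<bar> \<le> (2 + \<bar>r1\<bar>) * B" unfolding distrib_right by linarith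
      then have le: "exp (r2 * (x - Y m)) * \<bar>\<phi>' (Y m) - r1 * \<phi> (Y m)\<bar> \<le> exp (r2 * (x - Y m)) * ((2 + \<bar>r1\<bar>) * B)"
        by (intro mult_left_mono) auto
      have "norm (P (Y m)) = exp (r2 * (x - Y m)) * \<bar>\<phi>' (Y m) - r1 * \<phi> (Y m)\<bar>"
        by (simp add: P_def abs_mult)
      also note le
      also have "exp (r2 * (x - Y m)) * ((2 + \<bar>r1\<bar>) * B) = exp (r2 * x) * exp (- (r2 * Y m)) * ((2 + \<bar>r1\<bar>) * B)"
        by (simp add: mult_exp_exp right_diff_distrib)
      also have "\<dots> = exp (r2 * x) * ((2 + \<bar>r1\<bar>) * B) * exp (- (r2 * Y m))" by (simp only: mult_ac)
      finally show "norm (P (Y m)) \<le> exp (r2 * x) * ((2 + \<bar>r1\<bar>) * B) * exp (- (r2 * Y m))" .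
    qed
  qed
  then have "(\<integral>y. (exp (r2 * (x - y)) * h y) * indicator {x..} y \<partial>lborel) = - P x"
    by (intro integral_half_line[OF _ _ P' lim] integrable_exp_half_line[OF r ch hB] continuous_intros ch)
  then show ?thesis by (simp add: P_def)
qed

section \<open>Green kernel of a second-order operator with roots of opposite sign\<close>

locale green_kernel =
  fixes r1 r2 :: real
  assumes r1: "r1 < 0" and r2: "0 < r2"
begin

text \<open>The decaying Green function of minus the operator with characteristic roots
  \<open>r1\<close> and \<open>r2\<close>. The minimum picks \<open>r1\<close> on the right and
  \<open>r2\<close> on the left half-line, so that continuity and the Harnack bound follow without
  case distinctions.\<close>

definition G :: "real \<Rightarrow> real" where "G x = min (exp (r1 * x)) (exp (r2 * x)) / (r2 - r1)"

lemma G_ge0: "0 \<le> x \<Longrightarrow> G x = exp (r1 * x) / (r2 - r1)"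
  using r1 r2 by (simp add: G_def min_absorb1 mult_right_mono)

lemma G_le0: "x \<le> 0 \<Longrightarrow> G x = exp (r2 * x) / (r2 - r1)"
  using r1 r2 by (simp add: G_def min_absorb2 mult_right_mono_neg)

lemma G_pos: "0 < G x"
  using r1 r2 by (simp add: G_def)

lemma G_le: "G x \<le> 1 / (r2 - r1)"
proof -
  have "min (exp (r1 * x)) (exp (r2 * x)) \<le> 1"
    using r1 r2 by (cases "0 \<le> x") (auto simp: min_le_iff_disj mult_nonpos_nonneg mult_nonneg_nonpos)
  then show ?thesis unfolding G_def using r1 r2 by (intro divide_right_mono) auto
qed

lemma G_cont: "continuous_on UNIV G"
  unfolding G_def using r1 r2 by (intro continuous_intros) auto

lemma G_meas [measurable]: "G \<in> borel_measurable borel"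
  by (rule borel_measurable_continuous_onI[OF G_cont])

lemma G_harnack:
  assumes t: "\<bar>t\<bar> \<le> 1"
  shows "G x \<le> exp (r2 - r1) * G (x + t)"
proof -
  have *: "exp (r * x) \<le> exp (r2 - r1) * exp (r * (x + t))" if "\<bar>r\<bar> \<le> r2 - r1" for r
  proof -
    have "\<bar>r * t\<bar> \<le> (r2 - r1) * 1" unfolding abs_mult using that t by (intro mult_mono) auto
    then have "- (r * t) \<le> r2 - r1" by (simp add: abs_le_iff)
    then show ?thesis by (simp add: mult_exp_exp distrib_left)
  qed
  have "min (exp (r1 * x)) (exp (r2 * x)) \<le> min (exp (r2 - r1) * exp (r1 * (x + t))) (exp (r2 - r1) * exp (r2 * (x + t)))"
    using *[of r1] *[of r2] r1 r2 by (intro min.mono) auto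
  also have "\<dots> = exp (r2 - r1) * min (exp (r1 * (x + t))) (exp (r2 * (x + t)))"
    by (simp add: min_mult_distrib_left)
  finally have "G x \<le> exp (r2 - r1) * min (exp (r1 * (x + t))) (exp (r2 * (x + t))) / (r2 - r1)"
    unfolding G_def using r1 r2 by (intro divide_right_mono) auto
  then show ?thesis by (simp add: G_def)
qed

lemma G_transform:
  assumes z: "r1 < z" "z < r2"
  shows "(\<integral>\<^sup>+x. ennreal (G x * exp (- (z * x))) \<partial>lborel) = ennreal (1 / ((z - r1) * (r2 - z)))"
proof -
  have m: "0 < r2 - r1" using r1 r2 by simp
  have "(\<integral>\<^sup>+x. ennreal (G x * exp (- (z * x))) \<partial>lborel) =
    (\<integral>\<^sup>+x. ennreal (1 / (r2 - r1)) * (ennreal (exp ((r2 - z) * x)) * indicator {..0} x) +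
         ennreal (1 / (r2 - r1)) * (ennreal (exp (- (z - r1) * x)) * indicator {0..} x) \<partial>lborel)"
  proof (rule nn_integral_cong_AE)
    have "AE x in lborel. x \<noteq> (0::real)" by (rule AE_lborel_singleton)
    then show "AE x in lborel. ennreal (G x * exp (- (z * x))) =
        ennreal (1 / (r2 - r1)) * (ennreal (exp ((r2 - z) * x)) * indicator {..0} x) +
        ennreal (1 / (r2 - r1)) * (ennreal (exp (- (z - r1) * x)) * indicator {0..} x)"
    proof eventually_elim
      case (elim x)
      show ?case
      proof (cases "x < 0")
        case True
        have "G x * exp (- (z * x)) = 1 / (r2 - r1) * exp ((r2 - z) * x)"
          using True by (simp add: G_le0 mult_exp_exp algebra_simps)
        then show ?thesis using True m by (simp add: ennreal_mult'[symmetric])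
      next
        case False
        then have x: "0 < x" using elim by simp
        have "G x * exp (- (z * x)) = 1 / (r2 - r1) * exp (- (z - r1) * x)"
          using x by (simp add: G_ge0 mult_exp_exp algebra_simps)
        then show ?thesis using x m by (simp add: ennreal_mult'[symmetric])
      qed
    qed
  qed
  also have "\<dots> = ennreal (1 / (r2 - r1)) * (\<integral>\<^sup>+x. ennreal (exp ((r2 - z) * x)) * indicator {..0} x \<partial>lborel) +
     ennreal (1 / (r2 - r1)) * (\<integral>\<^sup>+x. ennreal (exp (- (z - r1) * x)) * indicator {0..} x \<partial>lborel)"
    by (subst nn_integral_add) (auto simp: nn_integral_cmult)
  also have "(\<integral>\<^sup>+x. ennreal (exp (- (z - r1) * x)) * indicator {0..} x \<partial>lborel) =
     (\<integral>\<^sup>+x. ennreal (exp ((z - r1) * x)) * indicator {..0} x \<partial>lborel)"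
    by (subst nn_integral_real_affine[of _ "-1" 0]) (auto simp: indicator_def algebra_simps intro!: nn_integral_cong)
  also have "\<dots> = ennreal (1 / (z - r1))" using z by (intro nn_integral_exp_atMost) auto
  also have "(\<integral>\<^sup>+x. ennreal (exp ((r2 - z) * x)) * indicator {..0} x \<partial>lborel) = ennreal (1 / (r2 - z))"
    using z by (intro nn_integral_exp_atMost) auto
  also have "ennreal (1 / (r2 - r1)) * ennreal (1 / (r2 - z)) + ennreal (1 / (r2 - r1)) * ennreal (1 / (z - r1)) =
     ennreal (1 / (r2 - r1) * (1 / (r2 - z)) + 1 / (r2 - r1) * (1 / (z - r1)))"
    using z m by (simp add: ennreal_mult'[symmetric] ennreal_plus[symmetric] del: ennreal_plus)
  also have "1 / (r2 - r1) * (1 / (r2 - z)) + 1 / (r2 - r1) * (1 / (z - r1)) = 1 / ((z - r1) * (r2 - z))"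
    using z m by (simp add: divide_simps)
  finally show ?thesis .
qed

text \<open>At its own rate \<open>r2\<close> the integrand is constant on the left half-line. This
  is the divergence that excludes waves whose decay would have to be faster.\<close>

lemma G_transform_infinite: "(\<integral>\<^sup>+x. ennreal (G x * exp (- (r2 * x))) * indicator {..0} x \<partial>lborel) = \<infinity>"
proof -
  have m: "0 < r2 - r1" using r1 r2 by simp
  have "ennreal (real m * (1 / (r2 - r1))) \<le> (\<integral>\<^sup>+x. ennreal (G x * exp (- (r2 * x))) * indicator {..0} x \<partial>lborel)" for m
  proof -
    have "ennreal (real m * (1 / (r2 - r1))) = (\<integral>\<^sup>+x. ennreal (1 / (r2 - r1)) * indicator {- real m..0} x \<partial>lborel)"
      by (simp add: nn_integral_cmult_indicator ennreal_mult'[symmetric] mult.commute)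
    also have "\<dots> \<le> (\<integral>\<^sup>+x. ennreal (G x * exp (- (r2 * x))) * indicator {..0} x \<partial>lborel)"
    proof (rule nn_integral_mono)
      fix x
      have "x \<le> 0 \<Longrightarrow> G x * exp (- (r2 * x)) = 1 / (r2 - r1)" by (simp add: G_le0 mult_exp_exp)
      then show "ennreal (1 / (r2 - r1)) * indicator {- real m..0} x \<le> ennreal (G x * exp (- (r2 * x))) * indicator {..0} x"
        by (auto simp: indicator_def)
    qed
    finally show ?thesis .
  qed
  then have up: "\<And>m. ennreal (real m * (1 / (r2 - r1))) \<le> (\<integral>\<^sup>+x. ennreal (G x * exp (- (r2 * x))) * indicator {..0} x \<partial>lborel)" .
  show ?thesis
  proof (rule ccontr)
    assume "\<not> ?thesis"
    then obtain y where y: "(\<integral>\<^sup>+x. ennreal (G x * exp (- (r2 * x))) * indicator {..0} x \<partial>lborel) = ennreal y" "0 \<le> y"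
      by (cases "\<integral>\<^sup>+x. ennreal (G x * exp (- (r2 * x))) * indicator {..0} x \<partial>lborel") auto
    have le: "real m * (1 / (r2 - r1)) \<le> y" for m
      using up[of m] y(2) unfolding y(1) by (subst (asm) ennreal_le_iff) auto
    obtain m0 :: nat where m0: "y * (r2 - r1) < real m0" using reals_Archimedean2 by blast
    have "real m0 \<le> y * (r2 - r1)" using le[of m0] m by (simp add: field_simps)
    with m0 show False by simp
  qed
qed

lemma G_int: "integrable lborel G"
proof (rule integrableI_nonneg)
  show "(\<integral>\<^sup>+x. ennreal (G x) \<partial>lborel) < \<infinity>"
    using G_transform[of 0] r1 r2 by simp
qed (use G_pos in \<open>auto intro: less_imp_le\<close>)

text \<open>The integral splits at \<open>x\<close>. The right half is \<open>half_line_rep\<close>;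
  the left half is the same lemma for the reflected function, and in the sum the two occurrences of
  \<phi>' cancel.\<close>

lemma G_rep:
  fixes \<phi> \<phi>' \<phi>'' h :: "real \<Rightarrow> real"
  assumes d1: "\<And>x. (\<phi> has_real_derivative \<phi>' x) (at x)" and d2: "\<And>x. (\<phi>' has_real_derivative \<phi>'' x) (at x)"
    and ode: "\<And>x. \<phi>'' x - (r1 + r2) * \<phi>' x + r1 * r2 * \<phi> x = - h x"
    and \<phi>B: "\<And>x. \<bar>\<phi> x\<bar> \<le> B" and ch: "continuous_on UNIV h" and hB: "\<And>x. \<bar>h x\<bar> \<le> B'"
  shows "\<phi> x = (\<integral>y. G y * h (x - y) \<partial>lborel)"
proof -
  have m: "0 < r2 - r1" using r1 r2 by simp
  have R: "(\<integral>y. (exp (r2 * (x - y)) * h y) * indicator {x..} y \<partial>lborel) = \<phi>' x - r1 * \<phi> x"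
    by (rule half_line_rep[OF r2 d1 d2 ode \<phi>B ch hB])
  have Ri: "integrable lborel (\<lambda>y. (exp (r2 * (x - y)) * h y) * indicator {x..} y)"
    by (rule integrable_exp_half_line[OF r2 ch hB])
  have ch': "continuous_on UNIV (\<lambda>y. h (- y))"
    by (intro continuous_on_compose2[OF ch] continuous_intros) auto
  \<comment> \<open>Reflection replaces the pair of roots by \<open>- r2\<close> and
    \<open>- r1\<close>, of which the latter is positive.\<close>
  have L': "(\<integral>y. (exp (- r1 * (- x - y)) * h (- y)) * indicator {- x..} y \<partial>lborel) = - \<phi>' (- (- x)) - (- r2) * \<phi> (- (- x))"
  proof (rule half_line_rep[where \<phi>="\<lambda>x. \<phi> (- x)" and \<phi>'="\<lambda>x. - \<phi>' (- x)" and \<phi>''="\<lambda>x. \<phi>'' (- x)"])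
    show "0 < - r1" using r1 by simp
    show "((\<lambda>x. \<phi> (- x)) has_real_derivative - \<phi>' (- x)) (at x)" for x
      using d1[of "- x"] by (simp add: DERIV_mirror)
    show "((\<lambda>x. - \<phi>' (- x)) has_real_derivative \<phi>'' (- x)) (at x)" for x
      using DERIV_minus[OF DERIV_mirror[THEN iffD1, OF d2[of "- x"]]] by simp
    show "\<phi>'' (- x) - (- r2 + - r1) * - \<phi>' (- x) + - r2 * - r1 * \<phi> (- x) = - h (- x)" for x
      using ode[of "- x"] by (simp add: algebra_simps)
  qed (use \<phi>B ch' hB in auto)
  have Li': "integrable lborel (\<lambda>y. (exp (- r1 * (- x - y)) * h (- y)) * indicator {- x..} y)"
    by (rule integrable_exp_half_line[OF _ ch' hB]) (use r1 in simp)
  have Leq: "(exp (- r1 * (- x - (0 + -1 * y))) * h (- (0 + -1 * y))) * indicator {- x..} (0 + -1 * y) =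
    (exp (r1 * (x - y)) * h y) * indicator {..x} y" for y
    by (auto simp: indicator_def algebra_simps)
  have L: "(\<integral>y. (exp (r1 * (x - y)) * h y) * indicator {..x} y \<partial>lborel) = - \<phi>' x + r2 * \<phi> x"
  proof -
    have "(\<integral>y. (exp (- r1 * (- x - y)) * h (- y)) * indicator {- x..} y \<partial>lborel) =
      \<bar>-1\<bar> *\<^sub>R (\<integral>y. (exp (- r1 * (- x - (0 + -1 * y))) * h (- (0 + -1 * y))) * indicator {- x..} (0 + -1 * y) \<partial>lborel)"
      by (rule lborel_integral_real_affine) simp
    then show ?thesis using L' unfolding Leq by simp
  qed
  have Li: "integrable lborel (\<lambda>y. (exp (r1 * (x - y)) * h y) * indicator {..x} y)"
    using lborel_integrable_real_affine[OF Li', of "-1" 0] unfolding Leq by simp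
  have [measurable]: "h \<in> borel_measurable borel" using ch by (rule borel_measurable_continuous_onI)
  have "(\<integral>y. G y * h (x - y) \<partial>lborel) = (\<integral>u. G (x - u) * h u \<partial>lborel)" by (rule conv_swap)
  also have "\<dots> = (\<integral>u. ((exp (r2 * (x - u)) * h u) * indicator {x..} u + (exp (r1 * (x - u)) * h u) * indicator {..x} u) / (r2 - r1) \<partial>lborel)"
  proof (rule integral_cong_AE)
    have "AE u in lborel. u \<noteq> x" by (rule AE_lborel_singleton)
    then show "AE u in lborel. G (x - u) * h u =
      ((exp (r2 * (x - u)) * h u) * indicator {x..} u + (exp (r1 * (x - u)) * h u) * indicator {..x} u) / (r2 - r1)"
    proof eventually_elim
      case (elim u)
      then show ?case
        by (cases "u < x") (auto simp: G_ge0 G_le0 indicator_def)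
    qed
  qed auto
  also have "\<dots> = ((\<phi>' x - r1 * \<phi> x) + (- \<phi>' x + r2 * \<phi> x)) / (r2 - r1)"
    using Ri Li by (simp add: R L)
  also have "\<dots> = \<phi> x" using m by (simp add: field_simps)
  finally show ?thesis by simp
qed

end

section \<open>Green kernel convolved with a probability law\<close>

lemma continuous_integral_shift:
  fixes B :: "real \<Rightarrow> real" and p :: "'b \<Rightarrow> real"
  assumes M: "finite_measure M" and [measurable]: "p \<in> borel_measurable M"
    and cB: "continuous_on UNIV B" and BB: "\<And>x. \<bar>B x\<bar> \<le> b"
  shows "continuous_on UNIV (\<lambda>x. \<integral>r. B (x - p r) \<partial>M)"
  unfolding continuous_on_sequentially
proof (intro ballI allI impI)
  interpret finite_measure M by (rule M)
  have [measurable]: "B \<in> borel_measurable borel" using cB by (rule borel_measurable_continuous_onI)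
  fix X and x :: real assume X: "(\<forall>m. X m \<in> UNIV) \<and> X \<longlonglongrightarrow> x"
  have "(\<lambda>m. \<integral>r. B (X m - p r) \<partial>M) \<longlonglongrightarrow> (\<integral>r. B (x - p r) \<partial>M)"
  proof (rule integral_dominated_convergence[where w="\<lambda>_. b"])
    show "AE r in M. (\<lambda>m. B (X m - p r)) \<longlonglongrightarrow> B (x - p r)"
    proof (intro AE_I2)
      fix r
      have "isCont B (x - p r)" using cB by (simp add: continuous_on_eq_continuous_at)
      moreover have "(\<lambda>m. X m - p r) \<longlonglongrightarrow> x - p r" using X by (intro tendsto_intros) auto
      ultimately show "(\<lambda>m. B (X m - p r)) \<longlonglongrightarrow> B (x - p r)" by (rule isCont_tendsto_compose)
    qed
  qed (use BB in auto)
  then show "((\<lambda>x. \<integral>r. B (x - p r) \<partial>M) \<circ> X) \<longlonglongrightarrow> (\<integral>r. B (x - p r) \<partial>M)" by (simp add: o_def)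
qed

lemma real_eq_of_ennreal: "ennreal x = ennreal y \<Longrightarrow> 0 \<le> x \<Longrightarrow> 0 \<le> y \<Longrightarrow> x = y"
  by simp

locale green_law = green_kernel r1 r2 + prob_space \<nu> for r1 r2 and \<nu> :: "real measure" +
  assumes sets_\<nu> [measurable_cong]: "sets \<nu> = sets borel"
begin

definition Gn :: "real \<Rightarrow> real" where "Gn x = (\<integral>s. G (x - s) \<partial>\<nu>)"

lemma G_shift_int: "integrable \<nu> (\<lambda>s. G (x - s))"
proof (rule integrable_const_bound[where B="1 / (r2 - r1)"])
  show "AE s in \<nu>. norm (G (x - s)) \<le> 1 / (r2 - r1)"
    using G_pos G_le by (auto simp: less_imp_le)
qed measurable

lemma Gn_cont: "continuous_on UNIV Gn"
  unfolding Gn_def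
proof (rule continuous_integral_shift[where p="\<lambda>s. s" and b="1 / (r2 - r1)"])
  show "finite_measure \<nu>" by unfold_locales
  show "\<bar>G x\<bar> \<le> 1 / (r2 - r1)" for x using G_pos[of x] G_le[of x] by simp
qed (use G_cont in auto)

lemma Gn_meas [measurable]: "Gn \<in> borel_measurable borel"
  by (rule borel_measurable_continuous_onI[OF Gn_cont])

lemma Gn_nn: "ennreal (Gn x) = (\<integral>\<^sup>+s. ennreal (G (x - s)) \<partial>\<nu>)"
  unfolding Gn_def using G_shift_int G_pos by (intro nn_integral_eq_integral[symmetric]) (auto intro: less_imp_le)

lemma Gn_nonneg: "0 \<le> Gn x"
  unfolding Gn_def using G_pos by (intro Bochner_Integration.integral_nonneg) (auto intro: less_imp_le)

lemma Gn_pos: "0 < Gn x"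
proof (rule ccontr)
  assume "\<not> ?thesis"
  then have "(\<integral>s. G (x - s) \<partial>\<nu>) = 0" using Gn_nonneg[of x] by (simp add: Gn_def)
  then have "AE s in \<nu>. G (x - s) = 0"
    using integral_nonneg_eq_0_iff_AE[OF G_shift_int[of x]] G_pos by (auto intro: less_imp_le)
  then have "AE s in \<nu>. False" by eventually_elim (metis G_pos less_irrefl)
  then show False using AE_False emeasure_space_1 by auto
qed

lemma Gn_harnack:
  assumes "\<bar>t\<bar> \<le> 1"
  shows "Gn x \<le> exp (r2 - r1) * Gn (x + t)"
proof -
  have "Gn x \<le> (\<integral>s. exp (r2 - r1) * G (x + t - s) \<partial>\<nu>)"
    unfolding Gn_def
  proof (rule integral_mono[OF G_shift_int])
    show "integrable \<nu> (\<lambda>s. exp (r2 - r1) * G (x + t - s))" using G_shift_int by simp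
    show "G (x - s) \<le> exp (r2 - r1) * G (x + t - s)" for s
      using G_harnack[OF assms, of "x - s"] by (simp add: algebra_simps)
  qed
  then show ?thesis by (simp add: Gn_def)
qed

lemma Gn_transform:
  "(\<integral>\<^sup>+x. ennreal (Gn x * exp (- (z * x))) \<partial>lborel) =
   (\<integral>\<^sup>+x. ennreal (G x * exp (- (z * x))) \<partial>lborel) * (\<integral>\<^sup>+s. ennreal (exp (- (z * s))) \<partial>\<nu>)"
proof -
  interpret pair_sigma_finite lborel \<nu> by unfold_locales
  have "(\<integral>\<^sup>+x. ennreal (Gn x * exp (- (z * x))) \<partial>lborel) =
    (\<integral>\<^sup>+x. (\<integral>\<^sup>+s. ennreal (G (x - s)) * ennreal (exp (- (z * x))) \<partial>\<nu>) \<partial>lborel)"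
    by (intro nn_integral_cong) (simp add: ennreal_mult Gn_nonneg Gn_nn nn_integral_multc)
  also have "\<dots> = (\<integral>\<^sup>+s. (\<integral>\<^sup>+x. ennreal (G (x - s)) * ennreal (exp (- (z * x))) \<partial>lborel) \<partial>\<nu>)"
    by (rule Fubini'[symmetric]) measurable
  also have "\<dots> = (\<integral>\<^sup>+s. (\<integral>\<^sup>+x. ennreal (G x * exp (- (z * x))) \<partial>lborel) * ennreal (exp (- (z * s))) \<partial>\<nu>)"
  proof (rule nn_integral_cong)
    fix s
    have "(\<integral>\<^sup>+x. ennreal (G (x - s)) * ennreal (exp (- (z * x))) \<partial>lborel) =
      (\<integral>\<^sup>+x. ennreal (G (s + 1 * x - s)) * ennreal (exp (- (z * (s + 1 * x)))) \<partial>lborel)"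
      by (subst nn_integral_real_affine[of _ 1 s]) auto
    also have "\<dots> = (\<integral>\<^sup>+x. ennreal (G x * exp (- (z * x))) * ennreal (exp (- (z * s))) \<partial>lborel)"
    proof (rule nn_integral_cong)
      fix x
      have "exp (- (z * (s + 1 * x))) = exp (- (z * x)) * exp (- (z * s))" by (simp add: mult_exp_exp algebra_simps)
      then show "ennreal (G (s + 1 * x - s)) * ennreal (exp (- (z * (s + 1 * x)))) =
        ennreal (G x * exp (- (z * x))) * ennreal (exp (- (z * s)))"
        using G_pos[of x] by (simp add: ennreal_mult less_imp_le mult.assoc)
    qed
    also have "\<dots> = (\<integral>\<^sup>+x. ennreal (G x * exp (- (z * x))) \<partial>lborel) * ennreal (exp (- (z * s)))"
      by (rule nn_integral_multc) measurable
    finally show "(\<integral>\<^sup>+x. ennreal (G (x - s)) * ennreal (exp (- (z * x))) \<partial>lborel) =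
      (\<integral>\<^sup>+x. ennreal (G x * exp (- (z * x))) \<partial>lborel) * ennreal (exp (- (z * s)))" .
  qed
  also have "\<dots> = (\<integral>\<^sup>+x. ennreal (G x * exp (- (z * x))) \<partial>lborel) * (\<integral>\<^sup>+s. ennreal (exp (- (z * s))) \<partial>\<nu>)"
    by (rule nn_integral_cmult) measurable
  finally show ?thesis .
qed

lemma Gn_int: "integrable lborel Gn"
proof (rule integrableI_nonneg)
  show "(\<integral>\<^sup>+x. ennreal (Gn x) \<partial>lborel) < \<infinity>"
    using Gn_transform[of 0] G_transform[of 0] r1 r2 by (simp add: emeasure_space_1)
qed (use Gn_nonneg in auto)

text \<open>Moves the averaging from the nonlinear term into the kernel. All quantities are
  nonnegative, so the exchange of integrals is done in \<open>ennreal\<close> and both sides are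
  compared there.\<close>

lemma G_conv_law:
  assumes [measurable]: "B \<in> borel_measurable borel" and B0: "\<And>x. 0 \<le> B x" and Bb: "\<And>x. B x \<le> b"
  shows "(\<integral>y. G y * (\<integral>s. B (x - y - s) \<partial>\<nu>) \<partial>lborel) = (\<integral>y. Gn y * B (x - y) \<partial>lborel)"
proof (rule real_eq_of_ennreal)
  interpret pair_sigma_finite lborel \<nu> by unfold_locales
  have Bi: "integrable \<nu> (\<lambda>s. B (u - s))" for u
    by (rule integrable_const_bound[where B=b]) (use B0 Bb in auto)
  have Bnn: "ennreal (\<integral>s. B (u - s) \<partial>\<nu>) = (\<integral>\<^sup>+s. ennreal (B (u - s)) \<partial>\<nu>)" for u
    using Bi B0 by (intro nn_integral_eq_integral[symmetric]) auto
  have N0: "0 \<le> (\<integral>s. B (u - s) \<partial>\<nu>)" for u using B0 by (intro Bochner_Integration.integral_nonneg) auto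
  have Nb: "(\<integral>s. B (u - s) \<partial>\<nu>) \<le> b" for u
  proof -
    have "(\<integral>s. B (u - s) \<partial>\<nu>) \<le> (\<integral>s. b \<partial>\<nu>)" using Bi Bb by (intro integral_mono) auto
    then show ?thesis by (simp add: prob_space)
  qed
  have [measurable]: "(\<lambda>u. \<integral>s. B (u - s) \<partial>\<nu>) \<in> borel_measurable borel" by measurable
  have "ennreal (\<integral>y. G y * (\<integral>s. B (x - y - s) \<partial>\<nu>) \<partial>lborel) = (\<integral>\<^sup>+y. ennreal (G y * (\<integral>s. B (x - y - s) \<partial>\<nu>)) \<partial>lborel)"
  proof (rule nn_integral_eq_integral[symmetric])
    show "integrable lborel (\<lambda>y. G y * (\<integral>s. B (x - y - s) \<partial>\<nu>))"
      by (rule integrable_mult_bounded[OF G_int, where B=b]) (use N0 Nb in auto)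
  qed (use G_pos N0 in \<open>auto intro: less_imp_le mult_nonneg_nonneg\<close>)
  also have "\<dots> = (\<integral>\<^sup>+y. (\<integral>\<^sup>+s. ennreal (G y) * ennreal (B (x - y - s)) \<partial>\<nu>) \<partial>lborel)"
    using G_pos N0 by (intro nn_integral_cong) (simp add: ennreal_mult less_imp_le Bnn nn_integral_cmult)
  also have "\<dots> = (\<integral>\<^sup>+s. (\<integral>\<^sup>+y. ennreal (G y) * ennreal (B (x - y - s)) \<partial>lborel) \<partial>\<nu>)"
    by (rule Fubini'[symmetric]) measurable
  also have "\<dots> = (\<integral>\<^sup>+s. (\<integral>\<^sup>+u. ennreal (G (u - s)) * ennreal (B (x - u)) \<partial>lborel) \<partial>\<nu>)"
  proof (rule nn_integral_cong)
    fix s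
    show "(\<integral>\<^sup>+y. ennreal (G y) * ennreal (B (x - y - s)) \<partial>lborel) = (\<integral>\<^sup>+u. ennreal (G (u - s)) * ennreal (B (x - u)) \<partial>lborel)"
      by (subst nn_integral_real_affine[of _ 1 "- s"]) (auto intro!: nn_integral_cong simp: algebra_simps)
  qed
  also have "\<dots> = (\<integral>\<^sup>+u. (\<integral>\<^sup>+s. ennreal (G (u - s)) * ennreal (B (x - u)) \<partial>\<nu>) \<partial>lborel)"
    by (rule Fubini') measurable
  also have "\<dots> = (\<integral>\<^sup>+u. ennreal (Gn u * B (x - u)) \<partial>lborel)"
    using B0 by (intro nn_integral_cong) (simp add: ennreal_mult Gn_nonneg Gn_nn nn_integral_multc)
  also have "\<dots> = ennreal (\<integral>y. Gn y * B (x - y) \<partial>lborel)"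
  proof (rule nn_integral_eq_integral)
    show "integrable lborel (\<lambda>y. Gn y * B (x - y))"
      by (rule integrable_mult_bounded[OF Gn_int, where B=b]) (use B0 Bb in auto)
  qed (use Gn_nonneg B0 in auto)
  finally show "ennreal (\<integral>y. G y * (\<integral>s. B (x - y - s) \<partial>\<nu>) \<partial>lborel) = ennreal (\<integral>y. Gn y * B (x - y) \<partial>lborel)" .
  show "0 \<le> (\<integral>y. G y * (\<integral>s. B (x - y - s) \<partial>\<nu>) \<partial>lborel)"
    using G_pos N0 by (intro Bochner_Integration.integral_nonneg) (auto intro: less_imp_le mult_nonneg_nonneg)
  show "0 \<le> (\<integral>y. Gn y * B (x - y) \<partial>lborel)"
    using Gn_nonneg B0 by (intro Bochner_Integration.integral_nonneg) auto
qed

end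

section \<open>The joint law of dispersal, relaxation and delay\<close>

locale delay_data =
  fixes \<alpha> c :: real and K :: "real \<Rightarrow> real" and P :: "real measure"
  assumes \<alpha>: "0 < \<alpha>" and K_int: "integrable lborel K" and K_nonneg: "AE w in lborel. 0 \<le> K w"
    and K_mass: "(\<integral>w. K w \<partial>lborel) = 1"
    and P_prob: "prob_space P" and sets_P [measurable_cong, simp]: "sets P = sets borel"
begin

lemma K_meas [measurable]: "K \<in> borel_measurable borel"
  using K_int by auto

definition kern :: "real measure" where "kern = density lborel (\<lambda>w. ennreal (K w))"
definition expo :: "real measure" where "expo = density lborel (\<lambda>s. ennreal (exponential_density \<alpha> s))"

lemma sets_kern [measurable_cong, simp]: "sets kern = sets borel" by (simp add: kern_def)
lemma sets_expo [measurable_cong, simp]: "sets expo = sets borel" by (simp add: expo_def)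

lemma prob_kern: "prob_space kern"
proof
  have "(\<integral>\<^sup>+w. ennreal (K w) \<partial>lborel) = ennreal 1"
    using nn_integral_eq_integral[OF K_int K_nonneg] K_mass by simp
  then show "emeasure kern (space kern) = 1" by (simp add: kern_def emeasure_density)
qed

lemma prob_expo: "prob_space expo"
  unfolding expo_def by (rule prob_space_exponential_density[OF \<alpha>])

text \<open>The law of \<open>W + c (E + R)\<close> for independent \<open>W\<close>, \<open>E\<close>, \<open>R\<close> with densities \<open>K\<close> and \<open>\<alpha> exp (- \<alpha> s)\<close> and law \<open>P\<close>:
  eliminating \<open>\<psi>\<close> from the profile equations turns the nonlocal term into a convolution with it.\<close>

definition law :: "real measure" where
  "law = distr (kern \<Otimes>\<^sub>M (expo \<Otimes>\<^sub>M P)) borel (\<lambda>(w, s, r). w + c * (s + r))"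

lemma shift_meas [measurable]: "(\<lambda>(w, s, r). w + c * (s + r)) \<in> borel_measurable (kern \<Otimes>\<^sub>M (expo \<Otimes>\<^sub>M P))"
  by measurable

lemma prob_law: "prob_space law"
proof -
  interpret K: prob_space kern by (rule prob_kern)
  interpret E: prob_space expo by (rule prob_expo)
  interpret P: prob_space P by (rule P_prob)
  interpret EP: pair_prob_space expo P ..
  interpret KEP: pair_prob_space kern "expo \<Otimes>\<^sub>M P" ..
  show ?thesis unfolding law_def by (rule KEP.prob_space_distr) (rule shift_meas)
qed

lemma sets_law [measurable_cong, simp]: "sets law = sets borel" by (simp add: law_def)

lemma law_nn:
  assumes [measurable]: "h \<in> borel_measurable borel"
  shows "(\<integral>\<^sup>+u. h u \<partial>law) =
    (\<integral>\<^sup>+w. ennreal (K w) * (\<integral>\<^sup>+s. ennreal (exponential_density \<alpha> s) * (\<integral>\<^sup>+r. h (w + c * (s + r)) \<partial>P) \<partial>lborel) \<partial>lborel)"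
proof -
  interpret K: prob_space kern by (rule prob_kern)
  interpret E: prob_space expo by (rule prob_expo)
  interpret P: prob_space P by (rule P_prob)
  interpret EP: pair_prob_space expo P ..
  have [measurable]: "(\<lambda>(w, s, r). h (w + c * (s + r))) \<in> borel_measurable (kern \<Otimes>\<^sub>M (expo \<Otimes>\<^sub>M P))"
    by measurable
  have "(\<integral>\<^sup>+u. h u \<partial>law) = (\<integral>\<^sup>+p. h ((\<lambda>(w, s, r). w + c * (s + r)) p) \<partial>(kern \<Otimes>\<^sub>M (expo \<Otimes>\<^sub>M P)))"
    unfolding law_def by (rule nn_integral_distr) measurable
  also have "\<dots> = (\<integral>\<^sup>+w. (\<integral>\<^sup>+q. h ((\<lambda>(w, s, r). w + c * (s + r)) (w, q)) \<partial>(expo \<Otimes>\<^sub>M P)) \<partial>kern)"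
    by (rule EP.nn_integral_fst[symmetric]) measurable
  also have "\<dots> = (\<integral>\<^sup>+w. (\<integral>\<^sup>+s. (\<integral>\<^sup>+r. h (w + c * (s + r)) \<partial>P) \<partial>expo) \<partial>kern)"
  proof (rule nn_integral_cong)
    fix w
    show "(\<integral>\<^sup>+q. h ((\<lambda>(w, s, r). w + c * (s + r)) (w, q)) \<partial>(expo \<Otimes>\<^sub>M P)) = (\<integral>\<^sup>+s. (\<integral>\<^sup>+r. h (w + c * (s + r)) \<partial>P) \<partial>expo)"
      by (subst P.nn_integral_fst[symmetric]) (auto simp: split_beta')
  qed
  also have "\<dots> = (\<integral>\<^sup>+w. ennreal (K w) * (\<integral>\<^sup>+s. (\<integral>\<^sup>+r. h (w + c * (s + r)) \<partial>P) \<partial>expo) \<partial>lborel)"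
    unfolding kern_def by (rule nn_integral_density) measurable
  also have "\<dots> = (\<integral>\<^sup>+w. ennreal (K w) * (\<integral>\<^sup>+s. ennreal (exponential_density \<alpha> s) * (\<integral>\<^sup>+r. h (w + c * (s + r)) \<partial>P) \<partial>lborel) \<partial>lborel)"
    unfolding expo_def by (subst nn_integral_density) measurable
  finally show ?thesis .
qed

lemma exponential_density_eq: "exponential_density \<alpha> s = \<alpha> * exp (- (\<alpha> * s)) * indicator {0..} s"
  by (simp add: exponential_density_def indicator_def mult.commute)

lemma expo_int: "integrable lborel (\<lambda>s. exp (- (\<alpha> * s)) * indicator {0..} s)"
  using integrable_exp_half_line[OF \<alpha>, of "\<lambda>_. 1" 1 0] by simp

text \<open>The formula for \<psi> integrates over an exponential waiting time with density \<alpha>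
  exp (- \<alpha> s), up to the factor \<alpha>; this is the origin of the division by \<alpha>.
  Together with the delay and the dispersal kernel it becomes one expectation under
  \<open>law\<close>.\<close>

lemma nonlocal_term:
  assumes ch: "continuous_on UNIV h" and h0: "\<And>x. 0 \<le> h x" and hb: "\<And>x. h x \<le> b"
    and [measurable]: "\<psi> \<in> borel_measurable borel" and \<psi>b: "\<And>x. \<bar>\<psi> x\<bar> \<le> b'"
    and \<psi>: "\<And>y. \<psi> y = (\<integral>s. (exp (- (\<alpha> * s)) * (\<integral>r. h (y - c * s - c * r) \<partial>P)) * indicator {0..} s \<partial>lborel)"
  shows "(\<integral>y. K (x - y) * \<psi> y \<partial>lborel) = (\<integral>u. h (x - u) / \<alpha> \<partial>law)"
proof (rule real_eq_of_ennreal)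
  interpret P: prob_space P by (rule P_prob)
  interpret L: prob_space law by (rule prob_law)
  have [measurable]: "h \<in> borel_measurable borel" using ch by (rule borel_measurable_continuous_onI)
  define g where "g y = (\<integral>r. h (y - c * r) \<partial>P)" for y
  have hi: "integrable P (\<lambda>r. h (y - c * r))" for y
    by (rule P.integrable_const_bound[where B=b]) (use h0 hb in auto)
  have cg: "continuous_on UNIV g" unfolding g_def
    by (rule continuous_integral_shift[where b=b]) (use ch h0 hb P.finite_measure_axioms in auto)
  have [measurable]: "g \<in> borel_measurable borel" using cg by (rule borel_measurable_continuous_onI)
  have g0: "0 \<le> g y" for y unfolding g_def using h0 by (intro Bochner_Integration.integral_nonneg) auto
  have gb: "g y \<le> b" for y
  proof -
    have "g y \<le> (\<integral>r. b \<partial>P)" unfolding g_def using hi hb by (intro integral_mono) auto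
    then show ?thesis by (simp add: P.prob_space)
  qed
  have gnn: "ennreal (g y) = (\<integral>\<^sup>+r. ennreal (h (y - c * r)) \<partial>P)" for y
    unfolding g_def using hi h0 by (intro nn_integral_eq_integral[symmetric]) auto
  have \<psi>eq: "\<psi> y = (\<integral>s. (exp (- (\<alpha> * s)) * indicator {0..} s) * g (y - c * s) \<partial>lborel)" for y
    unfolding \<psi> g_def by (simp add: mult_ac)
  have \<psi>0: "0 \<le> \<psi> y" for y unfolding \<psi>eq using g0 by (intro Bochner_Integration.integral_nonneg) auto
  have \<psi>nn: "ennreal (\<psi> y) = (\<integral>\<^sup>+s. ennreal (exp (- (\<alpha> * s)) * indicator {0..} s) * ennreal (g (y - c * s)) \<partial>lborel)" for y
  proof -
    have "integrable lborel (\<lambda>s. (exp (- (\<alpha> * s)) * indicator {0..} s) * g (y - c * s))"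
      by (rule integrable_mult_bounded[OF expo_int, where B=b]) (use g0 gb in auto)
    then have "ennreal (\<psi> y) = (\<integral>\<^sup>+s. ennreal ((exp (- (\<alpha> * s)) * indicator {0..} s) * g (y - c * s)) \<partial>lborel)"
      unfolding \<psi>eq using g0 by (intro nn_integral_eq_integral[symmetric]) auto
    then show ?thesis using g0 by (simp add: ennreal_mult)
  qed
  have "(\<integral>y. K (x - y) * \<psi> y \<partial>lborel) = (\<integral>w. K w * \<psi> (x - w) \<partial>lborel)" by (rule conv_swap[symmetric])
  also have "ennreal \<dots> = (\<integral>\<^sup>+w. ennreal (K w * \<psi> (x - w)) \<partial>lborel)"
  proof (rule nn_integral_eq_integral[symmetric])
    show "integrable lborel (\<lambda>w. K w * \<psi> (x - w))"
      by (rule integrable_mult_bounded[OF K_int, where B=b']) (use \<psi>b in auto)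
    show "AE w in lborel. 0 \<le> K w * \<psi> (x - w)" using K_nonneg by eventually_elim (simp add: \<psi>0)
  qed
  also have "\<dots> = (\<integral>\<^sup>+w. ennreal (K w) * ennreal (\<psi> (x - w)) \<partial>lborel)"
    using K_nonneg by (intro nn_integral_cong_AE, eventually_elim) (simp add: ennreal_mult \<psi>0)
  also have "\<dots> = (\<integral>\<^sup>+w. ennreal (K w) * (\<integral>\<^sup>+s. ennreal (exponential_density \<alpha> s) * (\<integral>\<^sup>+r. ennreal (h (x - (w + c * (s + r))) / \<alpha>) \<partial>P) \<partial>lborel) \<partial>lborel)"
  proof (intro nn_integral_cong arg_cong2[where f="(*)"] refl)
    fix w
    show "ennreal (\<psi> (x - w)) = (\<integral>\<^sup>+s. ennreal (exponential_density \<alpha> s) * (\<integral>\<^sup>+r. ennreal (h (x - (w + c * (s + r))) / \<alpha>) \<partial>P) \<partial>lborel)"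
      unfolding \<psi>nn
    proof (rule nn_integral_cong)
      fix s
      have "(\<integral>\<^sup>+r. ennreal (h (x - (w + c * (s + r))) / \<alpha>) \<partial>P) = (\<integral>\<^sup>+r. ennreal (inverse \<alpha>) * ennreal (h (x - w - c * s - c * r)) \<partial>P)"
        using \<alpha> by (intro nn_integral_cong) (simp add: ennreal_mult'[symmetric] divide_inverse algebra_simps)
      also have "\<dots> = ennreal (inverse \<alpha>) * ennreal (g (x - w - c * s))"
        unfolding gnn by (rule nn_integral_cmult) measurable
      finally have "ennreal (exponential_density \<alpha> s) * (\<integral>\<^sup>+r. ennreal (h (x - (w + c * (s + r))) / \<alpha>) \<partial>P) =
        ennreal (exponential_density \<alpha> s) * ennreal (inverse \<alpha>) * ennreal (g (x - w - c * s))" by (simp add: mult.assoc)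
      also have "ennreal (exponential_density \<alpha> s) * ennreal (inverse \<alpha>) = ennreal (exp (- (\<alpha> * s)) * indicator {0..} s)"
        using \<alpha> by (simp add: exponential_density_eq ennreal_mult[symmetric] field_simps)
      finally show "ennreal (exp (- (\<alpha> * s)) * indicator {0..} s) * ennreal (g (x - w - c * s)) =
        ennreal (exponential_density \<alpha> s) * (\<integral>\<^sup>+r. ennreal (h (x - (w + c * (s + r))) / \<alpha>) \<partial>P)" by simp
    qed
  qed
  also have "\<dots> = (\<integral>\<^sup>+u. ennreal (h (x - u) / \<alpha>) \<partial>law)"
    by (rule law_nn[symmetric]) measurable
  also have "\<dots> = ennreal (\<integral>u. h (x - u) / \<alpha> \<partial>law)"
  proof (rule nn_integral_eq_integral)
    show "integrable law (\<lambda>u. h (x - u) / \<alpha>)"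
    proof (rule L.integrable_const_bound[where B="b / \<alpha>"])
      show "AE u in law. norm (h (x - u) / \<alpha>) \<le> b / \<alpha>"
      proof (intro AE_I2)
        fix u show "norm (h (x - u) / \<alpha>) \<le> b / \<alpha>"
          using h0[of "x - u"] hb[of "x - u"] \<alpha> by (simp add: divide_right_mono)
      qed
    qed measurable
  qed (use h0 \<alpha> in auto)
  finally show "ennreal (\<integral>y. K (x - y) * \<psi> y \<partial>lborel) = ennreal (\<integral>u. h (x - u) / \<alpha> \<partial>law)" .
  have "0 \<le> (\<integral>w. K w * \<psi> (x - w) \<partial>lborel)"
  proof (rule integral_nonneg_AE)
    show "AE w in lborel. 0 \<le> K w * \<psi> (x - w)" using K_nonneg by eventually_elim (simp add: \<psi>0)
  qed
  then show "0 \<le> (\<integral>y. K (x - y) * \<psi> y \<partial>lborel)" by (simp add: conv_swap[where h=\<psi>])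
  show "0 \<le> (\<integral>u. h (x - u) / \<alpha> \<partial>law)" using h0 \<alpha> by (intro Bochner_Integration.integral_nonneg) auto
qed

text \<open>By independence the transform is a product of three; the exponential variable
  contributes \<alpha> / (c z + \<alpha>), finite because of \<open>cz\<close>.\<close>

lemma law_transform:
  assumes cz: "0 < c * z + \<alpha>"
  shows "(\<integral>\<^sup>+u. ennreal (exp (- (z * u))) \<partial>law) =
    ennreal (\<alpha> / (c * z + \<alpha>)) * ((\<integral>\<^sup>+r. ennreal (exp (- (z * c * r))) \<partial>P) * (\<integral>\<^sup>+w. ennreal (K w * exp (- (z * w))) \<partial>lborel))"
proof -
  have e: "exp (- (z * (w + c * (s + r)))) = exp (- (z * w)) * (exp (- (z * c * s)) * exp (- (z * c * r)))" for w s r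
    by (simp add: mult_exp_exp algebra_simps)
  define p where "p = (\<integral>\<^sup>+r. ennreal (exp (- (z * c * r))) \<partial>P)"
  define q where "q = (\<integral>\<^sup>+s. ennreal (exponential_density \<alpha> s) * ennreal (exp (- (z * c * s))) \<partial>lborel)"
  have "(\<integral>\<^sup>+u. ennreal (exp (- (z * u))) \<partial>law) =
    (\<integral>\<^sup>+w. ennreal (K w) * (\<integral>\<^sup>+s. ennreal (exponential_density \<alpha> s) * (\<integral>\<^sup>+r. ennreal (exp (- (z * (w + c * (s + r))))) \<partial>P) \<partial>lborel) \<partial>lborel)"
    by (rule law_nn) measurable
  also have "\<dots> = (\<integral>\<^sup>+w. ennreal (K w * exp (- (z * w))) * (q * p) \<partial>lborel)"
  proof (rule nn_integral_cong_AE)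
    show "AE w in lborel. ennreal (K w) * (\<integral>\<^sup>+s. ennreal (exponential_density \<alpha> s) * (\<integral>\<^sup>+r. ennreal (exp (- (z * (w + c * (s + r))))) \<partial>P) \<partial>lborel) =
      ennreal (K w * exp (- (z * w))) * (q * p)"
      using K_nonneg
    proof eventually_elim
      case (elim w)
      have "(\<integral>\<^sup>+r. ennreal (exp (- (z * (w + c * (s + r))))) \<partial>P) = ennreal (exp (- (z * w))) * ennreal (exp (- (z * c * s))) * p" for s
        unfolding p_def e by (simp add: ennreal_mult mult.assoc nn_integral_cmult)
      then have "(\<integral>\<^sup>+s. ennreal (exponential_density \<alpha> s) * (\<integral>\<^sup>+r. ennreal (exp (- (z * (w + c * (s + r))))) \<partial>P) \<partial>lborel) =
        (\<integral>\<^sup>+s. ennreal (exp (- (z * w))) * ((ennreal (exponential_density \<alpha> s) * ennreal (exp (- (z * c * s)))) * p) \<partial>lborel)"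
        by (intro nn_integral_cong) (simp add: mult_ac)
      also have "\<dots> = ennreal (exp (- (z * w))) * (q * p)"
        unfolding q_def by (simp add: nn_integral_cmult nn_integral_multc)
      finally show ?case using elim by (simp add: ennreal_mult mult.assoc)
    qed
  qed
  also have "\<dots> = (\<integral>\<^sup>+w. ennreal (K w * exp (- (z * w))) \<partial>lborel) * (q * p)" by (rule nn_integral_multc) measurable
  also have "q = ennreal (\<alpha> / (c * z + \<alpha>))"
  proof -
    have "q = (\<integral>\<^sup>+s. ennreal \<alpha> * (ennreal (exp (- ((c * z + \<alpha>) * s))) * indicator {0..} s) \<partial>lborel)"
      unfolding q_def using \<alpha>
    proof (intro nn_integral_cong)
      fix s
      have "exp (- (\<alpha> * s)) * exp (- (z * c * s)) = exp (- ((c * z + \<alpha>) * s))" by (simp add: mult_exp_exp algebra_simps)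
      then show "ennreal (exponential_density \<alpha> s) * ennreal (exp (- (z * c * s))) =
        ennreal \<alpha> * (ennreal (exp (- ((c * z + \<alpha>) * s))) * indicator {0..} s)"
        using \<alpha> by (auto simp: exponential_density_eq indicator_def ennreal_mult[symmetric] mult.assoc)
    qed
    also have "\<dots> = ennreal \<alpha> * (\<integral>\<^sup>+s. ennreal (exp (- ((c * z + \<alpha>) * s))) * indicator {0..} s \<partial>lborel)"
      by (rule nn_integral_cmult) measurable
    also have "(\<integral>\<^sup>+s. ennreal (exp (- ((c * z + \<alpha>) * s))) * indicator {0..} s \<partial>lborel) =
      (\<integral>\<^sup>+s. ennreal (exp ((c * z + \<alpha>) * s)) * indicator {..0} s \<partial>lborel)"
      by (subst nn_integral_real_affine[of _ "-1" 0]) (auto simp: indicator_def algebra_simps intro!: nn_integral_cong)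
    also have "\<dots> = ennreal (1 / (c * z + \<alpha>))" by (rule nn_integral_exp_atMost[OF cz])
    finally show ?thesis using \<alpha> cz by (simp add: ennreal_mult[symmetric])
  qed
  finally show ?thesis unfolding p_def by (simp add: mult_ac)
qed

end

section \<open>Profiles of waves of a given speed\<close>

text \<open>\<open>S\<close> bounds the waves under consideration, \<open>m\<close> and
  \<open>M\<close> bound the slopes of \<open>f\<close> on that range, \<open>p\<close> and
  \<open>q\<close> are the slopes of \<open>f\<close> and \<open>g\<close> at 0. The pair
  \<open>p\<close>, \<open>q\<close> enters \<open>\<chi>\<^sub>0\<close>, the pair
  \<open>m\<close>, \<open>L\<close> enters \<open>\<chi>\<^sub>L\<close>.\<close>

locale speed_data = delay_data \<alpha> c K P for \<alpha> c :: real and K :: "real \<Rightarrow> real" and P :: "real measure" +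
  fixes f g :: "real \<Rightarrow> real" and S C \<theta> p q m L M :: real
  assumes S_pos: "0 < S" and C_nonneg: "0 \<le> C" and \<theta>_pos: "0 < \<theta>"
    and f_zero: "f 0 = 0"
    and f_slope: "0 \<le> t \<Longrightarrow> t \<le> s \<Longrightarrow> s \<le> S \<Longrightarrow> m * (s - t) \<le> f s - f t \<and> f s - f t \<le> M * (s - t)"
    and f_lin: "0 \<le> s \<Longrightarrow> s \<le> S \<Longrightarrow> 0 \<le> t \<Longrightarrow> t \<le> S \<Longrightarrow>
      \<bar>f s - f t - p * (s - t)\<bar> \<le> C * (max s t powr \<theta>) * \<bar>s - t\<bar>"
    and g_zero: "g 0 = 0" and g_nonneg: "0 \<le> s \<Longrightarrow> s \<le> S \<Longrightarrow> 0 \<le> g s"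
    and g_Lip: "0 \<le> s \<Longrightarrow> s \<le> S \<Longrightarrow> 0 \<le> t \<Longrightarrow> t \<le> S \<Longrightarrow> \<bar>g s - g t\<bar> \<le> L * \<bar>s - t\<bar>"
    and g_lin: "0 \<le> s \<Longrightarrow> s \<le> S \<Longrightarrow> 0 \<le> t \<Longrightarrow> t \<le> S \<Longrightarrow>
      \<bar>g s - g t - q * (s - t)\<bar> \<le> C * (max s t powr \<theta>) * \<bar>s - t\<bar>"
    and slopes: "0 \<le> m" "m \<le> p" "p \<le> M" "0 < q" "q \<le> L"
begin

definition profile :: "(real \<Rightarrow> real) \<Rightarrow> bool" where
  "profile \<phi> \<longleftrightarrow> (\<forall>x. 0 \<le> \<phi> x \<and> \<phi> x \<le> S) \<and> (\<phi> \<longlongrightarrow> 0) at_bot \<and>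
     (\<exists>\<phi>' \<phi>''. (\<forall>x. (\<phi> has_real_derivative \<phi>' x) (at x)) \<and> (\<forall>x. (\<phi>' has_real_derivative \<phi>'' x) (at x)) \<and>
        (\<forall>x. \<phi>'' x - c * \<phi>' x - f (\<phi> x) + (\<integral>u. g (\<phi> (x - u)) / \<alpha> \<partial>law) = 0))"

definition law_mgf :: "real \<Rightarrow> ennreal" where "law_mgf z = (\<integral>\<^sup>+u. ennreal (exp (- (z * u))) \<partial>law)"

lemma f_cont: "continuous_on {0..S} f"
proof -
  have "M-lipschitz_on {0..S} f"
  proof (rule lipschitz_onI)
    fix x y assume xy: "x \<in> {0..S}" "y \<in> {0..S}"
    have *: "\<bar>f s - f t\<bar> \<le> M * \<bar>s - t\<bar>" if "0 \<le> t" "t \<le> s" "s \<le> S" for s t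
    proof -
      have "0 \<le> m * (s - t)" using slopes that by simp
      then show ?thesis using f_slope[OF that] that by simp
    qed
    show "dist (f x) (f y) \<le> M * dist x y"
      using *[of x y] *[of y x] xy by (cases "x \<le> y") (auto simp: dist_real_def abs_minus_commute)
  qed (use slopes in simp)
  then show ?thesis by (rule lipschitz_on_continuous_on)
qed

lemma g_cont: "continuous_on {0..S} g"
proof -
  have "L-lipschitz_on {0..S} g"
    using g_Lip slopes by (auto simp: lipschitz_on_def dist_real_def)
  then show ?thesis by (rule lipschitz_on_continuous_on)
qed

end

section \<open>Reduction of a profile to a convolution equation\<close>

locale speed_green = speed_data +
  fixes \<kappa> :: real
  assumes \<kappa>: "M < \<kappa>" "0 < \<kappa>"
begin

text \<open>The two numbers are the roots of z^2 - c z - \<kappa>. They have opposite signs for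
  every real \<open>c\<close>, since their product is - \<kappa>.\<close>

definition R1 :: real where "R1 = (c - sqrt (c\<^sup>2 + 4 * \<kappa>)) / 2"
definition R2 :: real where "R2 = (c + sqrt (c\<^sup>2 + 4 * \<kappa>)) / 2"

lemma sqrt_gt: "\<bar>c\<bar> < sqrt (c\<^sup>2 + 4 * \<kappa>)"
  using \<kappa> by (intro real_less_rsqrt) simp

lemma R_sum: "R1 + R2 = c" by (simp add: R1_def R2_def field_simps)

lemma R_prod: "R1 * R2 = - \<kappa>"
proof -
  have "(sqrt (c\<^sup>2 + 4 * \<kappa>))\<^sup>2 = c\<^sup>2 + 4 * \<kappa>" using \<kappa> by (simp add: add_nonneg_nonneg)
  moreover have "(c - s) * (c + s) = c\<^sup>2 - s\<^sup>2" for s by (simp add: power2_eq_square algebra_simps)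
  ultimately have "(c - sqrt (c\<^sup>2 + 4 * \<kappa>)) * (c + sqrt (c\<^sup>2 + 4 * \<kappa>)) = - (4 * \<kappa>)" by simp
  then show ?thesis by (simp add: R1_def R2_def)
qed

lemma R_factor: "(z - R1) * (R2 - z) = \<kappa> + c * z - z\<^sup>2"
proof -
  have "(z - R1) * (R2 - z) = z * (R1 + R2) - z\<^sup>2 - R1 * R2" by (simp add: algebra_simps power2_eq_square)
  then show ?thesis by (simp add: R_sum R_prod mult.commute)
qed

sublocale GL: green_law R1 R2 law
proof -
  interpret L: prob_space law by (rule prob_law)
  show "green_law R1 R2 law"
    using sqrt_gt by unfold_locales (auto simp: R1_def R2_def)
qed

text \<open>Two convolution terms indexed by truth values: \<open>True\<close> for the local
  reaction with the Green kernel, \<open>False\<close> for the delayed nonlocal birth term with the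
  Green kernel averaged over \<open>law\<close>. The shift by \<kappa> > \<open>M\<close> makes the
  local nonlinearity \<open>\<kappa> * s - f s\<close> positive for positive \<open>s\<close> and
  its slopes positive.\<close>

definition kb :: "bool \<Rightarrow> real \<Rightarrow> real" where "kb b = (if b then GL.G else GL.Gn)"
definition Fb :: "bool \<Rightarrow> real \<Rightarrow> real" where "Fb b s = (if b then \<kappa> * s - f s else g s / \<alpha>)"
definition ab :: "bool \<Rightarrow> real" where "ab b = (if b then \<kappa> - p else q / \<alpha>)"
definition Ab :: "bool \<Rightarrow> real" where "Ab b = (if b then \<kappa> - m else L / \<alpha>)"

lemma UNIV_bool_sum: "(\<Sum>b\<in>UNIV. h b) = h True + h False" for h :: "bool \<Rightarrow> real"
  by (simp add: UNIV_bool)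

lemma Fb_pos: "0 < s \<Longrightarrow> s \<le> S \<Longrightarrow> 0 < Fb True s"
proof -
  assume s: "0 < s" "s \<le> S"
  have "f s \<le> M * s" using f_slope[of 0 s] s f_zero by simp
  also have "\<dots> < \<kappa> * s" using \<kappa> s by simp
  finally show ?thesis by (simp add: Fb_def)
qed

sublocale CE: convolution_equation UNIV kb Fb ab S "C + C / \<alpha>" \<theta> "exp (R2 - R1)"
proof
  show "kb i \<in> borel_measurable borel" for i by (simp add: kb_def)
  show "0 < kb i x" for i x by (simp add: kb_def GL.G_pos GL.Gn_pos)
  show "integrable lborel (kb i)" for i by (simp add: kb_def GL.G_int GL.Gn_int)
  show "\<bar>t\<bar> \<le> 1 \<Longrightarrow> kb i x \<le> exp (R2 - R1) * kb i (x + t)" for i x t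
    by (simp add: kb_def GL.G_harnack GL.Gn_harnack)
  show "0 < ab i" for i using slopes \<kappa> \<alpha> by (simp add: ab_def)
  show "0 \<le> C + C / \<alpha>" using C_nonneg \<alpha> by simp
  show "Fb i 0 = 0" for i by (simp add: Fb_def f_zero g_zero)
  show "0 \<le> Fb i s" if "0 \<le> s" "s \<le> S" for i s
  proof (cases i)
    case True
    then show ?thesis using Fb_pos[of s] that by (cases "s = 0") (auto simp: Fb_def f_zero)
  next
    case False
    then show ?thesis using g_nonneg[OF that] \<alpha> by (simp add: Fb_def)
  qed
  show "\<bar>Fb i s - Fb i t - ab i * (s - t)\<bar> \<le> (C + C / \<alpha>) * (max s t powr \<theta>) * \<bar>s - t\<bar>"
    if st: "0 \<le> s" "s \<le> S" "0 \<le> t" "t \<le> S" for i s t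
  proof -
    define X where "X = (max s t powr \<theta>) * \<bar>s - t\<bar>"
    have X: "0 \<le> X" by (simp add: X_def)
    show ?thesis
    proof (cases i)
      case True
      have "\<bar>Fb i s - Fb i t - ab i * (s - t)\<bar> = \<bar>f s - f t - p * (s - t)\<bar>"
        using True by (simp add: Fb_def ab_def algebra_simps abs_minus_commute)
      also have "\<dots> \<le> C * X" using f_lin[OF st] by (simp add: X_def mult.assoc)
      also have "\<dots> \<le> (C + C / \<alpha>) * X" using C_nonneg \<alpha> X by (intro mult_right_mono) auto
      finally show ?thesis by (simp add: X_def mult.assoc)
    next
      case False
      have "Fb i s - Fb i t - ab i * (s - t) = (g s - g t - q * (s - t)) / \<alpha>"
        using False by (simp add: Fb_def ab_def diff_divide_distrib)
      then have "\<bar>Fb i s - Fb i t - ab i * (s - t)\<bar> = \<bar>g s - g t - q * (s - t)\<bar> / \<alpha>"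
        using \<alpha> by simp
      also have "\<dots> \<le> C * X / \<alpha>" using g_lin[OF st] \<alpha> by (intro divide_right_mono) (auto simp: X_def mult.assoc)
      also have "\<dots> \<le> (C + C / \<alpha>) * X" using C_nonneg \<alpha> X by (simp add: distrib_right)
      finally show ?thesis by (simp add: X_def mult.assoc)
    qed
  qed
qed (use S_pos \<theta>_pos in auto)

text \<open>Adding \<kappa> \<phi> on both sides leaves an invertible linear operator with a bounded
  continuous right-hand side, so \<open>G_rep\<close> applies; \<open>G_conv_law\<close> then moves
  the law from the birth term into its kernel.\<close>

lemma profile_sol:
  assumes "profile \<phi>"
  shows "CE.sol \<phi>"
proof -
  obtain \<phi>' \<phi>'' where b: "\<And>x. 0 \<le> \<phi> x" "\<And>x. \<phi> x \<le> S" and bot: "(\<phi> \<longlongrightarrow> 0) at_bot"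
    and d1: "\<And>x. (\<phi> has_real_derivative \<phi>' x) (at x)" and d2: "\<And>x. (\<phi>' has_real_derivative \<phi>'' x) (at x)"
    and ode: "\<And>x. \<phi>'' x - c * \<phi>' x - f (\<phi> x) + (\<integral>u. g (\<phi> (x - u)) / \<alpha> \<partial>law) = 0"
    using assms unfolding profile_def by blast
  have c\<phi>: "continuous_on UNIV \<phi>" using d1 by (meson DERIV_continuous continuous_at_imp_continuous_on)
  define B where "B x = g (\<phi> x) / \<alpha>" for x
  have cB: "continuous_on UNIV B"
    unfolding B_def using b \<alpha> by (intro continuous_intros continuous_on_compose2[OF g_cont c\<phi>]) auto
  have B0: "0 \<le> B x" for x unfolding B_def using g_nonneg[OF b] \<alpha> by simp
  have Bb: "B x \<le> L * S / \<alpha>" for x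
  proof -
    have "g (\<phi> x) \<le> L * \<phi> x" using g_Lip[of "\<phi> x" 0] b[of x] S_pos by (simp add: g_zero)
    also have "\<dots> \<le> L * S" using b(2) slopes by (intro mult_left_mono) auto
    finally show ?thesis unfolding B_def using \<alpha> by (intro divide_right_mono) auto
  qed
  have [measurable]: "B \<in> borel_measurable borel" using cB by (rule borel_measurable_continuous_onI)
  define F where "F x = \<kappa> * \<phi> x - f (\<phi> x)" for x
  have cF: "continuous_on UNIV F"
    unfolding F_def using b by (intro continuous_intros c\<phi> continuous_on_compose2[OF f_cont c\<phi>]) auto
  have [measurable]: "F \<in> borel_measurable borel" using cF by (rule borel_measurable_continuous_onI)
  have Fb': "\<bar>F x\<bar> \<le> \<kappa> * S" for x
  proof -
    have "0 \<le> m * \<phi> x" using b(1) slopes by simp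
    then have "0 \<le> f (\<phi> x)" using f_slope[of 0 "\<phi> x"] b[of x] f_zero by simp
    moreover have "f (\<phi> x) \<le> \<kappa> * \<phi> x"
    proof -
      have "f (\<phi> x) \<le> M * \<phi> x" using f_slope[of 0 "\<phi> x"] b[of x] f_zero by simp
      also have "\<dots> \<le> \<kappa> * \<phi> x" using \<kappa> b[of x] by (intro mult_right_mono) auto
      finally show ?thesis .
    qed
    moreover have "\<kappa> * \<phi> x \<le> \<kappa> * S" using b(2)[of x] \<kappa> by (intro mult_left_mono) auto
    ultimately show ?thesis by (simp add: F_def abs_le_iff)
  qed
  define J where "J x = (\<integral>u. B (x - u) \<partial>law)" for x
  have cJ: "continuous_on UNIV J"
    unfolding J_def
    by (rule continuous_integral_shift[where p="\<lambda>u. u" and b="L * S / \<alpha>"]) (use cB B0 Bb GL.finite_measure_axioms in auto)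
  have Bi: "integrable law (\<lambda>u. B (x - u))" for x
    by (rule GL.integrable_const_bound[where B="L * S / \<alpha>"]) (use B0 Bb in auto)
  have J0: "0 \<le> J x" for x unfolding J_def using B0 by (intro Bochner_Integration.integral_nonneg) auto
  have Jb: "J x \<le> L * S / \<alpha>" for x
  proof -
    have "J x \<le> (\<integral>u. L * S / \<alpha> \<partial>law)" unfolding J_def using Bi Bb by (intro integral_mono) auto
    then show ?thesis by (simp add: GL.prob_space)
  qed
  have [measurable]: "J \<in> borel_measurable borel" using cJ by (rule borel_measurable_continuous_onI)
  have eq: "\<phi> x = (\<integral>y. GL.G y * (F (x - y) + J (x - y)) \<partial>lborel)" for x
  proof (rule GL.G_rep[OF d1 d2])
    show "\<phi>'' x - (R1 + R2) * \<phi>' x + R1 * R2 * \<phi> x = - (F x + J x)" for x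
      using ode[of x] unfolding R_sum R_prod F_def J_def B_def by simp
    show "\<bar>\<phi> x\<bar> \<le> S" for x using b[of x] by simp
    show "continuous_on UNIV (\<lambda>a. F a + J a)" by (intro continuous_intros cF cJ)
    show "\<bar>F x + J x\<bar> \<le> \<kappa> * S + L * S / \<alpha>" for x using Fb'[of x] J0[of x] Jb[of x] by linarith
  qed
  have rep: "\<phi> x = (\<integral>y. GL.G y * F (x - y) \<partial>lborel) + (\<integral>y. GL.Gn y * B (x - y) \<partial>lborel)" for x
  proof -
    have "integrable lborel (\<lambda>y. GL.G y * F (x - y))"
      by (rule integrable_mult_bounded[OF GL.G_int, where B="\<kappa> * S"]) (use Fb' in auto)
    moreover have "integrable lborel (\<lambda>y. GL.G y * J (x - y))"
      by (rule integrable_mult_bounded[OF GL.G_int, where B="L * S / \<alpha>"]) (use J0 Jb in auto)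
    ultimately have "\<phi> x = (\<integral>y. GL.G y * F (x - y) \<partial>lborel) + (\<integral>y. GL.G y * J (x - y) \<partial>lborel)"
      unfolding eq[of x] distrib_left by simp
    also have "(\<integral>y. GL.G y * J (x - y) \<partial>lborel) = (\<integral>y. GL.Gn y * B (x - y) \<partial>lborel)"
      unfolding J_def by (rule GL.G_conv_law[OF _ B0 Bb]) measurable
    finally show ?thesis .
  qed
  show ?thesis
    unfolding CE.sol_def
  proof (intro conjI allI)
    fix x
    show "\<phi> x = (\<Sum>i\<in>UNIV. \<integral>y. kb i y * Fb i (\<phi> (x - y)) \<partial>lborel)"
      unfolding UNIV_bool_sum kb_def Fb_def if_True if_False
      using rep[of x] unfolding F_def B_def .
  qed (rule c\<phi> b bot)+
qed

lemma G_hat: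
  assumes "0 \<le> z" "z < R2"
  shows "0 < \<kappa> + c * z - z\<^sup>2"
    "(\<integral>\<^sup>+x. ennreal (GL.G x * exp (- (z * x))) \<partial>lborel) = ennreal (1 / (\<kappa> + c * z - z\<^sup>2))"
proof -
  have z: "R1 < z" "z < R2" using assms GL.r1 by auto
  then have "0 < (z - R1) * (R2 - z)" by simp
  then show "0 < \<kappa> + c * z - z\<^sup>2" by (simp add: R_factor)
  show "(\<integral>\<^sup>+x. ennreal (GL.G x * exp (- (z * x))) \<partial>lborel) = ennreal (1 / (\<kappa> + c * z - z\<^sup>2))"
    using GL.G_transform[OF z] by (simp add: R_factor)
qed

lemma n_eq: "CE.n x = (\<kappa> - p) * GL.G x + q / \<alpha> * GL.Gn x"
  by (simp add: CE.n_def UNIV_bool_sum ab_def kb_def)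

text \<open>Below \<open>R2\<close> the first factor is 1 / (\<kappa> + c z - z^2), so the product
  exceeds 1 exactly when z^2 - c z - p plus the law term is positive. Extended values are kept
  because at \<open>R2\<close> and beyond the convergence range of the law the transform is
  infinite, which also counts as exceeding 1.\<close>

lemma n_hat:
  "(\<integral>\<^sup>+x. ennreal (CE.n x * exp (- (z * x))) \<partial>lborel) =
   (\<integral>\<^sup>+x. ennreal (GL.G x * exp (- (z * x))) \<partial>lborel) * (ennreal (\<kappa> - p) + ennreal (q / \<alpha>) * law_mgf z)"
proof -
  have kp: "0 < \<kappa> - p" and qa: "0 < q / \<alpha>" using slopes \<kappa> \<alpha> by auto
  have "(\<integral>\<^sup>+x. ennreal (CE.n x * exp (- (z * x))) \<partial>lborel) =
    (\<integral>\<^sup>+x. ennreal (\<kappa> - p) * ennreal (GL.G x * exp (- (z * x))) + ennreal (q / \<alpha>) * ennreal (GL.Gn x * exp (- (z * x))) \<partial>lborel)"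
  proof (rule nn_integral_cong)
    fix x
    have "CE.n x * exp (- (z * x)) = (\<kappa> - p) * (GL.G x * exp (- (z * x))) + q / \<alpha> * (GL.Gn x * exp (- (z * x)))"
      by (simp add: n_eq algebra_simps)
    then have "ennreal (CE.n x * exp (- (z * x))) =
      ennreal ((\<kappa> - p) * (GL.G x * exp (- (z * x)))) + ennreal (q / \<alpha> * (GL.Gn x * exp (- (z * x))))"
      using kp qa less_imp_le[OF GL.G_pos] GL.Gn_nonneg by (simp only: ennreal_plus mult_nonneg_nonneg less_imp_le exp_ge_zero)
    then show "ennreal (CE.n x * exp (- (z * x))) =
      ennreal (\<kappa> - p) * ennreal (GL.G x * exp (- (z * x))) + ennreal (q / \<alpha>) * ennreal (GL.Gn x * exp (- (z * x)))"
      using kp qa by (simp only: ennreal_mult' less_imp_le)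
  qed
  also have "\<dots> = ennreal (\<kappa> - p) * (\<integral>\<^sup>+x. ennreal (GL.G x * exp (- (z * x))) \<partial>lborel) +
     ennreal (q / \<alpha>) * (\<integral>\<^sup>+x. ennreal (GL.Gn x * exp (- (z * x))) \<partial>lborel)"
    by (subst nn_integral_add) (auto simp: nn_integral_cmult)
  also have "\<dots> = (\<integral>\<^sup>+x. ennreal (GL.G x * exp (- (z * x))) \<partial>lborel) * (ennreal (\<kappa> - p) + ennreal (q / \<alpha>) * law_mgf z)"
    unfolding GL.Gn_transform law_mgf_def by (simp add: distrib_left mult_ac)
  finally show ?thesis .
qed

end

section \<open>Vanishing and uniqueness of profiles\<close>

context speed_data
begin

text \<open>If the characteristic function has no nonpositive value, the transform of the linearized
  kernel exceeds 1 all the way up to \<open>R2\<close>, the left rate of the Green kernel itself.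
  Decay at that rate is incompatible with the lower bound by this kernel.\<close>

lemma profile_zero:
  assumes pr: "profile \<phi>"
    and pos: "\<And>z. 0 \<le> z \<Longrightarrow> law_mgf z < \<infinity> \<Longrightarrow> 0 < z\<^sup>2 - c * z - p + q / \<alpha> * enn2real (law_mgf z)"
  shows "\<phi> x = 0"
proof -
  define \<kappa> where "\<kappa> = M + 1"
  interpret speed_green \<alpha> c K P f g S C \<theta> p q m L M \<kappa>
    by unfold_locales (use slopes in \<open>auto simp: \<kappa>_def\<close>)
  have kp: "0 < \<kappa> - p" using slopes by (simp add: \<kappa>_def)
  have qa: "0 < q / \<alpha>" using slopes \<alpha> by simp
  show ?thesis
  proof (rule CE.no_positive_solution[OF profile_sol[OF pr], of R2 True])
    show "0 \<le> R2" using GL.r2 by simp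
    show "0 < Fb True s" if "0 < s" "s \<le> S" for s using Fb_pos[OF that] .
    show inf: "(\<integral>\<^sup>+x. ennreal (kb True x * exp (- (R2 * x))) * indicator {..0} x \<partial>lborel) = \<infinity>"
      using GL.G_transform_infinite by (simp add: kb_def)
    fix z assume z: "0 \<le> z" "z \<le> R2"
    show "1 < (\<integral>\<^sup>+x. ennreal (CE.n x * exp (- (z * x))) \<partial>lborel)"
    proof (cases "z = R2")
      \<comment> \<open>At the endpoint the transform of the Green kernel diverges, and its
        coefficient \<open>\<kappa> - p\<close> is positive.\<close>
      case True
      have "(\<integral>\<^sup>+x. ennreal (GL.G x * exp (- (R2 * x))) * indicator {..0} x \<partial>lborel) \<le>
        (\<integral>\<^sup>+x. ennreal (GL.G x * exp (- (R2 * x))) \<partial>lborel)"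
        by (rule nn_integral_mono) (simp add: indicator_def)
      then have "(\<integral>\<^sup>+x. ennreal (GL.G x * exp (- (R2 * x))) \<partial>lborel) = \<infinity>"
        using GL.G_transform_infinite by (simp add: top_unique)
      then have "(\<integral>\<^sup>+x. ennreal (CE.n x * exp (- (z * x))) \<partial>lborel) = \<infinity>"
        unfolding n_hat True using kp by (simp add: ennreal_top_mult)
      then show ?thesis by simp
    next
      case False
      then have z': "0 \<le> z" "z < R2" using z by auto
      note Gh = G_hat[OF z']
      show ?thesis
      proof (cases "law_mgf z < \<infinity>")
        case True
        then obtain y where y: "law_mgf z = ennreal y" "0 \<le> y" by (cases "law_mgf z") auto
        have "0 < z\<^sup>2 - c * z - p + q / \<alpha> * y" using pos[OF z(1) True] y by simp
        then have "\<kappa> + c * z - z\<^sup>2 < \<kappa> - p + q / \<alpha> * y" by linarith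
        then have r: "1 < 1 / (\<kappa> + c * z - z\<^sup>2) * (\<kappa> - p + q / \<alpha> * y)" using Gh(1) by simp
        have "(\<integral>\<^sup>+x. ennreal (CE.n x * exp (- (z * x))) \<partial>lborel) = ennreal (1 / (\<kappa> + c * z - z\<^sup>2) * (\<kappa> - p + q / \<alpha> * y))"
        proof -
          have "ennreal (\<kappa> - p) + ennreal (q / \<alpha>) * law_mgf z = ennreal (\<kappa> - p + q / \<alpha> * y)"
            unfolding y(1) using kp qa y(2) by (simp only: ennreal_mult'[symmetric] ennreal_plus[symmetric] less_imp_le mult_nonneg_nonneg)
          then show ?thesis unfolding n_hat Gh(2) using Gh(1) by (simp only: ennreal_mult'[symmetric] less_imp_le zero_less_divide_1_iff)
        qed
        also have "1 < \<dots>" using r by (metis ennreal_1 ennreal_less_iff zero_le_one)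
        finally show ?thesis .
      next
        case False
        then have inf: "law_mgf z = \<infinity>" by (simp add: not_less top_unique)
        obtain Q where Q: "q / \<alpha> = Q" "0 < Q" using qa by blast
        obtain W where W: "1 / (\<kappa> + c * z - z\<^sup>2) = W" "0 < W" using Gh(1) by auto
        have "(\<integral>\<^sup>+x. ennreal (CE.n x * exp (- (z * x))) \<partial>lborel) = \<infinity>"
          unfolding n_hat Gh(2) Q(1) W(1) inf using Q(2) W(2) by (simp add: ennreal_mult_top)
        then show ?thesis by simp
      qed
    qed
  qed simp
qed

text \<open>The assumption \<open>root\<close> says that the Lipschitz constants, weighted with the
  kernel transforms at \<open>z0\<close>, add up to at most 1, and \<open>unstable\<close> says that
  the linearized kernel has mass above 1. The distance between \<open>z0\<close> and \<gamma> is the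
  room that the barrier needs.\<close>

lemma profile_unique:
  assumes pr1: "profile \<phi>1" and pr2: "profile \<phi>2" and p1: "0 < \<phi>1 x1" and p2: "0 < \<phi>2 x2"
    and z0: "0 < z0" "z0 < \<gamma>" and fin: "law_mgf \<gamma> < \<infinity>" "law_mgf z0 < \<infinity>"
    and root: "z0\<^sup>2 - c * z0 - m + L / \<alpha> * enn2real (law_mgf z0) \<le> 0" and unstable: "p < q / \<alpha>"
  shows "\<exists>h. \<forall>x. \<phi>2 x = \<phi>1 (x + h)"
proof -
  \<comment> \<open>Large enough to make \<kappa> + c \<gamma> - \<gamma>^2 positive, which places
    \<gamma> below \<open>R2\<close>, so the Green kernel has finite transforms up to
    \<gamma>.\<close>
  define \<kappa> where "\<kappa> = M + 1 + \<bar>\<gamma>\<^sup>2 - c * \<gamma>\<bar>"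
  interpret speed_green \<alpha> c K P f g S C \<theta> p q m L M \<kappa>
    by unfold_locales (use slopes in \<open>auto simp: \<kappa>_def add_pos_nonneg\<close>)
  have \<gamma>R: "\<gamma> < R2"
  proof -
    have "0 < (\<gamma> - R1) * (R2 - \<gamma>)" unfolding R_factor using slopes by (simp add: \<kappa>_def)
    moreover have "0 < \<gamma> - R1" using z0 GL.r1 by simp
    ultimately show ?thesis by (simp add: zero_less_mult_iff)
  qed
  have kint: "integrable lborel (\<lambda>x. kb i x * exp (- (z * x)))"
    "(\<integral>x. kb i x * exp (- (z * x)) \<partial>lborel) = (if i then 1 else enn2real (law_mgf z)) / (\<kappa> + c * z - z\<^sup>2)"
    if z: "0 \<le> z" "z \<le> \<gamma>" "law_mgf z < \<infinity>" for i z
  proof -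
    have z': "0 \<le> z" "z < R2" using z \<gamma>R by auto
    note Gh = G_hat[OF z']
    obtain y where y: "law_mgf z = ennreal y" "0 \<le> y" using z(3) by (cases "law_mgf z") auto
    define v where "v = (if i then 1 else y) / (\<kappa> + c * z - z\<^sup>2)"
    have v: "0 \<le> v" using Gh(1) y by (auto simp: v_def)
    have nn: "(\<integral>\<^sup>+x. ennreal (kb i x * exp (- (z * x))) \<partial>lborel) = ennreal v"
    proof (cases i)
      case True
      then show ?thesis using Gh(2) by (simp add: kb_def v_def)
    next
      case False
      then show ?thesis
        using Gh y by (simp add: kb_def v_def GL.Gn_transform law_mgf_def[symmetric] ennreal_mult'[symmetric])
    qed
    have "has_bochner_integral lborel (\<lambda>x. kb i x * exp (- (z * x))) v"
      by (rule has_bochner_integral_nn_integral)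
         (use nn v in \<open>auto simp: kb_def intro!: mult_nonneg_nonneg less_imp_le[OF GL.G_pos] GL.Gn_nonneg\<close>)
    then show "integrable lborel (\<lambda>x. kb i x * exp (- (z * x)))"
      "(\<integral>x. kb i x * exp (- (z * x)) \<partial>lborel) = (if i then 1 else enn2real (law_mgf z)) / (\<kappa> + c * z - z\<^sup>2)"
      using y by (auto simp: has_bochner_integral_iff v_def)
  qed
  have mgf0: "law_mgf 0 = 1"
    unfolding law_mgf_def using prob_space.emeasure_space_1[OF prob_law] by simp
  interpret convolution_lipschitz UNIV kb Fb ab S "C + C / \<alpha>" \<theta> "exp (R2 - R1)" Ab \<gamma> z0
  proof
    show "ab i \<le> Ab i" for i using slopes \<alpha> by (simp add: ab_def Ab_def divide_right_mono)
    show "\<bar>Fb i s - Fb i t\<bar> \<le> Ab i * \<bar>s - t\<bar>" if st: "0 \<le> s" "s \<le> S" "0 \<le> t" "t \<le> S" for i s t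
    proof (cases i)
      case True
      have *: "\<bar>Fb True s - Fb True t\<bar> \<le> Ab True * \<bar>s - t\<bar>" if st: "0 \<le> t" "t \<le> s" "s \<le> S" for s t
      proof -
        have "0 \<le> (\<kappa> - M) * (s - t)" using \<kappa> st by simp
        then show ?thesis using f_slope[OF st] st by (simp add: Fb_def Ab_def abs_le_iff algebra_simps)
      qed
      show ?thesis using *[of s t] *[of t s] st True by (cases "s \<le> t") (auto simp: abs_minus_commute)
    next
      case False
      have "Fb i s - Fb i t = (g s - g t) / \<alpha>" using False by (simp add: Fb_def diff_divide_distrib)
      then have "\<bar>Fb i s - Fb i t\<bar> = \<bar>g s - g t\<bar> / \<alpha>" using \<alpha> by simp
      also have "\<dots> \<le> L * \<bar>s - t\<bar> / \<alpha>" using g_Lip[OF st] \<alpha> by (intro divide_right_mono) auto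
      finally show ?thesis using False by (simp add: Ab_def)
    qed
    show "integrable lborel (\<lambda>x. kb i x * exp (- (\<gamma> * x)))" for i using kint(1)[of \<gamma>] z0 fin by simp
    show "0 < z0" "z0 < \<gamma>" using z0 by auto
    have pz: "0 < \<kappa> + c * z0 - z0\<^sup>2" using G_hat(1)[of z0] z0 \<gamma>R by simp
    have "(\<Sum>i\<in>UNIV. Ab i * (\<integral>x. kb i x * exp (- (z0 * x)) \<partial>lborel)) =
      (\<kappa> - m + L / \<alpha> * enn2real (law_mgf z0)) / (\<kappa> + c * z0 - z0\<^sup>2)"
      using z0 fin(2) by (simp add: UNIV_bool_sum kint(2) Ab_def add_divide_distrib)
    also have "\<dots> \<le> 1" using root pz by (simp add: divide_le_eq)
    finally show "(\<Sum>i\<in>UNIV. Ab i * (\<integral>x. kb i x * exp (- (z0 * x)) \<partial>lborel)) \<le> 1" .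
    have k0: "(\<integral>x. kb i x \<partial>lborel) = 1 / \<kappa>" for i
      using kint(2)[of 0 i] z0 mgf0 by simp
    have "(\<integral>x. CE.n x \<partial>lborel) = (\<kappa> - p) * (\<integral>x. kb True x \<partial>lborel) + q / \<alpha> * (\<integral>x. kb False x \<partial>lborel)"
      unfolding n_eq using GL.G_int GL.Gn_int by (simp add: kb_def)
    also have "\<dots> = (\<kappa> - p + q / \<alpha>) / \<kappa>"
      unfolding k0 by (simp add: add_divide_distrib)
    also have "1 < \<dots>" using unstable \<kappa>(2) by (simp add: less_divide_eq)
    finally show "1 < (\<integral>x. CE.n x \<partial>lborel)" .
  qed
  show ?thesis by (rule unique_modulo_shift[OF profile_sol[OF pr1] profile_sol[OF pr2] p1 p2])
qed

end

section \<open>The characteristic function and the wave speeds\<close>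

lemma deriv_nonneg_works:
  assumes "h differentiable (at s within {0..})"
  shows "(h has_real_derivative deriv_nonneg h s) (at s within {0..})"
  using assms unfolding deriv_nonneg_def has_real_derivative_iff_has_vector_derivative
  by (simp add: vector_derivative_works)

lemma at_within_nonneg_nontrivial: "0 \<le> s \<Longrightarrow> at s within {0..} \<noteq> (bot :: real filter)"
proof -
  assume s: "0 \<le> s"
  have "at s within {s..} \<le> at s within {0..}" using s by (intro at_le) auto
  moreover have "at s within {s..} \<noteq> (bot :: real filter)" by (simp add: at_within_Ici_at_right)
  ultimately show ?thesis using le_bot by metis
qed

lemma bounded_upper:
  fixes h :: "real \<Rightarrow> real"
  assumes "bounded (range h)"
  obtains S where "\<And>x. h x \<le> S"
  using assms unfolding bounded_iff by (metis abs_le_D1 rangeI real_norm_def)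

lemma slope_limit:
  assumes "(h has_real_derivative D) (at s within {0..})"
  shows "((\<lambda>y. (h y - h s) / (y - s)) \<longlongrightarrow> D) (at s within {0..})"
  using assms by (simp add: has_field_derivative_iff)

text \<open>Near 0 the derivative differs from its value at 0 by a Hoelder term, and the mean value
  inequality gives the bound. Away from 0 the factor \<open>max s t powr \<theta>\<close> is bounded
  below, so the Lipschitz estimate can be written in the same form.\<close>

lemma holder_linearization:
  assumes holder: "C1_holder_near_0 \<theta> h" and \<theta>: "0 < \<theta>"
    and lip: "\<And>s t. 0 \<le> s \<Longrightarrow> s \<le> S \<Longrightarrow> 0 \<le> t \<Longrightarrow> t \<le> S \<Longrightarrow> \<bar>h s - h t\<bar> \<le> \<Lambda> * \<bar>s - t\<bar>"
    and \<Lambda>: "0 \<le> \<Lambda>"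
  obtains C where "0 \<le> C" "\<And>s t. 0 \<le> s \<Longrightarrow> s \<le> S \<Longrightarrow> 0 \<le> t \<Longrightarrow> t \<le> S \<Longrightarrow>
    \<bar>h s - h t - deriv_nonneg h 0 * (s - t)\<bar> \<le> C * (max s t powr \<theta>) * \<bar>s - t\<bar>"
proof -
  obtain d C0 where d: "0 < d"
    and diff: "\<And>s. s \<in> {0..<d} \<Longrightarrow> h differentiable (at s within {0..})"
    and hol: "\<And>s t. s \<in> {0..<d} \<Longrightarrow> t \<in> {0..<d} \<Longrightarrow> \<bar>deriv_nonneg h s - deriv_nonneg h t\<bar> \<le> C0 * \<bar>s - t\<bar> powr \<theta>"
    using holder unfolding C1_holder_near_0_def by blast
  define p where "p = deriv_nonneg h 0"
  \<comment> \<open>Normalized so that at distance \<open>d / 2\<close> from 0 the Hoelder form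
    already covers the Lipschitz constant plus the slope.\<close>
  define C1 where "C1 = (\<Lambda> + \<bar>p\<bar>) / ((d / 2) powr \<theta>)"
  have dp: "0 < (d / 2) powr \<theta>" using d by simp
  have C1: "0 \<le> C1" using \<Lambda> dp by (simp add: C1_def)
  have main: "\<bar>h s - h t - p * (s - t)\<bar> \<le> (\<bar>C0\<bar> + C1) * (max s t powr \<theta>) * \<bar>s - t\<bar>"
    if st: "0 \<le> s" "s \<le> S" "0 \<le> t" "t \<le> S" for s t
  proof (cases "max s t < d / 2")
    case True
    define X where "X = max s t"
    have "norm ((h s - p * s) - (h t - p * t)) \<le> (\<bar>C0\<bar> * X powr \<theta>) * norm (s - t)"
    proof (rule field_differentiable_bound[where S="{0..X}" and f'="\<lambda>u. deriv_nonneg h u - p"])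
      fix u assume u: "u \<in> {0..X}"
      then have ud: "u \<in> {0..<d}" using True d by (auto simp: X_def)
      have "(h has_real_derivative deriv_nonneg h u) (at u within {0..X})"
        by (rule DERIV_subset[OF deriv_nonneg_works[OF diff[OF ud]]]) auto
      then show "((\<lambda>s. h s - p * s) has_field_derivative deriv_nonneg h u - p) (at u within {0..X})"
        by (auto intro!: derivative_eq_intros)
      have "\<bar>deriv_nonneg h u - p\<bar> \<le> C0 * \<bar>u - 0\<bar> powr \<theta>"
        unfolding p_def using ud d by (intro hol) auto
      also have "\<dots> \<le> \<bar>C0\<bar> * X powr \<theta>"
        using u \<theta> by (intro mult_mono powr_mono2) auto
      finally show "norm (deriv_nonneg h u - p) \<le> \<bar>C0\<bar> * X powr \<theta>" by simp
    qed (use st in \<open>auto simp: X_def\<close>)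
    then have "\<bar>h s - h t - p * (s - t)\<bar> \<le> \<bar>C0\<bar> * X powr \<theta> * \<bar>s - t\<bar>" by (simp add: algebra_simps)
    also have "\<dots> \<le> (\<bar>C0\<bar> + C1) * X powr \<theta> * \<bar>s - t\<bar>"
      using C1 by (intro mult_right_mono) auto
    finally show ?thesis by (simp add: X_def)
  next
    case False
    have "\<bar>h s - h t - p * (s - t)\<bar> \<le> \<bar>h s - h t\<bar> + \<bar>p\<bar> * \<bar>s - t\<bar>"
      by (metis abs_mult abs_triangle_ineq4)
    also have "\<dots> \<le> (\<Lambda> + \<bar>p\<bar>) * \<bar>s - t\<bar>" using lip[OF st] by (simp add: distrib_right)
    also have "\<Lambda> + \<bar>p\<bar> = C1 * (d / 2) powr \<theta>" using dp by (simp add: C1_def)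
    also have "C1 * (d / 2) powr \<theta> * \<bar>s - t\<bar> \<le> (\<bar>C0\<bar> + C1) * max s t powr \<theta> * \<bar>s - t\<bar>"
      using False C1 d \<theta> by (intro mult_right_mono mult_mono powr_mono2) auto
    finally show ?thesis .
  qed
  show ?thesis
    by (rule that[of "\<bar>C0\<bar> + C1"]) (use C1 main in \<open>auto simp: p_def\<close>)
qed

section \<open>From waves of the system to profiles\<close>

locale wave_problem =
  fixes \<alpha> \<theta> L :: real and K f g :: "real \<Rightarrow> real" and P :: "real measure"
  assumes \<alpha>: "\<alpha> > 0" and K_int: "integrable lborel K" and K_nonneg: "AE w in lborel. 0 \<le> K w"
    and K_mass: "(\<integral>w. K w \<partial>lborel) = 1"
    and P_prob: "prob_space P" and sets_P: "sets P = sets (restrict_space borel {0..})"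
    and H1: "hyp_H1 g" and H2: "hyp_H2 f g" and H3: "hyp_H3 \<theta> f g"
    and blow_up: "\<And>c. blow_up_condition \<alpha> (chi0 \<alpha> f g K P) c"
    and L: "L > 0" and g_Lip: "\<And>s1 s2. s1 \<ge> 0 \<Longrightarrow> s2 \<ge> 0 \<Longrightarrow> \<bar>g s1 - g s2\<bar> \<le> L * \<bar>s1 - s2\<bar>"
begin

abbreviation "p \<equiv> deriv_nonneg f 0"
abbreviation "q \<equiv> deriv_nonneg g 0"
abbreviation "m \<equiv> (INF s\<in>{0..}. deriv_nonneg f s)"

text \<open>The measure \<open>P\<close> lives on the sigma-algebra of the half-line; its image
  under the inclusion is a Borel measure on all reals, as the product constructions require.\<close>

definition Q :: "real measure" where "Q = distr P borel (\<lambda>r. r)"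

lemma id_P_meas: "(\<lambda>r. r) \<in> borel_measurable P"
proof -
  have "(\<lambda>r. r) \<in> borel_measurable (restrict_space borel {0..})"
    by (rule measurable_restrict_space1) simp
  then show ?thesis by (simp add: measurable_cong_sets[OF sets_P refl])
qed

lemma prob_Q: "prob_space Q"
  unfolding Q_def by (rule prob_space.prob_space_distr[OF P_prob id_P_meas])

lemma sets_Q [measurable_cong, simp]: "sets Q = sets borel" by (simp add: Q_def)

lemma Q_nonneg: "AE r in Q. 0 \<le> r"
proof -
  have "space P = {0..}" using sets_eq_imp_space_eq[OF sets_P] by (simp add: space_restrict_space)
  then have "AE r in P. 0 \<le> r" by (intro AE_I2) simp
  then show ?thesis unfolding Q_def by (subst AE_distr_iff[OF id_P_meas]) auto
qed

lemma Q_integral: "h \<in> borel_measurable borel \<Longrightarrow> (\<integral>r. h r \<partial>Q) = (\<integral>r. h r \<partial>P)" for h :: "real \<Rightarrow> real"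
  unfolding Q_def by (rule integral_distr[OF id_P_meas])

lemma Q_nn_integral: "h \<in> borel_measurable borel \<Longrightarrow> (\<integral>\<^sup>+r. h r \<partial>Q) = (\<integral>\<^sup>+r. h r \<partial>P)"
  unfolding Q_def by (rule nn_integral_distr[OF id_P_meas]) simp

lemma delay: "delay_data \<alpha> K Q"
  by (intro delay_data.intro \<alpha> K_int K_nonneg K_mass prob_Q sets_Q)

lemma f_deriv: "0 \<le> s \<Longrightarrow> (f has_real_derivative deriv_nonneg f s) (at s within {0..})"
  using H2 by (intro deriv_nonneg_works) (auto simp: hyp_H2_def differentiable_on_def)

lemma f_deriv_nonneg: "0 \<le> s \<Longrightarrow> 0 \<le> deriv_nonneg f s"
proof (rule tendsto_lowerbound[OF slope_limit[OF f_deriv] _ at_within_nonneg_nontrivial])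
  assume s: "0 \<le> s"
  have mono: "x < y \<Longrightarrow> 0 \<le> x \<Longrightarrow> f x < f y" for x y
    using H2 by (auto simp: hyp_H2_def strict_mono_on_def)
  show "\<forall>\<^sub>F y in at s within {0..}. 0 \<le> (f y - f s) / (y - s)"
    unfolding eventually_at_filter
  proof (intro always_eventually allI impI)
    fix y assume y: "y \<noteq> s" "y \<in> {0..}"
    show "0 \<le> (f y - f s) / (y - s)"
    proof (cases "y < s")
      case True
      then show ?thesis using mono[of y s] y by (simp add: divide_nonpos_neg)
    next
      case False
      then have "s < y" using y by simp
      then show ?thesis using mono[of s y] s by simp
    qed
  qed
qed

lemma m_le: "0 \<le> s \<Longrightarrow> m \<le> deriv_nonneg f s"
  by (rule cINF_lower) (auto intro!: bdd_belowI2[of _ 0] f_deriv_nonneg)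

lemma m_nonneg: "0 \<le> m"
  by (rule cINF_greatest) (auto intro: f_deriv_nonneg)

lemma q_pos: "0 < q" and g_deriv: "(g has_real_derivative q) (at 0 within {0..})"
  using H1 by (auto simp: hyp_H1_def intro: deriv_nonneg_works)

lemma q_le_L: "q \<le> L"
proof (rule tendsto_upperbound[OF slope_limit[OF g_deriv] _ at_within_nonneg_nontrivial])
  show "\<forall>\<^sub>F y in at 0 within {0..}. (g y - g 0) / (y - 0) \<le> L"
    unfolding eventually_at_filter
  proof (intro always_eventually allI impI)
    fix y :: real assume y: "y \<noteq> 0" "y \<in> {0..}"
    then have "g y - g 0 \<le> L * y" using g_Lip[of y 0] by simp
    then show "(g y - g 0) / (y - 0) \<le> L" using y by (simp add: divide_le_eq)
  qed
qed simp

lemma f_cont: "continuous_on {0..} f"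
  using H2 by (auto simp: hyp_H2_def intro: differentiable_imp_continuous_on)

lemma f_slope:
  assumes "0 \<le> t" "t \<le> s" and M: "\<And>u. t \<le> u \<Longrightarrow> u \<le> s \<Longrightarrow> deriv_nonneg f u \<le> M"
  shows "m * (s - t) \<le> f s - f t \<and> f s - f t \<le> M * (s - t)"
proof (cases "t = s")
  case False
  then have ts: "t < s" using assms by simp
  have der: "(f has_real_derivative deriv_nonneg f u) (at u)" if "t < u" for u
    using f_deriv[of u] at_within_interior[of u "{0..}"] that assms(1) by simp
  have "\<exists>l z. t < z \<and> z < s \<and> (f has_real_derivative l) (at z) \<and> f s - f t = (s - t) * l"
  proof (rule MVT[OF ts])
    show "continuous_on {t..s} f" using f_cont by (rule continuous_on_subset) (use assms in auto)
    show "f differentiable (at u)" if "t < u" "u < s" for u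
      using der[OF that(1)] by (auto simp: real_differentiable_def)
  qed
  then obtain l z where z: "t < z" "z < s" "(f has_real_derivative l) (at z)" "f s - f t = (s - t) * l" by blast
  have l: "l = deriv_nonneg f z" using DERIV_unique[OF z(3) der[OF z(1)]] .
  have "m \<le> l" "l \<le> M" unfolding l using m_le[of z] M[of z] z assms by auto
  then have "(s - t) * m \<le> (s - t) * l" "(s - t) * l \<le> (s - t) * M" using ts by (auto intro: mult_left_mono)
  then show ?thesis using z(4) by (simp add: mult.commute)
qed simp

text \<open>Waves are bounded, so only the compact range up to \<open>S\<close> matters: continuity
  of the derivative bounds the slopes of \<open>f\<close> there, and with them
  \<open>holder_linearization\<close> applies to \<open>f\<close>; for \<open>g\<close> the constant
  \<open>L\<close> does this.\<close>

lemma speed_data_exists: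
  assumes S: "0 < S"
  obtains C M where "speed_data \<alpha> K Q f g S C \<theta> p q m L M"
proof -
  have "continuous_on {0..S} (deriv_nonneg f)" using H2 by (auto simp: hyp_H2_def intro: continuous_on_subset)
  then have "compact (deriv_nonneg f ` {0..S})" by (intro compact_continuous_image) auto
  then obtain M0 where M0: "\<And>u. 0 \<le> u \<Longrightarrow> u \<le> S \<Longrightarrow> \<bar>deriv_nonneg f u\<bar> \<le> M0"
    using compact_imp_bounded by (force simp: bounded_iff)
  have M: "\<And>u. 0 \<le> u \<Longrightarrow> u \<le> S \<Longrightarrow> deriv_nonneg f u \<le> M0" using M0 by (meson abs_le_iff)
  have slope: "m * (s - t) \<le> f s - f t \<and> f s - f t \<le> M0 * (s - t)" if "0 \<le> t" "t \<le> s" "s \<le> S" for s t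
    using that M by (intro f_slope) auto
  have pM: "p \<le> M0" using M[of 0] S by simp
  have M00: "0 \<le> M0" using f_deriv_nonneg[of 0] pM by simp
  have lip1: "\<bar>f s - f t\<bar> \<le> M0 * \<bar>s - t\<bar>" if "0 \<le> t" "t \<le> s" "s \<le> S" for s t
  proof -
    have "0 \<le> m * (s - t)" using m_nonneg that by simp
    then show ?thesis using slope[OF that] that by simp
  qed
  have lip: "\<bar>f s - f t\<bar> \<le> M0 * \<bar>s - t\<bar>" if "0 \<le> s" "s \<le> S" "0 \<le> t" "t \<le> S" for s t
    using lip1[of s t] lip1[of t s] that by (cases "t \<le> s") (auto simp: abs_minus_commute)
  have h3: "0 < \<theta>" "C1_holder_near_0 \<theta> f" "C1_holder_near_0 \<theta> g" using H3 by (auto simp: hyp_H3_def)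
  obtain C1 where C1: "0 \<le> C1" "\<And>s t. 0 \<le> s \<Longrightarrow> s \<le> S \<Longrightarrow> 0 \<le> t \<Longrightarrow> t \<le> S \<Longrightarrow>
    \<bar>f s - f t - p * (s - t)\<bar> \<le> C1 * (max s t powr \<theta>) * \<bar>s - t\<bar>"
    using holder_linearization[OF h3(2,1) lip M00] by blast
  obtain C2 where C2: "0 \<le> C2" "\<And>s t. 0 \<le> s \<Longrightarrow> s \<le> S \<Longrightarrow> 0 \<le> t \<Longrightarrow> t \<le> S \<Longrightarrow>
    \<bar>g s - g t - q * (s - t)\<bar> \<le> C2 * (max s t powr \<theta>) * \<bar>s - t\<bar>"
    using holder_linearization[OF h3(3,1), of S L] g_Lip L by (metis less_imp_le)
  have "speed_data \<alpha> K Q f g S (C1 + C2) \<theta> p q m L M0"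
  proof (intro speed_data.intro delay speed_data_axioms.intro)
    show "\<bar>f s - f t - p * (s - t)\<bar> \<le> (C1 + C2) * (max s t powr \<theta>) * \<bar>s - t\<bar>"
      if "0 \<le> s" "s \<le> S" "0 \<le> t" "t \<le> S" for s t
      using C1(2)[OF that] by (rule order_trans) (use C2(1) in \<open>auto intro!: mult_right_mono\<close>)
    show "\<bar>g s - g t - q * (s - t)\<bar> \<le> (C1 + C2) * (max s t powr \<theta>) * \<bar>s - t\<bar>"
      if "0 \<le> s" "s \<le> S" "0 \<le> t" "t \<le> S" for s t
      using C2(2)[OF that] by (rule order_trans) (use C1(1) in \<open>auto intro!: mult_right_mono\<close>)
  qed (use S C1 C2 h3 slope g_Lip H1 H2 m_nonneg m_le[of 0] pM q_pos q_le_L in \<open>auto simp: hyp_H1_def hyp_H2_def\<close>)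
  then show ?thesis using that by blast
qed

text \<open>The first equation at time 0 is the equation for \<phi>. The second one, solved by
  variation of constants, expresses \<psi> through \<phi>; hence uniqueness of \<phi> up to a shift
  yields that of the pair with the same shift.\<close>

lemma semi_wavefrontD:
  assumes wave: "semi_wavefront \<alpha> f g K P c \<phi> \<psi>"
  shows "\<exists>\<phi>' \<phi>''. (\<forall>x. (\<phi> has_real_derivative \<phi>' x) (at x)) \<and> (\<forall>x. (\<phi>' has_real_derivative \<phi>'' x) (at x)) \<and>
      (\<forall>x. \<phi>'' x - c * \<phi>' x - f (\<phi> x) + (\<integral>y. K (x - y) * \<psi> y \<partial>lborel) = 0)"
    and "\<psi> x = (\<integral>s. (exp (- (\<alpha> * s)) * (\<integral>r. g (\<phi> (x - c * s - c * r)) \<partial>Q)) * indicator {0..} s \<partial>lborel)"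
proof -
  interpret Qp: prob_space Q by (rule prob_Q)
  have c\<phi>: "continuous_on UNIV \<phi>" and c\<psi>: "continuous_on UNIV \<psi>"
    and bd: "bounded (range \<phi>)" "bounded (range \<psi>)" and pos: "\<And>x. 0 < \<phi> x"
    and sys: "solves_system \<alpha> f g K P (\<lambda>t x. \<phi> (x + c * t)) (\<lambda>t x. \<psi> (x + c * t))"
    using wave unfolding semi_wavefront_def by auto
  obtain u_t u_x u_xx v_t where sys': "\<And>t x. 0 \<le> t \<Longrightarrow>
        ((\<lambda>\<tau>. \<phi> (x + c * \<tau>)) has_real_derivative u_t t x) (at t within {0..}) \<and>
        ((\<lambda>y. \<phi> (y + c * t)) has_real_derivative u_x t x) (at x) \<and>
        ((\<lambda>y. u_x t y) has_real_derivative u_xx t x) (at x) \<and>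
        ((\<lambda>\<tau>. \<psi> (x + c * \<tau>)) has_real_derivative v_t t x) (at t within {0..}) \<and>
        u_t t x = u_xx t x - f (\<phi> (x + c * t)) + (\<integral>y. K (x - y) * \<psi> (y + c * t) \<partial>lborel) \<and>
        v_t t x = - \<alpha> * \<psi> (x + c * t) + (\<integral>s. g (\<phi> (x + c * (t - s))) \<partial>P)"
    using sys unfolding solves_system_def by blast
  have d1: "(\<phi> has_real_derivative u_x 0 x) (at x)" for x using sys'[of 0 x] by simp
  have d2: "(u_x 0 has_real_derivative u_xx 0 x) (at x)" for x using sys'[of 0 x] by simp
  \<comment> \<open>At time 0 only a one-sided time derivative is given; it agrees with the chain
    rule because derivatives relative to the half-line are unique.\<close>
  have "c * u_x 0 x = u_t 0 x" for x
  proof -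
    have "((\<lambda>\<tau>. \<phi> (x + c * \<tau>)) has_real_derivative u_x 0 (x + c * 0) * c) (at 0)"
      by (rule DERIV_chain2[OF d1]) (auto intro!: derivative_eq_intros)
    then have 1: "((\<lambda>\<tau>. \<phi> (x + c * \<tau>)) has_vector_derivative u_x 0 (x + c * 0) * c) (at 0 within {0..})"
      unfolding has_real_derivative_iff_has_vector_derivative by (rule has_vector_derivative_at_within)
    have 2: "((\<lambda>\<tau>. \<phi> (x + c * \<tau>)) has_vector_derivative u_t 0 x) (at 0 within {0..})"
      unfolding has_real_derivative_iff_has_vector_derivative[symmetric] using conjunct1[OF sys'[of 0 x]] by simp
    show ?thesis
      using vector_derivative_unique_within[OF at_within_nonneg_nontrivial 1 2] by (simp add: mult.commute)
  qed
  then have "u_xx 0 x - c * u_x 0 x - f (\<phi> x) + (\<integral>y. K (x - y) * \<psi> y \<partial>lborel) = 0" for x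
    using sys'[of 0 x] by simp
  with d1 d2 show "\<exists>\<phi>' \<phi>''. (\<forall>x. (\<phi> has_real_derivative \<phi>' x) (at x)) \<and> (\<forall>x. (\<phi>' has_real_derivative \<phi>'' x) (at x)) \<and>
      (\<forall>x. \<phi>'' x - c * \<phi>' x - f (\<phi> x) + (\<integral>y. K (x - y) * \<psi> y \<partial>lborel) = 0)"
    by (intro exI[of _ "u_x 0"] exI[of _ "u_xx 0"]) auto
  obtain S where S: "\<And>x. \<phi> x \<le> S" using bounded_upper[OF bd(1)] by blast
  obtain S' where S': "\<And>x. \<bar>\<psi> x\<bar> \<le> S'" using bd(2) by (force simp: bounded_iff)
  have g_cont: "continuous_on {0..} g" and g_nonneg: "\<And>s. 0 \<le> s \<Longrightarrow> 0 \<le> g s" and g0: "g 0 = 0"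
    using H1 by (auto simp: hyp_H1_def)
  have ch: "continuous_on UNIV (\<lambda>x. g (\<phi> x))"
    using pos by (intro continuous_on_compose2[OF g_cont c\<phi>]) (auto intro: less_imp_le)
  have hb: "\<bar>g (\<phi> x)\<bar> \<le> L * S" for x
  proof -
    have "\<bar>g (\<phi> x)\<bar> \<le> L * \<phi> x" using g_Lip[of "\<phi> x" 0] pos[of x] by (simp add: g0)
    also have "\<dots> \<le> L * S" using S L by (intro mult_left_mono) auto
    finally show ?thesis .
  qed
  define G where "G y = (\<integral>r. g (\<phi> (y - c * r)) \<partial>Q)" for y
  have cG: "continuous_on UNIV G" unfolding G_def
    by (rule continuous_integral_shift[where b="L * S", OF Qp.finite_measure_axioms _ ch hb]) simp
  have Gb: "\<bar>G y\<bar> \<le> L * S" for y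
  proof -
    have [measurable]: "(\<lambda>x. g (\<phi> x)) \<in> borel_measurable borel" by (rule borel_measurable_continuous_onI[OF ch])
    have i: "integrable Q (\<lambda>r. g (\<phi> (y - c * r)))"
      by (rule Qp.integrable_const_bound[where B="L * S"]) (use hb in auto)
    have "\<bar>G y\<bar> \<le> (\<integral>r. \<bar>g (\<phi> (y - c * r))\<bar> \<partial>Q)" unfolding G_def by (rule integral_abs_bound)
    also have "\<dots> \<le> (\<integral>r. L * S \<partial>Q)" using i hb by (intro integral_mono) auto
    finally show ?thesis by (simp add: Qp.prob_space)
  qed
  \<comment> \<open>The second equation is read at time 1, where the time derivative is two-sided,
    and at the position \<open>y - c\<close>, so that the profile is evaluated at
    \<open>y\<close>.\<close>
  have v: "((\<lambda>\<tau>. \<psi> (y - c + c * \<tau>)) has_real_derivative - \<alpha> * \<psi> y + G y) (at 1)" for y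
  proof -
    have "at (1::real) within {0..} = at 1" by (rule at_within_interior) simp
    moreover have "(\<integral>s. g (\<phi> (y - c + c * (1 - s))) \<partial>P) = G y"
    proof -
      have "(\<lambda>r. g (\<phi> (y - c * r))) \<in> borel_measurable borel"
        by (intro borel_measurable_continuous_onI continuous_on_compose2[OF ch] continuous_intros) auto
      then have "G y = (\<integral>r. g (\<phi> (y - c * r)) \<partial>P)" unfolding G_def by (rule Q_integral)
      then show ?thesis by (simp add: algebra_simps)
    qed
    ultimately have e: "v_t 1 (y - c) = - \<alpha> * \<psi> y + G y" and at1: "at (1::real) within {0..} = at 1"
      using sys'[of 1 "y - c"] by simp_all
    have d: "((\<lambda>\<tau>. \<psi> (y - c + c * \<tau>)) has_real_derivative v_t 1 (y - c)) (at 1)"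
      using sys'[OF zero_le_one, of "y - c"] unfolding at1 by blast
    show ?thesis using d unfolding e .
  qed
  \<comment> \<open>Only the composite of \<psi> with \<open>x - c * s\<close> is differentiated,
    never \<psi> itself, so that a vanishing speed \<open>c\<close> is covered by the same
    computation.\<close>
  define R where "R s = - (exp (- (\<alpha> * s)) * \<psi> (x - c * s))" for s
  have R': "(R has_real_derivative exp (- (\<alpha> * s)) * G (x - c * s)) (at s)" for s
  proof -
    define T where "T \<tau> = \<psi> (x - c * s - c + c * \<tau>)" for \<tau>
    have T: "(T has_real_derivative - \<alpha> * \<psi> (x - c * s) + G (x - c * s)) (at (1 + s - s))"
      unfolding T_def using v[of "x - c * s"] by simp
    have "((\<lambda>s'. T (1 + s - s')) has_real_derivative (- \<alpha> * \<psi> (x - c * s) + G (x - c * s)) * (- 1)) (at s)"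
      by (rule DERIV_chain2[where f=T and g="\<lambda>s'. 1 + s - s'" and x=s, OF T]) (auto intro!: derivative_eq_intros)
    moreover have "(\<lambda>s'. T (1 + s - s')) = (\<lambda>s'. \<psi> (x - c * s'))"
      by (auto simp: T_def algebra_simps)
    ultimately have "((\<lambda>s'. \<psi> (x - c * s')) has_real_derivative \<alpha> * \<psi> (x - c * s) - G (x - c * s)) (at s)" by simp
    then show ?thesis unfolding R_def
      by (auto intro!: derivative_eq_intros simp: algebra_simps)
  qed
  have "(\<integral>s. (exp (- (\<alpha> * s)) * G (x - c * s)) * indicator {0..} s \<partial>lborel) = - R 0"
  proof (rule integral_half_line[OF _ _ R' filterlim_real_sequentially])
    have cGs: "continuous_on UNIV (\<lambda>s. G (x - c * s))" by (intro continuous_on_compose2[OF cG] continuous_intros) auto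
    then show "continuous_on UNIV (\<lambda>s. exp (- (\<alpha> * s)) * G (x - c * s))" by (intro continuous_intros)
    show "integrable lborel (\<lambda>s. exp (- (\<alpha> * s)) * G (x - c * s) * indicator {0..} s)"
      using integrable_exp_half_line[OF \<alpha> cGs, of "L * S" 0] Gb by simp
    show "(\<lambda>m. R (real m)) \<longlonglongrightarrow> 0"
    proof (rule Lim_null_comparison)
      show "(\<lambda>m. S' * exp (- (\<alpha> * real m))) \<longlonglongrightarrow> 0"
        using filterlim_compose[OF tendsto_exp_neg_at_top[OF \<alpha>] filterlim_real_sequentially] by (rule tendsto_mult_right_zero)
      show "\<forall>\<^sub>F m in sequentially. norm (R (real m)) \<le> S' * exp (- (\<alpha> * real m))"
        using S' by (intro always_eventually allI) (simp add: R_def abs_mult mult.commute[of _ "exp _"])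
    qed
  qed
  then show "\<psi> x = (\<integral>s. (exp (- (\<alpha> * s)) * (\<integral>r. g (\<phi> (x - c * s - c * r)) \<partial>Q)) * indicator {0..} s \<partial>lborel)"
    by (simp add: R_def G_def)
qed

lemma semi_wavefront_profile:
  assumes wave: "semi_wavefront \<alpha> f g K P c \<phi> \<psi>" and S: "\<And>x. \<phi> x \<le> S"
    and data: "speed_data \<alpha> K Q f g S C \<theta> p q m L M"
  shows "speed_data.profile \<alpha> c K Q f g S \<phi>"
proof -
  interpret speed_data \<alpha> c K Q f g S C \<theta> p q m L M by (rule data)
  have c\<phi>: "continuous_on UNIV \<phi>" and c\<psi>: "continuous_on UNIV \<psi>" and bot: "(\<phi> \<longlongrightarrow> 0) at_bot"
    and bd: "bounded (range \<psi>)" and pos: "\<And>x. 0 < \<phi> x"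
    using wave unfolding semi_wavefront_def by auto
  have g_cont: "continuous_on {0..} g" and g_nonneg: "\<And>s. 0 \<le> s \<Longrightarrow> 0 \<le> g s" and g0: "g 0 = 0"
    using H1 by (auto simp: hyp_H1_def)
  obtain S' where S': "\<And>x. \<bar>\<psi> x\<bar> \<le> S'" using bd by (force simp: bounded_iff)
  obtain \<phi>' \<phi>'' where d: "\<And>x. (\<phi> has_real_derivative \<phi>' x) (at x)" "\<And>x. (\<phi>' has_real_derivative \<phi>'' x) (at x)"
    and ode: "\<And>x. \<phi>'' x - c * \<phi>' x - f (\<phi> x) + (\<integral>y. K (x - y) * \<psi> y \<partial>lborel) = 0"
    using semi_wavefrontD(1)[OF wave] by blast
  have "(\<integral>y. K (x - y) * \<psi> y \<partial>lborel) = (\<integral>u. g (\<phi> (x - u)) / \<alpha> \<partial>law)" for x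
  proof (rule nonlocal_term[where h="\<lambda>x. g (\<phi> x)" and b="L * S" and b'=S'])
    show "continuous_on UNIV (\<lambda>x. g (\<phi> x))"
      using pos by (intro continuous_on_compose2[OF g_cont c\<phi>]) (auto intro: less_imp_le)
    show "0 \<le> g (\<phi> x)" for x using g_nonneg pos by (auto intro: less_imp_le)
    show "g (\<phi> x) \<le> L * S" for x
    proof -
      have "g (\<phi> x) \<le> L * \<phi> x" using wave_problem.g_Lip[OF wave_problem_axioms, of "\<phi> x" 0] pos[of x] by (simp add: g0)
      also have "\<dots> \<le> L * S" using S L by (intro mult_left_mono) auto
      finally show ?thesis .
    qed
  qed (use S' c\<psi> semi_wavefrontD(2)[OF wave] in \<open>auto intro: borel_measurable_continuous_onI\<close>)
  then show ?thesis
    unfolding profile_def using pos S bot d ode by (auto intro: less_imp_le)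
qed

section \<open>The transform of the law and the characteristic functions\<close>

definition mgf :: "real \<Rightarrow> real \<Rightarrow> ennreal" where
  "mgf c z = (\<integral>\<^sup>+u. ennreal (exp (- (z * u))) \<partial>(delay_data.law \<alpha> c K Q))"


lemma mgf_char:
  assumes cz: "0 < c * z + \<alpha>"
  shows "mgf c z = ennreal (\<alpha> / (c * z + \<alpha>)) *
    ((\<integral>\<^sup>+r. ennreal (exp (- (z * c * r))) \<partial>P) * (\<integral>\<^sup>+w. ennreal (K w * exp (- (z * w))) \<partial>lborel))"
proof -
  have "(\<integral>\<^sup>+r. ennreal (exp (- (z * c * r))) \<partial>Q) = (\<integral>\<^sup>+r. ennreal (exp (- (z * c * r))) \<partial>P)"
    by (rule Q_nn_integral) measurable
  then show ?thesis unfolding mgf_def using delay_data.law_transform[OF delay cz] by simp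
qed

text \<open>The factor 1 / (c z + \<alpha>) is part of the transform of the law, up to \<alpha>.
  This form has no singular denominator and makes convexity and monotonicity visible.\<close>

lemma char_fun_finite:
  assumes cz: "0 < c * z + \<alpha>" and M: "mgf c z = ennreal y" "0 \<le> y"
  shows "char_fun \<alpha> K P a b z c = ereal (z\<^sup>2 - c * z - a + b / \<alpha> * y)"
proof -
  define X where "X = (\<integral>\<^sup>+r. ennreal (exp (- (z * c * r))) \<partial>P) * (\<integral>\<^sup>+w. ennreal (K w * exp (- (z * w))) \<partial>lborel)"
  define k where "k = \<alpha> / (c * z + \<alpha>)"
  have k: "0 < k" using cz \<alpha> by (simp add: k_def)
  have MX: "mgf c z = ennreal k * X" unfolding mgf_char[OF cz] X_def k_def ..
  have "X \<noteq> \<infinity>" using MX M(1) k by (auto simp: ennreal_mult_top)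
  then obtain x where x: "X = ennreal x" "0 \<le> x" by (cases X) auto
  have "ennreal y = ennreal (k * x)" using MX M x k by (simp add: ennreal_mult)
  then have y: "y = k * x" using M(2) x(2) k by simp
  have "b / (c * z + \<alpha>) * x = b / \<alpha> * y" using \<alpha> cz by (simp add: y k_def)
  then show ?thesis
    unfolding char_fun_def X_def[symmetric] x(1) using x(2) by simp
qed

lemma char_fun_infinite:
  assumes cz: "0 < c * z + \<alpha>" and M: "mgf c z = \<infinity>" and b: "0 < b"
  shows "char_fun \<alpha> K P a b z c = \<infinity>"
proof -
  define X where "X = (\<integral>\<^sup>+r. ennreal (exp (- (z * c * r))) \<partial>P) * (\<integral>\<^sup>+w. ennreal (K w * exp (- (z * w))) \<partial>lborel)"
  have MX: "mgf c z = ennreal (\<alpha> / (c * z + \<alpha>)) * X" unfolding mgf_char[OF cz] X_def ..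
  have "X = \<infinity>"
  proof (rule ccontr)
    assume "X \<noteq> \<infinity>"
    then have "mgf c z < \<infinity>" unfolding MX by (simp add: ennreal_mult_less_top less_top)
    with M show False by simp
  qed
  moreover obtain k where "b / (c * z + \<alpha>) = k" "0 < k" using b cz by simp
  ultimately show ?thesis unfolding char_fun_def X_def[symmetric] by simp
qed

lemma mgf_0: "mgf c 0 = 1"
  unfolding mgf_def using prob_space.emeasure_space_1[OF delay_data.prob_law[OF delay]] by simp

lemma mgf_law_nn:
  "mgf c z = (\<integral>\<^sup>+w. ennreal (K w) * (\<integral>\<^sup>+s. ennreal (exponential_density \<alpha> s) *
     (\<integral>\<^sup>+r. ennreal (exp (- (z * (w + c * (s + r))))) \<partial>Q) \<partial>lborel) \<partial>lborel)"
  unfolding mgf_def by (rule delay_data.law_nn[OF delay]) measurable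

lemma mgf_le:
  assumes "0 \<le> z" "z \<le> z2"
  shows "mgf c z \<le> 1 + mgf c z2"
proof -
  have [simp]: "sets (delay_data.law \<alpha> c K Q) = sets borel" by (rule delay_data.sets_law[OF delay])
  have "mgf c z \<le> (\<integral>\<^sup>+u. 1 + ennreal (exp (- (z2 * u))) \<partial>(delay_data.law \<alpha> c K Q))"
    unfolding mgf_def
  proof (rule nn_integral_mono)
    fix u
    have "exp (- (z * u)) \<le> 1 + exp (- (z2 * u))"
    proof (cases "0 \<le> u")
      case True
      then have "exp (- (z * u)) \<le> 1" using assms by simp
      then show ?thesis by (simp add: add_increasing2)
    next
      case False
      then have "z2 * u \<le> z * u" using assms by (intro mult_right_mono_neg) auto
      then have "exp (- (z * u)) \<le> exp (- (z2 * u))" by simp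
      then show ?thesis by linarith
    qed
    then have "ennreal (exp (- (z * u))) \<le> ennreal (1 + exp (- (z2 * u)))" by (rule ennreal_leI)
    then show "ennreal (exp (- (z * u))) \<le> 1 + ennreal (exp (- (z2 * u)))" by (simp add: ennreal_plus)
  qed
  also have "\<dots> = mgf c 0 + mgf c z2"
    unfolding mgf_def by (subst nn_integral_add) (auto simp: measurable_cong_sets[OF \<open>sets _ = _\<close> refl])
  finally show ?thesis by (simp add: mgf_0)
qed

text \<open>Waiting time and delay are nonnegative, so a larger speed moves the law to the right and
  decreases the integrand.\<close>

lemma mgf_antimono:
  assumes "c \<le> c'" "0 \<le> z"
  shows "mgf c' z \<le> mgf c z"
  unfolding mgf_law_nn
proof (rule nn_integral_mono, rule mult_left_mono, rule nn_integral_mono)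
  fix w s :: real
  show "ennreal (exponential_density \<alpha> s) * (\<integral>\<^sup>+r. ennreal (exp (- (z * (w + c' * (s + r))))) \<partial>Q) \<le>
    ennreal (exponential_density \<alpha> s) * (\<integral>\<^sup>+r. ennreal (exp (- (z * (w + c * (s + r))))) \<partial>Q)"
  proof (cases "0 \<le> s")
    case True
    show ?thesis
    proof (intro mult_left_mono nn_integral_mono_AE)
      show "AE r in Q. ennreal (exp (- (z * (w + c' * (s + r))))) \<le> ennreal (exp (- (z * (w + c * (s + r)))))"
        using Q_nonneg
      proof eventually_elim
        case (elim r)
        have "c * (s + r) \<le> c' * (s + r)" using assms(1) True elim by (intro mult_right_mono) auto
        then have "z * (w + c * (s + r)) \<le> z * (w + c' * (s + r))" using assms(2) by (intro mult_left_mono) auto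
        then show ?case by (simp add: ennreal_leI)
      qed
    qed simp
  qed (simp add: exponential_density_def)
qed simp

lemma exp_convex_comb:
  fixes t x y :: real
  assumes "0 \<le> t" "t \<le> 1"
  shows "ennreal (exp (- ((1 - t) * x + t * y))) \<le> ennreal (1 - t) * ennreal (exp (- x)) + ennreal t * ennreal (exp (- y))"
proof -
  have "exp ((1 - t) *\<^sub>R (- x) + t *\<^sub>R (- y)) \<le> (1 - t) * exp (- x) + t * exp (- y)"
    using assms by (intro convex_onD[OF exp_convex]) auto
  then have "exp (- ((1 - t) * x + t * y)) \<le> (1 - t) * exp (- x) + t * exp (- y)" by (simp add: algebra_simps)
  then have "ennreal (exp (- ((1 - t) * x + t * y))) \<le> ennreal ((1 - t) * exp (- x) + t * exp (- y))" by (rule ennreal_leI)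
  also have "\<dots> = ennreal (1 - t) * ennreal (exp (- x)) + ennreal t * ennreal (exp (- y))"
    using assms by (simp add: ennreal_plus ennreal_mult)
  finally show ?thesis .
qed

text \<open>For fixed outcomes the exponent is affine in the speed, so the integrand is convex in
  it, and integration preserves this through all three layers.\<close>

lemma mgf_convex_speed:
  assumes "0 \<le> t" "t \<le> 1"
  shows "mgf ((1 - t) * c0 + t * c1) z \<le> ennreal (1 - t) * mgf c0 z + ennreal t * mgf c1 z"
proof -
  define A where "A c w s = (\<integral>\<^sup>+r. ennreal (exp (- (z * (w + c * (s + r))))) \<partial>Q)" for c w s
  interpret Qp: prob_space Q by (rule prob_Q)
  have [measurable]: "(\<lambda>(w, s). A c w s) \<in> borel_measurable (lborel \<Otimes>\<^sub>M lborel)" for c unfolding A_def by measurable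
  have [measurable]: "A c w \<in> borel_measurable borel" for c w unfolding A_def by measurable
  have 1: "A ((1 - t) * c0 + t * c1) w s \<le> ennreal (1 - t) * A c0 w s + ennreal t * A c1 w s" for w s
  proof -
    have "A ((1 - t) * c0 + t * c1) w s \<le> (\<integral>\<^sup>+r. ennreal (1 - t) * ennreal (exp (- (z * (w + c0 * (s + r))))) +
      ennreal t * ennreal (exp (- (z * (w + c1 * (s + r))))) \<partial>Q)"
      unfolding A_def
    proof (rule nn_integral_mono)
      fix r
      have "z * (w + ((1 - t) * c0 + t * c1) * (s + r)) = (1 - t) * (z * (w + c0 * (s + r))) + t * (z * (w + c1 * (s + r)))"
        by (simp add: algebra_simps)
      then show "ennreal (exp (- (z * (w + ((1 - t) * c0 + t * c1) * (s + r))))) \<le>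
        ennreal (1 - t) * ennreal (exp (- (z * (w + c0 * (s + r))))) + ennreal t * ennreal (exp (- (z * (w + c1 * (s + r)))))"
        using exp_convex_comb[OF assms] by simp
    qed
    also have "\<dots> = ennreal (1 - t) * A c0 w s + ennreal t * A c1 w s"
      unfolding A_def by (subst nn_integral_add) (auto simp: nn_integral_cmult)
    finally show ?thesis .
  qed
  define B where "B c w = (\<integral>\<^sup>+s. ennreal (exponential_density \<alpha> s) * A c w s \<partial>lborel)" for c w
  have [measurable]: "B c \<in> borel_measurable borel" for c unfolding B_def by measurable
  have 2: "B ((1 - t) * c0 + t * c1) w \<le> ennreal (1 - t) * B c0 w + ennreal t * B c1 w" for w
  proof -
    have "B ((1 - t) * c0 + t * c1) w \<le> (\<integral>\<^sup>+s. ennreal (1 - t) * (ennreal (exponential_density \<alpha> s) * A c0 w s) +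
      ennreal t * (ennreal (exponential_density \<alpha> s) * A c1 w s) \<partial>lborel)"
      unfolding B_def
    proof (rule nn_integral_mono)
      fix s
      have "ennreal (exponential_density \<alpha> s) * A ((1 - t) * c0 + t * c1) w s \<le>
        ennreal (exponential_density \<alpha> s) * (ennreal (1 - t) * A c0 w s + ennreal t * A c1 w s)"
        by (intro mult_left_mono 1) simp
      then show "ennreal (exponential_density \<alpha> s) * A ((1 - t) * c0 + t * c1) w s \<le>
        ennreal (1 - t) * (ennreal (exponential_density \<alpha> s) * A c0 w s) + ennreal t * (ennreal (exponential_density \<alpha> s) * A c1 w s)"
        by (simp only: distrib_left mult_ac)
    qed
    also have "\<dots> = ennreal (1 - t) * B c0 w + ennreal t * B c1 w"
      unfolding B_def by (subst nn_integral_add) (auto simp: nn_integral_cmult)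
    finally show ?thesis .
  qed
  have "mgf ((1 - t) * c0 + t * c1) z \<le> (\<integral>\<^sup>+w. ennreal (1 - t) * (ennreal (K w) * B c0 w) + ennreal t * (ennreal (K w) * B c1 w) \<partial>lborel)"
    unfolding mgf_law_nn A_def[symmetric] B_def[symmetric]
  proof (rule nn_integral_mono)
    fix w
    have "ennreal (K w) * B ((1 - t) * c0 + t * c1) w \<le> ennreal (K w) * (ennreal (1 - t) * B c0 w + ennreal t * B c1 w)"
      by (intro mult_left_mono 2) simp
    then show "ennreal (K w) * B ((1 - t) * c0 + t * c1) w \<le> ennreal (1 - t) * (ennreal (K w) * B c0 w) + ennreal t * (ennreal (K w) * B c1 w)"
      by (simp only: distrib_left mult_ac)
  qed
  also have "\<dots> = ennreal (1 - t) * mgf c0 z + ennreal t * mgf c1 z"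
    unfolding mgf_law_nn A_def[symmetric] B_def[symmetric] using K_int
    by (subst nn_integral_add) (auto simp: nn_integral_cmult)
  finally show ?thesis .
qed

text \<open>Convexity along the segment from 0 to \<open>z\<close>, with the value 1 at 0.\<close>

lemma mgf_convex_scale:
  assumes "0 \<le> t" "t \<le> 1"
  shows "mgf c (t * z) \<le> ennreal (1 - t) + ennreal t * mgf c z"
proof -
  have [simp]: "sets (delay_data.law \<alpha> c K Q) = sets borel" by (rule delay_data.sets_law[OF delay])
  have "mgf c (t * z) \<le> (\<integral>\<^sup>+u. ennreal (1 - t) * ennreal (exp (- (0 * u))) + ennreal t * ennreal (exp (- (z * u))) \<partial>(delay_data.law \<alpha> c K Q))"
    unfolding mgf_def
  proof (rule nn_integral_mono)
    fix u
    show "ennreal (exp (- (t * z * u))) \<le> ennreal (1 - t) * ennreal (exp (- (0 * u))) + ennreal t * ennreal (exp (- (z * u)))"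
      using exp_convex_comb[OF assms, of "0 * u" "z * u"] by (simp add: mult.assoc)
  qed
  also have "\<dots> = ennreal (1 - t) * mgf c 0 + ennreal t * mgf c z"
    unfolding mgf_def by (subst nn_integral_add) (auto simp: nn_integral_cmult measurable_cong_sets[OF \<open>sets _ = _\<close> refl])
  finally show ?thesis by (simp add: mgf_0)
qed

lemma mgf_continuous:
  assumes fin: "mgf c z2 < \<infinity>"
  shows "continuous_on {0..z2} (\<lambda>z. enn2real (mgf c z))"
proof -
  define M where "M = delay_data.law \<alpha> c K Q"
  interpret M: prob_space M unfolding M_def by (rule delay_data.prob_law[OF delay])
  have sM [measurable_cong]: "sets M = sets borel" unfolding M_def by (rule delay_data.sets_law[OF delay])
  have eq: "enn2real (mgf c z) = (\<integral>u. exp (- (z * u)) \<partial>M)" for z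
    unfolding mgf_def M_def[symmetric] by (subst integral_eq_nn_integral) auto
  have i2: "integrable M (\<lambda>u. exp (- (z2 * u)))"
    by (rule integrableI_nonneg) (use fin in \<open>auto simp: mgf_def M_def[symmetric]\<close>)
  show ?thesis
    unfolding eq continuous_on_sequentially
  proof (intro ballI allI impI)
    fix X z assume z: "z \<in> {0..z2}" and X: "(\<forall>m. X m \<in> {0..z2}) \<and> X \<longlonglongrightarrow> z"
    have "(\<lambda>m. \<integral>u. exp (- (X m * u)) \<partial>M) \<longlonglongrightarrow> (\<integral>u. exp (- (z * u)) \<partial>M)"
    proof (rule integral_dominated_convergence[where w="\<lambda>u. 1 + exp (- (z2 * u))"])
      show "integrable M (\<lambda>u. 1 + exp (- (z2 * u)))" using i2 by simp
      show "AE u in M. (\<lambda>m. exp (- (X m * u))) \<longlonglongrightarrow> exp (- (z * u))"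
        using X by (intro AE_I2 tendsto_intros) auto
      show "AE u in M. norm (exp (- (X m * u))) \<le> 1 + exp (- (z2 * u))" for m
      proof (intro AE_I2)
        fix u
        have Xm: "0 \<le> X m" "X m \<le> z2" using X by auto
        show "norm (exp (- (X m * u))) \<le> 1 + exp (- (z2 * u))"
        proof (cases "0 \<le> u")
          case True
          then have "exp (- (X m * u)) \<le> 1" using Xm by simp
          then show ?thesis by (simp add: add_increasing2)
        next
          case False
          then have "z2 * u \<le> X m * u" using Xm by (intro mult_right_mono_neg) auto
          then have "exp (- (X m * u)) \<le> exp (- (z2 * u))" by simp
          then show ?thesis by (simp del: exp_le_cancel_iff)
        qed
      qed
    qed auto
    then show "((\<lambda>z. \<integral>u. exp (- (z * u)) \<partial>M) \<circ> X) \<longlonglongrightarrow> (\<integral>u. exp (- (z * u)) \<partial>M)" by (simp add: o_def)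
  qed
qed

abbreviation chi :: "real \<Rightarrow> real \<Rightarrow> real" where
  "chi z c \<equiv> z\<^sup>2 - c * z - p + q / \<alpha> * enn2real (mgf c z)"

text \<open>The last property says that finiteness of the transform never persists up to \<gamma>: a
  finite value at or beyond \<gamma> would bound the characteristic function on all of the interval
  below \<gamma>, against its blow-up. Hence the convergence range is open on the right, which
  leaves room beyond any admissible exponent.\<close>

lemma blow_up_point:
  obtains \<gamma> :: ereal where "0 < \<gamma>"
    "\<And>z. 0 \<le> z \<Longrightarrow> ereal z < \<gamma> \<Longrightarrow> 0 < c * z + \<alpha> \<and> mgf c z < \<infinity> \<and> chi0 \<alpha> f g K P z c = ereal (chi z c)"
    "\<And>z B. 0 \<le> z \<Longrightarrow> ereal z < \<gamma> \<Longrightarrow> \<exists>z'>z. ereal z' < \<gamma> \<and> B < chi z' c"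
    "\<And>z. 0 \<le> z \<Longrightarrow> mgf c z < \<infinity> \<Longrightarrow> ereal z < \<gamma>"
proof -
  obtain \<gamma> :: ereal where \<gamma>: "0 < \<gamma>"
    and dom: "\<And>z. 0 \<le> z \<Longrightarrow> ereal z < \<gamma> \<Longrightarrow> c * z + \<alpha> > 0 \<and> chi0 \<alpha> f g K P z c < \<infinity>"
    and lim: "((\<lambda>x. chi0 \<alpha> f g K P (real_of_ereal x) c) \<longlongrightarrow> \<infinity>) (at_left \<gamma>)"
    using blow_up[of c] unfolding blow_up_condition_def by blast
  have fin: "0 < c * z + \<alpha> \<and> mgf c z < \<infinity> \<and> chi0 \<alpha> f g K P z c = ereal (chi z c)" if "0 \<le> z" "ereal z < \<gamma>" for z
  proof -
    have cz: "0 < c * z + \<alpha>" and "chi0 \<alpha> f g K P z c \<noteq> \<infinity>" using dom[OF that] by auto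
    then have "mgf c z \<noteq> \<infinity>" using char_fun_infinite[OF cz _ q_pos] by (auto simp: chi0_def)
    then obtain y where y: "mgf c z = ennreal y" "0 \<le> y" by (cases "mgf c z") auto
    show ?thesis using cz char_fun_finite[OF cz y] y by (simp add: chi0_def)
  qed
  have big: "\<exists>z'>z. ereal z' < \<gamma> \<and> B < chi z' c" if z: "0 \<le> z" "ereal z < \<gamma>" for z B
  proof -
    have "\<forall>\<^sub>F x in at_left \<gamma>. ereal B < chi0 \<alpha> f g K P (real_of_ereal x) c"
      by (rule order_tendstoD(1)[OF lim]) simp
    then obtain b where b: "b < \<gamma>" "\<And>y. b < y \<Longrightarrow> y < \<gamma> \<Longrightarrow> ereal B < chi0 \<alpha> f g K P (real_of_ereal y) c"
      unfolding eventually_at_left[OF \<gamma>] by blast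
    have "max b (ereal z) < \<gamma>" using b(1) z(2) by simp
    then obtain w where w: "max b (ereal z) < ereal w" "ereal w < \<gamma>" using ereal_dense2 by blast
    have zw: "z < w" using w(1) by simp
    have "ereal B < chi0 \<alpha> f g K P w c" using b(2)[of "ereal w"] w by simp
    then show ?thesis using fin[of w] zw z w(2) by (intro exI[of _ w]) auto
  qed
  have lt: "ereal z < \<gamma>" if z: "0 \<le> z" "mgf c z < \<infinity>" for z
  proof (rule ccontr)
    assume n: "\<not> ereal z < \<gamma>"
    define y where "y = enn2real (1 + mgf c z)"
    have y: "1 + mgf c z = ennreal y" using z(2) by (simp add: y_def)
    obtain z' where z': "0 < z'" "ereal z' < \<gamma>" "z\<^sup>2 + \<bar>c\<bar> * z + q / \<alpha> * y < chi z' c"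
      using big[of 0 "z\<^sup>2 + \<bar>c\<bar> * z + q / \<alpha> * y"] \<gamma> by (auto simp: zero_ereal_def)
    have "ereal z' < ereal z" using z'(2) n by (meson less_le_trans not_less)
    then have zz: "z' < z" by simp
    have "mgf c z' \<le> ennreal y" using mgf_le[of z' z c] z' zz y by simp
    then have "enn2real (mgf c z') \<le> y" by (intro enn2real_leI) (simp_all add: y_def)
    then have "q / \<alpha> * enn2real (mgf c z') \<le> q / \<alpha> * y" using q_pos \<alpha> by (intro mult_left_mono) auto
    moreover have "z'\<^sup>2 \<le> z\<^sup>2" using zz z' by (intro power_mono) auto
    moreover have "- (c * z') \<le> \<bar>c\<bar> * z"
    proof -
      have "- (c * z') \<le> \<bar>c\<bar> * z'" using z' by (simp add: abs_if)
      also have "\<dots> \<le> \<bar>c\<bar> * z" using zz by (intro mult_left_mono) auto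
      finally show ?thesis .
    qed
    moreover have "0 \<le> p" by (rule f_deriv_nonneg) simp
    ultimately show False using z'(3) by linarith
  qed
  show ?thesis using that[OF \<gamma> fin big lt] by blast
qed

text \<open>A nonpositive value, followed by growth beyond all bounds before \<gamma>, produces a
  zero by continuity; so a nonpositive value is as good as a root.\<close>

lemma root_exists:
  assumes z: "0 < z" "mgf c z < \<infinity>" and neg: "chi z c \<le> 0"
  shows "c \<in> root_speeds \<alpha> (chi0 \<alpha> f g K P)"
proof -
  obtain \<gamma> :: ereal where \<gamma>: "0 < \<gamma>"
    and dom: "\<And>z. 0 \<le> z \<Longrightarrow> ereal z < \<gamma> \<Longrightarrow> 0 < c * z + \<alpha> \<and> mgf c z < \<infinity> \<and> chi0 \<alpha> f g K P z c = ereal (chi z c)"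
    and big: "\<And>z B. 0 \<le> z \<Longrightarrow> ereal z < \<gamma> \<Longrightarrow> \<exists>z'>z. ereal z' < \<gamma> \<and> B < chi z' c"
    and lt: "\<And>z. 0 \<le> z \<Longrightarrow> mgf c z < \<infinity> \<Longrightarrow> ereal z < \<gamma>"
    using blow_up_point[of c] by blast
  have z\<gamma>: "ereal z < \<gamma>" using lt z by simp
  obtain z2 where z2: "z < z2" "ereal z2 < \<gamma>" "0 < chi z2 c" using big[of z 0] z z\<gamma> by auto
  have "continuous_on {0..z2} (\<lambda>z. enn2real (mgf c z))" by (rule mgf_continuous) (use dom z z2 in auto)
  then have "continuous_on {z..z2} (\<lambda>z. enn2real (mgf c z))" by (rule continuous_on_subset) (use z in auto)
  then have "continuous_on {z..z2} (\<lambda>z. chi z c)" by (intro continuous_intros)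
  then obtain x where x: "z \<le> x" "x \<le> z2" "chi x c = 0"
    using IVT'[of "\<lambda>z. chi z c" z 0 z2] neg z2 by auto
  have "ereal x < \<gamma>" using x(2) z2(2) by (meson ereal_less_eq(3) le_less_trans)
  then have "0 < c * x + \<alpha>" "chi0 \<alpha> f g K P x c = 0" using dom[of x] x z by (auto simp: zero_ereal_def)
  moreover have "0 < x" using x(1) z(1) by simp
  ultimately show ?thesis unfolding root_speeds_def by blast
qed

text \<open>If \<open>\<chi>\<^sub>0\<close> were nonpositive at \<open>0\<close>, strict convexity in \<open>z\<close> and convexity in \<open>c\<close> would
  produce roots for speeds below any given root speed.\<close>

lemma unstable:
  assumes min: "minimal_speed \<alpha> (chi0 \<alpha> f g K P) c0"
  shows "p < q / \<alpha>"
proof (rule ccontr)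
  assume "\<not> p < q / \<alpha>"
  then have le: "q / \<alpha> \<le> p" by simp
  have qa: "0 < q / \<alpha>" using q_pos \<alpha> by simp
  obtain z0 where z0: "0 < z0" "0 < c0 * z0 + \<alpha>" "chi0 \<alpha> f g K P z0 c0 = 0"
    using min unfolding minimal_speed_def root_speeds_def by blast
  have "mgf c0 z0 \<noteq> \<infinity>" using char_fun_infinite[OF z0(2) _ q_pos] z0(3) by (auto simp: chi0_def)
  then obtain y0 where y0: "mgf c0 z0 = ennreal y0" "0 \<le> y0" by (cases "mgf c0 z0") auto
  have root: "z0\<^sup>2 - c0 * z0 - p + q / \<alpha> * y0 = 0"
    using z0(3) char_fun_finite[OF z0(2) y0] by (simp add: chi0_def zero_ereal_def)
  \<comment> \<open>An arbitrary slower speed. The blow-up condition at \<open>c1\<close> provides a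
    small exponent \<open>z\<close> with finite transform there, and convexity in the speed controls
    everything between \<open>c1\<close> and \<open>c0\<close>.\<close>
  define c1 where "c1 = c0 - 1"
  obtain \<gamma> :: ereal where \<gamma>: "0 < \<gamma>"
    and dom: "\<And>z. 0 \<le> z \<Longrightarrow> ereal z < \<gamma> \<Longrightarrow> 0 < c1 * z + \<alpha> \<and> mgf c1 z < \<infinity> \<and> chi0 \<alpha> f g K P z c1 = ereal (chi z c1)"
    using blow_up_point[of c1] by metis
  have "ereal 0 < min \<gamma> (ereal z0)" using \<gamma> z0 by (simp add: zero_ereal_def)
  then obtain z where z: "ereal 0 < ereal z" "ereal z < min \<gamma> (ereal z0)" using ereal_dense2 by blast
  have z': "0 < z" "z < z0" "mgf c1 z < \<infinity>" using z dom[of z] by auto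
  define t where "t = z / z0"
  have t: "0 < t" "t < 1" "z = t * z0" using z' z0 by (auto simp: t_def)
  have Mz: "mgf c0 z \<le> ennreal (1 - t + t * y0)"
  proof -
    have "mgf c0 (t * z0) \<le> ennreal (1 - t) + ennreal t * mgf c0 z0" using t by (intro mgf_convex_scale) auto
    also have "\<dots> = ennreal (1 - t + t * y0)" unfolding y0(1) using t y0(2) by (simp add: ennreal_mult ennreal_plus)
    finally show ?thesis using t(3) by simp
  qed
  obtain x0 where x0: "mgf c0 z = ennreal x0" "0 \<le> x0" using Mz by (cases "mgf c0 z") (auto simp: top_unique)
  obtain x1 where x1: "mgf c1 z = ennreal x1" "0 \<le> x1" using z'(3) by (cases "mgf c1 z") auto
  have x0le: "x0 \<le> 1 - t + t * y0" using Mz x0 t y0 by (subst (asm) x0(1), subst (asm) ennreal_le_iff) auto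
  define A where "A = z\<^sup>2 - c0 * z - p + q / \<alpha> * x0"
  define B where "B = z\<^sup>2 - c1 * z - p + q / \<alpha> * x1"
  \<comment> \<open>On the segment from 0 to the root \<open>z0\<close>, convexity of the transform
    leaves a multiple of the root value 0, a multiple of the nonpositive value at 0, and the
    strictly negative contribution \<open>t\<^sup>2 - t\<close> of the square.\<close>
  have A: "A < 0"
  proof -
    have "q / \<alpha> * x0 \<le> q / \<alpha> * (1 - t + t * y0)" using x0le qa by (intro mult_left_mono) auto
    then have "A \<le> t\<^sup>2 * z0\<^sup>2 - t * (c0 * z0) - p + q / \<alpha> * (1 - t + t * y0)"
      unfolding A_def by (simp add: t(3) power_mult_distrib algebra_simps)
    also have "\<dots> = t * (z0\<^sup>2 - c0 * z0 - p + q / \<alpha> * y0) + (t\<^sup>2 - t) * z0\<^sup>2 + (1 - t) * (q / \<alpha> - p)"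
      by (simp add: algebra_simps add_divide_distrib diff_divide_distrib)
    also have "\<dots> < 0"
    proof -
      have "t\<^sup>2 < t" using t by (simp add: power2_eq_square)
      then have "(t\<^sup>2 - t) * z0\<^sup>2 < 0" using z0 by (intro mult_neg_pos) auto
      moreover have "(1 - t) * (q / \<alpha> - p) \<le> 0" using t le by (intro mult_nonneg_nonpos) auto
      ultimately show ?thesis unfolding root by simp
    qed
    finally show ?thesis .
  qed
  define W where "W = \<bar>A\<bar> + \<bar>B\<bar>"
  have p2: "0 < W" "\<bar>A\<bar> < 2 * W" using A by (auto simp: W_def)
  \<comment> \<open>So small that moving the speed by the fraction \<open>e\<close> towards
    \<open>c1\<close> changes the value by at most half of \<open>\<bar>A\<bar>\<close>, which keeps
    it negative.\<close>
  define e where "e = \<bar>A\<bar> / (2 * W)"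
  have "0 < e" unfolding e_def using A p2(1) by (intro divide_pos_pos) auto
  moreover have "e < 1" unfolding e_def using p2 by (subst pos_divide_less_eq) linarith+
  ultimately have e: "0 < e" "e < 1" by auto
  define c where "c = (1 - e) * c0 + e * c1"
  have c: "c < c0" using e by (simp add: c_def c1_def algebra_simps)
  have Mc: "mgf c z \<le> ennreal ((1 - e) * x0 + e * x1)"
  proof -
    have "mgf c z \<le> ennreal (1 - e) * mgf c0 z + ennreal e * mgf c1 z"
      unfolding c_def using e by (intro mgf_convex_speed) auto
    also have "\<dots> = ennreal ((1 - e) * x0 + e * x1)"
      unfolding x0(1) x1(1) using e x0(2) x1(2) by (simp add: ennreal_mult ennreal_plus)
    finally show ?thesis .
  qed
  have fin: "mgf c z < \<infinity>" using Mc by (simp add: le_less_trans)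
  have "enn2real (mgf c z) \<le> (1 - e) * x0 + e * x1"
    by (rule enn2real_leI[OF _ Mc]) (use e x0 x1 in auto)
  then have "q / \<alpha> * enn2real (mgf c z) \<le> q / \<alpha> * ((1 - e) * x0 + e * x1)" using qa by (intro mult_left_mono) auto
  then have "chi z c \<le> z\<^sup>2 - c * z - p + q / \<alpha> * ((1 - e) * x0 + e * x1)" by simp
  also have "\<dots> = A + e * (B - A)" by (simp add: A_def B_def c_def algebra_simps add_divide_distrib)
  also have "\<dots> \<le> A + e * W" using e by (intro add_left_mono mult_left_mono) (auto simp: W_def)
  also have "e * W = \<bar>A\<bar> / 2" using p2 by (simp add: e_def)
  also have "A + \<bar>A\<bar> / 2 \<le> 0" using A by simp
  finally have "c \<in> root_speeds \<alpha> (chi0 \<alpha> f g K P)" by (intro root_exists[OF z'(1) fin])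
  then show False using min c unfolding minimal_speed_def by fastforce
qed

text \<open>At 0 the characteristic function is positive by \<open>unstable\<close>. A nonpositive
  value at a positive exponent would make \<open>c\<close> a root speed below the minimal one, so
  \<open>profile_zero\<close> applies and contradicts positivity.\<close>

lemma no_wave_below_minimal_speed:
  assumes min: "minimal_speed \<alpha> (chi0 \<alpha> f g K P) c0" and c: "c < c0"
  shows "\<not> admissible_speed \<alpha> f g K P c"
proof
  assume "admissible_speed \<alpha> f g K P c"
  then obtain \<phi> \<psi> where wave: "semi_wavefront \<alpha> f g K P c \<phi> \<psi>" unfolding admissible_speed_def by blast
  then have "bounded (range \<phi>)" and pos: "\<And>x. 0 < \<phi> x" by (auto simp: semi_wavefront_def)
  then obtain S where S: "\<And>x. \<phi> x \<le> S" using bounded_upper by blast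
  have S0: "0 < S" using pos[of 0] S[of 0] by simp
  obtain C M where data: "speed_data \<alpha> K Q f g S C \<theta> p q m L M" by (rule speed_data_exists[OF S0])
  interpret SD: speed_data \<alpha> c K Q f g S C \<theta> p q m L M by (rule data)
  have pr: "SD.profile \<phi>" by (rule semi_wavefront_profile[OF wave S data])
  have mg: "SD.law_mgf z = mgf c z" for z by (simp add: SD.law_mgf_def mgf_def)
  have "\<phi> 0 = 0"
  proof (rule SD.profile_zero[OF pr])
    fix z assume z: "0 \<le> z" "SD.law_mgf z < \<infinity>"
    show "0 < z\<^sup>2 - c * z - p + q / \<alpha> * enn2real (SD.law_mgf z)"
    proof (cases "z = 0")
      case True
      then show ?thesis using unstable[OF min] by (simp add: mg mgf_0)
    next
      case False
      show ?thesis
      proof (rule ccontr)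
        assume "\<not> ?thesis"
        then have "c \<in> root_speeds \<alpha> (chi0 \<alpha> f g K P)" using False z by (intro root_exists[of z]) (auto simp: mg)
        then show False using min c unfolding minimal_speed_def by fastforce
      qed
    qed
  qed
  then show False using pos[of 0] by simp
qed

text \<open>The root at the minimal speed \<open>cL\<close> is kept as exponent for the larger speed
  \<open>c\<close>: both the transform and \<open>- c * z\<close> decrease with the speed, so
  \<open>\<chi>\<^sub>L\<close> is nonpositive there, which is all that the maximum principle
  needs.\<close>

lemma uniqueness_above_minimal_speed:
  assumes min0: "minimal_speed \<alpha> (chi0 \<alpha> f g K P) c0"
    and minL: "minimal_speed \<alpha> (chiL \<alpha> f L K P) cL" and c: "cL \<le> c"
  shows "unique_modulo_translation \<alpha> f g K P c"
  unfolding unique_modulo_translation_def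
proof (intro allI impI)
  fix \<phi>1 \<psi>1 \<phi>2 \<psi>2
  assume w1: "semi_wavefront \<alpha> f g K P c \<phi>1 \<psi>1" and w2: "semi_wavefront \<alpha> f g K P c \<phi>2 \<psi>2"
  have "bounded (range \<phi>1)" "bounded (range \<phi>2)" and pos: "\<And>x. 0 < \<phi>1 x" "\<And>x. 0 < \<phi>2 x"
    using w1 w2 by (auto simp: semi_wavefront_def)
  then obtain S1 S2 where S12: "\<And>x. \<phi>1 x \<le> S1" "\<And>x. \<phi>2 x \<le> S2" using bounded_upper by metis
  define S where "S = max S1 S2"
  have S: "\<phi>1 x \<le> S" "\<phi>2 x \<le> S" for x using S12[of x] by (auto simp: S_def)
  have S0: "0 < S" using pos(1)[of 0] S(1)[of 0] by simp
  obtain C M where data: "speed_data \<alpha> K Q f g S C \<theta> p q m L M" by (rule speed_data_exists[OF S0])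
  interpret SD: speed_data \<alpha> c K Q f g S C \<theta> p q m L M by (rule data)
  have mg: "SD.law_mgf z = mgf c z" for z by (simp add: SD.law_mgf_def mgf_def)
  obtain z0 where z0: "0 < z0" "0 < cL * z0 + \<alpha>" "chiL \<alpha> f L K P z0 cL = 0"
    using minL unfolding minimal_speed_def root_speeds_def by blast
  have "mgf cL z0 \<noteq> \<infinity>" using char_fun_infinite[OF z0(2) _ L] z0(3) by (auto simp: chiL_def)
  then obtain y0 where y0: "mgf cL z0 = ennreal y0" "0 \<le> y0" by (cases "mgf cL z0") auto
  have root: "z0\<^sup>2 - cL * z0 - m + L / \<alpha> * y0 = 0"
    using z0(3) char_fun_finite[OF z0(2) y0] by (simp add: chiL_def zero_ereal_def)
  have Mc: "mgf c z0 \<le> ennreal y0" using mgf_antimono[OF c, of z0] z0 y0 by simp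
  have fin: "mgf c z0 < \<infinity>" using Mc by (simp add: le_less_trans)
  have root_c: "z0\<^sup>2 - c * z0 - m + L / \<alpha> * enn2real (mgf c z0) \<le> 0"
  proof -
    have "enn2real (mgf c z0) \<le> y0" by (rule enn2real_leI[OF y0(2) Mc])
    then have "L / \<alpha> * enn2real (mgf c z0) \<le> L / \<alpha> * y0" using L \<alpha> by (intro mult_left_mono) auto
    moreover have "cL * z0 \<le> c * z0" using c z0 by simp
    ultimately show ?thesis using root by linarith
  qed
  obtain \<gamma> :: ereal where dom: "\<And>z. 0 \<le> z \<Longrightarrow> ereal z < \<gamma> \<Longrightarrow> 0 < c * z + \<alpha> \<and> mgf c z < \<infinity> \<and> chi0 \<alpha> f g K P z c = ereal (chi z c)"
    and lt: "\<And>z. 0 \<le> z \<Longrightarrow> mgf c z < \<infinity> \<Longrightarrow> ereal z < \<gamma>"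
    using blow_up_point[of c] by metis
  \<comment> \<open>Finiteness at \<open>z0\<close> puts it strictly below the blow-up point, so an
    exponent \<open>z1\<close> beyond \<open>z0\<close> with finite transform is available.\<close>
  have "ereal z0 < \<gamma>" using lt z0 fin by simp
  then obtain z1 where z1: "ereal z0 < ereal z1" "ereal z1 < \<gamma>" using ereal_dense2 by blast
  have z1': "z0 < z1" "mgf c z1 < \<infinity>" using z1 dom[of z1] z0 by auto
  obtain h where h: "\<And>x. \<phi>2 x = \<phi>1 (x + h)"
    using SD.profile_unique[OF semi_wavefront_profile[OF w1 S(1) data] semi_wavefront_profile[OF w2 S(2) data] pos(1) pos(2) z0(1) z1'(1)]
      z1'(2) fin root_c unstable[OF min0] unfolding mg by blast
  have "\<psi>2 x = \<psi>1 (x + h)" for x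
    unfolding semi_wavefrontD(2)[OF w1] semi_wavefrontD(2)[OF w2] h by (simp add: algebra_simps)
  with h show "\<exists>h. \<forall>x. \<phi>2 x = \<phi>1 (x + h) \<and> \<psi>2 x = \<psi>1 (x + h)" by blast
qed

end

theorem theorem5p1:
  fixes \<alpha> \<theta> L c_min0 c_minL :: real
    and K f g :: "real \<Rightarrow> real"
    and P :: "real measure"
  assumes "\<alpha> > 0"
    and "integrable lborel K"
    and "AE w in lborel. 0 \<le> K w"
    and "(\<integral>w. K w \<partial>lborel) = 1"
    and "prob_space P"
    and "sets P = sets (restrict_space borel {0..})"
    and "hyp_H1 g"
    and "hyp_H2 f g"
    and "hyp_H3 \<theta> f g"
    and "\<And>c. blow_up_condition \<alpha> (chi0 \<alpha> f g K P) c"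
    and "L > 0"
    and "\<And>s1 s2. s1 \<ge> 0 \<Longrightarrow> s2 \<ge> 0 \<Longrightarrow> \<bar>g s1 - g s2\<bar> \<le> L * \<bar>s1 - s2\<bar>"
    and "minimal_speed \<alpha> (chi0 \<alpha> f g K P) c_min0"
    and "minimal_speed \<alpha> (chiL \<alpha> f L K P) c_minL"
  shows "(\<forall>c\<ge>c_minL. admissible_speed \<alpha> f g K P c \<longrightarrow> unique_modulo_translation \<alpha> f g K P c) \<and>
         (\<forall>c<c_min0. \<not> admissible_speed \<alpha> f g K P c)"
proof -
  interpret wave_problem \<alpha> \<theta> L K f g P using assms(1-12) by (rule wave_problem.intro)
  show ?thesis
    using uniqueness_above_minimal_speed[OF assms(13,14)] no_wave_below_minimal_speed[OF assms(13)] by blast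
qed

end
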